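(* Let $A=\mathrm{k}\Delta/I^N$ be a truncated quiver algebra. With the projective resolutions $(\mathbf P,d)$ and $(\mathbf Q,b)$ of $A$ and the $A$-bimodule morphisms $\mathbf F_n:\mathbf P_n\to\mathbf Q_n$ and $\mathbf G_n:\mathbf Q_n\to\mathbf P_n$ ($n\ge 0$) defined in the context, one has, for all $n\ge 1$, $$b_n\circ \mathbf F_n=\mathbf F_{n-1}\circ d_n,\qquad d_n\circ\mathbf G_n=\mathbf G_{n-1}\circ b_n ,$$ and therefore $\mathbf F:\mathbf P\to\mathbf Q$ and $\mathbf G:\mathbf Q\to\mathbf P$ are comparison morphisms between the $A^e$-projective resolutions $\mathbf P$ and $\mathbf Q$ of $A$ (i.e. morphisms of chain complexes of $A$-bimodules lifting the identity of $A$).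
   Context: $\mathrm{k}$ is a field of characteristic $0$; $\Delta$ is a finite connected quiver (multiple arrows and loops allowed) with vertex set $\Delta_0$ and arrow set $\Delta_1$; an arrow $a$ has source $o(a)$ and end $t(a)$. A path of length $n\ge1$ is a sequence of arrows $a_1\dots a_n$ with $t(a_i)=o(a_{i+1})$; its source is $o(a_1)$, its end is $t(a_n)$. Vertices are the paths of length $0$. $\Delta_n$ is the set of paths of length $n$, $|\alpha|$ the length of $\alpha$, $\mathrm{k}\Delta_n$ the vector space with basis $\Delta_n$, and $\mathrm{k}\Delta=\bigoplus_{n\ge0}\mathrm{k}\Delta_n$ is the path algebra with product given by concatenation ($\alpha\beta=0$ if $t(\alpha)\ne o(\beta)$). $I$ is the two-sided ideal generated by $\Delta_1$, $N$ is a positive integer and $A=\mathrm{k}\Delta/I^N$; $\mathcal B=\bigcup_{n=0}^{N-1}\Delta_n$ is a basis of $A$, and paths of length $\ge N$ are zero in $A$. $A_+=\bigoplus_{n=1}^{N-1}\mathrm{k}\Delta_n$ is an ideal of $A$. $A^e=A\otimes_{\mathrm k}A^{op}$, and $A$-bimodules are identified with left $A^e$-modules. All tensor products below are over $\mathrm{k}\Delta_0$. Resolution $\mathbf Q$: $\mathbf Q_n=A\otimes A_+^{\otimes n}\otimes A$, with elements written $\alpha_0[\alpha_1|\dots|\alpha_n]\alpha_{n+1}$, augmentation $\epsilon:\mathbf Q_0=A\otimes A\to A$, $\epsilon(\alpha\otimes\beta)=\alpha\beta$, and $$b_n(\alpha_0[\alpha_1|\dots|\alpha_n]\alpha_{n+1})=\alpha_0\alpha_1[\alpha_2|\dots|\alpha_n]\alpha_{n+1}+\sum_{i=1}^{n-1}(-1)^i\alpha_0[\alpha_1|\dots|\alpha_i\alpha_{i+1}|\dots|\alpha_n]\alpha_{n+1}+(-1)^n\alpha_0[\alpha_1|\dots|\alpha_{n-1}]\alpha_n\alpha_{n+1}.$$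 Resolution $\mathbf P$: $\mathbf P_{2k}=A\otimes\mathrm{k}\Delta_{kN}\otimes A$, $\mathbf P_{2k+1}=A\otimes\mathrm{k}\Delta_{kN+1}\otimes A$ (so $\mathbf P_0=A\otimes A$), the same augmentation $\epsilon(\alpha\otimes\beta)=\alpha\beta$, and $$d_{2k}(\alpha\otimes v_1\dots v_{kN}\otimes\beta)=\sum_{j=0}^{N-1}\alpha v_1\dots v_j\otimes v_{j+1}\dots v_{j+(k-1)N+1}\otimes v_{j+(k-1)N+2}\dots v_{kN}\beta\quad(k\ge1),$$ $$d_{2k+1}(\alpha\otimes v_1\dots v_{kN+1}\otimes\beta)=\alpha v_1\otimes v_2\dots v_{kN+1}\otimes\beta-\alpha\otimes v_1\dots v_{kN}\otimes v_{kN+1}\beta\quad(k\ge0).$$ Morphism $\mathbf F$: $\mathbf F_0=\mathrm{id}$, and $\mathbf F_n$ is the $A$-bimodule extension of the following. For $n=2k$, $$\mathbf F_{2k}(1\otimes v_1\dots v_{kN}\otimes1)=\sum 1[p_1|q_1|p_2|q_2|\dots|p_k|q_k]\,r,$$ the sum over all $(x_1,\dots,x_k)\in\mathbb Z^k$ with $1\le x_i<N$, where $v_1\dots v_{kN}=p_1q_1p_2q_2\dots p_kq_kr$ is the factorization into consecutive subpaths with $|p_i|=x_i$, $|q_i|=1$, $|r|=kN-k-\sum x_i$. For $n=2k+1$, $$\mathbf F_{2k+1}(1\otimes v_1\dots v_{kN+1}\otimes1)=\sum 1[q_0|p_1|q_1|p_2|q_2|\dots|p_k|q_k]\,r,$$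 the sum over the same tuples, where $v_1\dots v_{kN+1}=q_0p_1q_1\dots p_kq_kr$ with $|q_i|=1$, $|p_i|=x_i$, $|r|=kN-k-\sum x_i$. (The terms with $|r|\ge N$ are zero.) Morphism $\mathbf G$: $\mathbf G_0=\mathrm{id}$, and $\mathbf G_n$ is the $A$-bimodule extension of the following map on elements $q=1[\alpha_1|\dots|\alpha_n]1$, where $\alpha_i\in\mathcal B$, $|\alpha_i|\ge1$ and $t(\alpha_i)=o(\alpha_{i+1})$. Let $v_1\dots v_{|q|}$ be the arrow decomposition of the path $\alpha_1\alpha_2\dots\alpha_n$ in $\mathrm{k}\Delta$ (not in $A$), $|q|=\sum|\alpha_i|$. For $n=2k$: $$\mathbf G_{2k}(q)=1\otimes v_1\dots v_{kN}\otimes v_{kN+1}\dots v_{|q|}\quad\text{if }\alpha_{2i-1}\alpha_{2i}=0\text{ in }A\text{ for all }i=1,\dots,k,$$ and $\mathbf G_{2k}(q)=0$ otherwise. For $n=2k+1$: $$\mathbf G_{2k+1}(q)=\sum_{j=1}^{|\alpha_1|}v_1\dots v_{j-1}\otimes v_j\dots v_{kN+j}\otimes v_{kN+j+1}\dots v_{|q|}\quad\text{if }\alpha_{2i}\alpha_{2i+1}=0\text{ in }A\text{ for all }i=1,\dots,k,$$ and $\mathbf G_{2k+1}(q)=0$ otherwise. *)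

theory Defs
  imports
    "HOL-Algebra.Free_Abelian_Groups"
    "HOL-Algebra.QuotRing"
    "HOL-Algebra.Ideal_Product"
    "Graph_Theory.Digraph_Component"
begin

section \<open>Bimodules and tensor products\<close>

text \<open>
  As for the library's record \<open>module\<close>, the fields \<open>mult\<close> and \<open>one\<close> inherited from \<open>ring\<close> are
  irrelevant: only the additive group and the two actions matter.
\<close>

record ('r, 'm) bimod = "'m ring" +
  lact :: "'r \<Rightarrow> 'm \<Rightarrow> 'm"
  ract :: "'m \<Rightarrow> 'r \<Rightarrow> 'm"

text \<open>
  \<open>Z\<close> is the image of the ground field in \<open>R\<close>. Requiring it to act in the same way on both
  sides makes an \<open>R\<close>-bimodule the same thing as a left module over the enveloping algebra over
  the ground field.
\<close>

definition bimodule :: "('r, 'a) ring_scheme \<Rightarrow> 'r set \<Rightarrow> ('r, 'm, 'b) bimod_scheme \<Rightarrow> bool" where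
  "bimodule R Z M \<longleftrightarrow>
     abelian_group M \<and>
     (\<forall>a\<in>carrier R. \<forall>x\<in>carrier M. lact M a x \<in> carrier M \<and> ract M x a \<in> carrier M) \<and>
     (\<forall>a\<in>carrier R. \<forall>x\<in>carrier M. \<forall>y\<in>carrier M.
        lact M a (x \<oplus>\<^bsub>M\<^esub> y) = lact M a x \<oplus>\<^bsub>M\<^esub> lact M a y \<and>
        ract M (x \<oplus>\<^bsub>M\<^esub> y) a = ract M x a \<oplus>\<^bsub>M\<^esub> ract M y a) \<and>
     (\<forall>a\<in>carrier R. \<forall>b\<in>carrier R. \<forall>x\<in>carrier M.
        lact M (a \<oplus>\<^bsub>R\<^esub> b) x = lact M a x \<oplus>\<^bsub>M\<^esub> lact M b x \<and>
        ract M x (a \<oplus>\<^bsub>R\<^esub> b) = ract M x a \<oplus>\<^bsub>M\<^esub> ract M x b \<and>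
        lact M (a \<otimes>\<^bsub>R\<^esub> b) x = lact M a (lact M b x) \<and>
        ract M x (a \<otimes>\<^bsub>R\<^esub> b) = ract M (ract M x a) b \<and>
        ract M (lact M a x) b = lact M a (ract M x b)) \<and>
     (\<forall>x\<in>carrier M. lact M \<one>\<^bsub>R\<^esub> x = x \<and> ract M x \<one>\<^bsub>R\<^esub> = x) \<and>
     (\<forall>z\<in>Z. \<forall>x\<in>carrier M. lact M z x = ract M x z)"

definition bimod_hom ::
  "('r, 'a) ring_scheme \<Rightarrow> ('r, 'm, 'b) bimod_scheme \<Rightarrow> ('r, 'n, 'c) bimod_scheme \<Rightarrow> ('m \<Rightarrow> 'n) set" where
  "bimod_hom R M M' = {f. f \<in> carrier M \<rightarrow> carrier M' \<and>
     (\<forall>x\<in>carrier M. \<forall>y\<in>carrier M. f (x \<oplus>\<^bsub>M\<^esub> y) = f x \<oplus>\<^bsub>M'\<^esub> f y) \<and>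
     (\<forall>a\<in>carrier R. \<forall>x\<in>carrier M. f (lact M a x) = lact M' a (f x) \<and> f (ract M x a) = ract M' (f x) a)}"

text \<open>
  The bimodule morphism sending the generator \<open>g s\<close> of \<open>M\<close> to \<open>h s\<close>, for all \<open>s\<close> in \<open>S\<close>.
  (Extensionality only pins down the irrelevant values outside the carrier.)
\<close>

definition bimod_ext ::
  "('r, 'a) ring_scheme \<Rightarrow> ('r, 'm, 'b) bimod_scheme \<Rightarrow> ('r, 'n, 'c) bimod_scheme \<Rightarrow>
   's set \<Rightarrow> ('s \<Rightarrow> 'm) \<Rightarrow> ('s \<Rightarrow> 'n) \<Rightarrow> 'm \<Rightarrow> 'n" where
  "bimod_ext R M M' S g h =
     (THE f. f \<in> bimod_hom R M M' \<and> f \<in> extensional (carrier M) \<and> (\<forall>s\<in>S. f (g s) = h s))"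

definition regular_bimod :: "('r, 'a) ring_scheme \<Rightarrow> ('r, 'r) bimod" where
  "regular_bimod R = \<lparr>carrier = carrier R, monoid.mult = monoid.mult R, one = one R,
     zero = zero R, add = add R, lact = monoid.mult R, ract = monoid.mult R\<rparr>"

text \<open>
  The tensor product over \<open>E\<close> of a list of \<open>E\<close>-bimodules: the free abelian group on the tuples,
  modulo additivity in each slot and balancing between neighbouring slots.
\<close>

definition tensor_tuples :: "('e, 'x) bimod list \<Rightarrow> 'x list set" where
  "tensor_tuples Ms = listset (map carrier Ms)"

definition tensor_rel :: "('e, 'a) ring_scheme \<Rightarrow> ('e, 'x) bimod list \<Rightarrow> ('x list \<Rightarrow>\<^sub>0 int) set" where
  "tensor_rel E Ms = generate (free_Abelian_group (tensor_tuples Ms))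
     ({frag_of (xs @ [x \<oplus>\<^bsub>Ms ! length xs\<^esub> y] @ ys) - frag_of (xs @ [x] @ ys) - frag_of (xs @ [y] @ ys) |
         xs x y ys. xs @ [x] @ ys \<in> tensor_tuples Ms \<and> xs @ [y] @ ys \<in> tensor_tuples Ms} \<union>
      {frag_of (xs @ [ract (Ms ! length xs) x e, y] @ ys)
         - frag_of (xs @ [x, lact (Ms ! Suc (length xs)) e y] @ ys) |
         xs x e y ys. xs @ [x, y] @ ys \<in> tensor_tuples Ms \<and> e \<in> carrier E})"

definition tensor_coset ::
  "('e, 'a) ring_scheme \<Rightarrow> ('e, 'x) bimod list \<Rightarrow> ('x list \<Rightarrow>\<^sub>0 int) \<Rightarrow> ('x list \<Rightarrow>\<^sub>0 int) set" where
  "tensor_coset E Ms c = tensor_rel E Ms #>\<^bsub>free_Abelian_group (tensor_tuples Ms)\<^esub> c"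

definition tens :: "('e, 'a) ring_scheme \<Rightarrow> ('e, 'x) bimod list \<Rightarrow> 'x list \<Rightarrow> ('x list \<Rightarrow>\<^sub>0 int) set" where
  "tens E Ms xs = tensor_coset E Ms (frag_of xs)"

text \<open>
  \<open>L\<close> is a left action of \<open>'r\<close> on the first factor and \<open>Rt\<close> a right action of \<open>'r\<close> on the last
  factor; the tensor product inherits both.
\<close>

definition tensor ::
  "('e, 'a) ring_scheme \<Rightarrow> ('e, 'x) bimod list \<Rightarrow> ('r \<Rightarrow> 'x \<Rightarrow> 'x) \<Rightarrow> ('x \<Rightarrow> 'r \<Rightarrow> 'x) \<Rightarrow>
   ('r, ('x list \<Rightarrow>\<^sub>0 int) set) bimod" where
  "tensor E Ms L Rt =
     (let T = free_Abelian_group (tensor_tuples Ms) Mod tensor_rel E Ms in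
      \<lparr>carrier = carrier T, monoid.mult = undefined, one = undefined,
       zero = one T, add = monoid.mult T,
       lact = (\<lambda>a X. \<Union>c\<in>X. tensor_coset E Ms (frag_extend (\<lambda>xs. frag_of (L a (hd xs) # tl xs)) c)),
       ract = (\<lambda>X a. \<Union>c\<in>X. tensor_coset E Ms
                 (frag_extend (\<lambda>xs. frag_of (butlast xs @ [Rt (last xs) a])) c))\<rparr>)"


section \<open>Complexes of bimodules\<close>

definition augmented_complex ::
  "('r, 'a) ring_scheme \<Rightarrow> 'r set \<Rightarrow>
   (nat \<Rightarrow> ('r, 'm) bimod) \<Rightarrow> (nat \<Rightarrow> 'm \<Rightarrow> 'm) \<Rightarrow> ('m \<Rightarrow> 'r) \<Rightarrow> bool" where
  "augmented_complex R Z M d e \<longleftrightarrow>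
     (\<forall>n. bimodule R Z (M n)) \<and>
     (\<forall>n\<ge>1. d n \<in> bimod_hom R (M n) (M (n - 1))) \<and>
     (\<forall>n\<ge>1. \<forall>x\<in>carrier (M (n + 1)). d n (d (n + 1) x) = \<zero>\<^bsub>M (n - 1)\<^esub>) \<and>
     e \<in> bimod_hom R (M 0) (regular_bimod R) \<and>
     (\<forall>x\<in>carrier (M 1). e (d 1 x) = \<zero>\<^bsub>R\<^esub>)"

definition comparison_morphism ::
  "('r, 'a) ring_scheme \<Rightarrow> 'r set \<Rightarrow>
   (nat \<Rightarrow> ('r, 'm) bimod) \<Rightarrow> (nat \<Rightarrow> 'm \<Rightarrow> 'm) \<Rightarrow> ('m \<Rightarrow> 'r) \<Rightarrow>
   (nat \<Rightarrow> ('r, 'n) bimod) \<Rightarrow> (nat \<Rightarrow> 'n \<Rightarrow> 'n) \<Rightarrow> ('n \<Rightarrow> 'r) \<Rightarrow>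
   (nat \<Rightarrow> 'm \<Rightarrow> 'n) \<Rightarrow> bool" where
  "comparison_morphism R Z M d e M' d' e' f \<longleftrightarrow>
     augmented_complex R Z M d e \<and> augmented_complex R Z M' d' e' \<and>
     (\<forall>n. f n \<in> bimod_hom R (M n) (M' n)) \<and>
     (\<forall>n\<ge>1. \<forall>x\<in>carrier (M n). d' n (f n x) = f (n - 1) (d n x)) \<and>
     (\<forall>x\<in>carrier (M 0). e' (f 0 x) = e x)"


section \<open>Paths and the truncated quiver algebra\<close>

text \<open>
  A path is given by its source and its list of arrows, so that the paths of length 0 are the
  vertices. The source of an arrow is its \<open>tail\<close>, its end is its \<open>head\<close>.
\<close>

type_synonym ('v, 'e) path = "'v \<times> 'e list"

definition paths :: "('v, 'e) pre_digraph \<Rightarrow> nat \<Rightarrow> ('v, 'e) path set" where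
  "paths G n = {(u, p). length p = n \<and> (\<exists>v. pre_digraph.awalk G u p v)}"

definition path_end :: "('v, 'e) pre_digraph \<Rightarrow> ('v, 'e) path \<Rightarrow> 'v" where
  "path_end G p = last (pre_digraph.awalk_verts G (fst p) (snd p))"

abbreviation path_len :: "('v, 'e) path \<Rightarrow> nat" where
  "path_len p \<equiv> length (snd p)"

text \<open>For \<open>p = v\<^sub>1 \<dots> v\<^sub>m\<close> and \<open>i \<le> j \<le> m\<close>, \<open>subpath G p i j\<close> is \<open>v\<^sub>i\<^sub>+\<^sub>1 \<dots> v\<^sub>j\<close>.\<close>

definition subpath :: "('v, 'e) pre_digraph \<Rightarrow> ('v, 'e) path \<Rightarrow> nat \<Rightarrow> nat \<Rightarrow> ('v, 'e) path" where
  "subpath G p i j = (pre_digraph.awalk_verts G (fst p) (snd p) ! i, take (j - i) (drop i (snd p)))"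

definition path_concat :: "('v, 'e) path list \<Rightarrow> ('v, 'e) path" where
  "path_concat ps = (fst (hd ps), concat (map snd ps))"

definition path_vec :: "('v, 'e) path \<Rightarrow> ('v, 'e) path \<Rightarrow>\<^sub>0 'k::field" where
  "path_vec p = Poly_Mapping.single p 1"

definition path_span :: "('v, 'e) path set \<Rightarrow> (('v, 'e) path \<Rightarrow>\<^sub>0 'k::field) set" where
  "path_span S = {x. Poly_Mapping.keys x \<subseteq> S}"

definition path_algebra :: "('v, 'e) pre_digraph \<Rightarrow> (('v, 'e) path \<Rightarrow>\<^sub>0 'k::field) ring" where
  "path_algebra G =
     \<lparr>carrier = path_span (\<Union>n. paths G n),
      monoid.mult = (\<lambda>x y. \<Sum>p\<in>Poly_Mapping.keys x. \<Sum>q\<in>Poly_Mapping.keys y.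
        if path_end G p = fst q
        then Poly_Mapping.single (fst p, snd p @ snd q) (Poly_Mapping.lookup x p * Poly_Mapping.lookup y q)
        else 0),
      one = (\<Sum>v\<in>verts G. path_vec (v, [])),
      zero = 0,
      add = (+)\<rparr>"

text \<open>The subring \<open>k\<Delta>\<^sub>0\<close>, over which all tensor products are taken.\<close>

definition vertex_algebra :: "('v, 'e) pre_digraph \<Rightarrow> (('v, 'e) path \<Rightarrow>\<^sub>0 'k::field) ring" where
  "vertex_algebra G = (path_algebra G)\<lparr>carrier := path_span (paths G 0)\<rparr>"

primrec ideal_power :: "('r, 'a) ring_scheme \<Rightarrow> 'r set \<Rightarrow> nat \<Rightarrow> 'r set" where
  "ideal_power R I 0 = carrier R"
| "ideal_power R I (Suc n) = ideal_prod R (ideal_power R I n) I"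

definition arrow_ideal :: "('v, 'e) pre_digraph \<Rightarrow> (('v, 'e) path \<Rightarrow>\<^sub>0 'k::field) set" where
  "arrow_ideal G = genideal (path_algebra G) (path_vec ` paths G 1)"

type_synonym ('v, 'e, 'k) trunc = "(('v, 'e) path \<Rightarrow>\<^sub>0 'k) set"

definition truncated_algebra :: "('v, 'e) pre_digraph \<Rightarrow> nat \<Rightarrow> ('v, 'e, 'k::field) trunc ring" where
  "truncated_algebra G N = path_algebra G Quot ideal_power (path_algebra G) (arrow_ideal G) N"

definition trunc_class ::
  "('v, 'e) pre_digraph \<Rightarrow> nat \<Rightarrow> (('v, 'e) path \<Rightarrow>\<^sub>0 'k::field) \<Rightarrow> ('v, 'e, 'k) trunc" where
  "trunc_class G N x = ideal_power (path_algebra G) (arrow_ideal G) N +>\<^bsub>path_algebra G\<^esub> x"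

definition path_class ::
  "('v, 'e) pre_digraph \<Rightarrow> nat \<Rightarrow> ('v, 'e) path \<Rightarrow> ('v, 'e, 'k::field) trunc" where
  "path_class G N p = trunc_class G N (path_vec p)"

text \<open>The image of the ground field in the truncated algebra.\<close>

definition scalars :: "('v, 'e) pre_digraph \<Rightarrow> nat \<Rightarrow> ('v, 'e, 'k::field) trunc set" where
  "scalars G N = range (\<lambda>c. trunc_class G N (\<Sum>v\<in>verts G. Poly_Mapping.single (v, []) c))"


section \<open>The factors of the resolutions, as bimodules over the vertex algebra\<close>

definition A_bimod ::
  "('v, 'e) pre_digraph \<Rightarrow> nat \<Rightarrow> (('v, 'e) path \<Rightarrow>\<^sub>0 'k::field, ('v, 'e, 'k) trunc) bimod" where
  "A_bimod G N = (let A = truncated_algebra G N in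
     \<lparr>carrier = carrier A, monoid.mult = monoid.mult A, one = one A, zero = zero A, add = add A,
      lact = (\<lambda>e x. trunc_class G N e \<otimes>\<^bsub>A\<^esub> x), ract = (\<lambda>x e. x \<otimes>\<^bsub>A\<^esub> trunc_class G N e)\<rparr>)"

definition Aplus_bimod ::
  "('v, 'e) pre_digraph \<Rightarrow> nat \<Rightarrow> (('v, 'e) path \<Rightarrow>\<^sub>0 'k::field, ('v, 'e, 'k) trunc) bimod" where
  "Aplus_bimod G N =
     (A_bimod G N)\<lparr>carrier := trunc_class G N ` path_span (\<Union>i\<in>{1..<N}. paths G i)\<rparr>"

text \<open>
  The bimodule \<open>k\<Delta>\<^sub>m\<close>. Its elements \<open>x\<close> are carried as singletons \<open>{x}\<close> (the cosets of the zero
  submodule), so that all the factors of a tensor product have elements of the same type.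
\<close>

definition path_bimod ::
  "('v, 'e) pre_digraph \<Rightarrow> nat \<Rightarrow> (('v, 'e) path \<Rightarrow>\<^sub>0 'k::field, ('v, 'e, 'k) trunc) bimod" where
  "path_bimod G m =
     \<lparr>carrier = (\<lambda>x. {x}) ` path_span (paths G m), monoid.mult = undefined, one = undefined,
      zero = {0}, add = (\<lambda>X Y. {the_elem X + the_elem Y}),
      lact = (\<lambda>e X. {e \<otimes>\<^bsub>path_algebra G\<^esub> the_elem X}),
      ract = (\<lambda>X e. {the_elem X \<otimes>\<^bsub>path_algebra G\<^esub> e})\<rparr>"

type_synonym ('v, 'e, 'k) tens_elt = "(('v, 'e, 'k) trunc list \<Rightarrow>\<^sub>0 int) set"

type_synonym ('v, 'e, 'k) A_bimodule = "(('v, 'e, 'k) trunc, ('v, 'e, 'k) tens_elt) bimod"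


section \<open>The resolution Q\<close>

definition Q_factors ::
  "('v, 'e) pre_digraph \<Rightarrow> nat \<Rightarrow> nat \<Rightarrow> (('v, 'e) path \<Rightarrow>\<^sub>0 'k::field, ('v, 'e, 'k) trunc) bimod list" where
  "Q_factors G N n = [A_bimod G N] @ replicate n (Aplus_bimod G N) @ [A_bimod G N]"

definition Q_mod :: "('v, 'e) pre_digraph \<Rightarrow> nat \<Rightarrow> nat \<Rightarrow> ('v, 'e, 'k::field) A_bimodule" where
  "Q_mod G N n = tensor (vertex_algebra G) (Q_factors G N n)
     (monoid.mult (truncated_algebra G N)) (monoid.mult (truncated_algebra G N))"

text \<open>\<open>Q_elt G N n [\<alpha>\<^sub>0, \<dots>, \<alpha>\<^sub>n\<^sub>+\<^sub>1]\<close> is the element \<open>\<alpha>\<^sub>0[\<alpha>\<^sub>1|\<dots>|\<alpha>\<^sub>n]\<alpha>\<^sub>n\<^sub>+\<^sub>1\<close>.\<close>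

definition Q_elt ::
  "('v, 'e) pre_digraph \<Rightarrow> nat \<Rightarrow> nat \<Rightarrow> ('v, 'e, 'k::field) trunc list \<Rightarrow> ('v, 'e, 'k) tens_elt" where
  "Q_elt G N n as = tens (vertex_algebra G) (Q_factors G N n) as"

definition Q_aug :: "('v, 'e) pre_digraph \<Rightarrow> nat \<Rightarrow> ('v, 'e, 'k::field) tens_elt \<Rightarrow> ('v, 'e, 'k) trunc" where
  "Q_aug G N = (let A = truncated_algebra G N in
     bimod_ext A (Q_mod G N 0) (regular_bimod A) (carrier A \<times> carrier A)
       (\<lambda>(\<alpha>, \<beta>). Q_elt G N 0 [\<alpha>, \<beta>]) (\<lambda>(\<alpha>, \<beta>). \<alpha> \<otimes>\<^bsub>A\<^esub> \<beta>))"

text \<open>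
  The outer terms of the bar differential are the summands \<open>i = 0\<close> and \<open>i = n\<close>: in all of them
  the neighbouring entries \<open>\<alpha>\<^sub>i\<close> and \<open>\<alpha>\<^sub>i\<^sub>+\<^sub>1\<close> are replaced by their product.
\<close>

definition Q_diff ::
  "('v, 'e) pre_digraph \<Rightarrow> nat \<Rightarrow> nat \<Rightarrow> ('v, 'e, 'k::field) tens_elt \<Rightarrow> ('v, 'e, 'k) tens_elt" where
  "Q_diff G N n = (let A = truncated_algebra G N in
     bimod_ext A (Q_mod G N n) (Q_mod G N (n - 1)) (tensor_tuples (Q_factors G N n)) (Q_elt G N n)
       (\<lambda>as. \<Oplus>\<^bsub>Q_mod G N (n - 1)\<^esub>i\<in>{0..n}.
          add_pow (Q_mod G N (n - 1)) ((-1::int) ^ i)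
            (Q_elt G N (n - 1) (take i as @ [as ! i \<otimes>\<^bsub>A\<^esub> as ! (i + 1)] @ drop (i + 2) as))))"


section \<open>The resolution P\<close>

definition P_deg :: "nat \<Rightarrow> nat \<Rightarrow> nat" where
  "P_deg N n = (if even n then (n div 2) * N else (n div 2) * N + 1)"

text \<open>In degree 0, \<open>A \<otimes> k\<Delta>\<^sub>0 \<otimes> A\<close> is identified with \<open>A \<otimes> A\<close>.\<close>

definition P_factors ::
  "('v, 'e) pre_digraph \<Rightarrow> nat \<Rightarrow> nat \<Rightarrow> (('v, 'e) path \<Rightarrow>\<^sub>0 'k::field, ('v, 'e, 'k) trunc) bimod list" where
  "P_factors G N n = (if n = 0 then [A_bimod G N, A_bimod G N]
     else [A_bimod G N, path_bimod G (P_deg N n), A_bimod G N])"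

definition P_mod :: "('v, 'e) pre_digraph \<Rightarrow> nat \<Rightarrow> nat \<Rightarrow> ('v, 'e, 'k::field) A_bimodule" where
  "P_mod G N n = tensor (vertex_algebra G) (P_factors G N n)
     (monoid.mult (truncated_algebra G N)) (monoid.mult (truncated_algebra G N))"

text \<open>
  \<open>P_elt G N n \<alpha> v \<beta>\<close> is the element \<open>\<alpha> \<otimes> v \<otimes> \<beta>\<close>, for a path \<open>v\<close> of length \<open>P_deg N n\<close>; in
  degree 0 it is \<open>\<alpha>v \<otimes> \<beta>\<close>, by the identification above.
\<close>

definition P_elt ::
  "('v, 'e) pre_digraph \<Rightarrow> nat \<Rightarrow> nat \<Rightarrow>
   ('v, 'e, 'k::field) trunc \<Rightarrow> ('v, 'e) path \<Rightarrow> ('v, 'e, 'k) trunc \<Rightarrow> ('v, 'e, 'k) tens_elt" where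
  "P_elt G N n \<alpha> v \<beta> = tens (vertex_algebra G) (P_factors G N n)
     (if n = 0 then [\<alpha> \<otimes>\<^bsub>truncated_algebra G N\<^esub> path_class G N v, \<beta>] else [\<alpha>, {path_vec v}, \<beta>])"

definition P_aug :: "('v, 'e) pre_digraph \<Rightarrow> nat \<Rightarrow> ('v, 'e, 'k::field) tens_elt \<Rightarrow> ('v, 'e, 'k) trunc" where
  "P_aug G N = (let A = truncated_algebra G N in
     bimod_ext A (P_mod G N 0) (regular_bimod A) (carrier A \<times> carrier A)
       (\<lambda>(\<alpha>, \<beta>). tens (vertex_algebra G) (P_factors G N 0) [\<alpha>, \<beta>]) (\<lambda>(\<alpha>, \<beta>). \<alpha> \<otimes>\<^bsub>A\<^esub> \<beta>))"

definition P_diff_val ::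
  "('v, 'e) pre_digraph \<Rightarrow> nat \<Rightarrow> nat \<Rightarrow>
   ('v, 'e, 'k::field) trunc \<Rightarrow> ('v, 'e) path \<Rightarrow> ('v, 'e, 'k) trunc \<Rightarrow> ('v, 'e, 'k) tens_elt" where
  "P_diff_val G N n \<alpha> v \<beta> =
     (let A = truncated_algebra G N; P = P_mod G N (n - 1); k = n div 2 in
      if even n then
        (\<Oplus>\<^bsub>P\<^esub>j\<in>{0..N - 1}. P_elt G N (n - 1)
           (\<alpha> \<otimes>\<^bsub>A\<^esub> path_class G N (subpath G v 0 j))
           (subpath G v j (j + (k - 1) * N + 1))
           (path_class G N (subpath G v (j + (k - 1) * N + 1) (k * N)) \<otimes>\<^bsub>A\<^esub> \<beta>))
      else
        P_elt G N (n - 1) (\<alpha> \<otimes>\<^bsub>A\<^esub> path_class G N (subpath G v 0 1)) (subpath G v 1 (k * N + 1)) \<beta>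
        \<ominus>\<^bsub>P\<^esub> P_elt G N (n - 1) \<alpha> (subpath G v 0 (k * N))
               (path_class G N (subpath G v (k * N) (k * N + 1)) \<otimes>\<^bsub>A\<^esub> \<beta>))"

definition P_diff ::
  "('v, 'e) pre_digraph \<Rightarrow> nat \<Rightarrow> nat \<Rightarrow> ('v, 'e, 'k::field) tens_elt \<Rightarrow> ('v, 'e, 'k) tens_elt" where
  "P_diff G N n = (let A = truncated_algebra G N in
     bimod_ext A (P_mod G N n) (P_mod G N (n - 1)) (carrier A \<times> paths G (P_deg N n) \<times> carrier A)
       (\<lambda>(\<alpha>, v, \<beta>). P_elt G N n \<alpha> v \<beta>) (\<lambda>(\<alpha>, v, \<beta>). P_diff_val G N n \<alpha> v \<beta>))"


section \<open>The morphism F\<close>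

text \<open>
  \<open>F_cuts G v s [x\<^sub>1, \<dots>, x\<^sub>k]\<close> is \<open>[p\<^sub>1, q\<^sub>1, \<dots>, p\<^sub>k, q\<^sub>k]\<close>, where \<open>p\<^sub>1 q\<^sub>1 \<dots> p\<^sub>k q\<^sub>k\<close> are consecutive
  subpaths of \<open>v\<close> starting after its first \<open>s\<close> arrows, with lengths \<open>x\<^sub>1, 1, \<dots>, x\<^sub>k, 1\<close>.
\<close>

primrec F_cuts ::
  "('v, 'e) pre_digraph \<Rightarrow> ('v, 'e) path \<Rightarrow> nat \<Rightarrow> nat list \<Rightarrow> ('v, 'e) path list" where
  "F_cuts G v s [] = []"
| "F_cuts G v s (x # xs) =
     subpath G v s (s + x) # subpath G v (s + x) (s + x + 1) # F_cuts G v (s + x + 1) xs"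

definition F_term ::
  "('v, 'e) pre_digraph \<Rightarrow> nat \<Rightarrow> nat \<Rightarrow> ('v, 'e) path \<Rightarrow> nat list \<Rightarrow> ('v, 'e, 'k::field) tens_elt" where
  "F_term G N n v xs =
     (let s = (if even n then 0 else 1);
          entries = (if even n then [] else [subpath G v 0 1]) @ F_cuts G v s xs;
          r = subpath G v (s + sum_list xs + length xs) (path_len v)
      in Q_elt G N n ([\<one>\<^bsub>truncated_algebra G N\<^esub>] @ map (path_class G N) entries @ [path_class G N r]))"

definition F_map ::
  "('v, 'e) pre_digraph \<Rightarrow> nat \<Rightarrow> nat \<Rightarrow> ('v, 'e, 'k::field) tens_elt \<Rightarrow> ('v, 'e, 'k) tens_elt" where
  "F_map G N n = (if n = 0 then (\<lambda>x. x) else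
     (let A = truncated_algebra G N in
      bimod_ext A (P_mod G N n) (Q_mod G N n) (paths G (P_deg N n))
        (\<lambda>v. P_elt G N n \<one>\<^bsub>A\<^esub> v \<one>\<^bsub>A\<^esub>)
        (\<lambda>v. \<Oplus>\<^bsub>Q_mod G N n\<^esub>xs\<in>{xs. length xs = n div 2 \<and> set xs \<subseteq> {1..<N}}. F_term G N n v xs)))"


section \<open>The morphism G\<close>

definition G_index :: "('v, 'e) pre_digraph \<Rightarrow> nat \<Rightarrow> nat \<Rightarrow> ('v, 'e) path list set" where
  "G_index G N n = {as. length as = n \<and> set as \<subseteq> (\<Union>i\<in>{1..<N}. paths G i) \<and>
     (\<forall>i. Suc i < n \<longrightarrow> path_end G (as ! i) = fst (as ! Suc i))}"

text \<open>
  Note that the list \<open>[\<alpha>\<^sub>1, \<dots>, \<alpha>\<^sub>n]\<close> is indexed from 0: \<open>\<alpha>\<^sub>i\<close> is \<open>as ! (i - 1)\<close>. The path \<open>w\<close> is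
  the concatenation in the path algebra, not in the truncated algebra.
\<close>

definition G_val ::
  "('v, 'e) pre_digraph \<Rightarrow> nat \<Rightarrow> nat \<Rightarrow> ('v, 'e) path list \<Rightarrow> ('v, 'e, 'k::field) tens_elt" where
  "G_val G N n as =
     (let A = (truncated_algebra G N :: ('v, 'e, 'k) trunc ring); P = P_mod G N n;
          k = n div 2; w = path_concat as; \<alpha> = (\<lambda>i. as ! (i - 1)) in
      if even n then
        (if \<forall>i\<in>{1..k}. path_class G N (\<alpha> (2 * i - 1)) \<otimes>\<^bsub>A\<^esub> path_class G N (\<alpha> (2 * i)) = \<zero>\<^bsub>A\<^esub>
         then P_elt G N n \<one>\<^bsub>A\<^esub> (subpath G w 0 (k * N)) (path_class G N (subpath G w (k * N) (path_len w)))
         else \<zero>\<^bsub>P\<^esub>)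
      else
        (if \<forall>i\<in>{1..k}. path_class G N (\<alpha> (2 * i)) \<otimes>\<^bsub>A\<^esub> path_class G N (\<alpha> (2 * i + 1)) = \<zero>\<^bsub>A\<^esub>
         then (\<Oplus>\<^bsub>P\<^esub>j\<in>{1..path_len (\<alpha> 1)}. P_elt G N n
                 (path_class G N (subpath G w 0 (j - 1)))
                 (subpath G w (j - 1) (k * N + j))
                 (path_class G N (subpath G w (k * N + j) (path_len w))))
         else \<zero>\<^bsub>P\<^esub>))"

definition G_map ::
  "('v, 'e) pre_digraph \<Rightarrow> nat \<Rightarrow> nat \<Rightarrow> ('v, 'e, 'k::field) tens_elt \<Rightarrow> ('v, 'e, 'k) tens_elt" where
  "G_map G N n = (if n = 0 then (\<lambda>x. x) else
     (let A = truncated_algebra G N in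
      bimod_ext A (Q_mod G N n) (P_mod G N n) (G_index G N n)
        (\<lambda>as. Q_elt G N n ([\<one>\<^bsub>A\<^esub>] @ map (path_class G N) as @ [\<one>\<^bsub>A\<^esub>]))
        (G_val G N n)))"

end

theory Submission
  imports Defs
begin

text \<open>
The maps \<open>b\<close>, \<open>d\<close>, \<open>F\<close> and \<open>G\<close> never look at the arrows of a path; they only move the places at
  which a path is cut into tensor factors. Since the tensor products are taken over the vertex
  algebra, \<open>Q\<^sub>n\<close> has a basis of paths \<open>w\<close> of \<open>\<Delta>\<close>, of any length, cut into \<open>n + 2\<close> consecutive pieces:
  the two outer ones shorter than \<open>N\<close>, the inner ones of length between \<open>1\<close> and \<open>N - 1\<close>. A basis of
  \<open>P\<^sub>n\<close> consists of paths cut into three pieces (two if \<open>n = 0\<close>), the inner one of a prescribed length.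
  All four maps keep \<open>w\<close> and replace the list of the lengths of the pieces by an integer combination
  of such lists that depends on this list only. So \<open>b F = F d\<close> and \<open>d G = G b\<close> are identities between
  integer combinations of lists of natural numbers: \<open>bar_F_lengths\<close> and \<open>P_lengths_G_lengths\<close>.

  These identities hold because \<open>F\<close> and \<open>G\<close> are built by the standard recursion for comparison
  maps. Let \<open>s\<close> and \<open>t\<close> be the contractions \<open>b s + s b = id\<close> of \<open>Q\<close> (\<open>bar_homotopy\<close>) and \<open>d t + t d = id\<close>
  of \<open>P\<close> (\<open>P_homotopy\<close>). On the basis elements whose first piece has length \<open>0\<close>, which generate
  under the left action, the explicit formulas of the theorem satisfy \<open>F\<^sub>n\<^sub>+\<^sub>1 = s F\<^sub>n d\<close> and
  \<open>G\<^sub>n\<^sub>+\<^sub>1 = t G\<^sub>n b\<close> (\<open>F_lengths_rec\<close>, \<open>G_lengths_rec\<close>). By induction \<open>b F\<^sub>n d = F\<^sub>n\<^sub>-\<^sub>1 d d = 0\<close>, hence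
  \<open>b F\<^sub>n\<^sub>+\<^sub>1 = b s F\<^sub>n d = F\<^sub>n d - s b F\<^sub>n d = F\<^sub>n d\<close> on these elements, and everywhere because both sides
  are compatible with the left action; the argument for \<open>G\<close> is the same with \<open>t\<close> in place of \<open>s\<close>.

  What remains is to justify the description by cut paths. The power \<open>I\<^sup>N\<close> is spanned by the paths of
  length at least \<open>N\<close> (\<open>ideal_power_eq\<close>), so that every element of \<open>A\<close> has a unique representative
  without such paths. Recording how the basis paths of the entries of a tuple fit together kills the
  relations of the tensor product; conversely every tuple is congruent to the combination of tuples
  of basis paths that this record describes (\<open>tensor_normal_form\<close>). Therefore the tensor products are
  isomorphic to spaces of combinations of cut paths (\<open>coordinatized_tensor\<close>). The maps of the theorem are
  specified as the bimodule maps with given values on generators; by \<open>bimod_ext_realizes\<close> such a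
  map exists, is unique, and acts on cut paths through a given rule on lengths, as soon as the rule
  gives the right values on the generators and commutes with the outer actions. The facts named
  \<open>..._realizes\<close> check this for all the maps involved.
\<close>

section \<open>Chains of length lists\<close>

abbreviation keys where "keys \<equiv> Poly_Mapping.keys"
abbreviation lookup where "lookup \<equiv> Poly_Mapping.lookup"
abbreviation single where "single \<equiv> Poly_Mapping.single"

abbreviation cons_chain :: "nat \<Rightarrow> (nat list \<Rightarrow>\<^sub>0 int) \<Rightarrow> (nat list \<Rightarrow>\<^sub>0 int)" where
  "cons_chain x \<equiv> frag_extend (\<lambda>ls. frag_of (x # ls))"

text \<open>
  Left multiplication by a path of length \<open>a\<close>, seen on the lengths of the pieces: the first entry of
  a tensor, an element of \<open>A\<close>, becomes zero once its length reaches \<open>N\<close>.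
\<close>

definition grow_first :: "nat \<Rightarrow> nat \<Rightarrow> nat list \<Rightarrow> (nat list \<Rightarrow>\<^sub>0 int)" where
  "grow_first N a ls = (if ls \<noteq> [] \<and> a + hd ls < N then frag_of ((a + hd ls) # tl ls) else 0)"

definition grow_last :: "nat \<Rightarrow> nat \<Rightarrow> nat list \<Rightarrow> (nat list \<Rightarrow>\<^sub>0 int)" where
  "grow_last N a ls = (if ls \<noteq> [] \<and> last ls + a < N then frag_of (butlast ls @ [last ls + a]) else 0)"

text \<open>
  The trace on lengths of being a morphism of \<open>A\<close>-bimodules.
\<close>

definition length_equivariant where
  "length_equivariant N L m \<longleftrightarrow> (\<forall>ls\<in>L. \<forall>a.
     frag_extend m (grow_first N a ls) = frag_extend (grow_first N a) (m ls) \<and>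
     frag_extend m (grow_last N a ls) = frag_extend (grow_last N a) (m ls))"

text \<open>
  A rule that does not change the path that is cut must preserve the sum of the lengths.
\<close>

definition length_preserving where
  "length_preserving L L' m \<longleftrightarrow>
     (\<forall>ls\<in>L. keys (m ls) \<subseteq> {ls'\<in>L'. sum_list ls' = sum_list ls})"

lemma frag_extend_cong:
  assumes "\<And>x. x \<in> keys c \<Longrightarrow> f x = g x"
  shows "frag_extend f c = frag_extend g c"
  using assms by (rule frag_extend_eq)

lemma frag_extend_frag_extend:
  "frag_extend g (frag_extend f c) = frag_extend (\<lambda>x. frag_extend g (f x)) c"
proof -
  have "keys c \<subseteq> UNIV" by simp
  then show ?thesis
    by (induction c rule: frag_induction) (auto simp: frag_extend_diff)
qed

lemma frag_extend_fun_add: "frag_extend (\<lambda>x. f x + g x) c = frag_extend f c + frag_extend g c"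
proof -
  have "keys c \<subseteq> UNIV" by simp
  then show ?thesis
    by (induction c rule: frag_induction) (auto simp: frag_extend_diff)
qed

lemma frag_extend_sum':
  "finite I \<Longrightarrow> frag_extend f (\<Sum>i\<in>I. g i) = (\<Sum>i\<in>I. frag_extend f (g i))"
  by (induction I rule: finite_induct) (auto simp: frag_extend_add)

lemma frag_extend_const_0 [simp]: "frag_extend (\<lambda>x. 0) c = 0"
  by (rule frag_extend_eq_0) simp

section \<open>The bar differential on lengths\<close>

text \<open>
  The alternating sum over the ways to merge two neighbouring pieces, by recursion on the first
  piece; merging a piece of length \<open>x\<close> with its right neighbour is the left action of a path of length
  \<open>x\<close> on the rest. On lists with two entries this is the augmentation \<open>A \<otimes> A \<rightarrow> A\<close>.
\<close>

fun bar_lengths :: "nat \<Rightarrow> nat list \<Rightarrow> (nat list \<Rightarrow>\<^sub>0 int)" where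
  "bar_lengths N (x # y # ls) = grow_first N x (y # ls) - cons_chain x (bar_lengths N (y # ls))"
| "bar_lengths N ls = 0"

lemma keys_consf: "keys (cons_chain x f) = (#) x ` keys f"
proof -
  have "inj ((#) x)" by simp
  have "lookup (cons_chain x f) ls = (case ls of [] \<Rightarrow> 0 | y # ys \<Rightarrow> if y = x then lookup f ys else 0)" for ls
  proof -
    have "keys f \<subseteq> UNIV" by simp
    then show ?thesis
      by (induction f rule: frag_induction)
        (auto simp: frag_extend_diff lookup_minus Poly_Mapping.lookup_single when_def split: list.splits)
  qed
  then show ?thesis by (auto simp: in_keys_iff image_iff split: list.splits if_splits)
qed

lemma grow_first_add:
  "frag_extend (grow_first N a) (grow_first N b ls) = grow_first N (a + b) ls"
  by (auto simp: grow_first_def add.assoc)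

text \<open>
  Only the first two pieces matter, and there merging is addition of lengths, truncated at \<open>N\<close>.
\<close>

lemma bar_grow_first:
  "frag_extend (bar_lengths N) (grow_first N a (y # ls)) = frag_extend (grow_first N a) (bar_lengths N (y # ls))"
proof (cases ls)
  case Nil
  then show ?thesis by (auto simp: grow_first_def)
next
  case (Cons z zs)
  have *: "frag_extend (grow_first N a) (cons_chain y X) = (if a + y < N then cons_chain (a + y) X else 0)" for X
    by (simp add: frag_extend_frag_extend grow_first_def)
  show ?thesis
    unfolding Cons bar_lengths.simps frag_extend_diff grow_first_add *
    by (auto simp: grow_first_def add.assoc)
qed

lemma bar_consf: "[] \<notin> keys f \<Longrightarrow>
  frag_extend (bar_lengths N) (cons_chain x f) = frag_extend (grow_first N x) f - cons_chain x (frag_extend (bar_lengths N) f)"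
proof -
  assume "[] \<notin> keys f"
  then have "keys f \<subseteq> - {[]}" by auto
  then show ?thesis
  proof (induction f rule: frag_induction)
    case (one ls) then show ?case by (cases ls) auto
  qed (auto simp: frag_extend_diff)
qed

lemma keys_diff_subset: "keys a \<subseteq> S \<Longrightarrow> keys b \<subseteq> S \<Longrightarrow> keys (a - b) \<subseteq> S"
  using keys_diff[of a b] by blast

lemma keys_add_subset: "keys a \<subseteq> S \<Longrightarrow> keys b \<subseteq> S \<Longrightarrow> keys (a + b) \<subseteq> S"
  using Poly_Mapping.keys_add[of a b] by blast

lemma keys_sum_subset: "(\<And>i. i \<in> I \<Longrightarrow> keys (f i) \<subseteq> S) \<Longrightarrow> keys (sum f I) \<subseteq> S"
  using keys_sum[of f I] by blast

lemma keys_frag_extend_subset: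
  "(\<And>l. l \<in> keys c \<Longrightarrow> keys (f l) \<subseteq> S) \<Longrightarrow> keys (frag_extend f c) \<subseteq> S"
  using keys_frag_extend[of f c] by blast

lemma keys_bar_length: "keys (bar_lengths N ls) \<subseteq> {ls'. Suc (length ls') = length ls \<and> sum_list ls' = sum_list ls}"
proof (induction N ls rule: bar_lengths.induct)
  case (1 N x y ls)
  show ?case unfolding bar_lengths.simps keys_consf
    by (rule keys_diff_subset) (use 1 in \<open>auto simp: keys_consf grow_first_def\<close>)
qed auto

lemma Nil_notin_bar: "[] \<notin> keys (bar_lengths N (x # y # ls))"
  using keys_bar_length[of N "x # y # ls"] by auto

text \<open>
  By the recursion for \<open>bar_lengths\<close>, applying it twice produces the growth of the differential of the
  tail twice, with opposite signs, and the square of the differential of the tail.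
\<close>

lemma bar_bar: "frag_extend (bar_lengths N) (bar_lengths N ls) = 0"
proof (induction N ls rule: bar_lengths.induct)
  case (1 N x y ls)
  show ?case
  proof (cases ls)
    case Nil then show ?thesis by (auto simp: grow_first_def)
  next
    case (Cons z zs)
    have "frag_extend (bar_lengths N) (bar_lengths N (x # y # ls)) =
      frag_extend (grow_first N x) (bar_lengths N (y # ls)) - frag_extend (bar_lengths N) (cons_chain x (bar_lengths N (y # ls)))"
      by (simp only: bar_lengths.simps frag_extend_diff bar_grow_first)
    also have "\<dots> = cons_chain x (frag_extend (bar_lengths N) (bar_lengths N (y # ls)))"
      by (subst bar_consf) (auto simp: Cons Nil_notin_bar simp del: bar_lengths.simps)
    finally show ?thesis using 1 by simp
  qed
qed auto

lemma grow_last_Cons: "ls \<noteq> [] \<Longrightarrow> grow_last N a (x # ls) = cons_chain x (grow_last N a ls)"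
  by (auto simp: grow_last_def)

lemma grow_last_consf: "[] \<notin> keys f \<Longrightarrow>
   frag_extend (grow_last N a) (cons_chain x f) = cons_chain x (frag_extend (grow_last N a) f)"
  by (auto simp: frag_extend_frag_extend intro!: frag_extend_cong grow_last_Cons)

lemma grow_first_last_commute:
  "frag_extend (grow_last N a) (grow_first N b ls) = frag_extend (grow_first N b) (grow_last N a ls)"
  by (cases ls; cases "tl ls") (auto simp: grow_first_def grow_last_def add.assoc)

lemma bar_grow_last:
  "length ls \<ge> 2 \<Longrightarrow> frag_extend (bar_lengths N) (grow_last N a ls) = frag_extend (grow_last N a) (bar_lengths N ls)"
proof (induction N ls rule: bar_lengths.induct)
  case (1 N x y ls)
  show ?case
  proof (cases ls)
    case Nil then show ?thesis by (auto simp: grow_first_def grow_last_def add.assoc)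
  next
    case (Cons z zs)
    have ne: "[] \<notin> keys (grow_last N a (y # ls))" by (auto simp: grow_last_def Cons)
    have "frag_extend (bar_lengths N) (grow_last N a (x # y # ls)) =
       frag_extend (bar_lengths N) (cons_chain x (grow_last N a (y # ls)))" by (subst grow_last_Cons) auto
    also have "\<dots> = frag_extend (grow_first N x) (grow_last N a (y # ls)) - cons_chain x (frag_extend (bar_lengths N) (grow_last N a (y # ls)))"
      using ne by (rule bar_consf)
    also have "\<dots> = frag_extend (grow_last N a) (bar_lengths N (x # y # ls))"
      using 1 Cons by (simp add: frag_extend_diff grow_first_last_commute grow_last_consf Nil_notin_bar del: bar_lengths.simps(1)
          add: bar_lengths.simps(1)[of N x y])
    finally show ?thesis .
  qed
qed auto

definition bar_lists :: "nat \<Rightarrow> nat \<Rightarrow> nat list set" where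
  "bar_lists N n = listset ([{..<N}] @ replicate n {1..<N} @ [{..<N}])"

lemma bar_lists_iff:
  "ls \<in> bar_lists N n \<longleftrightarrow> length ls = n + 2 \<and> hd ls < N \<and> last ls < N \<and> set (butlast (tl ls)) \<subseteq> {1..<N}"
proof -
  have *: "ls \<in> listset (replicate n {1..<N} @ [{..<N}]) \<longleftrightarrow> length ls = n + 1 \<and> last ls < N \<and> set (butlast ls) \<subseteq> {1..<N}" for ls n
  proof (induction n arbitrary: ls)
    case 0 then show ?case by (cases ls) (auto simp: set_Cons_def)
  next
    case (Suc n)
    show ?case
    proof (cases ls)
      case Nil then show ?thesis by (auto simp: set_Cons_def)
    next
      case (Cons a list)
      then show ?thesis using Suc[of list] by (auto simp: set_Cons_def)
    qed
  qed
  show ?thesis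
  proof (cases ls)
    case Nil then show ?thesis by (auto simp: set_Cons_def bar_lists_def)
  next
    case (Cons a list)
    then show ?thesis using *[of list n] by (auto simp: set_Cons_def bar_lists_def)
  qed
qed

text \<open>
  Merging two inner pieces gives an inner piece of positive length, and the terms with a piece
  that is too long have been dropped.
\<close>

lemma length_preserving_bar:
  "ls \<in> bar_lists N (Suc n) \<Longrightarrow> keys (bar_lengths N ls) \<subseteq> {ls' \<in> bar_lists N n. sum_list ls' = sum_list ls}"
proof (induction n arbitrary: ls)
  case 0
  then obtain x y z where "ls = [x,y,z]" "x < N" "y < N" "z < N" "y \<ge> 1"
    by (auto simp: bar_lists_iff numeral_3_eq_3 length_Suc_conv)
  then show ?case by (auto simp: grow_first_def bar_lists_iff frag_extend_diff dest!: subsetD[OF keys_diff])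
next
  case (Suc n)
  then obtain x y z zs where ls: "ls = x # y # z # zs" by (auto simp: bar_lists_iff length_Suc_conv)
  then have *: "x < N" "y < N" "1 \<le> y" "y # z # zs \<in> bar_lists N (Suc n)" using Suc.prems by (auto simp: bar_lists_iff)
  have keyz: "1 \<le> hd l" if "l \<in> keys (bar_lengths N (y # z # zs))" for l
    using that *(3) by (auto simp: grow_first_def keys_consf dest!: subsetD[OF keys_diff] split: if_splits)
  have "keys (grow_first N x (y # z # zs)) \<subseteq> {ls' \<in> bar_lists N (Suc n). sum_list ls' = sum_list ls}"
    using * ls by (auto simp: bar_lists_iff grow_first_def)
  moreover have "keys (cons_chain x (bar_lengths N (y # z # zs))) \<subseteq> {ls' \<in> bar_lists N (Suc n). sum_list ls' = sum_list ls}"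
  proof -
    have "x # l \<in> {ls' \<in> bar_lists N (Suc n). sum_list ls' = sum_list ls}" if "l \<in> keys (bar_lengths N (y # z # zs))" for l
    proof -
      have "l \<in> bar_lists N n" "sum_list l = sum_list (y # z # zs)" using Suc.IH[OF *(4)] that by blast+
      then show ?thesis using keyz[OF that] * ls by (cases l) (auto simp: bar_lists_iff)
    qed
    then show ?thesis unfolding keys_consf by blast
  qed
  ultimately show ?case unfolding ls bar_lengths.simps(1) by (intro keys_diff_subset) auto
qed

text \<open>
  The standard contraction \<open>\<alpha>\<^sub>0[\<alpha>\<^sub>1|\<dots>]\<alpha>\<^sub>n\<^sub>+\<^sub>1 \<mapsto> 1[\<alpha>\<^sub>0|\<alpha>\<^sub>1|\<dots>]\<alpha>\<^sub>n\<^sub>+\<^sub>1\<close>. As the inner factors are \<open>A\<^sub>+\<close>, the result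
  is zero if \<open>\<alpha>\<^sub>0\<close> is a vertex.
\<close>

definition bar_homotopy :: "nat list \<Rightarrow> (nat list \<Rightarrow>\<^sub>0 int)" where
  "bar_homotopy ls = (if hd ls \<ge> 1 then frag_of (0 # ls) else 0)"

lemma bar_homotopy:
  assumes "ls \<in> bar_lists N n" "n \<ge> 1"
  shows "frag_extend (bar_lengths N) (bar_homotopy ls) + frag_extend bar_homotopy (bar_lengths N ls) = frag_of ls"
proof -
  obtain x y zs where ls: "ls = x # y # zs" and *: "x < N" "1 \<le> y" "y < N"
    using assms by (cases n) (auto simp: bar_lists_iff length_Suc_conv)
  have c: "frag_extend bar_homotopy (cons_chain x X) = (if x \<ge> 1 then cons_chain 0 (cons_chain x X) else 0)" for X
    by (simp add: frag_extend_frag_extend bar_homotopy_def)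
  show ?thesis
  proof (cases "x = 0")
    case True
    then show ?thesis using * unfolding ls bar_lengths.simps(1) frag_extend_diff c by (simp add: bar_homotopy_def grow_first_def)
  next
    case False
    have "frag_extend bar_homotopy (grow_first N x (y # zs)) = cons_chain 0 (grow_first N x (y # zs))"
      using False by (simp add: grow_first_def bar_homotopy_def)
    then show ?thesis using False * unfolding ls frag_extend_diff c bar_lengths.simps(1)
      by (simp add: frag_extend_diff c bar_homotopy_def) (simp add: grow_first_def frag_extend_diff)
  qed
qed

section \<open>The resolution P on lengths\<close>

text \<open>
  The pieces of a basis element of \<open>P\<^sub>n\<close> with outer pieces of length \<open>i\<close> and \<open>j\<close>. In degree \<open>0\<close> there is
  no inner piece, since \<open>P\<^sub>0 = A \<otimes> A\<close>.
\<close>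

definition P_list :: "nat \<Rightarrow> nat \<Rightarrow> nat \<Rightarrow> nat \<Rightarrow> nat list" where
  "P_list N n i j = (if n = 0 then [i, j] else [i, P_deg N n, j])"

definition P_lists :: "nat \<Rightarrow> nat \<Rightarrow> nat list set" where
  "P_lists N n = {P_list N n i j | i j. i < N \<and> j < N}"

text \<open>
  On a path of length \<open>W\<close>, a basis element of \<open>P\<^sub>n\<close> is determined by the position \<open>i\<close> at which its
  inner piece starts. Letting all \<open>i\<close> be admissible, with value \<open>0\<close> when an outer piece is too long,
  turns the sums over positions in the sequel into telescoping sums without side conditions.
\<close>

definition P_cut :: "nat \<Rightarrow> nat \<Rightarrow> nat \<Rightarrow> nat \<Rightarrow> (nat list \<Rightarrow>\<^sub>0 int)" where
  "P_cut N n W i = (if i + P_deg N n \<le> W \<and> i < N \<and> W - i - P_deg N n < N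
     then frag_of (P_list N n i (W - i - P_deg N n)) else 0)"

definition P_lengths :: "nat \<Rightarrow> nat \<Rightarrow> nat list \<Rightarrow> (nat list \<Rightarrow>\<^sub>0 int)" where
  "P_lengths N n ls = (let W = sum_list ls; i = hd ls in
     if even n then \<Sum>r<N. P_cut N (n - 1) W (i + r)
     else P_cut N (n - 1) W (i + 1) - P_cut N (n - 1) W i)"

lemma P_deg_0 [simp]: "P_deg N 0 = 0" by (simp add: P_deg_def)

lemma P_deg_step: "N \<ge> 1 \<Longrightarrow> P_deg N (Suc n) = P_deg N n + (if even n then 1 else N - 1)"
  by (auto simp: P_deg_def elim!: oddE)

lemma P_list_simps [simp]:
  "hd (P_list N n i j) = i" "last (P_list N n i j) = j" "sum_list (P_list N n i j) = i + P_deg N n + j" "P_list N n i j \<noteq> []"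
  by (auto simp: P_list_def)

lemma P_cut_P_list: "i < N \<Longrightarrow> j < N \<Longrightarrow> frag_of (P_list N n i j) = P_cut N n (i + P_deg N n + j) i"
  by (simp add: P_cut_def)

lemma P_cut_eq_0: "i \<ge> N \<Longrightarrow> P_cut N n W i = 0" "W \<ge> i + P_deg N n + N \<Longrightarrow> P_cut N n W i = 0"
  by (auto simp: P_cut_def)

lemma keys_P_cut: "keys (P_cut N n W i) \<subseteq> {ls \<in> P_lists N n. sum_list ls = W}"
  by (auto simp: P_cut_def P_lists_def)

lemma grow_first_P_cut: "frag_extend (grow_first N a) (P_cut N n W i) = P_cut N n (a + W) (a + i)"
  by (auto simp: P_cut_def grow_first_def P_list_def)

lemma grow_last_P_cut: "i + P_deg N n \<le> W \<Longrightarrow> frag_extend (grow_last N a) (P_cut N n W i) = P_cut N n (W + a) i"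
  by (auto simp: P_cut_def grow_last_def P_list_def)

lemma frag_extend_P_cut:
  assumes "i + P_deg N n \<le> W"
    and "i < N \<Longrightarrow> W - i - P_deg N n < N \<Longrightarrow> m (P_list N n i (W - i - P_deg N n)) = X"
    and "i \<ge> N \<Longrightarrow> X = 0" "W - i - P_deg N n \<ge> N \<Longrightarrow> X = 0"
  shows "frag_extend m (P_cut N n W i) = X"
  using assms by (auto simp: P_cut_def not_less)

text \<open>
  The formula for the differential also holds at the positions where \<open>P_cut\<close> vanishes: an outer piece
  that is too long stays so in every term, because \<open>d\<close> only shortens the inner piece.
\<close>

lemma P_lengths_P_cut:
  assumes N: "N \<ge> 1" and n: "n \<ge> 1" and W: "i + P_deg N n \<le> W"
  shows "frag_extend (P_lengths N n) (P_cut N n W i) =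
     (if even n then \<Sum>r<N. P_cut N (n - 1) W (i + r)
      else P_cut N (n - 1) W (i + 1) - P_cut N (n - 1) W i)"
proof (rule frag_extend_P_cut[OF W])
  assume "i \<ge> N"
  then show "(if even n then \<Sum>r<N. P_cut N (n - 1) W (i + r)
      else P_cut N (n - 1) W (i + 1) - P_cut N (n - 1) W i) = 0" by (auto simp: P_cut_eq_0)
next
  assume *: "W - i - P_deg N n \<ge> N"
  obtain n' where n': "n = Suc n'" using n by (cases n) auto
  have "P_cut N (n - 1) W (i + r) = 0" if "r < N" "even n" for r
    using * that W N by (intro P_cut_eq_0) (auto simp: n' P_deg_step)
  moreover have "P_cut N (n - 1) W (i + 1) = 0" "P_cut N (n - 1) W i = 0" if "odd n"
    using * that W N by (auto intro!: P_cut_eq_0(2) simp: n' P_deg_step)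
  ultimately show "(if even n then \<Sum>r<N. P_cut N (n - 1) W (i + r)
      else P_cut N (n - 1) W (i + 1) - P_cut N (n - 1) W i) = 0" by auto
qed (use W in \<open>simp add: P_lengths_def Let_def\<close>)

text \<open>
  One of the two differentials is the difference of two neighbouring positions of the inner piece,
  the other the sum over \<open>N\<close> consecutive positions. The composite telescopes to the cuts at \<open>i + N\<close> and
  at \<open>i\<close>, and both vanish: the left outer piece of the first and the right outer piece of the second
  have length at least \<open>N\<close>.
\<close>

lemma P_lengths_P_lengths:
  assumes N: "N \<ge> 1" and n: "n \<ge> 1" and ls: "ls \<in> P_lists N (Suc n)"
  shows "frag_extend (P_lengths N n) (P_lengths N (Suc n) ls) = 0"
proof -
  obtain i j where ls: "ls = P_list N (Suc n) i j" and ij: "i < N" "j < N" using ls by (auto simp: P_lists_def)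
  define W where "W = i + P_deg N (Suc n) + j"
  obtain n' where n': "n = Suc n'" using n by (cases n) auto
  have tele: "(\<Sum>r<N. P_cut N (n - 1) W (i + (r + 1)) - P_cut N (n - 1) W (i + r)) = 0"
  proof -
    have "(\<Sum>r<N. P_cut N (n - 1) W (i + (r + 1)) - P_cut N (n - 1) W (i + r)) = P_cut N (n - 1) W (i + N) - P_cut N (n - 1) W i"
      using sum_lessThan_telescope[of "\<lambda>r. P_cut N (n - 1) W (i + r)" N] by simp
    also have "\<dots> = 0"
      using N ij by (simp add: W_def P_deg_step n' P_cut_eq_0)
    finally show ?thesis .
  qed
  show ?thesis
  proof (cases "even n")
    case True
    have eq: "P_lengths N (Suc n) ls = P_cut N n W (i + 1) - P_cut N n W i"
      using True ls by (simp add: P_lengths_def W_def Let_def)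
    have W: "i + 1 + P_deg N n \<le> W" "i + P_deg N n \<le> W" using True N by (auto simp: W_def P_deg_step)
    show ?thesis unfolding eq frag_extend_diff using tele True
      by (subst P_lengths_P_cut[OF N n W(1)], subst P_lengths_P_cut[OF N n W(2)]) (simp add: sum_subtractf add.assoc add.commute[of 1])
  next
    case False
    have eq: "P_lengths N (Suc n) ls = (\<Sum>r<N. P_cut N n W (i + r))"
      using False ls by (simp add: P_lengths_def W_def Let_def)
    have "frag_extend (P_lengths N n) (P_lengths N (Suc n) ls) = (\<Sum>r<N. frag_extend (P_lengths N n) (P_cut N n W (i + r)))"
      by (simp add: eq frag_extend_sum')
    also have "\<dots> = (\<Sum>r<N. P_cut N (n - 1) W (i + r + 1) - P_cut N (n - 1) W (i + r))"
    proof (rule sum.cong)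
      fix r assume "r \<in> {..<N}"
      then have "i + r + P_deg N n \<le> W" using False by (auto simp: W_def P_deg_step N)
      from P_lengths_P_cut[OF N n this] show "frag_extend (P_lengths N n) (P_cut N n W (i + r)) = P_cut N (n - 1) W (i + r + 1) - P_cut N (n - 1) W (i + r)"
        using False by simp
    qed simp
    finally show ?thesis using tele by (simp add: add.assoc)
  qed
qed

lemma bar_P_cut: "frag_extend (bar_lengths N) (P_cut N 0 W i) = (if i \<le> W \<and> W < N then frag_of [W] else 0)"
  by (auto simp: P_cut_def P_list_def grow_first_def)

lemma P_lists_0: "P_lists N 0 = bar_lists N 0"
  by (auto simp: P_lists_def P_list_def bar_lists_iff length_Suc_conv numeral_2_eq_2)

lemma bar_P_lengths:
  assumes "ls \<in> P_lists N 1"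
  shows "frag_extend (bar_lengths N) (P_lengths N 1 ls) = 0"
  using assms by (auto simp: P_lists_def P_lengths_def frag_extend_diff bar_P_cut P_deg_def)

lemma length_preserving_P_lengths:
  "length_preserving (P_lists N n) (P_lists N (n - 1)) (P_lengths N n)"
  unfolding length_preserving_def P_lengths_def Let_def
  by (intro ballI, split if_split, intro conjI impI keys_diff_subset keys_sum_subset keys_P_cut)

text \<open>
  Growing an outer piece only shifts or extends the path below the inner piece, that is, it sends a
  \<open>P_cut\<close> to a \<open>P_cut\<close>; so the formula of \<open>P_lengths_P_cut\<close> applies on both sides.
\<close>

lemma length_equivariant_P_lengths:
  assumes N: "N \<ge> 1" and n: "n \<ge> 1"
  shows "length_equivariant N (P_lists N n) (P_lengths N n)"
  unfolding length_equivariant_def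
proof (intro ballI allI)
  fix ls a assume "ls \<in> P_lists N n"
  then obtain i j where ls: "ls = P_list N n i j" and ij: "i < N" "j < N" by (auto simp: P_lists_def)
  define W where "W = i + P_deg N n + j"
  have W: "i + P_deg N n \<le> W" by (simp add: W_def)
  have eq: "P_lengths N n ls = frag_extend (P_lengths N n) (P_cut N n W i)" "frag_of ls = P_cut N n W i"
    unfolding ls W_def using ij by (simp_all add: P_cut_P_list flip: P_cut_P_list)
  have l: "grow_first N a ls = P_cut N n (a + W) (a + i)"
    using grow_first_P_cut[of N a n W i] by (simp flip: eq(2))
  have r: "grow_last N a ls = P_cut N n (W + a) i"
    using grow_last_P_cut[OF W, of a] by (simp flip: eq(2))
  obtain n' where n': "n = Suc n'" using n by (cases n) auto
  have W': "i + r + P_deg N (n - 1) \<le> W" if "even n" "r < N" for r using that N by (auto simp: W_def n' P_deg_step)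
  have W'': "i + 1 + P_deg N (n - 1) \<le> W" "i + P_deg N (n - 1) \<le> W" if "odd n" using that N by (auto simp: W_def n' P_deg_step)
  show "frag_extend (P_lengths N n) (grow_first N a ls) = frag_extend (grow_first N a) (P_lengths N n ls) \<and>
     frag_extend (P_lengths N n) (grow_last N a ls) = frag_extend (grow_last N a) (P_lengths N n ls)"
    unfolding l r eq(1) using W W' W'' N n
    by (auto simp: P_lengths_P_cut frag_extend_diff frag_extend_sum' grow_first_P_cut grow_last_P_cut add.assoc)
qed

section \<open>A contraction of P\<close>

text \<open>
  In even degree the summation over all earlier positions inverts the difference operator that
  is the differential of odd degree. The differential of even degree sums over \<open>N\<close> consecutive
  positions, and among the windows of this kind the one that starts at \<open>0\<close> is recognised by its last
  position \<open>N - 1\<close>; this gives the inverse in odd degree.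
\<close>

definition P_homotopy :: "nat \<Rightarrow> nat \<Rightarrow> nat list \<Rightarrow> (nat list \<Rightarrow>\<^sub>0 int)" where
  "P_homotopy N n ls = (let W = sum_list ls; i = hd ls in
     if even n then \<Sum>r<i. P_cut N (n + 1) W r
     else if i = N - 1 then P_cut N (n + 1) W 0 else 0)"

lemma P_homotopy_P_cut:
  assumes N: "N \<ge> 1" and W: "i + P_deg N n \<le> W" and i: "i < N"
  shows "frag_extend (P_homotopy N n) (P_cut N n W i) =
    (if even n then \<Sum>r<i. P_cut N (n + 1) W r
     else if i = N - 1 then P_cut N (n + 1) W 0 else 0)"
proof (rule frag_extend_P_cut[OF W])
  assume *: "W - i - P_deg N n \<ge> N"
  have "P_cut N (n + 1) W r = 0" if "even n" "r < i" for r
    using * that W N by (intro P_cut_eq_0(2)) (auto simp: P_deg_step)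
  moreover have "P_cut N (n + 1) W 0 = 0" if "odd n" "i = N - 1"
    using * that W N by (intro P_cut_eq_0(2)) (auto simp: P_deg_step)
  ultimately show "(if even n then \<Sum>r<i. P_cut N (n + 1) W r
     else if i = N - 1 then P_cut N (n + 1) W 0 else 0) = 0" by auto
qed (use i W in \<open>auto simp add: P_homotopy_def Let_def\<close>)

lemma P_homotopy:
  assumes N: "N \<ge> 1" and n: "n \<ge> 1" and ls: "ls \<in> P_lists N n"
  shows "frag_extend (P_lengths N (Suc n)) (P_homotopy N n ls) + frag_extend (P_homotopy N (n - 1)) (P_lengths N n ls) = frag_of ls"
proof -
  obtain i j where ls: "ls = P_list N n i j" and ij: "i < N" "j < N" using ls by (auto simp: P_lists_def)
  define W where "W = i + P_deg N n + j"
  obtain n' where n': "n = Suc n'" using n by (cases n) auto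
  have eq: "frag_of ls = P_cut N n W i" unfolding ls W_def using ij by (simp add: P_cut_P_list)
  show ?thesis
  proof (cases "even n")
    case True
    have Wn: "W \<ge> i + (P_deg N n' + (N - 1))" using True N by (simp add: W_def n' P_deg_step)
    have "frag_extend (P_lengths N (Suc n)) (P_homotopy N n ls) = (\<Sum>r<i. frag_extend (P_lengths N (Suc n)) (P_cut N (Suc n) W r))"
      using True by (simp add: P_homotopy_def ls W_def frag_extend_sum')
    also have "\<dots> = (\<Sum>r<i. P_cut N n W (Suc r) - P_cut N n W r)"
      using True N by (intro sum.cong refl, subst P_lengths_P_cut) (auto simp: W_def P_deg_step)
    also have "\<dots> = P_cut N n W i - P_cut N n W 0" by (rule sum_lessThan_telescope)
    finally have 1: "frag_extend (P_lengths N (Suc n)) (P_homotopy N n ls) = P_cut N n W i - P_cut N n W 0" .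
    have "frag_extend (P_homotopy N (n - 1)) (P_lengths N n ls) = (\<Sum>r<N. frag_extend (P_homotopy N (n - 1)) (P_cut N (n - 1) W (i + r)))"
      using True by (simp add: P_lengths_def ls W_def frag_extend_sum')
    also have "\<dots> = (\<Sum>r<N. if r = N - 1 - i then P_cut N n W 0 else 0)"
    proof (rule sum.cong)
      fix r assume r: "r \<in> {..<N}"
      show "frag_extend (P_homotopy N (n - 1)) (P_cut N (n - 1) W (i + r)) = (if r = N - 1 - i then P_cut N n W 0 else 0)"
      proof (cases "i + r < N")
        case True
        then show ?thesis using \<open>even n\<close> r Wn N by (subst P_homotopy_P_cut) (auto simp: n')
      next
        case False
        then show ?thesis using N ij by (auto simp: P_cut_eq_0)
      qed
    qed simp
    also have "\<dots> = P_cut N n W 0" using N ij by simp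
    finally show ?thesis using 1 eq by simp
  next
    case False
    have W1: "i + 1 + P_deg N n' \<le> W" using False N by (simp add: W_def n' P_deg_step)
    have d: "P_lengths N n ls = P_cut N (n - 1) W (i + 1) - P_cut N (n - 1) W i"
      using False by (simp add: P_lengths_def ls W_def Let_def)
    have t0: "frag_extend (P_homotopy N (n - 1)) (P_cut N (n - 1) W i) = (\<Sum>r<i. P_cut N n W r)"
      using False W1 ij N by (subst P_homotopy_P_cut) (auto simp: n')
    show ?thesis
    proof (cases "i = N - 1")
      case True
      have "frag_extend (P_lengths N (Suc n)) (P_homotopy N n ls) = frag_extend (P_lengths N (Suc n)) (P_cut N (Suc n) W 0)"
        using False True by (simp add: P_homotopy_def ls W_def)
      also have "\<dots> = (\<Sum>r<N. P_cut N n W r)"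
        using False True N by (subst P_lengths_P_cut) (auto simp: W_def P_deg_step)
      also have "\<dots> = (\<Sum>r<i. P_cut N n W r) + P_cut N n W i"
        using True N by (cases N) auto
      finally show ?thesis using True t0 N ij
        by (simp add: d frag_extend_diff frag_extend_minus P_cut_eq_0 eq)
    next
      case False2: False
      have "frag_extend (P_homotopy N (n - 1)) (P_cut N (n - 1) W (i + 1)) = (\<Sum>r<i + 1. P_cut N n W r)"
        using False False2 W1 ij N by (subst P_homotopy_P_cut) (auto simp: n')
      then show ?thesis using False False2 t0 eq
        by (simp add: d frag_extend_diff) (simp add: P_homotopy_def ls)
    qed
  qed
qed

section \<open>F commutes with the differentials on lengths\<close>

text \<open>
  The possible lengths of an inner piece in a term of \<open>F\<close> when \<open>n\<close> inner pieces follow it: the pieces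
  \<open>q\<^sub>i\<close>, of length \<open>1\<close>, are followed by an even number of pieces, the pieces \<open>p\<^sub>i\<close> by an odd number. For
  \<open>N = 1\<close> there are none, as \<open>A\<^sub>+ = 0\<close>.
\<close>

definition F_step :: "nat \<Rightarrow> nat \<Rightarrow> nat set" where
  "F_step N n = {x. 1 \<le> x \<and> x < N \<and> (even n \<longrightarrow> x = 1)}"

text \<open>
  The pieces after the first outer one in the terms of \<open>F\<close>, for a path of length \<open>W\<close>. The recursion
  matches that of \<open>F_lengths_rec\<close>; the closed form is \<open>F_tail_sum\<close>.
\<close>

primrec F_tail :: "nat \<Rightarrow> nat \<Rightarrow> nat \<Rightarrow> (nat list \<Rightarrow>\<^sub>0 int)" where
  "F_tail N 0 W = (if W < N then frag_of [W] else 0)"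
| "F_tail N (Suc n) W = (\<Sum>x\<in>F_step N n. cons_chain x (F_tail N n (W - x)))"

definition F_lengths :: "nat \<Rightarrow> nat \<Rightarrow> nat list \<Rightarrow> (nat list \<Rightarrow>\<^sub>0 int)" where
  "F_lengths N n ls = cons_chain (hd ls) (F_tail N n (sum_list ls - hd ls))"

lemma finite_F_step [simp]: "finite (F_step N n)"
  by (rule finite_subset[of _ "{..N}"]) (auto simp: F_step_def)

lemma F_step_le: "x \<in> F_step N n \<Longrightarrow> P_deg N (Suc n) \<le> W \<Longrightarrow> P_deg N n \<le> W - x \<and> x \<le> W"
  by (auto simp: F_step_def P_deg_step split: if_splits)

text \<open>
  The inner pieces use up at most \<open>P_deg N n\<close> arrows, so the last piece has length at least \<open>N\<close>.
\<close>

lemma F_tail_eq_0: "W \<ge> P_deg N n + N \<Longrightarrow> F_tail N n W = 0"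
proof (induction n arbitrary: W)
  case (Suc n)
  have "F_tail N n (W - x) = 0" if "x \<in> F_step N n" for x
    using that Suc.prems by (intro Suc.IH) (auto simp: F_step_def P_deg_step split: if_splits)
  then show ?case by simp
qed auto

lemma keys_F_tail:
  "P_deg N n \<le> W \<Longrightarrow> keys (F_tail N n W) \<subseteq>
     {ls. length ls = n + 1 \<and> last ls < N \<and> set (butlast ls) \<subseteq> {1..<N} \<and> sum_list ls = W}"
proof (induction n arbitrary: W)
  case (Suc n)
  show ?case unfolding F_tail.simps
  proof (rule keys_sum_subset)
    fix x assume x: "x \<in> F_step N n"
    show "keys (cons_chain x (F_tail N n (W - x))) \<subseteq>
       {ls. length ls = Suc n + 1 \<and> last ls < N \<and> set (butlast ls) \<subseteq> {1..<N} \<and> sum_list ls = W}"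
      using F_step_le[OF x Suc.prems] subsetD[OF Suc.IH[of "W - x"]] x
      by (fastforce simp: keys_consf F_step_def split: if_splits)
  qed
qed (auto)

lemma F_tail_grow_last:
  "P_deg N n \<le> W \<Longrightarrow> frag_extend (grow_last N a) (F_tail N n W) = F_tail N n (W + a)"
proof (induction n arbitrary: W)
  case 0
  then show ?case by (auto simp: grow_last_def)
next
  case (Suc n)
  have "frag_extend (grow_last N a) (cons_chain x (F_tail N n (W - x))) = cons_chain x (F_tail N n (W + a - x))" if x: "x \<in> F_step N n" for x
  proof -
    have "[] \<notin> keys (F_tail N n (W - x))"
      using keys_F_tail[of N n "W - x"] F_step_le[OF x Suc.prems] by auto
    then show ?thesis using Suc.IH[of "W - x"] F_step_le[OF x Suc.prems] by (simp add: grow_last_consf)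
  qed
  then show ?case by (simp add: frag_extend_sum')
qed

lemma F_lengths_P_cut:
  assumes W: "i + P_deg N n \<le> W"
  shows "frag_extend (F_lengths N n) (P_cut N n W i) = (if i < N then cons_chain i (F_tail N n (W - i)) else 0)"
proof (rule frag_extend_P_cut[OF W])
  assume "N \<le> W - i - P_deg N n"
  then have "F_tail N n (W - i) = 0" using W by (intro F_tail_eq_0) auto
  then show "(if i < N then cons_chain i (F_tail N n (W - i)) else 0) = 0" by simp
qed (use W in \<open>auto simp: F_lengths_def\<close>)

lemma length_preserving_F: "length_preserving (P_lists N n) (bar_lists N n) (F_lengths N n)"
  unfolding length_preserving_def
proof
  fix ls assume "ls \<in> P_lists N n"
  then obtain i j where ls: "ls = P_list N n i j" and ij: "i < N" "j < N" by (auto simp: P_lists_def)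
  have "x \<noteq> []" "i # x \<in> bar_lists N n" "sum_list (i # x) = sum_list ls" if "x \<in> keys (F_tail N n (P_deg N n + j))" for x
  proof -
    have *: "length x = n + 1 \<and> last x < N \<and> set (butlast x) \<subseteq> {1..<N} \<and> sum_list x = P_deg N n + j"
      using that keys_F_tail[of N n "P_deg N n + j"] by auto
    then show "x \<noteq> []" by auto
    then show "i # x \<in> bar_lists N n" "sum_list (i # x) = sum_list ls" using * ij by (auto simp: bar_lists_iff ls)
  qed
  then show "keys (F_lengths N n ls) \<subseteq> {ls' \<in> bar_lists N n. sum_list ls' = sum_list ls}"
    by (auto simp: F_lengths_def ls keys_consf add.assoc)
qed

lemma grow_first_consf: "frag_extend (grow_first N a) (cons_chain i X) = (if a + i < N then cons_chain (a + i) X else 0)"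
  by (simp add: frag_extend_frag_extend grow_first_def)

lemma P_lists_cases:
  assumes "ls \<in> P_lists N n"
  obtains i W where "i < N" "i + P_deg N n \<le> W" "frag_of ls = P_cut N n W i" "hd ls = i" "sum_list ls = W"
  using assms by (force simp: P_lists_def P_cut_P_list)

lemma length_equivariant_F: "length_equivariant N (P_lists N n) (F_lengths N n)"
  unfolding length_equivariant_def
proof (intro ballI allI)
  fix ls a assume "ls \<in> P_lists N n"
  then obtain i W where i: "i < N" and W: "i + P_deg N n \<le> W" and c: "frag_of ls = P_cut N n W i" and [simp]: "hd ls = i" "sum_list ls = W"
    by (rule P_lists_cases)
  have l: "grow_first N a ls = P_cut N n (a + W) (a + i)" using grow_first_P_cut[of N a n W i] by (simp flip: c)
  have r: "grow_last N a ls = P_cut N n (W + a) i" using grow_last_P_cut[OF W, of a] by (simp flip: c)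
  have "P_deg N n \<le> W - i" using W by linarith
  then have ne: "[] \<notin> keys (F_tail N n (W - i))" using subsetD[OF keys_F_tail[of N n "W - i"], of "[]"] by auto
  show "frag_extend (F_lengths N n) (grow_first N a ls) = frag_extend (grow_first N a) (F_lengths N n ls) \<and>
        frag_extend (F_lengths N n) (grow_last N a ls) = frag_extend (grow_last N a) (F_lengths N n ls)"
    unfolding l r using i W ne
    by (simp add: F_lengths_P_cut F_lengths_def grow_first_consf grow_last_consf F_tail_grow_last)
qed

lemma length_equivariantD:
  assumes "length_equivariant N L m" "keys f \<subseteq> L"
  shows "frag_extend m (frag_extend (grow_first N a) f) = frag_extend (grow_first N a) (frag_extend m f)"
    "frag_extend m (frag_extend (grow_last N a) f) = frag_extend (grow_last N a) (frag_extend m f)"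
  using assms unfolding frag_extend_frag_extend length_equivariant_def by (auto intro!: frag_extend_cong)

lemma length_preserving_keys:
  assumes "length_preserving L L' m" "keys f \<subseteq> L"
  shows "keys (frag_extend m f) \<subseteq> L'"
  using assms unfolding length_preserving_def by (intro keys_frag_extend_subset) blast

lemma length_preservingD:
  assumes "length_preserving L L' m" "ls \<in> L"
  shows "keys (m ls) \<subseteq> L'"
  using assms unfolding length_preserving_def by blast

lemma length_preserving_bar': "n \<ge> 1 \<Longrightarrow> length_preserving (bar_lists N n) (bar_lists N (n - 1)) (bar_lengths N)"
  using length_preserving_bar[of _ N "n - 1"] unfolding length_preserving_def by simp

lemma length_equivariant_bar: "length_equivariant N (bar_lists N n) (bar_lengths N)"
  unfolding length_equivariant_def
proof (intro ballI allI)
  fix ls a assume "ls \<in> bar_lists N n"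
  then have "length ls \<ge> 2" by (auto simp: bar_lists_iff)
  moreover from this obtain y zs where "ls = y # zs" by (cases ls) auto
  ultimately show "frag_extend (bar_lengths N) (grow_first N a ls) = frag_extend (grow_first N a) (bar_lengths N ls) \<and>
     frag_extend (bar_lengths N) (grow_last N a ls) = frag_extend (grow_last N a) (bar_lengths N ls)"
    using bar_grow_first bar_grow_last by blast
qed

text \<open>
  The contraction kills every list that starts with \<open>0\<close>, hence of the terms of \<open>d\<close> only those in
  which the inner piece starts at a positive position \<open>r < N\<close> survive, and \<open>r\<close> becomes the length of
  a new inner piece. In the differential of odd degree this leaves \<open>r = 1\<close>, in that of even degree
  all \<open>r\<close>: these are the two cases of \<open>F_step\<close>.
\<close>

lemma F_lengths_rec:
  assumes N: "N \<ge> 1"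
  shows "F_lengths N (Suc n) (P_list N (Suc n) 0 j) =
    frag_extend bar_homotopy (frag_extend (F_lengths N n) (P_lengths N (Suc n) (P_list N (Suc n) 0 j)))"
proof -
  define W where "W = P_deg N (Suc n) + j"
  have hs: "frag_extend bar_homotopy (frag_extend (F_lengths N n) (P_cut N n W r)) =
      (if 1 \<le> r \<and> r < N then cons_chain 0 (cons_chain r (F_tail N n (W - r))) else 0)" if "r + P_deg N n \<le> W" for r
    using that by (simp add: F_lengths_P_cut frag_extend_frag_extend bar_homotopy_def)
  have "frag_extend bar_homotopy (frag_extend (F_lengths N n) (P_lengths N (Suc n) (P_list N (Suc n) 0 j)))
    = (\<Sum>r\<in>F_step N n. cons_chain 0 (cons_chain r (F_tail N n (W - r))))"
  proof (cases "even n")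
    case True
    have "F_step N n = (if 1 < N then {1} else {})" using True by (auto simp: F_step_def)
    moreover have "1 + P_deg N n \<le> W" "0 + P_deg N n \<le> W" using True N by (auto simp: W_def P_deg_step)
    ultimately show ?thesis using True
      by (simp add: P_lengths_def frag_extend_diff hs flip: W_def)
  next
    case False
    have "P_lengths N (Suc n) (P_list N (Suc n) 0 j) = (\<Sum>r<N. P_cut N n W r)" using False by (simp add: P_lengths_def W_def Let_def)
    then have "frag_extend bar_homotopy (frag_extend (F_lengths N n) (P_lengths N (Suc n) (P_list N (Suc n) 0 j)))
      = (\<Sum>r<N. frag_extend bar_homotopy (frag_extend (F_lengths N n) (P_cut N n W r)))"
      by (simp add: frag_extend_sum')
    also have "\<dots> = (\<Sum>r<N. if 1 \<le> r \<and> r < N then cons_chain 0 (cons_chain r (F_tail N n (W - r))) else 0)"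
      using False N by (intro sum.cong refl hs) (auto simp: W_def P_deg_step)
    also have "\<dots> = (\<Sum>r\<in>F_step N n. cons_chain 0 (cons_chain r (F_tail N n (W - r))))"
      using False by (intro sum.mono_neutral_cong_right) (auto simp: F_step_def)
    finally show ?thesis .
  qed
  then show ?thesis by (simp add: F_lengths_def frag_extend_sum' flip: W_def)
qed

text \<open>
  On a cycle, the identity for a contraction leaves only one of its two terms.
\<close>

lemma frag_homotopy:
  assumes "keys f \<subseteq> L" "\<And>ls. ls \<in> L \<Longrightarrow> frag_extend d (h ls) + frag_extend h' (d' ls) = frag_of ls"
    and "frag_extend d' f = 0"
  shows "frag_extend d (frag_extend h f) = f"
proof -
  have "frag_extend (\<lambda>ls. frag_extend d (h ls) + frag_extend h' (d' ls)) f = frag_extend frag_of f"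
    using assms by (intro frag_extend_cong) blast
  then have "frag_extend d (frag_extend h f) + frag_extend h' (frag_extend d' f) = f"
    by (simp add: frag_extend_fun_add frag_extend_frag_extend flip: frag_expansion)
  then show ?thesis using assms by simp
qed

text \<open>
  In the induction step \<open>F d\<close> of a list that starts with \<open>0\<close> is a cycle, because \<open>b F d = F d d = 0\<close>; hence
  it is \<open>b\<close> of its image under the contraction, which is \<open>F\<close> of the list by \<open>F_lengths_rec\<close>. Other lists
  arise by the left action. Degree \<open>1\<close> is a direct computation, the contraction being available in
  positive degrees only.
\<close>

theorem bar_F_lengths:
  assumes N: "N \<ge> 1" and "n \<ge> 1" "ls \<in> P_lists N n"
  shows "frag_extend (bar_lengths N) (F_lengths N n ls) = frag_extend (F_lengths N (n - 1)) (P_lengths N n ls)"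
  using assms(2,3)
proof (induction n arbitrary: ls)
  case (Suc n)
  obtain i j where ls: "ls = P_list N (Suc n) i j" and ij: "i < N" "j < N" using Suc.prems by (auto simp: P_lists_def)
  let ?ls = "P_list N (Suc n) 0 j"
  have mem: "?ls \<in> P_lists N (Suc n)" using ij N unfolding P_lists_def mem_Collect_eq by (intro exI[of _ 0] exI[of _ j]) auto
  have d: "keys (P_lengths N (Suc n) ?ls) \<subseteq> P_lists N n"
    using length_preservingD[OF length_preserving_P_lengths mem] by simp
  have 0: "frag_extend (bar_lengths N) (F_lengths N (Suc n) ?ls) = frag_extend (F_lengths N n) (P_lengths N (Suc n) ?ls)"
  proof (cases "n = 0")
    case True
    have "F_step N 0 = (if 1 < N then {1} else {})" by (auto simp: F_step_def)
    then show ?thesis using True N ij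
      by (auto simp: F_lengths_def P_lengths_def Let_def P_deg_def frag_extend_diff F_lengths_P_cut grow_first_def frag_extend_minus)
  next
    case False
    have "frag_extend (bar_lengths N) (frag_extend (F_lengths N n) (P_lengths N (Suc n) ?ls)) =
       frag_extend (F_lengths N (n - 1)) (frag_extend (P_lengths N n) (P_lengths N (Suc n) ?ls))"
      unfolding frag_extend_frag_extend using d Suc.IH False by (intro frag_extend_cong) auto
    also have "\<dots> = 0" using P_lengths_P_lengths[OF N _ mem] False by simp
    finally have z: "frag_extend (bar_lengths N) (frag_extend (F_lengths N n) (P_lengths N (Suc n) ?ls)) = 0" .
    have "frag_extend (bar_lengths N) (frag_extend bar_homotopy (frag_extend (F_lengths N n) (P_lengths N (Suc n) ?ls)))
      = frag_extend (F_lengths N n) (P_lengths N (Suc n) ?ls)"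
      by (rule frag_homotopy[OF length_preserving_keys[OF length_preserving_F d] _ z, of _ _ bar_homotopy])
        (use False in \<open>auto intro!: bar_homotopy\<close>)
    then show ?thesis by (simp add: F_lengths_rec[OF N])
  qed
  \<comment> \<open>All the maps commute with the growth of the first piece, which leads from \<open>?ls\<close> to \<open>ls\<close>.\<close>
  have g: "frag_of ls = frag_extend (grow_first N i) (frag_of ?ls)" using ij by (simp add: ls grow_first_def P_list_def)
  have "frag_extend (bar_lengths N) (frag_extend (F_lengths N (Suc n)) (frag_of ls)) =
     frag_extend (grow_first N i) (frag_extend (bar_lengths N) (frag_extend (F_lengths N (Suc n)) (frag_of ?ls)))"
    unfolding g
    by (subst length_equivariantD(1)[OF length_equivariant_F], use mem in simp,
        subst length_equivariantD(1)[OF length_equivariant_bar])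
      (use mem length_preservingD[OF length_preserving_F mem] in auto)
  also have "\<dots> = frag_extend (grow_first N i) (frag_extend (F_lengths N n) (frag_extend (P_lengths N (Suc n)) (frag_of ?ls)))"
    using 0 by simp
  also have "\<dots> = frag_extend (F_lengths N n) (frag_extend (P_lengths N (Suc n)) (frag_of ls))"
    unfolding g
    by (subst length_equivariantD(1)[OF length_equivariant_P_lengths], use mem N in simp, use mem N in simp, use mem in simp,
        subst length_equivariantD(1)[OF length_equivariant_F])
      (use d in auto)
  finally show ?case by simp
qed simp

section \<open>G commutes with the differentials on lengths\<close>

text \<open>
  The condition in the definition of \<open>G\<close>: the products of the first and second, of the third and
  fourth entry, and so on, vanish in \<open>A\<close>. A last entry without a partner carries no condition.
\<close>

fun zero_pairs :: "nat \<Rightarrow> nat list \<Rightarrow> bool" where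
  "zero_pairs N (a # b # ls) = (a + b \<ge> N \<and> zero_pairs N ls)"
| "zero_pairs N ls = True"

text \<open>
  The pairs start with the first inner piece in even degree and with the second one in odd degree.
\<close>

definition G_lengths :: "nat \<Rightarrow> nat \<Rightarrow> nat list \<Rightarrow> (nat list \<Rightarrow>\<^sub>0 int)" where
  "G_lengths N n ls =
     (if even n then (if zero_pairs N (tl ls) then P_cut N n (sum_list ls) (hd ls) else 0)
      else if zero_pairs N (tl (tl ls)) then \<Sum>r<hd (tl ls). P_cut N n (sum_list ls) (hd ls + r) else 0)"

text \<open>
  Each pair contributes at least \<open>N\<close> arrows; so the path is long enough to contain the inner piece
  of a basis element of \<open>P\<close>, followed by a piece no shorter than the last one.
\<close>

lemma zero_pairs_sum: "odd (length xs) \<Longrightarrow> zero_pairs N xs \<Longrightarrow> (length xs div 2) * N + last xs \<le> sum_list xs"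
proof (induction N xs rule: zero_pairs.induct)
  case (1 N a b ls)
  then show ?case by (cases ls) auto
next
  case ("2_2" N v) then show ?case by simp
qed simp

lemma zero_pairs_grow_last: "odd (length xs) \<Longrightarrow> zero_pairs N (butlast xs @ [y]) = zero_pairs N xs"
proof (induction N xs rule: zero_pairs.induct)
  case (1 N a b ls)
  then show ?case by (cases ls) auto
qed auto

lemma length_preserving_G: "length_preserving (bar_lists N n) (P_lists N n) (G_lengths N n)"
  unfolding length_preserving_def G_lengths_def
  by (auto simp del: mem_Collect_eq intro!: keys_sum_subset subset_trans[OF keys_P_cut])

lemma bar_lists_cases:
  assumes "ls \<in> bar_lists N n"
  obtains i xs where "ls = i # xs" "i < N" "length xs = n + 1" "last xs < N" "set (butlast xs) \<subseteq> {1..<N}"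
  using assms by (cases ls) (auto simp: bar_lists_iff split: if_splits)

lemma zero_pairs_bounds:
  assumes "length xs = n + 1" "even n" "zero_pairs N xs"
  shows "P_deg N n + last xs \<le> sum_list xs"
  using zero_pairs_sum[of xs N] assms by (auto simp: P_deg_def)

text \<open>
  If growing the last piece makes the tensor vanish, then every term of \<open>G\<close> vanishes as well, because
  its last piece is at least as long; in all other cases \<open>G\<close> sees the growth only through the total
  length.
\<close>

lemma length_equivariant_G:
  assumes N: "N \<ge> 1"
  shows "length_equivariant N (bar_lists N n) (G_lengths N n)"
  unfolding length_equivariant_def
proof (intro ballI allI)
  fix ls a assume "ls \<in> bar_lists N n"
  then obtain i xs where ls: "ls = i # xs" "i < N" "length xs = n + 1" "last xs < N" "set (butlast xs) \<subseteq> {1..<N}"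
    by (rule bar_lists_cases)
  have [simp]: "xs \<noteq> []" using ls by auto
  have sl: "sum_list (butlast xs @ [last xs + a]) = sum_list xs + a"
    using arg_cong[OF append_butlast_last_id[of xs], of sum_list] by (simp del: append_butlast_last_id)
  have sl2: "sum_list (butlast xs) + (last xs + a) = sum_list xs + a" using sl by simp
  show "frag_extend (G_lengths N n) (grow_first N a ls) = frag_extend (grow_first N a) (G_lengths N n ls) \<and>
        frag_extend (G_lengths N n) (grow_last N a ls) = frag_extend (grow_last N a) (G_lengths N n ls)"
  proof (cases "even n")
    case True
    have zp: "zero_pairs N (butlast xs @ [last xs + a]) = zero_pairs N xs" using ls True by (intro zero_pairs_grow_last) auto
    have b: "P_deg N n + last xs \<le> sum_list xs" if "zero_pairs N xs" using zero_pairs_bounds[OF ls(3) True that] .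
    have "frag_extend (G_lengths N n) (grow_first N a ls) = frag_extend (grow_first N a) (G_lengths N n ls)"
      using True by (auto simp: ls(1) grow_first_P_cut grow_first_def G_lengths_def P_cut_eq_0 add.assoc)
    moreover have "frag_extend (G_lengths N n) (grow_last N a ls) = frag_extend (grow_last N a) (G_lengths N n ls)"
    proof (cases "zero_pairs N xs \<and> last xs + a \<ge> N")
      case True2: True
      then show ?thesis using True b by (auto simp: ls(1) G_lengths_def grow_last_P_cut grow_last_def P_cut_eq_0)
    next
      case False
      then show ?thesis using True b by (auto simp: ls(1) G_lengths_def grow_last_P_cut grow_last_def P_cut_eq_0 zp sl2 add.assoc)
    qed
    ultimately show ?thesis ..
  next
    case False
    obtain y ys where xs: "xs = y # ys" by (cases xs) auto
    have [simp]: "ys \<noteq> []" using ls(3) False by (auto simp: xs)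
    have "y \<ge> 1" using ls(5) by (auto simp: xs)
    have zp: "zero_pairs N (butlast ys @ [last ys + a]) = zero_pairs N ys" using ls False xs by (intro zero_pairs_grow_last) auto
    obtain n' where n': "n = Suc n'" "even n'" using False by (cases n) auto
    have b: "P_deg N n + last xs + y \<le> Suc (sum_list xs)" if "zero_pairs N ys"
      using zero_pairs_bounds[of ys n' N] that ls xs n' by (auto simp: P_deg_step[OF N])
    have "frag_extend (G_lengths N n) (grow_first N a ls) = frag_extend (grow_first N a) (G_lengths N n ls)"
      using False by (auto simp: ls(1) xs grow_first_P_cut grow_first_def G_lengths_def P_cut_eq_0 add.assoc frag_extend_sum')
    moreover have "frag_extend (G_lengths N n) (grow_last N a ls) = frag_extend (grow_last N a) (G_lengths N n ls)"
    proof (cases "zero_pairs N ys")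
      case True
      have "frag_extend (grow_last N a) (G_lengths N n ls) = (\<Sum>r<y. P_cut N n (sum_list ls + a) (i + r))"
        using False True b by (auto simp: ls(1) xs G_lengths_def frag_extend_sum' intro!: sum.cong grow_last_P_cut)
      also have "\<dots> = frag_extend (G_lengths N n) (grow_last N a ls)"
      proof (cases "last xs + a \<ge> N")
        case big: True
        then have "P_cut N n (sum_list ls + a) (i + r) = 0" if "r < y" for r
          using that b[OF True] by (intro P_cut_eq_0(2)) (auto simp: ls(1))
        then show ?thesis using big by (simp add: grow_last_def ls(1))
      next
        case small: False
        have sl': "sum_list (butlast ys) + (last ys + a) = sum_list ys + a" using sl by (simp add: xs)
        show ?thesis using small False True zp by (simp add: grow_last_def ls(1) xs G_lengths_def add.assoc sl')
      qed
      finally show ?thesis by simp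
    next
      case False2: False
      then show ?thesis using False zp by (simp add: G_lengths_def ls(1) xs grow_last_def)
    qed
    ultimately show ?thesis ..
  qed
qed

lemma hd_bar_less: "x \<in> keys (bar_lengths N ls) \<Longrightarrow> hd ls < N \<Longrightarrow> hd x < N"
  by (cases "(N, ls)" rule: bar_lengths.cases) (auto simp: keys_consf grow_first_def dest!: subsetD[OF keys_diff] split: if_splits)

text \<open>
  A term of \<open>b\<close> that keeps the leading \<open>0\<close> is killed by \<open>t G\<close>: in even degree \<open>t\<close> sums over the positions
  before \<open>0\<close>, and in odd degree \<open>G\<close> only reaches positions before \<open>N - 1\<close>. The remaining term merges \<open>0\<close>
  with the first inner piece \<open>y\<close>, so that \<open>G\<close> is evaluated at a list that starts with \<open>y\<close>. In even degree
  \<open>t\<close> sums over the \<open>y\<close> positions before it. In odd degree \<open>t\<close> asks whether position \<open>N - 1\<close> lies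
  among \<open>y, \<dots>, y + z - 1\<close>, for the next piece \<open>z\<close>, which is the new condition \<open>y + z \<ge> N\<close>.
\<close>

lemma G_lengths_rec:
  assumes N: "N \<ge> 1" and ls: "0 # xs \<in> bar_lists N (Suc n)"
  shows "G_lengths N (Suc n) (0 # xs) = frag_extend (P_homotopy N n) (frag_extend (G_lengths N n) (bar_lengths N (0 # xs)))"
proof -
  define W where "W = sum_list xs"
  obtain y z zs where xs: "xs = y # z # zs" and y: "y \<ge> 1" "y < N" and len: "length (z # zs) = n + 1"
    using ls by (auto simp: bar_lists_iff length_Suc_conv)
  \<comment> \<open>These are the terms of the differential that do not involve the leading \<open>0\<close>.\<close>
  have kill: "frag_extend (P_homotopy N n) (G_lengths N n (0 # x)) = 0" if "x \<in> keys (bar_lengths N xs)" for x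
  proof (cases "even n")
    case True
    then show ?thesis by (simp add: G_lengths_def P_cut_def P_homotopy_def)
  next
    case False
    have "hd x < N" using hd_bar_less[OF that] y by (simp add: xs)
    then have "frag_extend (P_homotopy N n) (P_cut N n w r) = 0" if "r < hd x" for r w
      using False that by (auto simp: P_cut_def P_homotopy_def)
    then show ?thesis using False by (simp add: G_lengths_def frag_extend_sum')
  qed
  have "frag_extend (P_homotopy N n) (frag_extend (G_lengths N n) (cons_chain 0 (bar_lengths N xs))) = 0"
    using kill by (simp add: frag_extend_frag_extend) (meson frag_extend_eq_0)
  then have "frag_extend (P_homotopy N n) (frag_extend (G_lengths N n) (bar_lengths N (0 # xs))) =
     frag_extend (P_homotopy N n) (G_lengths N n xs)"
    using y by (simp add: xs frag_extend_diff) (simp add: grow_first_def)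
  also have "\<dots> = G_lengths N (Suc n) (0 # xs)"
  proof (cases "even n")
    case True
    have "P_deg N n \<le> sum_list (z # zs)" if "zero_pairs N (z # zs)"
      using zero_pairs_bounds[OF len True that] by simp
    then show ?thesis using True y N by (auto simp: G_lengths_def xs P_homotopy_P_cut)
  next
    case False
    obtain n' where n': "n = Suc n'" "even n'" using False by (cases n) auto
    show ?thesis
    proof (cases "zero_pairs N zs")
      case True
      have z: "z < N" "z \<ge> 1" using ls n' len by (auto simp: xs bar_lists_iff split: if_splits)
      have "P_deg N n' \<le> sum_list zs"
        using zero_pairs_bounds[of zs n' N] len True n' by simp
      then have W: "y + r + P_deg N n \<le> W" if "r < z" for r using that n' N by (simp add: W_def xs P_deg_step)
      have "frag_extend (P_homotopy N n) (G_lengths N n xs) = (\<Sum>r<z. frag_extend (P_homotopy N n) (P_cut N n W (y + r)))"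
        using False True by (simp add: xs G_lengths_def W_def frag_extend_sum')
      also have "\<dots> = (\<Sum>r<z. if r = N - 1 - y then P_cut N (Suc n) W 0 else 0)"
      proof (rule sum.cong)
        fix r assume r: "r \<in> {..<z}"
        show "frag_extend (P_homotopy N n) (P_cut N n W (y + r)) = (if r = N - 1 - y then P_cut N (Suc n) W 0 else 0)"
        proof (cases "y + r < N")
          case True
          then show ?thesis using False W r y N by (subst P_homotopy_P_cut) auto
        qed (use y in \<open>auto simp: P_cut_eq_0\<close>)
      qed simp
      also have "\<dots> = (if y + z \<ge> N then P_cut N (Suc n) W 0 else 0)" using y z by auto
      finally show ?thesis using False True by (simp add: xs G_lengths_def W_def)
    qed (use False in \<open>simp add: xs G_lengths_def\<close>)
  qed
  finally show ?thesis by simp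
qed

text \<open>
  The argument of \<open>bar_F_lengths\<close>, with the contraction of \<open>P\<close> instead of that of \<open>Q\<close>.
\<close>

theorem P_lengths_G_lengths:
  assumes N: "N \<ge> 1" and "n \<ge> 1" "ls \<in> bar_lists N n"
  shows "frag_extend (P_lengths N n) (G_lengths N n ls) = frag_extend (G_lengths N (n - 1)) (bar_lengths N ls)"
  using assms(2,3)
proof (induction n arbitrary: ls)
  case (Suc n)
  obtain i xs where ls: "ls = i # xs" and i: "i < N" using Suc.prems(2) by (rule bar_lists_cases)
  let ?ls = "0 # xs"
  have mem: "?ls \<in> bar_lists N (Suc n)" using Suc.prems N by (auto simp: ls bar_lists_iff split: if_splits)
  have d: "keys (bar_lengths N ?ls) \<subseteq> bar_lists N n"
    using length_preservingD[OF length_preserving_bar' mem] by simp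
  have 0: "frag_extend (P_lengths N (Suc n)) (G_lengths N (Suc n) ?ls) = frag_extend (G_lengths N n) (bar_lengths N ?ls)"
  proof (cases "n = 0")
    case True
    obtain y z where xs: "xs = [y, z]" and y: "y < N" "z < N" using mem True by (auto simp: bar_lists_iff length_Suc_conv numeral_2_eq_2)
    have "frag_extend (P_lengths N 1) (G_lengths N 1 ?ls) = (\<Sum>r<y. frag_extend (P_lengths N 1) (P_cut N 1 (y + z) r))"
      by (simp add: G_lengths_def xs frag_extend_sum')
    also have "\<dots> = (\<Sum>r<y. P_cut N 0 (y + z) (Suc r) - P_cut N 0 (y + z) r)"
      using N by (intro sum.cong refl, subst P_lengths_P_cut) (auto simp: P_deg_def)
    also have "\<dots> = P_cut N 0 (y + z) y - P_cut N 0 (y + z) 0" by (rule sum_lessThan_telescope)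
    finally show ?thesis using True N y
      by (simp add: xs frag_extend_diff) (simp add: grow_first_def G_lengths_def frag_extend_diff frag_extend_minus P_cut_eq_0)
  next
    case False
    have "frag_extend (P_lengths N n) (frag_extend (G_lengths N n) (bar_lengths N ?ls)) =
       frag_extend (G_lengths N (n - 1)) (frag_extend (bar_lengths N) (bar_lengths N ?ls))"
      unfolding frag_extend_frag_extend using d Suc.IH False by (intro frag_extend_cong) auto
    also have "\<dots> = 0" by (simp add: bar_bar del: bar_lengths.simps)
    finally have z: "frag_extend (P_lengths N n) (frag_extend (G_lengths N n) (bar_lengths N ?ls)) = 0" .
    have "frag_extend (P_lengths N (Suc n)) (frag_extend (P_homotopy N n) (frag_extend (G_lengths N n) (bar_lengths N ?ls)))
      = frag_extend (G_lengths N n) (bar_lengths N ?ls)"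
      by (rule frag_homotopy[OF length_preserving_keys[OF length_preserving_G d] _ z, of _ _ "P_homotopy N (n - 1)"])
        (use False P_homotopy[OF N, of n] in auto)
    then show ?thesis by (simp add: G_lengths_rec[OF N mem] del: bar_lengths.simps)
  qed
  have g: "frag_of ls = frag_extend (grow_first N i) (frag_of ?ls)" using i by (simp add: ls grow_first_def)
  have "frag_extend (P_lengths N (Suc n)) (frag_extend (G_lengths N (Suc n)) (frag_of ls)) =
     frag_extend (grow_first N i) (frag_extend (P_lengths N (Suc n)) (frag_extend (G_lengths N (Suc n)) (frag_of ?ls)))"
    unfolding g
    by (subst length_equivariantD(1)[OF length_equivariant_G[OF N]], use mem in simp,
        subst length_equivariantD(1)[OF length_equivariant_P_lengths[OF N]])
      (use mem length_preservingD[OF length_preserving_G mem] in auto)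
  also have "\<dots> = frag_extend (grow_first N i) (frag_extend (G_lengths N n) (frag_extend (bar_lengths N) (frag_of ?ls)))"
    using 0 by simp
  also have "\<dots> = frag_extend (G_lengths N n) (frag_extend (bar_lengths N) (frag_of ls))"
    unfolding g
    by (subst length_equivariantD(1)[OF length_equivariant_bar], use mem in simp,
        subst length_equivariantD(1)[OF length_equivariant_G[OF N]])
      (use d in auto)
  finally show ?case by simp
qed simp

section \<open>Linear extension\<close>

definition scale :: "'k::field \<Rightarrow> ('a \<Rightarrow>\<^sub>0 'k) \<Rightarrow> ('a \<Rightarrow>\<^sub>0 'k)" where
  "scale c x = Poly_Mapping.map ((*) c) x"

definition lin :: "('a \<Rightarrow> ('b \<Rightarrow>\<^sub>0 'k::field)) \<Rightarrow> ('a \<Rightarrow>\<^sub>0 'k) \<Rightarrow> ('b \<Rightarrow>\<^sub>0 'k)" where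
  "lin f x = (\<Sum>a\<in>keys x. scale (lookup x a) (f a))"

lemma lookup_scale [simp]: "lookup (scale c x) a = c * lookup x a"
  by (simp add: scale_def Poly_Mapping.map.rep_eq when_def)

lemma scale_simps [simp]: "scale 0 x = 0" "scale c 0 = 0" "scale 1 x = x" "scale c (scale d x) = scale (c * d) x"
  "scale c (single a d) = single a (c * d)"
  by (auto intro!: poly_mapping_eqI simp: Poly_Mapping.lookup_single when_def)

lemma scale_add: "scale c (x + y) = scale c x + scale c y" "scale (c + d) x = scale c x + scale d x"
  by (auto intro!: poly_mapping_eqI simp: lookup_add algebra_simps)

lemma scale_minus: "scale c (- x) = - scale c x"  "scale (- c) x = - scale c x"
  by (auto intro!: poly_mapping_eqI)

lemma scale_sum: "scale c (sum f I) = (\<Sum>i\<in>I. scale c (f i))"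
  by (induction I rule: infinite_finite_induct) (auto simp: scale_add)

lemma keys_scale: "keys (scale c x) \<subseteq> keys x"
  by (auto simp: in_keys_iff)

lemma keys_single_subset: "a \<in> S \<Longrightarrow> keys (single a c) \<subseteq> S"
  by (auto split: if_splits)

lemma lin_superset: "finite S \<Longrightarrow> keys x \<subseteq> S \<Longrightarrow> lin f x = (\<Sum>a\<in>S. scale (lookup x a) (f a))"
  unfolding lin_def by (intro sum.mono_neutral_left) (auto simp: in_keys_iff)

lemma lin_add: "lin f (x + y) = lin f x + lin f y"
  by (simp add: lin_superset[of "keys x \<union> keys y"] Poly_Mapping.keys_add lookup_add scale_add sum.distrib)

lemma lin_scale: "lin f (scale c x) = scale c (lin f x)"
  by (simp add: lin_superset[of "keys x"] keys_scale scale_sum)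

lemma lin_single [simp]: "lin f (single a c) = scale c (f a)"
  by (simp add: lin_superset[of "{a}"])

lemma lin_0 [simp]: "lin f 0 = 0"
  by (simp add: lin_def)

lemma lin_minus: "lin f (- x) = - lin f x"
  using lin_scale[of f "- 1" x] by (simp add: scale_minus)

lemma lin_diff: "lin f (x - y) = lin f x - lin f y"
  using lin_add[of f x "- y"] by (simp add: lin_minus)

lemma lin_sum: "lin f (sum g I) = (\<Sum>i\<in>I. lin f (g i))"
  by (induction I rule: infinite_finite_induct) (auto simp: lin_add)

lemma lin_cong: "(\<And>a. a \<in> keys x \<Longrightarrow> f a = g a) \<Longrightarrow> lin f x = lin g x"
  by (simp add: lin_def)

lemma lin_const_0 [simp]: "lin (\<lambda>a. 0) x = 0"
  by (simp add: lin_def)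

lemma lin_fun_add: "lin (\<lambda>a. f a + g a) x = lin f x + lin g x"
  by (simp add: lin_def scale_add sum.distrib)

lemma lin_fun_scale: "lin (\<lambda>a. scale c (f a)) x = scale c (lin f x)"
  by (simp add: lin_def scale_sum mult.commute)

lemma lin_fun_minus: "lin (\<lambda>a. - f a) x = - lin f x"
  by (simp add: lin_def scale_minus sum_negf)

lemma lin_fun_diff: "lin (\<lambda>a. f a - g a) x = lin f x - lin g x"
  using lin_fun_add[of f "\<lambda>a. - g a" x] by (simp add: lin_fun_minus)

lemma lin_fun_sum: "lin (\<lambda>a. \<Sum>i\<in>I. f i a) x = (\<Sum>i\<in>I. lin (f i) x)"
  by (induction I rule: infinite_finite_induct) (auto simp: lin_fun_add)

lemma lin_lin: "lin g (lin f x) = lin (\<lambda>a. lin g (f a)) x"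
  by (simp add: lin_def[of f] lin_def[of "\<lambda>a. lin g (f a)"] lin_sum lin_scale)

lemma lin_id: "lin (\<lambda>a. single a 1) x = x"
proof (rule poly_mapping_eqI)
  fix b
  show "lookup (lin (\<lambda>a. single a 1) x) b = lookup x b"
    by (simp add: lin_def lookup_sum Poly_Mapping.lookup_single when_def in_keys_iff)
qed

lemma lin_swap: "lin (\<lambda>a. lin (\<lambda>b. h a b) y) x = lin (\<lambda>b. lin (\<lambda>a. h a b) x) y"
  unfolding lin_def scale_sum by (subst sum.swap) (simp add: mult.commute)

lemma keys_lin_subset: "(\<And>a. a \<in> keys x \<Longrightarrow> keys (f a) \<subseteq> S) \<Longrightarrow> keys (lin f x) \<subseteq> S"
  unfolding lin_def by (intro keys_sum_subset order_trans[OF keys_scale])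

lemma linear_induct [consumes 1, case_names zero single add]:
  fixes x :: "'a \<Rightarrow>\<^sub>0 'k::field"
  assumes "keys x \<subseteq> S" "P 0"
    and "\<And>a c. a \<in> S \<Longrightarrow> P (single a c)"
    and "\<And>x y. keys x \<subseteq> S \<Longrightarrow> keys y \<subseteq> S \<Longrightarrow> P x \<Longrightarrow> P y \<Longrightarrow> P (x + y)"
  shows "P x"
proof -
  have "P (\<Sum>a\<in>T. single a (f a)) \<and> keys (\<Sum>a\<in>T. single a (f a)) \<subseteq> S" if "finite T" "T \<subseteq> S" for T f
    using that
  proof (induction T rule: finite_induct)
    case (insert a T)
    have "keys (single a (f a)) \<subseteq> S" using insert by (intro keys_single_subset) auto
    then show ?case using insert assms(3)[of a "f a"] assms(4) by (simp add: keys_add_subset)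
  qed (use assms in auto)
  from this[of "keys x" "lookup x"] assms(1) lin_id[of x] show ?thesis
    by (simp add: lin_def)
qed

section \<open>Linear maps on cut paths\<close>

text \<open>
  The chain \<open>f\<close> of length lists, read as a combination of cuts of \<open>w\<close> with coefficients in the field.
\<close>

definition emb :: "'w \<Rightarrow> (nat list \<Rightarrow>\<^sub>0 int) \<Rightarrow> ('w \<times> nat list) \<Rightarrow>\<^sub>0 'k::field" where
  "emb w f = (\<Sum>ls\<in>keys f. single (w, ls) (of_int (lookup f ls)))"

definition ext :: "(nat list \<Rightarrow> (nat list \<Rightarrow>\<^sub>0 int)) \<Rightarrow> (('w \<times> nat list) \<Rightarrow>\<^sub>0 'k::field) \<Rightarrow> (('w \<times> nat list) \<Rightarrow>\<^sub>0 'k)" where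
  "ext m = lin (\<lambda>(w, ls). emb w (m ls))"

lemma emb_superset: "finite S \<Longrightarrow> keys f \<subseteq> S \<Longrightarrow>
  emb w f = (\<Sum>ls\<in>S. single (w, ls) (of_int (lookup f ls)))"
  unfolding emb_def by (intro sum.mono_neutral_left) (auto simp: in_keys_iff)

lemma emb_0 [simp]: "emb w 0 = 0" by (simp add: emb_def)

lemma emb_frag_of [simp]: "emb w (frag_of ls) = single (w, ls) 1"
  by (simp add: emb_def)

lemma emb_add: "emb w (f + g) = emb w f + emb w g"
  by (simp add: emb_superset[of "keys f \<union> keys g"] Poly_Mapping.keys_add lookup_add single_add sum.distrib)

lemma emb_diff: "emb w (f - g) = emb w f - emb w g"
  using emb_add[of w "f - g" g, symmetric] by (simp add: eq_diff_eq)

lemma emb_sum: "emb w (sum f I) = (\<Sum>i\<in>I. emb w (f i))"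
  by (induction I rule: infinite_finite_induct) (auto simp: emb_add)

lemma keys_emb: "keys (emb w f) \<subseteq> {w} \<times> keys f"
  unfolding emb_def by (rule keys_sum_subset, rule keys_single_subset) auto

lemma frag_induct_UNIV [case_names zero one diff]:
  assumes "P 0" "\<And>ls. P (frag_of ls)" "\<And>a b. P a \<Longrightarrow> P b \<Longrightarrow> P (a - b)"
  shows "P (f :: 'a \<Rightarrow>\<^sub>0 int)"
  using frag_induction[of f UNIV P] assms by blast

lemma ext_emb: "ext m (emb w f) = emb w (frag_extend m f)"
  by (induction f rule: frag_induct_UNIV) (auto simp: ext_def lin_diff emb_diff frag_extend_diff)

lemma ext_ext: "ext m (ext m' x) = ext (\<lambda>ls. frag_extend m (m' ls)) x"
proof -
  have "ext m (ext m' x) = lin (\<lambda>k. ext m (case k of (w, ls) \<Rightarrow> emb w (m' ls))) x"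
    by (simp add: ext_def lin_lin)
  also have "\<dots> = ext (\<lambda>ls. frag_extend m (m' ls)) x"
    unfolding ext_def[of "\<lambda>ls. frag_extend m (m' ls)"] by (rule lin_cong) (auto simp: ext_emb split: prod.splits)
  finally show ?thesis .
qed

lemma ext_0 [simp]: "ext m 0 = 0"
  by (simp add: ext_def)

lemma ext_add: "ext m (x + y) = ext m x + ext m y"
  by (simp add: ext_def lin_add)

lemma ext_single [simp]: "ext m (single (w, ls) c) = scale c (emb w (m ls))"
  by (simp add: ext_def)

lemma ext_cong: "(\<And>w ls. (w, ls) \<in> keys x \<Longrightarrow> m ls = m' ls) \<Longrightarrow> ext m x = ext m' x"
  unfolding ext_def by (rule lin_cong) auto

lemma ext_const_0: "ext (\<lambda>ls. 0) x = 0"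
  unfolding ext_def by (simp add: lin_def case_prod_unfold)

lemma ext_frag_of: "ext frag_of x = x"
proof -
  have "ext frag_of x = lin (\<lambda>a. single a 1) x" unfolding ext_def by (rule lin_cong) auto
  then show ?thesis by (simp add: lin_id)
qed

definition path_append :: "('v, 'e) path \<Rightarrow> ('v, 'e) path \<Rightarrow> ('v, 'e) path" where
  "path_append p q = (fst p, snd p @ snd q)"

abbreviation composable where "composable G p q \<equiv> path_end G p = fst q"

lemma path_append_simps [simp]: "fst (path_append p q) = fst p" "snd (path_append p q) = snd p @ snd q"
  "path_append (path_append p q) r = path_append p (path_append q r)"
  by (auto simp: path_append_def)

lemma path_end_Nil [simp]: "path_end G (v, []) = v"
  by (simp add: path_end_def pre_digraph.awalk_verts.simps)

lemma path_end_append [simp]: "composable G p q \<Longrightarrow> path_end G (path_append p q) = path_end G q"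
  by (auto simp: path_end_def path_append_def pre_digraph.awalk_verts_conv split: if_splits)

lemma path_append_Nil [simp]: "composable G p (v, []) \<Longrightarrow> path_append p (v, []) = p"
  "v = fst p \<Longrightarrow> path_append (v, []) p = p"
  by (auto simp: path_append_def)

definition path_times :: "('v, 'e) pre_digraph \<Rightarrow> ('v, 'e) path \<Rightarrow> ('v, 'e) path \<Rightarrow> (('v, 'e) path \<Rightarrow>\<^sub>0 'k::field)" where
  "path_times G p q = (if composable G p q then single (path_append p q) 1 else 0)"

type_synonym ('v, 'e, 'k) cut_vec = "('v, 'e) path \<times> nat list \<Rightarrow>\<^sub>0 'k"

text \<open>
  A path \<open>p\<close> acts on the cut path \<open>(w, ls)\<close> by prolonging \<open>w\<close> to \<open>pw\<close> (or giving \<open>0\<close> if this is not a path) and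
  changing the lengths by \<open>m |p|\<close>. For \<open>m = grow_first N\<close> this is the left action of \<open>A\<close>; if \<open>m\<close> puts \<open>|p|\<close> in
  front of the list, it is the tensor product with one more factor on the left. The bilinear
  extensions are \<open>lop\<close> and \<open>rop\<close>.
\<close>

definition left_op where
  "left_op G m p = (\<lambda>(w, ls). if composable G p w then emb (path_append p w) (m (path_len p) ls) else 0)"

definition right_op where
  "right_op G m = (\<lambda>(w, ls) p. if composable G w p then emb (path_append w p) (m (path_len p) ls) else 0)"

definition path_mult where "path_mult G x y = lin (\<lambda>p. lin (path_times G p) y) x"

definition lop :: "('v, 'e) pre_digraph \<Rightarrow> (nat \<Rightarrow> nat list \<Rightarrow> (nat list \<Rightarrow>\<^sub>0 int)) \<Rightarrow> (('v, 'e) path \<Rightarrow>\<^sub>0 'k::field) \<Rightarrow>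
    (('v, 'e) path \<times> nat list \<Rightarrow>\<^sub>0 'k) \<Rightarrow> (('v, 'e) path \<times> nat list \<Rightarrow>\<^sub>0 'k)" where
  "lop G m x v = lin (\<lambda>p. lin (left_op G m p) v) x"

definition rop :: "('v, 'e) pre_digraph \<Rightarrow> (nat \<Rightarrow> nat list \<Rightarrow> (nat list \<Rightarrow>\<^sub>0 int)) \<Rightarrow>
    (('v, 'e) path \<times> nat list \<Rightarrow>\<^sub>0 'k::field) \<Rightarrow> (('v, 'e) path \<Rightarrow>\<^sub>0 'k) \<Rightarrow> (('v, 'e) path \<times> nat list \<Rightarrow>\<^sub>0 'k)" where
  "rop G m v x = lin (\<lambda>k. lin (right_op G m k) x) v"

lemma times_add: "path_mult G (x + x') y = path_mult G x y + path_mult G x' y" "path_mult G x (y + y') = path_mult G x y + path_mult G x y'"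
  by (simp_all add: path_mult_def lin_add lin_fun_add)

lemma lop_add: "lop G m (x + x') v = lop G m x v + lop G m x' v" "lop G m x (v + v') = lop G m x v + lop G m x v'"
  by (simp_all add: lop_def lin_add lin_fun_add)

lemma rop_add: "rop G m (v + v') x = rop G m v x + rop G m v' x" "rop G m v (x + x') = rop G m v x + rop G m v x'"
  by (simp_all add: rop_def lin_add lin_fun_add)

lemma zero_ops [simp]: "path_mult G 0 y = 0" "path_mult G x 0 = 0" "lop G m 0 v = 0" "lop G m x 0 = 0" "rop G m 0 x = 0" "rop G m v 0 = 0"
  by (simp_all add: path_mult_def lop_def rop_def)

lemma left_op_emb: "lin (left_op G m p) (emb w f) = (if composable G p w then emb (path_append p w) (frag_extend (m (path_len p)) f) else 0)"
  by (induction f rule: frag_induct_UNIV) (auto simp: left_op_def lin_diff emb_diff frag_extend_diff)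

lemma right_op_emb: "lin (\<lambda>k. right_op G m k p) (emb w f) = (if composable G w p then emb (path_append w p) (frag_extend (m (path_len p)) f) else 0)"
  by (induction f rule: frag_induct_UNIV) (auto simp: right_op_def lin_diff emb_diff frag_extend_diff)

lemma times_single: "path_mult G (single p c) (single q d) =
   (if composable G p q then single (path_append p q) (c * d) else 0)"
  by (simp add: path_mult_def path_times_def)

lemma lop_single: "lop G m (single p c) (single (w, ls) d) =
   (if composable G p w then scale (c * d) (emb (path_append p w) (m (path_len p) ls)) else 0)"
  by (simp add: lop_def left_op_def)

lemma rop_single: "rop G m (single (w, ls) d) (single p c) =
   (if composable G w p then scale (d * c) (emb (path_append w p) (m (path_len p) ls)) else 0)"
  by (simp add: rop_def right_op_def)

lemma times_assoc: "path_mult G (path_mult G x y) z = path_mult G x (path_mult G y z)"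
proof -
  have *: "lin (\<lambda>r. lin (path_times G r) z) (path_times G p q) = lin (\<lambda>s. lin (path_times G p) (path_times G q s)) z" for p q
    unfolding lin_swap[of _ z] by (rule lin_cong) (auto simp: path_times_def)
  show ?thesis unfolding path_mult_def lin_lin * ..
qed

text \<open>
  For basis paths both sides prolong the path in the same way, by associativity of concatenation;
  what is left is an identity between rules on lengths. The same holds for the next two lemmas.
\<close>

lemma lop_lop_times:
  assumes "\<And>w ls p q. (w, ls) \<in> keys v \<Longrightarrow> p \<in> keys x \<Longrightarrow> q \<in> keys y \<Longrightarrow>
    frag_extend (m (path_len p)) (m' (path_len q) ls) = m'' (path_len p + path_len q) ls"
  shows "lop G m x (lop G m' y v) = lop G m'' (path_mult G x y) v"
proof -
  have "lin (\<lambda>k. lin (left_op G m p) (left_op G m' q k)) v = lin (\<lambda>r. lin (left_op G m'' r) v) (path_times G p q)"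
    if pq: "p \<in> keys x" "q \<in> keys y" for p q
    unfolding lin_swap[of _ v]
  proof (rule lin_cong)
    fix k assume k: "k \<in> keys v"
    obtain w ls where "k = (w, ls)" by (cases k)
    with k pq assms show "lin (left_op G m p) (left_op G m' q k) = lin (\<lambda>r. left_op G m'' r k) (path_times G p q)"
      by (auto simp: left_op_def[of _ m'] left_op_def[of _ m''] path_times_def left_op_emb)
  qed
  then show ?thesis unfolding lop_def path_mult_def lin_lin by (intro lin_cong)
qed

lemma rop_rop_times:
  assumes "\<And>w ls a b. (w, ls) \<in> keys v \<Longrightarrow> frag_extend (m b) (m a ls) = m (a + b) ls"
  shows "rop G m (rop G m v x) y = rop G m v (path_mult G x y)"
proof -
  have "lin (\<lambda>k. lin (right_op G m k) y) (lin (right_op G m k) x) = lin (right_op G m k) (lin (\<lambda>p. lin (path_times G p) y) x)"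
    if k: "k \<in> keys v" for k
  proof -
    obtain w ls where wls: "k = (w, ls)" by (cases k)
    have "lin (\<lambda>k. lin (right_op G m k) y) (right_op G m k p) = lin (\<lambda>q. lin (right_op G m k) (path_times G p q)) y" for p
      unfolding lin_swap[of _ y]
      by (rule lin_cong) (use k assms in \<open>auto simp: wls right_op_def[of G m] right_op_emb[unfolded right_op_def] path_times_def\<close>)
    then show ?thesis by (simp add: lin_lin)
  qed
  then show ?thesis unfolding rop_def path_mult_def lin_lin[of _ _ v] by (rule lin_cong)
qed

lemma lop_rop_commute:
  assumes "\<And>w ls a b. (w, ls) \<in> keys v \<Longrightarrow> frag_extend (r b) (l a ls) = frag_extend (l a) (r b ls)"
  shows "rop G r (lop G l x v) y = lop G l x (rop G r v y)"
proof -
  have "lin (\<lambda>k. lin (right_op G r k) y) (left_op G l p k) = lin (\<lambda>q. lin (left_op G l p) (right_op G r k q)) y"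
    if k: "k \<in> keys v" for p k
  proof -
    obtain w ls where wls: "k = (w, ls)" by (cases k)
    have e: "lin (\<lambda>k. right_op G r k q) (left_op G l p k) = lin (left_op G l p) (right_op G r k q)" for q
      using k assms[of w ls] by (auto simp: wls left_op_def[of G l p] right_op_def[of G r] right_op_emb[unfolded right_op_def] left_op_emb[unfolded left_op_def])
    show ?thesis
      unfolding lin_swap[of _ y] by (rule lin_cong) (rule e)
  qed
  then show ?thesis unfolding rop_def lop_def lin_lin by (intro lin_cong) simp
qed

lemma ext_lin: "ext m (lin f x) = lin (\<lambda>a. ext m (f a)) x"
  by (simp add: ext_def lin_lin)

lemma ext_expand: "ext m v = lin (\<lambda>k. ext m (single k 1)) v"
  by (metis ext_lin lin_id)

text \<open>
  A rule on lengths does not see the path and the prolongation of the path does not see the lengths;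
  so the linear maps commute if the two rules on lengths do.
\<close>

lemma ext_lop:
  fixes v :: "('v, 'e) path \<times> nat list \<Rightarrow>\<^sub>0 'k::field"
  assumes "\<And>w ls a. (w, ls) \<in> keys v \<Longrightarrow> frag_extend m (l a ls) = frag_extend (l' a) (m ls)"
  shows "ext m (lop G l x v) = lop G l' x (ext m v)"
proof -
  have "ext m (left_op G l p k) = lin (left_op G l' p) (ext m (single k (1::'k)))"
    if k: "k \<in> keys v" for p k
    using k assms[of "fst k" "snd k"] by (cases k) (auto simp: left_op_def[of G l p] ext_emb left_op_emb)
  then have "ext m (lin (left_op G l p) v) = lin (left_op G l' p) (ext m v)" for p
    unfolding ext_lin by (subst ext_expand[of m v]) (simp add: lin_lin cong: lin_cong)
  then show ?thesis unfolding lop_def by (simp add: ext_lin)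
qed

lemma ext_rop:
  fixes v :: "('v, 'e) path \<times> nat list \<Rightarrow>\<^sub>0 'k::field"
  assumes "\<And>w ls a. (w, ls) \<in> keys v \<Longrightarrow> frag_extend m (r a ls) = frag_extend (r' a) (m ls)"
  shows "ext m (rop G r v x) = rop G r' (ext m v) x"
proof -
  have *: "ext m (lin (right_op G r k) x) = lin (\<lambda>k. lin (right_op G r' k) x) (ext m (single k 1))"
    if k: "k \<in> keys v" for k
  proof -
    have "ext m (right_op G r k p) = lin (\<lambda>k. right_op G r' k p) (ext m (single k (1::'k)))" for p
      using k assms[of "fst k" "snd k"] by (cases k) (auto simp: right_op_def[of G r] ext_emb right_op_emb)
    then show ?thesis unfolding ext_lin by (subst lin_swap) simp
  qed
  then show ?thesis unfolding rop_def ext_lin by (subst ext_expand[of m v]) (simp add: lin_lin[of _ _ v] * cong: lin_cong)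
qed

section \<open>The truncated algebra\<close>

locale truncated_quiver = fin_digraph \<Delta> for \<Delta> :: "('v, 'e) pre_digraph" +
  fixes N :: nat
  assumes N_pos: "N \<ge> 1"
begin

definition all_paths :: "('v, 'e) path set" where "all_paths = (\<Union>n. paths \<Delta> n)"

lemma all_paths_iff: "p \<in> all_paths \<longleftrightarrow> awalk (fst p) (snd p) (path_end \<Delta> p)"
  by (cases p) (auto simp: all_paths_def paths_def path_end_def)

lemma paths_iff: "p \<in> paths \<Delta> n \<longleftrightarrow> p \<in> all_paths \<and> path_len p = n"
  by (cases p) (auto simp: all_paths_def paths_def)

lemma vertex_path_iff [simp]: "(v, []) \<in> all_paths \<longleftrightarrow> v \<in> verts \<Delta>"
  by (simp add: all_paths_iff awalk_Nil_iff)

lemma path_ends_in_verts [simp]: "p \<in> all_paths \<Longrightarrow> fst p \<in> verts \<Delta>" "p \<in> all_paths \<Longrightarrow> path_end \<Delta> p \<in> verts \<Delta>"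
  by (auto simp: all_paths_iff)

lemma path_append_in_paths [simp]: "p \<in> all_paths \<Longrightarrow> q \<in> all_paths \<Longrightarrow> composable \<Delta> p q \<Longrightarrow> path_append p q \<in> all_paths"
  by (auto simp: all_paths_iff intro: awalk_appendI)

lemma path_splitE:
  assumes "p \<in> all_paths" "i \<le> path_len p"
  obtains q r where "p = path_append q r" "q \<in> all_paths" "r \<in> all_paths" "composable \<Delta> q r" "path_len q = i"
    "q = (fst p, take i (snd p))" "r = (path_end \<Delta> q, drop i (snd p))"
proof
  let ?q = "(fst p, take i (snd p))" let ?r = "(path_end \<Delta> ?q, drop i (snd p))"
  show "p = path_append ?q ?r" by (simp add: path_append_def)
  have "awalk (fst p) (take i (snd p) @ drop i (snd p)) (path_end \<Delta> p)" using assms by (simp add: all_paths_iff)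
  then have *: "awalk (fst p) (take i (snd p)) (path_end \<Delta> ?q)" "awalk (path_end \<Delta> ?q) (drop i (snd p)) (path_end \<Delta> p)"
    unfolding awalk_append_iff by (simp_all add: path_end_def)
  then show "?q \<in> all_paths" "?r \<in> all_paths"
    by (auto simp: all_paths_iff) (auto simp: path_end_def awlast_of_awalk)
qed (use assms in auto)

abbreviation "PA \<equiv> path_algebra \<Delta>"

lemma carrier_PA: "carrier PA = {x. keys x \<subseteq> all_paths}"
  by (simp add: path_algebra_def path_span_def all_paths_def)

lemma PA_simps [simp]: "\<zero>\<^bsub>PA\<^esub> = 0" "x \<oplus>\<^bsub>PA\<^esub> y = x + y" "\<one>\<^bsub>PA\<^esub> = (\<Sum>v\<in>verts \<Delta>. path_vec (v, []))"
  by (simp_all add: path_algebra_def)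

lemma PA_mult [simp]: "x \<otimes>\<^bsub>PA\<^esub> y = path_mult \<Delta> x y"
  by (simp add: path_algebra_def path_mult_def lin_def path_times_def path_append_def scale_sum)
    (intro sum.cong refl, auto simp: path_append_def ac_simps)

abbreviation unit :: "('v, 'e) path \<Rightarrow>\<^sub>0 'k::field" where "unit \<equiv> (\<Sum>v\<in>verts \<Delta>. path_vec (v, []))"

lemma times_unit_left:
  assumes "keys x \<subseteq> all_paths" shows "path_mult \<Delta> unit x = x"
proof -
  have "path_mult \<Delta> unit x = lin (\<lambda>q. \<Sum>v\<in>verts \<Delta>. path_times \<Delta> (v, []) q) x"
    by (simp add: path_mult_def lin_sum path_vec_def lin_fun_sum)
  also have "\<dots> = lin (\<lambda>q. single q 1) x"
  proof (rule lin_cong)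
    fix q assume "q \<in> keys x"
    then have "fst q \<in> verts \<Delta>" using assms by auto
    then have "(\<Sum>v\<in>verts \<Delta>. path_times \<Delta> (v, []) q) = (\<Sum>v\<in>verts \<Delta>. if v = fst q then single q 1 else 0)"
      by (intro sum.cong) (auto simp: path_times_def)
    then show "(\<Sum>v\<in>verts \<Delta>. path_times \<Delta> (v, []) q) = single q 1" using \<open>fst q \<in> verts \<Delta>\<close> by simp
  qed
  finally show ?thesis by (simp add: lin_id)
qed

lemma times_unit_right:
  assumes "keys x \<subseteq> all_paths" shows "path_mult \<Delta> x unit = x"
proof -
  have "path_mult \<Delta> x unit = lin (\<lambda>q. \<Sum>v\<in>verts \<Delta>. path_times \<Delta> q (v, [])) x"
    by (simp add: path_mult_def lin_sum path_vec_def)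
  also have "\<dots> = lin (\<lambda>q. single q 1) x"
  proof (rule lin_cong)
    fix q assume "q \<in> keys x"
    then have "path_end \<Delta> q \<in> verts \<Delta>" using assms by auto
    then have "(\<Sum>v\<in>verts \<Delta>. path_times \<Delta> q (v, [])) = (\<Sum>v\<in>verts \<Delta>. if v = path_end \<Delta> q then single q 1 else 0)"
      by (intro sum.cong) (auto simp: path_times_def)
    then show "(\<Sum>v\<in>verts \<Delta>. path_times \<Delta> q (v, [])) = single q 1" using \<open>path_end \<Delta> q \<in> verts \<Delta>\<close> by simp
  qed
  finally show ?thesis by (simp add: lin_id)
qed

definition long_paths :: "nat \<Rightarrow> ('v, 'e) path set" where "long_paths n = {p \<in> all_paths. n \<le> path_len p}"

lemma keys_times:
  assumes "keys x \<subseteq> long_paths m" "keys y \<subseteq> long_paths n"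
  shows "keys (path_mult \<Delta> x y) \<subseteq> long_paths (m + n)"
  unfolding path_mult_def
proof (intro keys_lin_subset)
  fix p q assume "p \<in> keys x" "q \<in> keys y"
  then have "p \<in> long_paths m" "q \<in> long_paths n" using assms by auto
  then show "keys (path_times \<Delta> p q) \<subseteq> long_paths (m + n)"
    by (auto simp: path_times_def long_paths_def)
qed

lemma long_paths_0: "long_paths 0 = all_paths" by (simp add: long_paths_def)

lemma keys_times_all: "keys x \<subseteq> all_paths \<Longrightarrow> keys y \<subseteq> all_paths \<Longrightarrow> keys (path_mult \<Delta> x y) \<subseteq> all_paths"
  using keys_times[of x 0 y 0] by (simp add: long_paths_0)

lemma keys_unit: "keys unit \<subseteq> all_paths"
  by (rule keys_sum_subset) (auto simp: path_vec_def)

lemma ring_PA: "ring PA"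
proof (rule ringI)
  show "abelian_group PA"
  proof (rule abelian_groupI)
    fix x assume "x \<in> carrier PA"
    then show "\<exists>y\<in>carrier PA. y \<oplus>\<^bsub>PA\<^esub> x = \<zero>\<^bsub>PA\<^esub>" by (intro bexI[of _ "- x"]) (auto simp: carrier_PA)
  qed (auto simp: carrier_PA keys_add_subset add.assoc add.commute intro!: subsetD[OF keys_add_subset])
  show "Group.monoid PA"
    by (rule monoidI) (simp_all add: carrier_PA keys_times_all keys_unit times_assoc times_unit_left times_unit_right)
qed (simp_all add: times_add)

definition long_span :: "nat \<Rightarrow> (('v, 'e) path \<Rightarrow>\<^sub>0 'k::field) set" where
  "long_span n = {x. keys x \<subseteq> long_paths n}"

lemma long_paths_mono: "m \<le> n \<Longrightarrow> long_paths n \<subseteq> long_paths m" by (auto simp: long_paths_def)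

lemma ideal_long_span: "ideal (long_span n :: (('v, 'e) path \<Rightarrow>\<^sub>0 'k::field) set) PA"
proof (rule idealI)
  show "subgroup (long_span n) (add_monoid (PA :: (('v, 'e) path \<Rightarrow>\<^sub>0 'k) ring))"
  proof (rule subgroup.intro)
    show "long_span n \<subseteq> carrier (add_monoid (PA :: (('v, 'e) path \<Rightarrow>\<^sub>0 'k) ring))"
      using long_paths_mono[of 0 n] by (auto simp: long_span_def carrier_PA long_paths_0)
  next
    fix x assume x: "x \<in> (long_span n :: (('v, 'e) path \<Rightarrow>\<^sub>0 'k) set)"
    have "\<ominus>\<^bsub>PA\<^esub> x = - x"
      using x long_paths_mono[of 0 n]
      by (intro abelian_group.minus_equality[OF ring.is_abelian_group[OF ring_PA]])
         (auto simp: long_span_def carrier_PA long_paths_0)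
    then have *: "inv\<^bsub>add_monoid PA\<^esub> x = - x" unfolding a_inv_def .
    show "inv\<^bsub>add_monoid PA\<^esub> x \<in> long_span n" unfolding * using x by (simp add: long_span_def)
  qed (auto simp: long_span_def keys_add_subset intro!: subsetD[OF keys_add_subset])
next
  fix a x :: "('v, 'e) path \<Rightarrow>\<^sub>0 'k" assume "a \<in> (long_span n :: (('v, 'e) path \<Rightarrow>\<^sub>0 'k) set)" "x \<in> carrier PA"
  then show "x \<otimes>\<^bsub>PA\<^esub> a \<in> long_span n" "a \<otimes>\<^bsub>PA\<^esub> x \<in> long_span n"
    using keys_times[of x 0 a n] keys_times[of a n x 0] by (auto simp: long_span_def carrier_PA long_paths_0)
qed (rule ring_PA)

lemma long_spanI:
  fixes S :: "(('v, 'e) path \<Rightarrow>\<^sub>0 'k::field) set"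
  assumes "\<And>p c. p \<in> long_paths n \<Longrightarrow> single p c \<in> S" "0 \<in> S" "\<And>x y. x \<in> S \<Longrightarrow> y \<in> S \<Longrightarrow> x + y \<in> S"
  shows "long_span n \<subseteq> S"
proof
  fix x :: "('v, 'e) path \<Rightarrow>\<^sub>0 'k" assume "x \<in> long_span n"
  then have "keys x \<subseteq> long_paths n" by (simp add: long_span_def)
  then show "x \<in> S" by (induction rule: linear_induct) (use assms in auto)
qed

text \<open>
  A path of positive length is a multiple of its first arrow.
\<close>

lemma arrow_ideal_eq: "arrow_ideal \<Delta> = (long_span 1 :: (('v, 'e) path \<Rightarrow>\<^sub>0 'k::field) set)"
proof
  have sub: "path_vec ` paths \<Delta> 1 \<subseteq> (long_span 1 :: (('v, 'e) path \<Rightarrow>\<^sub>0 'k) set)"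
    by (auto simp: long_span_def path_vec_def paths_iff long_paths_def)
  then show "arrow_ideal \<Delta> \<subseteq> (long_span 1 :: (('v, 'e) path \<Rightarrow>\<^sub>0 'k) set)"
    unfolding arrow_ideal_def by (rule ring.genideal_minimal[OF ring_PA ideal_long_span])
  have carr: "path_vec ` paths \<Delta> 1 \<subseteq> carrier (PA :: (('v, 'e) path \<Rightarrow>\<^sub>0 'k) ring)"
    by (auto simp: carrier_PA path_vec_def paths_iff)
  interpret J: ideal "arrow_ideal \<Delta> :: (('v, 'e) path \<Rightarrow>\<^sub>0 'k) set" PA
    unfolding arrow_ideal_def by (rule ring.genideal_ideal[OF ring_PA carr])
  show "(long_span 1 :: (('v, 'e) path \<Rightarrow>\<^sub>0 'k) set) \<subseteq> arrow_ideal \<Delta>"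
  proof (rule long_spanI)
    fix p :: "('v, 'e) path" and c :: 'k assume "p \<in> long_paths 1"
    then obtain q r where *: "p = path_append q r" "q \<in> all_paths" "r \<in> all_paths" "composable \<Delta> q r" "path_len q = 1"
      by (auto simp: long_paths_def elim: path_splitE[of p 1])
    have "path_vec q \<in> (arrow_ideal \<Delta> :: (('v, 'e) path \<Rightarrow>\<^sub>0 'k) set)"
      unfolding arrow_ideal_def using * by (intro subsetD[OF ring.genideal_self[OF ring_PA carr]]) (auto simp: paths_iff)
    from J.I_r_closed[OF this, of "single r c"]
    show "single p c \<in> arrow_ideal \<Delta>" using * by (auto simp: carrier_PA path_vec_def times_single)
  qed (use additive_subgroup.zero_closed[OF ideal.axioms(1)[OF J.ideal_axioms]]
      additive_subgroup.a_closed[OF ideal.axioms(1)[OF J.ideal_axioms]] in auto)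
qed

text \<open>
  A path of length more than \<open>n\<close> is a path of length \<open>n\<close> followed by a path of positive length.
\<close>

lemma ideal_power_eq: "ideal_power PA (arrow_ideal \<Delta>) n = (long_span n :: (('v, 'e) path \<Rightarrow>\<^sub>0 'k::field) set)"
proof (induction n)
  case 0 then show ?case by (simp add: carrier_PA long_span_def long_paths_0)
next
  case (Suc n)
  let ?I = "ideal_prod PA (long_span n) (long_span 1 :: (('v, 'e) path \<Rightarrow>\<^sub>0 'k::field) set)"
  interpret J: ideal ?I PA
    by (rule ring.ideal_prod_is_ideal[OF ring_PA ideal_long_span ideal_long_span])
  have "?I \<subseteq> long_span (Suc n)"
  proof
    fix x assume "x \<in> ?I"
    then show "x \<in> long_span (Suc n)"
    proof induction
      case (prod i j)
      then show ?case using keys_times[of i n j 1] by (simp add: long_span_def)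
    next
      case (sum s1 s2)
      then show ?case by (simp add: long_span_def keys_add_subset)
    qed
  qed
  moreover have "long_span (Suc n) \<subseteq> ?I"
  proof (rule long_spanI)
    fix p :: "('v, 'e) path" and c :: 'k assume p: "p \<in> long_paths (Suc n)"
    then have "p \<in> all_paths" "n \<le> path_len p" by (auto simp: long_paths_def)
    then obtain q r where *: "p = path_append q r" "q \<in> all_paths" "r \<in> all_paths" "composable \<Delta> q r" "path_len q = n"
      by (rule path_splitE)
    have "path_vec q \<otimes>\<^bsub>PA\<^esub> single r c \<in> ?I"
      using * p by (intro ideal_prod.prod) (auto simp: long_span_def path_vec_def long_paths_def)
    then show "single p c \<in> ?I" using * by (simp add: path_vec_def times_single)
  qed (use additive_subgroup.zero_closed[OF ideal.axioms(1)[OF J.ideal_axioms]]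
      additive_subgroup.a_closed[OF ideal.axioms(1)[OF J.ideal_axioms]] in auto)
  ultimately show ?case using Suc by (auto simp: arrow_ideal_eq)
qed

abbreviation "A \<equiv> truncated_algebra \<Delta> N"

abbreviation "tc \<equiv> trunc_class \<Delta> N"

lemma ring_A: "ring (A :: ('v, 'e, 'k::field) trunc ring)"
  unfolding truncated_algebra_def ideal_power_eq by (rule ideal.quotient_is_ring[OF ideal_long_span])

lemma trunc_class_def': "tc x = long_span N +>\<^bsub>PA\<^esub> x"
  by (simp add: trunc_class_def ideal_power_eq)

lemma carrier_A: "carrier A = tc ` carrier PA"
  by (auto simp: truncated_algebra_def FactRing_def A_RCOSETS_def' ideal_power_eq trunc_class_def')

lemma tc_mult:
  assumes "keys x \<subseteq> all_paths" "keys y \<subseteq> all_paths"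
  shows "tc x \<otimes>\<^bsub>A\<^esub> tc y = tc (path_mult \<Delta> x y)"
  using ideal.rcoset_mult_add[OF ideal_long_span, of x y N] assms
  by (simp add: truncated_algebra_def FactRing_def ideal_power_eq trunc_class_def' carrier_PA)

lemma tc_add:
  assumes "keys x \<subseteq> all_paths" "keys y \<subseteq> all_paths"
  shows "tc x \<oplus>\<^bsub>A\<^esub> tc y = tc (x + y)"
  using abelian_subgroup.a_rcos_sum[of "long_span N" PA x y] assms ideal.axioms(1)[OF ideal_long_span]
    abelian_subgroupI3[OF ideal.axioms(1)[OF ideal_long_span] ring.is_abelian_group[OF ring_PA], of N]
  by (simp add: truncated_algebra_def FactRing_def ideal_power_eq trunc_class_def' carrier_PA)

lemma tc_one: "\<one>\<^bsub>A\<^esub> = tc unit"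
  by (simp add: truncated_algebra_def FactRing_def ideal_power_eq trunc_class_def')

lemma tc_eq_iff:
  assumes "keys x \<subseteq> all_paths" "keys y \<subseteq> all_paths"
  shows "tc x = tc y \<longleftrightarrow> x - y \<in> long_span N"
proof -
  have m: "x \<ominus>\<^bsub>PA\<^esub> y = x - y"
  proof -
    have "\<ominus>\<^bsub>PA\<^esub> y = - y"
      using assms by (intro abelian_group.minus_equality[OF ring.is_abelian_group[OF ring_PA]]) (auto simp: carrier_PA)
    then show ?thesis by (simp add: a_minus_def)
  qed
  show ?thesis using ring.quotient_eq_iff_same_a_r_cos[OF ring_PA ideal_long_span, of x y N] assms
    by (simp add: trunc_class_def' carrier_PA m)
qed

lemma tc_zero: "\<zero>\<^bsub>A\<^esub> = tc 0"
  using ring.a_rcos_zero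
  by (simp add: truncated_algebra_def FactRing_def ideal_power_eq trunc_class_def' a_r_coset_def' )

definition truncate :: "(('v, 'e) path \<Rightarrow>\<^sub>0 'k::field) \<Rightarrow> (('v, 'e) path \<Rightarrow>\<^sub>0 'k)" where
  "truncate = lin (\<lambda>p. if path_len p < N then single p 1 else 0)"

lemma truncate_diff: "truncate (x - y) = truncate x - truncate y"
  by (simp add: truncate_def lin_diff)

lemma truncate_single: "truncate (single p c) = (if path_len p < N then single p c else 0)"
  by (simp add: truncate_def)

definition short_paths :: "('v, 'e) path set" where "short_paths = {p \<in> all_paths. path_len p < N}"

lemma keys_truncate: "keys x \<subseteq> all_paths \<Longrightarrow> keys (truncate x) \<subseteq> short_paths"
  unfolding truncate_def by (rule keys_lin_subset) (auto simp: short_paths_def)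

lemma truncate_long: "x \<in> long_span N \<Longrightarrow> truncate x = 0"
  unfolding truncate_def by (subst lin_cong[of _ _ "\<lambda>p. 0"]) (auto simp: long_span_def long_paths_def)

lemma truncate_short: "keys x \<subseteq> short_paths \<Longrightarrow> truncate x = x"
  unfolding truncate_def by (subst lin_cong[of _ _ "\<lambda>p. single p 1"]) (auto simp: short_paths_def lin_id)

lemma minus_truncate_long: "keys x \<subseteq> all_paths \<Longrightarrow> x - truncate x \<in> long_span N"
proof -
  assume *: "keys x \<subseteq> all_paths"
  have "x - truncate x = lin (\<lambda>p. single p 1 - (if path_len p < N then single p 1 else 0)) x"
    by (simp add: lin_fun_diff lin_id truncate_def)
  also have "\<dots> \<in> long_span N"
    unfolding long_span_def mem_Collect_eq by (rule keys_lin_subset) (use * in \<open>auto simp: long_paths_def\<close>)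
  finally show ?thesis .
qed

lemma short_all: "short_paths \<subseteq> all_paths" by (auto simp: short_paths_def)

lemma tc_truncate: "keys x \<subseteq> all_paths \<Longrightarrow> tc (truncate x) = tc x"
  using minus_truncate_long[of x] keys_truncate[of x] short_all
  by (subst eq_commute, subst tc_eq_iff) auto

lemma truncate_eq_iff: "keys x \<subseteq> all_paths \<Longrightarrow> keys y \<subseteq> all_paths \<Longrightarrow> tc x = tc y \<longleftrightarrow> truncate x = truncate y"
  by (metis tc_eq_iff tc_truncate truncate_long truncate_diff right_minus_eq)

text \<open>
  The representative of a class that involves no path of length \<open>N\<close> or more; by \<open>truncate_eq_iff\<close> it does
  not depend on the choice.
\<close>

definition coords :: "('v, 'e, 'k::field) trunc \<Rightarrow> (('v, 'e) path \<Rightarrow>\<^sub>0 'k)" where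
  "coords a = truncate (SOME x. keys x \<subseteq> all_paths \<and> tc x = a)"

lemma coords_tc: "keys x \<subseteq> all_paths \<Longrightarrow> coords (tc x) = truncate x"
proof -
  assume *: "keys x \<subseteq> all_paths"
  let ?P = "\<lambda>y. keys y \<subseteq> all_paths \<and> tc y = tc x"
  have "?P (SOME y. ?P y)" using * by (intro someI[of ?P x]) auto
  then show ?thesis unfolding coords_def using * truncate_eq_iff by blast
qed

end

section \<open>Tensor products of paths over the vertices\<close>

primrec cut_path :: "('v, 'e) pre_digraph \<Rightarrow> ('v, 'e) path \<Rightarrow> nat list \<Rightarrow> ('v, 'e) path list" where
  "cut_path G w [] = []"
| "cut_path G w (l # ls) = (fst w, take l (snd w)) # cut_path G (path_end G (fst w, take l (snd w)), drop l (snd w)) ls"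

lemma length_cut_path [simp]: "length (cut_path G w ls) = length ls"
  by (induction ls arbitrary: w) auto

lemma path_concat_Cons: "ps \<noteq> [] \<Longrightarrow> path_concat (p # ps) = path_append p (path_concat ps)"
  by (simp add: path_concat_def path_append_def)

lemma path_concat_single [simp]: "path_concat [p] = p"
  by (simp add: path_concat_def)

lemma fst_path_concat [simp]: "ps \<noteq> [] \<Longrightarrow> fst (path_concat ps) = fst (hd ps)"
  by (simp add: path_concat_def)

lemma len_path_concat [simp]: "path_len (path_concat ps) = sum_list (map path_len ps)"
  by (simp add: path_concat_def length_concat comp_def)

lemma cut_path_concat:
  "successively (composable G) ps \<Longrightarrow> ps \<noteq> [] \<Longrightarrow> cut_path G (path_concat ps) (map path_len ps) = ps"
proof (induction ps)
  case (Cons p ps)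
  show ?case
  proof (cases "ps = []")
    case True then show ?thesis by simp
  next
    case False
    then have "cut_path G (path_concat ps) (map path_len ps) = ps" "path_end G p = fst (hd ps)"
      using Cons by (auto simp: successively_Cons)
    moreover have "(fst (hd ps), snd (path_concat ps)) = path_concat ps" using False by (simp add: prod_eq_iff)
    ultimately show ?thesis using False by (simp add: path_concat_Cons)
  qed
qed simp

abbreviation cons_op :: "nat \<Rightarrow> nat list \<Rightarrow> (nat list \<Rightarrow>\<^sub>0 int)" where
  "cons_op \<equiv> (\<lambda>a ls. frag_of (a # ls))"

text \<open>
  The coordinates of a pure tensor: its entries are multiplied, and for each resulting path the
  lengths of the basis paths that formed it are recorded. The empty tensor is the sum of all
  vertices, which is neutral for prepending an entry.
\<close>

primrec tprod :: "('v, 'e) pre_digraph \<Rightarrow> (('v, 'e) path \<Rightarrow>\<^sub>0 'k::field) list \<Rightarrow> (('v, 'e) path \<times> nat list \<Rightarrow>\<^sub>0 'k)" where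
  "tprod G [] = (\<Sum>v\<in>verts G. single ((v, []), []) 1)"
| "tprod G (x # xs) = lop G cons_op x (tprod G xs)"

lemma tprod_add: "tprod G (xs @ (x + y) # ys) = tprod G (xs @ x # ys) + tprod G (xs @ y # ys)"
  by (induction xs) (auto simp: lop_add)

lemma tprod_zero: "tprod G (xs @ 0 # ys) = 0"
  by (induction xs) auto

lemma not_successively_split:
  "\<not> successively P ps \<Longrightarrow> \<exists>as x y bs. ps = as @ x # y # bs \<and> \<not> P x y"
proof (induction ps rule: induct_list012)
  case (3 x y zs)
  show ?case
  proof (cases "P x y")
    case True
    then obtain as a b bs where "y # zs = as @ a # b # bs" "\<not> P a b" using 3 by auto
    then show ?thesis by (metis append_Cons)
  next
    case False
    then show ?thesis by (intro exI[of _ "[]"]) auto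
  qed
qed auto

context truncated_quiver begin

definition len_span :: "nat set \<Rightarrow> (('v, 'e) path \<Rightarrow>\<^sub>0 'k::field) set" where
  "len_span \<Lambda> = {x. keys x \<subseteq> {p \<in> all_paths. path_len p \<in> \<Lambda>}}"

abbreviation adm where "adm \<Lambda>s zs \<equiv> list_all2 (\<lambda>\<Lambda> z. z \<in> len_span \<Lambda>) \<Lambda>s zs"

definition cuts :: "nat list set \<Rightarrow> (('v, 'e) path \<times> nat list) set" where
  "cuts L = {(w, ls). w \<in> all_paths \<and> ls \<in> L \<and> sum_list ls = path_len w}"

text \<open>
  A vertex contributes no length, so it makes no difference to which neighbour it is multiplied.
\<close>

lemma tprod_balanced:
  assumes "keys e \<subseteq> paths \<Delta> 0"
  shows "tprod \<Delta> (xs @ path_mult \<Delta> x e # y # ys) = tprod \<Delta> (xs @ x # path_mult \<Delta> e y # ys)"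
proof (induction xs)
  case Nil
  have e: "path_len q = 0" if "q \<in> keys e" for q using that assms by (auto simp: paths_iff)
  have "lop \<Delta> cons_op (path_mult \<Delta> x e) v = lop \<Delta> cons_op x (lop \<Delta> (\<lambda>a. frag_of) e v)" for v
    by (rule lop_lop_times[symmetric]) (simp add: e)
  moreover have "lop \<Delta> (\<lambda>a. frag_of) e (lop \<Delta> cons_op y v) = lop \<Delta> cons_op (path_mult \<Delta> e y) v" for v
    by (rule lop_lop_times) (simp add: e)
  ultimately show ?case by simp
qed simp

lemma cut_path_props:
  assumes "w \<in> all_paths" "sum_list ls = path_len w" "ls \<noteq> []"
  shows "path_concat (cut_path \<Delta> w ls) = w \<and> successively (composable \<Delta>) (cut_path \<Delta> w ls) \<and>
    set (cut_path \<Delta> w ls) \<subseteq> all_paths \<and> map path_len (cut_path \<Delta> w ls) = ls \<and> fst (hd (cut_path \<Delta> w ls)) = fst w"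
  using assms
proof (induction ls arbitrary: w)
  case (Cons l ls)
  obtain q r where *: "w = path_append q r" "q \<in> all_paths" "r \<in> all_paths" "composable \<Delta> q r" "path_len q = l"
    "q = (fst w, take l (snd w))" "r = (path_end \<Delta> q, drop l (snd w))"
    using Cons.prems by (auto elim!: path_splitE[of w l])
  have c: "cut_path \<Delta> w (l # ls) = q # cut_path \<Delta> r ls" using * by simp
  have r: "sum_list ls = path_len r" using * Cons.prems by (metis add_left_cancel length_append path_append_simps(2) sum_list.Cons)
  show ?case
  proof (cases "ls = []")
    case True
    then have "r = (path_end \<Delta> q, [])" using r *(4) by (auto simp: prod_eq_iff)
    then have "w = q" using *(1) by (simp add: path_append_def)
    then show ?thesis unfolding c using True *(2,5) by simp
  next
    case False
    then have ne: "cut_path \<Delta> r ls \<noteq> []" by (metis length_cut_path length_0_conv)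
    show ?thesis unfolding c using Cons.IH[OF *(3) r False] ne *(1,2,4,5)
      by (auto simp: path_concat_Cons successively_Cons)
  qed
qed simp_all

lemma lop_cons_Nil: "p \<in> all_paths \<Longrightarrow> lop \<Delta> cons_op (single p c) (tprod \<Delta> []) = single (p, [path_len p]) c"
proof -
  assume p: "p \<in> all_paths"
  have "lop \<Delta> cons_op (single p c) (tprod \<Delta> []) =
     (\<Sum>v\<in>verts \<Delta>. lop \<Delta> cons_op (single p c) (single ((v, []), []) 1))"
    by (simp add: lop_def lin_sum scale_sum)
  also have "\<dots> = (\<Sum>v\<in>verts \<Delta>. if v = path_end \<Delta> p then single (p, [path_len p]) c else 0)"
    by (intro sum.cong) (auto simp: lop_single)
  finally show ?thesis using p by simp
qed

lemma tprod_singles: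
  assumes "length cs = length ps" "set ps \<subseteq> all_paths" "ps \<noteq> []"
  shows "tprod \<Delta> (map2 single ps cs) =
    (if successively (composable \<Delta>) ps then single (path_concat ps, map path_len ps) (prod_list cs) else 0)"
  using assms
proof (induction ps arbitrary: cs)
  case (Cons p ps)
  obtain c cs' where cs: "cs = c # cs'" "length cs' = length ps" using Cons.prems by (cases cs) auto
  show ?case
  proof (cases "ps = []")
    case True
    then show ?thesis using Cons.prems cs lop_cons_Nil[of p c] by simp
  next
    case False
    then show ?thesis using Cons cs by (auto simp: lop_single successively_Cons path_concat_Cons)
  qed
qed simp

lemma keys_tprod:
  "adm \<Lambda>s zs \<Longrightarrow> keys (tprod \<Delta> zs) \<subseteq> cuts (listset \<Lambda>s)"
proof (induction zs arbitrary: \<Lambda>s)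
  case Nil
  then have "\<Lambda>s = []" by (cases \<Lambda>s) auto
  then show ?case unfolding tprod.simps by (intro keys_sum_subset keys_single_subset) (auto simp: cuts_def)
next
    case (Cons z zs)
    then obtain \<Lambda> \<Lambda>s' where L: "\<Lambda>s = \<Lambda> # \<Lambda>s'" "z \<in> len_span \<Lambda>" "adm \<Lambda>s' zs" by (auto simp: list_all2_Cons2)
    show ?case unfolding tprod.simps lop_def
    proof (intro keys_lin_subset)
      fix p k assume p: "p \<in> keys z" and k: "k \<in> keys (tprod \<Delta> zs)"
      obtain w ls where wls: "k = (w, ls)" by (cases k)
      then have "(w, ls) \<in> cuts (listset \<Lambda>s')" using Cons.IH[OF L(3)] k by auto
      moreover have "p \<in> all_paths" "path_len p \<in> \<Lambda>" using p L by (auto simp: len_span_def)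
      ultimately show "keys (left_op \<Delta> cons_op p k) \<subseteq> cuts (listset \<Lambda>s)"
        by (auto simp: wls left_op_def L cuts_def set_Cons_def)
    qed
qed

text \<open>
  The pieces of a cut path form a tuple of basis paths; a scalar \<open>c\<close> may be placed in any entry, and the
  first one is chosen.
\<close>

definition unit_tuple :: "('v, 'e) path \<times> nat list \<Rightarrow> 'k \<Rightarrow> (('v, 'e) path \<Rightarrow>\<^sub>0 'k::field) list" where
  "unit_tuple k c = map2 single (cut_path \<Delta> (fst k) (snd k)) (c # replicate (length (snd k) - 1) 1)"

text \<open>
  The combination of tuples of pieces that has the coordinates \<open>v\<close>, evaluated by \<open>g\<close>.
\<close>

definition normal_form :: "((('v, 'e) path \<Rightarrow>\<^sub>0 'k::field) list \<Rightarrow> 'g::ab_group_add) \<Rightarrow> (('v, 'e) path \<times> nat list \<Rightarrow>\<^sub>0 'k) \<Rightarrow> 'g" where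
  "normal_form g v = (\<Sum>k\<in>keys v. g (unit_tuple k (lookup v k)))"

lemma scalar_times:
  assumes "keys x \<subseteq> all_paths"
  shows "path_mult \<Delta> x (scale c unit) = scale c x" "path_mult \<Delta> (scale c unit) x = scale c x"
proof -
  have "path_mult \<Delta> x (scale c unit) = scale c (path_mult \<Delta> x unit)" "path_mult \<Delta> (scale c unit) x = scale c (path_mult \<Delta> unit x)"
    by (simp_all add: path_mult_def lin_scale lin_fun_scale)
  then show "path_mult \<Delta> x (scale c unit) = scale c x" "path_mult \<Delta> (scale c unit) x = scale c x"
    using assms by (simp_all only: times_unit_left times_unit_right)
qed

lemma keys_scalar: "keys (scale c unit) \<subseteq> paths \<Delta> 0"
  by (rule order_trans[OF keys_scale], rule keys_sum_subset) (auto simp: path_vec_def paths_iff)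

lemma len_span_keys: "x \<in> len_span \<Lambda> \<Longrightarrow> keys x \<subseteq> all_paths"
  by (auto simp: len_span_def)

lemma len_span_closed [simp]: "0 \<in> len_span \<Lambda>" "x \<in> len_span \<Lambda> \<Longrightarrow> y \<in> len_span \<Lambda> \<Longrightarrow> x + y \<in> len_span \<Lambda>"
  "x \<in> len_span \<Lambda> \<Longrightarrow> scale c x \<in> len_span \<Lambda>"
  using keys_scale[of c x] by (auto simp: len_span_def keys_add_subset intro!: subsetD[OF keys_add_subset])

lemma adm_unit_tuple:
  assumes k: "k \<in> cuts (listset \<Lambda>s)" and ne: "\<Lambda>s \<noteq> []"
  shows "\<exists>p ps. cut_path \<Delta> (fst k) (snd k) = p # ps \<and> adm \<Lambda>s (single p (1::'k::field) # map (\<lambda>p. single p 1) ps) \<and>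
      (\<forall>c::'k. unit_tuple k c = single p c # map (\<lambda>p. single p 1) ps \<and> adm \<Lambda>s (unit_tuple k c))"
proof -
  obtain w ls where wls: "k = (w, ls)" by (cases k)
  with k have *: "w \<in> all_paths" "sum_list ls = path_len w" and ls: "ls \<in> listset \<Lambda>s" by (auto simp: cuts_def)
  have ll: "list_all2 (\<lambda>\<Lambda> l. l \<in> \<Lambda>) \<Lambda>s ls" if "ls \<in> listset \<Lambda>s" for ls and \<Lambda>s :: "nat set list"
    using that by (induction \<Lambda>s arbitrary: ls) (auto simp: set_Cons_def)
  have ne: "ls \<noteq> []" using ll[OF ls] assms(2) by auto
  obtain p ps where ps: "cut_path \<Delta> w ls = p # ps" using ne by (cases ls) auto
  have l: "length ps = length ls - 1" using arg_cong[OF ps, of length] by simp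
  have m2: "map2 single ps (replicate (length ls - Suc 0) 1) = map (\<lambda>p. single p 1) ps"
    using l by (auto intro!: nth_equalityI)
  have "list_all2 (\<lambda>\<Lambda> q. q \<in> all_paths \<and> path_len q \<in> \<Lambda>) \<Lambda>s (p # ps)"
    using ll[OF ls] cut_path_props[OF * ne]
    unfolding ps list_all2_conv_all_nth by (metis length_map nth_map nth_mem subsetD)
  then have "adm \<Lambda>s (single p c # map (\<lambda>p. single p (1::'k)) ps)" for c
    by (auto simp: list_all2_Cons2 len_span_def list_all2_map2 split: if_splits elim!: list_all2_mono)
  then show ?thesis using ps m2 by (auto simp: wls unit_tuple_def)
qed

text \<open>
  Here \<open>R\<close> stands for the subgroup of tensor relations and \<open>g\<close> for the generator of the free group
  that belongs to a tuple. Modulo the relations, additivity in each slot reduces a tuple to tuples of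
  multiples of paths. The scalars move to the first entry, because they belong to the vertex algebra
  and can be balanced. If two neighbouring paths \<open>x\<close> and \<open>y\<close> do not compose, moving the end vertex of
  \<open>x\<close> across replaces \<open>y\<close> by \<open>0\<close>, and the tuple vanishes. If all neighbours compose, the tuple is the
  tuple of pieces of a cut path. The normal form is additive only modulo \<open>R\<close>, since \<open>g\<close> need not be
  additive in the first slot.
\<close>

lemma tensor_normal_form:
  fixes g :: "(('v, 'e) path \<Rightarrow>\<^sub>0 'k::field) list \<Rightarrow> 'g::ab_group_add"
  assumes R: "0 \<in> R" "\<And>a b. a \<in> R \<Longrightarrow> b \<in> R \<Longrightarrow> a - b \<in> R"
    and T1: "\<And>zs1 x y zs2. adm \<Lambda>s (zs1 @ x # zs2) \<Longrightarrow> adm \<Lambda>s (zs1 @ y # zs2) \<Longrightarrow>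
        g (zs1 @ (x + y) # zs2) - g (zs1 @ x # zs2) - g (zs1 @ y # zs2) \<in> R"
    and T2: "\<And>zs1 x e y zs2. adm \<Lambda>s (zs1 @ x # y # zs2) \<Longrightarrow> keys e \<subseteq> paths \<Delta> 0 \<Longrightarrow>
        g (zs1 @ path_mult \<Delta> x e # y # zs2) - g (zs1 @ x # path_mult \<Delta> e y # zs2) \<in> R"
    and zs: "adm \<Lambda>s zs" "\<Lambda>s \<noteq> []"
  shows "g zs - normal_form g (tprod \<Delta> zs) \<in> R"
    and "keys v \<subseteq> cuts (listset \<Lambda>s) \<Longrightarrow> keys v' \<subseteq> cuts (listset \<Lambda>s) \<Longrightarrow>
      normal_form g (v + v') - (normal_form g v + normal_form g v') \<in> R"
proof -
  have Rm: "- a \<in> R" if "a \<in> R" for a using R(2)[OF R(1) that] by simp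
  have Ra: "a + b \<in> R" if "a \<in> R" "b \<in> R" for a b using R(2)[OF that(1) Rm[OF that(2)]] by simp
  define eqv where "eqv a b \<longleftrightarrow> a - b \<in> R" for a b
  have eq_refl: "eqv a a" for a by (simp add: eqv_def R)
  have eq_sym: "eqv b a" if "eqv a b" for a b using Rm[of "a - b"] that by (simp add: eqv_def)
  have eq_trans [trans]: "eqv a c" if "eqv a b" "eqv b c" for a b c
    using Ra[of "a - b" "b - c"] that by (simp add: eqv_def)
  have eq_add: "eqv (a + a') (b + b')" if "eqv a b" "eqv a' b'" for a b a' b'
    using Ra[of "a - b" "a' - b'"] that by (simp add: eqv_def algebra_simps)
  have eq_sum: "eqv (sum f I) (sum f' I)" if "\<And>i. i \<in> I \<Longrightarrow> eqv (f i) (f' i)" for f f' :: "_ \<Rightarrow> 'g" and I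
    using that by (induction I rule: infinite_finite_induct) (auto simp: eq_refl eq_add)
  have slot_zero: "eqv (g (zs1 @ 0 # zs2)) 0" if "adm \<Lambda>s (zs1 @ 0 # zs2)" for zs1 zs2
    using Rm[OF T1[OF that that]] by (simp add: eqv_def)
  have slot_add: "eqv (g (zs1 @ (x + y) # zs2)) (g (zs1 @ x # zs2) + g (zs1 @ y # zs2))"
    if "adm \<Lambda>s (zs1 @ x # zs2)" "adm \<Lambda>s (zs1 @ y # zs2)" for zs1 x y zs2
    using T1[OF that] by (simp add: eqv_def algebra_simps)
  have adm_mid: "keys x \<subseteq> all_paths" if "adm \<Lambda>s (zs1 @ x # zs2)" for x zs1 zs2
    using that by (auto simp: list_all2_append2 list_all2_Cons2 dest!: len_span_keys)
  have adm_upd: "adm \<Lambda>s (zs1 @ y # zs2)" if "adm \<Lambda>s (zs1 @ x # zs2)" "\<And>\<Lambda>. x \<in> len_span \<Lambda> \<Longrightarrow> y \<in> len_span \<Lambda>" for x y zs1 zs2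
    using that by (fastforce simp: list_all2_append2 list_all2_Cons2)
  have shift1: "eqv (g (zs1 @ scale c x # y # zs2)) (g (zs1 @ x # scale c y # zs2))" if a: "adm \<Lambda>s (zs1 @ x # y # zs2)" for zs1 x y zs2 c
    using T2[OF a keys_scalar[of c]] adm_mid[OF a] adm_mid[of "zs1 @ [x]" y zs2] a
    by (simp add: eqv_def scalar_times)
  \<comment> \<open>Scalars of later entries are collected in one entry.\<close>
  have shift: "eqv (g (zs1 @ x # map2 single ps cs)) (g (zs1 @ scale (prod_list cs) x # map (\<lambda>p. single p 1) ps))"
    if "adm \<Lambda>s (zs1 @ x # map (\<lambda>p. single p 1) ps)" "length cs = length ps" for zs1 x ps cs
    using that
  proof (induction ps arbitrary: zs1 x cs)
    case (Cons q ps)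
    obtain c cs' where cs: "cs = c # cs'" "length cs' = length ps" using Cons.prems by (cases cs) auto
    let ?r = "map (\<lambda>p. single p 1) ps"
    have a: "adm \<Lambda>s ((zs1 @ [x]) @ single q c # ?r)"
      by (rule adm_upd[of _ "single q 1"]) (use Cons.prems in \<open>auto simp: len_span_def split: if_splits\<close>)
    have "eqv (g ((zs1 @ [x]) @ single q c # map2 single ps cs'))
      (g ((zs1 @ [x]) @ scale (prod_list cs') (single q c) # ?r))" by (rule Cons.IH[OF a cs(2)])
    also have "scale (prod_list cs') (single q c) = scale (prod_list cs) (single q 1)"
      by (simp add: cs mult.commute)
    also have "eqv (g ((zs1 @ [x]) @ scale (prod_list cs) (single q 1) # ?r)) (g (zs1 @ scale (prod_list cs) x # single q 1 # ?r))"
      using eq_sym[OF shift1[of zs1 x "single q 1" ?r "prod_list cs"]] Cons.prems by simp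
    finally show ?case by (simp add: cs)
  qed (simp add: eq_refl)
  note nf_def = normal_form_def[of g]
  note unit_tuple = adm_unit_tuple[OF _ zs(2)]
  have nf_superset: "eqv (normal_form g v) (\<Sum>k\<in>S. g (unit_tuple k (lookup v k)))"
    if "finite S" "keys v \<subseteq> S" "S \<subseteq> cuts (listset \<Lambda>s)" for S v
  proof -
    have "(\<Sum>k\<in>S. g (unit_tuple k (lookup v k))) = normal_form g v + (\<Sum>k\<in>S - keys v. g (unit_tuple k (lookup v k)))"
      unfolding nf_def sum.subset_diff[OF that(2,1)] by (rule add.commute)
    moreover have "eqv (\<Sum>k\<in>S - keys v. g (unit_tuple k (lookup v k))) (\<Sum>k\<in>S - keys v. 0)"
    proof (rule eq_sum)
      fix k assume k: "k \<in> S - keys v"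
      then have "k \<in> cuts (listset \<Lambda>s)" using that by auto
      from unit_tuple[OF this] obtain p ps where "unit_tuple k (0::'k) = single p 0 # map (\<lambda>p. single p 1) ps \<and> adm \<Lambda>s (unit_tuple k (0::'k))" by blast
      then obtain ps where "unit_tuple k (0::'k) = 0 # ps" "adm \<Lambda>s (0 # ps)" by auto
      then show "eqv (g (unit_tuple k (lookup v k))) 0" using slot_zero[of "[]" ps] k by (simp add: in_keys_iff)
    qed
    ultimately show ?thesis using eq_sym[OF eq_add[OF eq_refl[of "normal_form g v"]]] by fastforce
  qed
  have nf_add: "eqv (normal_form g (v + v')) (normal_form g v + normal_form g v')" if v: "keys v \<subseteq> cuts (listset \<Lambda>s)" "keys v' \<subseteq> cuts (listset \<Lambda>s)" for v v'
  proof -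
    let ?S = "keys v \<union> keys v'"
    have S: "finite ?S" "?S \<subseteq> cuts (listset \<Lambda>s)" using v by auto
    have "eqv (normal_form g (v + v')) (\<Sum>k\<in>?S. g (unit_tuple k (lookup (v + v') k)))"
      by (rule nf_superset[OF S(1) _ S(2)]) (rule Poly_Mapping.keys_add)
    also have "eqv \<dots> (\<Sum>k\<in>?S. g (unit_tuple k (lookup v k)) + g (unit_tuple k (lookup v' k)))"
    proof (rule eq_sum)
      fix k assume "k \<in> ?S"
      then have "k \<in> cuts (listset \<Lambda>s)" using S by auto
      from unit_tuple[OF this] obtain p ps where u: "\<And>c::'k. unit_tuple k c = single p c # ps" "\<And>c::'k. adm \<Lambda>s (single p c # ps)"
        by metis
      show "eqv (g (unit_tuple k (lookup (v + v') k))) (g (unit_tuple k (lookup v k)) + g (unit_tuple k (lookup v' k)))"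
        unfolding u lookup_add single_add using slot_add[of "[]"] u(2) by simp
    qed
    also have "eqv \<dots> (normal_form g v + normal_form g v')"
      unfolding sum.distrib by (intro eq_add eq_sym[OF nf_superset]) (use v in auto)
    finally show ?thesis .
  qed
  have singles: "eqv (g (map2 single ps cs)) (normal_form g (tprod \<Delta> (map2 single ps cs)))"
    if a: "adm \<Lambda>s (map (\<lambda>p. single p (1::'k)) ps)" and l: "length cs = length ps" for ps cs
  proof -
    have a': "length \<Lambda>s = length ps" "\<And>i. i < length ps \<Longrightarrow> ps ! i \<in> all_paths \<and> path_len (ps ! i) \<in> \<Lambda>s ! i"
      using a by (auto simp: list_all2_map2 list_all2_conv_all_nth len_span_def)
    have aps: "set ps \<subseteq> all_paths"
      using a'(2) by (metis in_set_conv_nth subsetI)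
    have ne: "ps \<noteq> []" using a zs(2) by auto
    note tp = tprod_singles[OF l aps ne]
    have ad: "adm \<Lambda>s (map2 single ps cs)"
      using a' l unfolding list_all2_conv_all_nth by (simp add: len_span_def)
    show ?thesis
    proof (cases "successively (composable \<Delta>) ps")
      case True
      obtain p ps' c cs' where p: "ps = p # ps'" "cs = c # cs'" "length cs' = length ps'" using ne l by (cases ps; cases cs) auto
      let ?C = "prod_list cs" and ?k = "(path_concat ps, map path_len ps)"
      have m2: "map2 single ps' (replicate (length ps') 1) = map (\<lambda>p. single p 1) ps'"
        by (auto intro!: nth_equalityI)
      have u: "unit_tuple ?k ?C = single p ?C # map (\<lambda>p. single p 1) ps'"
        unfolding unit_tuple_def fst_conv snd_conv cut_path_concat[OF True ne] by (simp add: p m2)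
      have "adm \<Lambda>s (single p c # map (\<lambda>p. single p 1) ps')"
        using adm_upd[of "[]" "single p 1" _ "single p c"] a by (auto simp: p len_span_def split: if_splits)
      from shift[of "[]", simplified, OF this p(3)]
      have e: "eqv (g (map2 single ps cs)) (g (unit_tuple ?k ?C))"
        unfolding u by (simp add: p mult.commute)
      show ?thesis
      proof (cases "?C = 0")
        case C: True
        have "adm \<Lambda>s (0 # map (\<lambda>p. single p (1::'k)) ps')"
          using adm_upd[of "[]" "single p 1" _ 0] a by (auto simp: p)
        from slot_zero[of "[]", simplified, OF this] have "eqv (g (unit_tuple ?k ?C)) 0" unfolding C u[unfolded C] by simp
        with e have "eqv (g (map2 single ps cs)) 0" by (rule eq_trans)
        moreover have "tprod \<Delta> (map2 single ps cs) = 0" unfolding tp C by simp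
        ultimately show ?thesis by (simp add: nf_def)
      next
        case False
        have t: "tprod \<Delta> (map2 single ps cs) = single ?k ?C" unfolding tp using True by simp
        have "normal_form g (single ?k ?C) = g (unit_tuple ?k ?C)" using False unfolding nf_def by simp
        then show ?thesis using e unfolding t by simp
      qed
    next
      case False
      from not_successively_split[OF False] obtain as x y bs where s: "ps = as @ x # y # bs" "\<not> composable \<Delta> x y" by blast
      let ?z1 = "map2 single as (take (length as) cs)"
      obtain c1 c d c2 where cs: "cs = c1 @ c # d # c2" "length c1 = length as" "length c2 = length bs"
      proof -
        let ?n = "length as"
        have n: "Suc ?n < length cs" using l s by simp
        then have "drop ?n cs = cs ! ?n # cs ! Suc ?n # drop (Suc (Suc ?n)) cs"
          by (simp add: Cons_nth_drop_Suc)
        then have "cs = take ?n cs @ cs ! ?n # cs ! Suc ?n # drop (Suc (Suc ?n)) cs"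
          by (metis append_take_drop_id)
        then show ?thesis by (rule that) (use n l s in auto)
      qed
      have m: "map2 single ps cs = map2 single as c1 @ single x c # single y d # map2 single bs c2"
        using cs by (simp add: s)
      \<comment> \<open>This vertex fixes \<open>x\<close> from the right and kills \<open>y\<close> from the left.\<close>
      let ?e = "single (path_end \<Delta> x, []) (1::'k)"
      have x: "x \<in> all_paths" using aps s by auto
      have t: "path_mult \<Delta> (single x c) ?e = single x c" "path_mult \<Delta> ?e (single y d) = 0"
        using s by (auto simp: times_single)
      have "eqv (g (map2 single ps cs)) (g (map2 single as c1 @ single x c # 0 # map2 single bs c2))"
        using T2[OF ad[unfolded m], of ?e] x by (simp add: t m eqv_def paths_iff)
      also have "eqv \<dots> 0"
      proof -
        have "adm \<Lambda>s ((map2 single as c1 @ [single x c]) @ 0 # map2 single bs c2)"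
          by (rule adm_upd[of _ "single y d"]) (use ad in \<open>auto simp: m\<close>)
        from slot_zero[OF this] show ?thesis by simp
      qed
      finally show ?thesis by (simp add: tp False nf_def)
    qed
  qed
  \<comment> \<open>The slots are decomposed into paths from right to left: those of \<open>ps\<close> are done.\<close>
  have main: "eqv (g (xs @ map2 single ps cs)) (normal_form g (tprod \<Delta> (xs @ map2 single ps cs)))"
    if "adm \<Lambda>s (xs @ map (\<lambda>p. single p (1::'k)) ps)" "length cs = length ps" for xs ps cs
    using that
  proof (induction xs arbitrary: ps cs rule: rev_induct)
    case Nil
    then show ?case using singles by simp
  next
    case (snoc x xs)
    define Ys where "Ys = map2 single ps cs"
    obtain \<Lambda>1 \<Lambda> \<Lambda>2 where L: "\<Lambda>s = \<Lambda>1 @ \<Lambda> # \<Lambda>2" "adm \<Lambda>1 xs" "x \<in> len_span \<Lambda>" "adm \<Lambda>2 (map (\<lambda>p. single p (1::'k)) ps)"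
      using snoc.prems by (auto simp: list_all2_append2 list_all2_Cons2)
    have adm: "adm \<Lambda>s (xs @ y # map (\<lambda>p. single p (1::'k)) ps)" if "y \<in> len_span \<Lambda>" for y
      using L that by (auto intro!: list_all2_appendI)
    have "adm \<Lambda>2 Ys" using L(4) snoc.prems(2) unfolding Ys_def list_all2_conv_all_nth by (auto simp: len_span_def)
    then have upd: "adm \<Lambda>s (xs @ y # Ys)" if "y \<in> len_span \<Lambda>" for y
      using L that by (auto intro!: list_all2_appendI)
    have "keys x \<subseteq> {p \<in> all_paths. path_len p \<in> \<Lambda>}" using L by (simp add: len_span_def)
    then have "eqv (g (xs @ x # Ys)) (normal_form g (tprod \<Delta> (xs @ x # Ys)))"
    proof (induction rule: linear_induct)
      case zero
      then show ?case using slot_zero[OF upd] by (simp add: tprod_zero nf_def)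
    next
      case (single p c)
      then have "adm \<Lambda>s (xs @ map (\<lambda>p. single p (1::'k)) (p # ps))" using adm[of "single p 1"] by (simp add: len_span_def)
      from snoc.IH[OF this, of "c # cs"] show ?case using snoc.prems by (simp add: Ys_def)
    next
      case (add x y)
      then have xy: "x \<in> len_span \<Lambda>" "y \<in> len_span \<Lambda>" by (auto simp: len_span_def)
      have ax: "adm \<Lambda>s (xs @ x # Ys)" "adm \<Lambda>s (xs @ y # Ys)" using upd xy by auto
      have "eqv (g (xs @ (x + y) # Ys)) (g (xs @ x # Ys) + g (xs @ y # Ys))" by (rule slot_add[OF ax])
      also have "eqv \<dots> (normal_form g (tprod \<Delta> (xs @ x # Ys)) + normal_form g (tprod \<Delta> (xs @ y # Ys)))" using add by (intro eq_add)
      also have "eqv \<dots> (normal_form g (tprod \<Delta> (xs @ (x + y) # Ys)))" unfolding tprod_add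
        by (rule eq_sym[OF nf_add]) (rule keys_tprod, fact)+
      finally show ?case .
    qed
    then show ?case by (simp add: Ys_def)
  qed
  show "g zs - normal_form g (tprod \<Delta> zs) \<in> R" using main[of zs "[]" "[]"] zs by (simp add: eqv_def)
  show "normal_form g (v + v') - (normal_form g v + normal_form g v') \<in> R"
    if "keys v \<subseteq> cuts (listset \<Lambda>s)" "keys v' \<subseteq> cuts (listset \<Lambda>s)"
    using nf_add[OF that] by (simp add: eqv_def)
qed

end

section \<open>Coordinates on tensor products\<close>

definition zext :: "('a \<Rightarrow> ('b \<Rightarrow>\<^sub>0 'k::field)) \<Rightarrow> ('a \<Rightarrow>\<^sub>0 int) \<Rightarrow> ('b \<Rightarrow>\<^sub>0 'k)" where
  "zext f c = (\<Sum>a\<in>keys c. scale (of_int (lookup c a)) (f a))"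

lemma zext_superset: "finite S \<Longrightarrow> keys c \<subseteq> S \<Longrightarrow>
  zext f c = (\<Sum>a\<in>S. scale (of_int (lookup c a)) (f a))"
  unfolding zext_def by (intro sum.mono_neutral_left) (auto simp: in_keys_iff)

lemma zext_0 [simp]: "zext f 0 = 0" by (simp add: zext_def)

lemma zext_frag_of [simp]: "zext f (frag_of a) = f a" by (simp add: zext_def)

lemma zext_add: "zext f (c + d) = zext f c + zext f d"
  by (simp add: zext_superset[of "keys c \<union> keys d"] Poly_Mapping.keys_add lookup_add scale_add sum.distrib)

lemma zext_diff: "zext f (c - d) = zext f c - zext f d"
  using zext_add[of f "c - d" d] by (simp add: eq_diff_eq)

lemma zext_minus: "zext f (- c) = - zext f c"
  using zext_diff[of f 0 c] by simp

lemma zext_frag_extend: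
  assumes "keys c \<subseteq> S" "\<And>a. a \<in> S \<Longrightarrow> zext f (g a) = h (f' a)" "h 0 = 0" "\<And>x y. h (x - y) = h x - h y"
  shows "zext f (frag_extend g c) = h (zext f' c)"
  using assms(1) by (induction c rule: frag_induction) (auto simp: assms zext_diff frag_extend_diff)

lemma ops_diff: "lop G m x (v - w) = lop G m x v - lop G m x w" "rop G m (v - w) x = rop G m v x - rop G m w x"
  by (simp_all add: lop_def rop_def lin_diff lin_fun_diff)

context truncated_quiver begin

definition cut_space :: "nat list set \<Rightarrow> (('v, 'e) path \<times> nat list \<Rightarrow>\<^sub>0 'k::field) set" where
  "cut_space L = {v. keys v \<subseteq> cuts L}"

text \<open>
  \<open>\<Phi>\<close> identifies the bimodule \<open>M\<close> with the combinations of paths cut into pieces whose lengths form a list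
  in \<open>L\<close>. Compatibility with scalars is contained in that with \<open>A\<close>, through which the field acts.
\<close>

definition coordinatized :: "(('v, 'e, 'k::field) trunc, 'm, 'b) bimod_scheme \<Rightarrow> nat list set \<Rightarrow> ('m \<Rightarrow> (('v, 'e) path \<times> nat list \<Rightarrow>\<^sub>0 'k)) \<Rightarrow> bool" where
  "coordinatized M L \<Phi> \<longleftrightarrow>
     bij_betw \<Phi> (carrier M) (cut_space L) \<and>
     \<zero>\<^bsub>M\<^esub> \<in> carrier M \<and> \<Phi> \<zero>\<^bsub>M\<^esub> = 0 \<and>
     (\<forall>x\<in>carrier M. \<forall>y\<in>carrier M. x \<oplus>\<^bsub>M\<^esub> y \<in> carrier M \<and> \<Phi> (x \<oplus>\<^bsub>M\<^esub> y) = \<Phi> x + \<Phi> y) \<and>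
     (\<forall>a. keys a \<subseteq> all_paths \<longrightarrow> (\<forall>x\<in>carrier M.
        lact M (tc a) x \<in> carrier M \<and> \<Phi> (lact M (tc a) x) = lop \<Delta> (grow_first N) a (\<Phi> x) \<and>
        ract M x (tc a) \<in> carrier M \<and> \<Phi> (ract M x (tc a)) = rop \<Delta> (grow_last N) (\<Phi> x) a))"

text \<open>
  A factor of a tensor product: the bimodule, the lengths of its basis paths, and mutually inverse maps
  between its elements and combinations of such paths. The maps are part of the data because elements
  of \<open>A\<close> are cosets of an ideal whereas elements of \<open>k\<Delta>\<^sub>m\<close> are singletons.
\<close>

type_synonym ('a, 'b, 'c) factor = "(('a, 'b) path \<Rightarrow>\<^sub>0 'c, ('a, 'b, 'c) trunc) bimod \<times> nat set \<times>
  ((('a, 'b) path \<Rightarrow>\<^sub>0 'c) \<Rightarrow> ('a, 'b, 'c) trunc) \<times> (('a, 'b, 'c) trunc \<Rightarrow> (('a, 'b) path \<Rightarrow>\<^sub>0 'c))"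

fun fac_mod :: "('v, 'e, 'k::field) factor \<Rightarrow> (('v, 'e) path \<Rightarrow>\<^sub>0 'k, ('v, 'e, 'k) trunc) bimod" where "fac_mod (M, \<Lambda>, \<iota>, \<kappa>) = M"
fun fac_len :: "('v, 'e, 'k::field) factor \<Rightarrow> nat set" where "fac_len (M, \<Lambda>, \<iota>, \<kappa>) = \<Lambda>"
fun fac_in :: "('v, 'e, 'k::field) factor \<Rightarrow> (('v, 'e) path \<Rightarrow>\<^sub>0 'k) \<Rightarrow> ('v, 'e, 'k) trunc" where "fac_in (M, \<Lambda>, \<iota>, \<kappa>) = \<iota>"
fun fac_co :: "('v, 'e, 'k::field) factor \<Rightarrow> ('v, 'e, 'k) trunc \<Rightarrow> (('v, 'e) path \<Rightarrow>\<^sub>0 'k)" where "fac_co (M, \<Lambda>, \<iota>, \<kappa>) = \<kappa>"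

definition graded_factor :: "('v, 'e, 'k::field) factor \<Rightarrow> bool" where
  "graded_factor F \<longleftrightarrow> carrier (fac_mod F) = fac_in F ` len_span (fac_len F) \<and>
    (\<forall>x\<in>len_span (fac_len F). fac_co F (fac_in F x) = x \<and>
      (\<forall>y\<in>len_span (fac_len F). fac_in F x \<oplus>\<^bsub>fac_mod F\<^esub> fac_in F y = fac_in F (x + y)) \<and>
      (\<forall>e. keys e \<subseteq> paths \<Delta> 0 \<longrightarrow>
         lact (fac_mod F) e (fac_in F x) = fac_in F (path_mult \<Delta> e x) \<and> ract (fac_mod F) (fac_in F x) e = fac_in F (path_mult \<Delta> x e)))"

definition coord_list :: "('v, 'e, 'k::field) factor list \<Rightarrow> ('v, 'e, 'k) trunc list \<Rightarrow> (('v, 'e) path \<Rightarrow>\<^sub>0 'k) list" where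
  "coord_list Fs xs = map2 fac_co Fs xs"

abbreviation "tup Fs zs \<equiv> map2 fac_in Fs zs"

text \<open>
  Multiplication by a vertex keeps a path or kills it.
\<close>

lemma vertex_times_closed:
  assumes "keys e \<subseteq> paths \<Delta> 0" "x \<in> len_span \<Lambda>"
  shows "path_mult \<Delta> e x \<in> len_span \<Lambda>" "path_mult \<Delta> x e \<in> len_span \<Lambda>"
proof -
  show "path_mult \<Delta> e x \<in> len_span \<Lambda>" unfolding path_mult_def len_span_def mem_Collect_eq
  proof (intro keys_lin_subset)
    fix p q assume "p \<in> keys e" "q \<in> keys x"
    then have "p \<in> paths \<Delta> 0" "q \<in> all_paths" "path_len q \<in> \<Lambda>" using assms by (auto simp: len_span_def)
    then show "keys (path_times \<Delta> p q) \<subseteq> {p \<in> all_paths. path_len p \<in> \<Lambda>}"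
      by (auto simp: path_times_def paths_iff)
  qed
  show "path_mult \<Delta> x e \<in> len_span \<Lambda>" unfolding path_mult_def len_span_def mem_Collect_eq
  proof (intro keys_lin_subset)
    fix p q assume "p \<in> keys x" "q \<in> keys e"
    then have "q \<in> paths \<Delta> 0" "p \<in> all_paths" "path_len p \<in> \<Lambda>" using assms by (auto simp: len_span_def)
    then show "keys (path_times \<Delta> p q) \<subseteq> {p \<in> all_paths. path_len p \<in> \<Lambda>}"
      by (auto simp: path_times_def paths_iff)
  qed
qed

lemma graded_factorD:
  assumes "graded_factor F" "x \<in> carrier (fac_mod F)"
  shows "fac_co F x \<in> len_span (fac_len F)" "fac_in F (fac_co F x) = x"
  using assms by (auto simp: graded_factor_def)

lemma graded_factor_in:
  assumes "graded_factor F" "z \<in> len_span (fac_len F)"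
  shows "fac_in F z \<in> carrier (fac_mod F)" "fac_co F (fac_in F z) = z"
  using assms by (auto simp: graded_factor_def)

lemma graded_factor_ops:
  assumes F: "graded_factor F" and x: "x \<in> carrier (fac_mod F)" and y: "y \<in> carrier (fac_mod F)" and e: "keys e \<subseteq> paths \<Delta> 0"
  shows "x \<oplus>\<^bsub>fac_mod F\<^esub> y \<in> carrier (fac_mod F)" "fac_co F (x \<oplus>\<^bsub>fac_mod F\<^esub> y) = fac_co F x + fac_co F y"
    "lact (fac_mod F) e x \<in> carrier (fac_mod F)" "fac_co F (lact (fac_mod F) e x) = path_mult \<Delta> e (fac_co F x)"
    "ract (fac_mod F) x e \<in> carrier (fac_mod F)" "fac_co F (ract (fac_mod F) x e) = path_mult \<Delta> (fac_co F x) e"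
proof -
  obtain z w where z: "x = fac_in F z" "z \<in> len_span (fac_len F)" "y = fac_in F w" "w \<in> len_span (fac_len F)"
    using F x y by (auto simp: graded_factor_def)
  have "x \<oplus>\<^bsub>fac_mod F\<^esub> y = fac_in F (z + w)" "lact (fac_mod F) e x = fac_in F (path_mult \<Delta> e z)" "ract (fac_mod F) x e = fac_in F (path_mult \<Delta> z e)"
    using F z e by (auto simp: graded_factor_def)
  then show "x \<oplus>\<^bsub>fac_mod F\<^esub> y \<in> carrier (fac_mod F)" "fac_co F (x \<oplus>\<^bsub>fac_mod F\<^esub> y) = fac_co F x + fac_co F y"
    "lact (fac_mod F) e x \<in> carrier (fac_mod F)" "fac_co F (lact (fac_mod F) e x) = path_mult \<Delta> e (fac_co F x)"
    "ract (fac_mod F) x e \<in> carrier (fac_mod F)" "fac_co F (ract (fac_mod F) x e) = path_mult \<Delta> (fac_co F x) e"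
    using z vertex_times_closed[OF e z(2)] by (simp_all add: graded_factor_in[OF F])
qed

lemma listset_iff_list_all2: "xs \<in> listset As \<longleftrightarrow> list_all2 (\<lambda>A x. x \<in> A) As xs"
  by (induction As arbitrary: xs) (auto simp: set_Cons_def list_all2_Cons1)

abbreviation "is_tuple Fs xs \<equiv> list_all2 (\<lambda>F x. x \<in> carrier (fac_mod F)) Fs xs"

lemma tensor_tuples_iff: "xs \<in> tensor_tuples (map fac_mod Fs) \<longleftrightarrow> is_tuple Fs xs"
  by (simp add: tensor_tuples_def listset_iff_list_all2 list_all2_map1 comp_def)

lemma is_tuple_coords:
  assumes "\<forall>F\<in>set Fs. graded_factor F" "is_tuple Fs xs"
  shows "adm (map fac_len Fs) (coord_list Fs xs)" "tup Fs (coord_list Fs xs) = xs"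
  using assms(2,1) unfolding coord_list_def by (induction rule: list_all2_induct) (auto simp: graded_factorD)

lemma is_tuple_tup:
  assumes "\<forall>F\<in>set Fs. graded_factor F" "adm (map fac_len Fs) zs"
  shows "is_tuple Fs (tup Fs zs)" "coord_list Fs (tup Fs zs) = zs"
  using assms(2,1) unfolding coord_list_def list_all2_map1 by (induction rule: list_all2_induct) (auto simp: graded_factor_in)

lemma coord_list_append: "length xs = length Fs1 \<Longrightarrow> coord_list (Fs1 @ Fs2) (xs @ ys) = coord_list Fs1 xs @ coord_list Fs2 ys"
  by (simp add: coord_list_def)

lemma coord_list_Cons [simp]: "coord_list (F # Fs) (x # xs) = fac_co F x # coord_list Fs xs" "coord_list [] [] = []"
  by (simp_all add: coord_list_def)

context
  fixes Fs :: "('v, 'e, 'k::field) factor list"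
  assumes Fs: "\<forall>F\<in>set Fs. graded_factor F" "Fs \<noteq> []"
begin

abbreviation "Ms \<equiv> map fac_mod Fs"
abbreviation "E \<equiv> (vertex_algebra \<Delta> :: (('v, 'e) path \<Rightarrow>\<^sub>0 'k) ring)"
abbreviation "FA \<equiv> free_Abelian_group (tensor_tuples Ms)"
abbreviation "phi \<equiv> \<lambda>xs. tprod \<Delta> (coord_list Fs xs)"

definition "tensor_gens = {frag_of (xs @ [x \<oplus>\<^bsub>Ms ! length xs\<^esub> y] @ ys) - frag_of (xs @ [x] @ ys) - frag_of (xs @ [y] @ ys) |
         xs x y ys. xs @ [x] @ ys \<in> tensor_tuples Ms \<and> xs @ [y] @ ys \<in> tensor_tuples Ms} \<union>
      {frag_of (xs @ [ract (Ms ! length xs) x e, y] @ ys)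
         - frag_of (xs @ [x, lact (Ms ! Suc (length xs)) e y] @ ys) |
         xs x e y ys. xs @ [x, y] @ ys \<in> tensor_tuples Ms \<and> e \<in> carrier E}"

lemma tensor_rel_gens: "tensor_rel E Ms = generate FA tensor_gens"
  by (simp add: tensor_rel_def tensor_gens_def)

lemma carrier_E: "e \<in> carrier E \<longleftrightarrow> keys e \<subseteq> paths \<Delta> 0"
  by (simp add: vertex_algebra_def path_span_def)

text \<open>
  The coordinates \<open>tprod\<close> are additive in each slot and balanced.
\<close>

lemma tensor_gens_props:
  assumes "r \<in> tensor_gens" shows "keys r \<subseteq> tensor_tuples Ms" "zext phi r = 0"
proof -
  have "keys r \<subseteq> tensor_tuples Ms \<and> zext phi r = 0"
    using assms unfolding tensor_gens_def
  proof (elim UnE)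
    assume "r \<in> {frag_of (xs @ [x \<oplus>\<^bsub>Ms ! length xs\<^esub> y] @ ys) - frag_of (xs @ [x] @ ys) - frag_of (xs @ [y] @ ys) |
         xs x y ys. xs @ [x] @ ys \<in> tensor_tuples Ms \<and> xs @ [y] @ ys \<in> tensor_tuples Ms}"
    then obtain xs x y ys where r: "r = frag_of (xs @ [x \<oplus>\<^bsub>Ms ! length xs\<^esub> y] @ ys) - frag_of (xs @ [x] @ ys) - frag_of (xs @ [y] @ ys)"
      and t: "is_tuple Fs (xs @ x # ys)" "is_tuple Fs (xs @ y # ys)" by (auto simp: tensor_tuples_iff)
    from t(1) obtain F1 F F2 where F: "Fs = F1 @ F # F2" "length F1 = length xs" "is_tuple F1 xs" "x \<in> carrier (fac_mod F)" "is_tuple F2 ys"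
      by (auto simp: list_all2_append2 list_all2_Cons2 dest: list_all2_lengthD)
    have y: "y \<in> carrier (fac_mod F)" using t(2) F by (simp add: list_all2_append)
    have gF: "graded_factor F" using Fs F by auto
    have n: "Ms ! length xs = fac_mod F" using F by (simp add: nth_append)
    have k: "keys (0 :: ('v, 'e) path \<Rightarrow>\<^sub>0 'k) \<subseteq> paths \<Delta> 0" by simp
    have "is_tuple Fs (xs @ (x \<oplus>\<^bsub>fac_mod F\<^esub> y) # ys)" using F graded_factor_ops(1)[OF gF F(4) y k] by (simp add: list_all2_appendI)
    then have "keys r \<subseteq> tensor_tuples Ms" unfolding r n using t by (intro keys_diff_subset) (auto simp: tensor_tuples_iff)
    moreover have "zext phi r = 0" unfolding r n zext_diff zext_frag_of using F(2)
      by (simp add: F(1) coord_list_append graded_factor_ops(2)[OF gF F(4) y k] tprod_add)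
    ultimately show ?thesis ..
  next
    assume "r \<in> {frag_of (xs @ [ract (Ms ! length xs) x e, y] @ ys)
         - frag_of (xs @ [x, lact (Ms ! Suc (length xs)) e y] @ ys) |
         xs x e y ys. xs @ [x, y] @ ys \<in> tensor_tuples Ms \<and> e \<in> carrier E}"
    then obtain xs x e y ys where r: "r = frag_of (xs @ [ract (Ms ! length xs) x e, y] @ ys)
         - frag_of (xs @ [x, lact (Ms ! Suc (length xs)) e y] @ ys)"
      and t: "is_tuple Fs (xs @ x # y # ys)" and e: "keys e \<subseteq> paths \<Delta> 0" by (auto simp: tensor_tuples_iff carrier_E)
    from t obtain F1 F F' F2 where F: "Fs = F1 @ F # F' # F2" "length F1 = length xs" "is_tuple F1 xs" "x \<in> carrier (fac_mod F)"
       "y \<in> carrier (fac_mod F')" "is_tuple F2 ys"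
      by (auto simp: list_all2_append2 list_all2_Cons2 dest: list_all2_lengthD)
    have gF: "graded_factor F" "graded_factor F'" using Fs F by auto
    have n: "Ms ! length xs = fac_mod F" "Ms ! Suc (length xs) = fac_mod F'" using F by (simp_all add: nth_append)
    have "is_tuple Fs (xs @ ract (fac_mod F) x e # y # ys)" "is_tuple Fs (xs @ x # lact (fac_mod F') e y # ys)"
      using F graded_factor_ops(5)[OF gF(1) F(4) F(4) e] graded_factor_ops(3)[OF gF(2) F(5) F(5) e] by (simp_all add: list_all2_appendI)
    then have "keys r \<subseteq> tensor_tuples Ms" unfolding r n by (intro keys_diff_subset) (auto simp: tensor_tuples_iff)
    moreover have "zext phi r = 0" unfolding r n zext_diff zext_frag_of using F(2)
      by (simp add: F(1) coord_list_append graded_factor_ops(6)[OF gF(1) F(4) F(4) e] graded_factor_ops(4)[OF gF(2) F(5) F(5) e] tprod_balanced[OF e])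
    ultimately show ?thesis ..
  qed
  then show "keys r \<subseteq> tensor_tuples Ms" "zext phi r = 0" by auto
qed

lemma subgroup_tensor_rel: "subgroup (tensor_rel E Ms) FA"
  unfolding tensor_rel_gens by (rule group.generate_is_subgroup) (auto dest: tensor_gens_props)

lemma tensor_rel_props:
  assumes "r \<in> tensor_rel E Ms" shows "keys r \<subseteq> tensor_tuples Ms" "zext phi r = 0"
proof -
  show "keys r \<subseteq> tensor_tuples Ms" using subgroup.mem_carrier[OF subgroup_tensor_rel assms] by simp
  show "zext phi r = 0" using assms unfolding tensor_rel_gens
  proof induction
    case (inv h)
    then show ?case using tensor_gens_props[of h] by (simp add: zext_minus)
  next
    case (eng h1 h2)
    then show ?case by (simp add: zext_add)
  qed (auto simp: tensor_gens_props)
qed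

lemma tensor_rel_diff: "a \<in> tensor_rel E Ms \<Longrightarrow> b \<in> tensor_rel E Ms \<Longrightarrow> a - b \<in> tensor_rel E Ms"
  using subgroup.m_closed[OF subgroup_tensor_rel, of a "inv\<^bsub>FA\<^esub> b"] subgroup.m_inv_closed[OF subgroup_tensor_rel, of b]
    tensor_rel_props(1)[of b] by simp

lemma tensor_rel_0: "0 \<in> tensor_rel E Ms"
  using subgroup.one_closed[OF subgroup_tensor_rel] by simp

lemma tensor_rel_normal_form:
  assumes "adm (map fac_len Fs) zs"
  shows "frag_of (tup Fs zs) - normal_form (\<lambda>zs. frag_of (tup Fs zs)) (tprod \<Delta> zs) \<in> tensor_rel E Ms"
    and "keys v \<subseteq> cuts (listset (map fac_len Fs)) \<Longrightarrow> keys v' \<subseteq> cuts (listset (map fac_len Fs)) \<Longrightarrow>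
      normal_form (\<lambda>zs. frag_of (tup Fs zs)) (v + v') - (normal_form (\<lambda>zs. frag_of (tup Fs zs)) v + normal_form (\<lambda>zs. frag_of (tup Fs zs)) v') \<in> tensor_rel E Ms"
proof -
  have gen: "r \<in> tensor_rel E Ms" if "r \<in> tensor_gens" for r
    unfolding tensor_rel_gens using that by (rule generate.incl)
  have T1: "frag_of (tup Fs (zs1 @ (x + y) # zs2)) - frag_of (tup Fs (zs1 @ x # zs2)) - frag_of (tup Fs (zs1 @ y # zs2)) \<in> tensor_rel E Ms"
    if a: "adm (map fac_len Fs) (zs1 @ x # zs2)" "adm (map fac_len Fs) (zs1 @ y # zs2)" for zs1 x y zs2
  proof -
    from a(1)[unfolded list_all2_map1] obtain F1 F F2 where F: "Fs = F1 @ F # F2" "length F1 = length zs1" "x \<in> len_span (fac_len F)"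
      by (auto simp: list_all2_append2 list_all2_Cons2 dest: list_all2_lengthD)
    have y: "y \<in> len_span (fac_len F)" using a(2) F by (simp add: list_all2_append)
    have gF: "graded_factor F" using Fs F by auto
    then have p: "fac_in F x \<oplus>\<^bsub>fac_mod F\<^esub> fac_in F y = fac_in F (x + y)" using F y by (simp add: graded_factor_def)
    have n: "Ms ! length (tup F1 zs1) = fac_mod F" using F by (simp add: nth_append)
    have "tup F1 zs1 @ [fac_in F x] @ tup F2 zs2 \<in> tensor_tuples Ms" "tup F1 zs1 @ [fac_in F y] @ tup F2 zs2 \<in> tensor_tuples Ms"
      unfolding tensor_tuples_iff using is_tuple_tup(1)[OF Fs(1) a(1)] is_tuple_tup(1)[OF Fs(1) a(2)] F by simp_all
    then have "frag_of (tup F1 zs1 @ [fac_in F x \<oplus>\<^bsub>Ms ! length (tup F1 zs1)\<^esub> fac_in F y] @ tup F2 zs2)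
       - frag_of (tup F1 zs1 @ [fac_in F x] @ tup F2 zs2) - frag_of (tup F1 zs1 @ [fac_in F y] @ tup F2 zs2) \<in> tensor_gens"
      unfolding tensor_gens_def by blast
    then show ?thesis using gen F unfolding n p by simp
  qed
  have T2: "frag_of (tup Fs (zs1 @ path_mult \<Delta> x e # y # zs2)) - frag_of (tup Fs (zs1 @ x # path_mult \<Delta> e y # zs2)) \<in> tensor_rel E Ms"
    if a: "adm (map fac_len Fs) (zs1 @ x # y # zs2)" and e: "keys e \<subseteq> paths \<Delta> 0" for zs1 x e y zs2
  proof -
    from a(1)[unfolded list_all2_map1] obtain F1 F F' F2 where F: "Fs = F1 @ F # F' # F2" "length F1 = length zs1" "x \<in> len_span (fac_len F)" "y \<in> len_span (fac_len F')"
      by (auto simp: list_all2_append2 list_all2_Cons2 dest: list_all2_lengthD)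
    have gF: "graded_factor F" "graded_factor F'" using Fs F by auto
    then have p: "ract (fac_mod F) (fac_in F x) e = fac_in F (path_mult \<Delta> x e)" "lact (fac_mod F') e (fac_in F' y) = fac_in F' (path_mult \<Delta> e y)"
      using F e by (simp_all add: graded_factor_def)
    have n: "Ms ! length (tup F1 zs1) = fac_mod F" "Ms ! Suc (length (tup F1 zs1)) = fac_mod F'" using F by (simp_all add: nth_append)
    have "tup F1 zs1 @ [fac_in F x, fac_in F' y] @ tup F2 zs2 \<in> tensor_tuples Ms"
      unfolding tensor_tuples_iff using is_tuple_tup(1)[OF Fs(1) a(1)] F by simp
    then have "frag_of (tup F1 zs1 @ [ract (Ms ! length (tup F1 zs1)) (fac_in F x) e, fac_in F' y] @ tup F2 zs2)
       - frag_of (tup F1 zs1 @ [fac_in F x, lact (Ms ! Suc (length (tup F1 zs1))) e (fac_in F' y)] @ tup F2 zs2) \<in> tensor_gens"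
      using e unfolding tensor_gens_def carrier_E by blast
    then show ?thesis using gen F unfolding n p by simp
  qed
  have ne: "map fac_len Fs \<noteq> []" using Fs by simp
  note nf = tensor_normal_form[where g = "\<lambda>zs. frag_of (tup Fs zs)", OF tensor_rel_0 tensor_rel_diff T1 T2 assms ne]
  show "frag_of (tup Fs zs) - normal_form (\<lambda>zs. frag_of (tup Fs zs)) (tprod \<Delta> zs) \<in> tensor_rel E Ms"
    by (rule nf(1))
  show "normal_form (\<lambda>zs. frag_of (tup Fs zs)) (v + v') - (normal_form (\<lambda>zs. frag_of (tup Fs zs)) v + normal_form (\<lambda>zs. frag_of (tup Fs zs)) v') \<in> tensor_rel E Ms"
    if "keys v \<subseteq> cuts (listset (map fac_len Fs))" "keys v' \<subseteq> cuts (listset (map fac_len Fs))"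
    by (rule nf(2)) (rule that | assumption)+
qed

lemma zero_adm: "adm (map fac_len Fs) (replicate (length Fs) 0)"
  by (auto simp: list_all2_conv_all_nth)

text \<open>
  Coordinates vanish on the relations because they do so on generating relations. Conversely, an
  element is congruent to the normal form of its coordinates, and the normal form of \<open>0\<close> is \<open>0\<close>.
\<close>

lemma tensor_rel_iff:
  assumes "keys c \<subseteq> tensor_tuples Ms"
  shows "c \<in> tensor_rel E Ms \<longleftrightarrow> zext phi c = 0"
proof
  let ?nf = "normal_form (\<lambda>zs. frag_of (tup Fs zs))"
  have "c - ?nf (zext phi c) \<in> tensor_rel E Ms \<and> keys (zext phi c) \<subseteq> cuts (listset (map fac_len Fs))"
    using assms
  proof (induction c rule: frag_induction)
    case zero
    then show ?case by (simp add: normal_form_def tensor_rel_0)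
  next
    case (one xs)
    then have t: "is_tuple Fs xs" by (simp add: tensor_tuples_iff)
    note c = is_tuple_coords[OF Fs(1) t]
    show ?case using tensor_rel_normal_form(1)[OF c(1)] keys_tprod[OF c(1)] unfolding c(2) by simp
  next
    case (diff a b)
    let ?a = "zext phi a" and ?b = "zext phi b"
    have k: "keys (?a - ?b) \<subseteq> cuts (listset (map fac_len Fs))" using diff by (intro keys_diff_subset) auto
    have "?nf (?a - ?b + ?b) - (?nf (?a - ?b) + ?nf ?b) \<in> tensor_rel E Ms"
      using diff k by (intro tensor_rel_normal_form(2)[OF zero_adm]) auto
    then have 1: "?nf ?a - (?nf (?a - ?b) + ?nf ?b) \<in> tensor_rel E Ms" by simp
    have 2: "(a - ?nf ?a) - (b - ?nf ?b) \<in> tensor_rel E Ms" using diff by (auto intro: tensor_rel_diff[of "a - ?nf ?a" "b - ?nf ?b"])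
    have "((a - ?nf ?a) - (b - ?nf ?b)) - (0 - (?nf ?a - (?nf (?a - ?b) + ?nf ?b))) \<in> tensor_rel E Ms"
      by (rule tensor_rel_diff[OF 2 tensor_rel_diff[OF tensor_rel_0 1]])
    then show ?case using k by (simp add: zext_diff algebra_simps)
  qed
  then show "zext phi c = 0 \<Longrightarrow> c \<in> tensor_rel E Ms" by (simp add: normal_form_def)
qed (rule tensor_rel_props(2))

lemma tensor_coset_eq_iff:
  assumes "keys c \<subseteq> tensor_tuples Ms" "keys d \<subseteq> tensor_tuples Ms"
  shows "tensor_coset E Ms c = tensor_coset E Ms d \<longleftrightarrow> zext phi c = zext phi d"
proof -
  have e: "tensor_coset E Ms c = {r + c | r. r \<in> tensor_rel E Ms}" for c by (auto simp: tensor_coset_def r_coset_def)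
  have "tensor_coset E Ms c = tensor_coset E Ms d \<longleftrightarrow> c - d \<in> tensor_rel E Ms"
  proof
    assume "tensor_coset E Ms c = tensor_coset E Ms d"
    then have "0 + c \<in> {r + d | r. r \<in> tensor_rel E Ms}" unfolding e using tensor_rel_0 by blast
    then show "c - d \<in> tensor_rel E Ms" by auto
  next
    assume cd: "c - d \<in> tensor_rel E Ms"
    have add: "a + b \<in> tensor_rel E Ms" if "a \<in> tensor_rel E Ms" "b \<in> tensor_rel E Ms" for a b
      using tensor_rel_diff[OF that(1) tensor_rel_diff[OF tensor_rel_0 that(2)]] by simp
    have "\<exists>r'. r + c = r' + d \<and> r' \<in> tensor_rel E Ms" if "r \<in> tensor_rel E Ms" for r
      using add[OF that cd] by (intro exI[of _ "r + (c - d)"]) simp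
    moreover have "\<exists>r'. r + d = r' + c \<and> r' \<in> tensor_rel E Ms" if "r \<in> tensor_rel E Ms" for r
      using tensor_rel_diff[OF that cd] by (intro exI[of _ "r - (c - d)"]) simp
    ultimately show "tensor_coset E Ms c = tensor_coset E Ms d" unfolding e by blast
  qed
  also have "\<dots> \<longleftrightarrow> zext phi c = zext phi d"
    using tensor_rel_iff[of "c - d"] keys_diff_subset[OF assms] by (simp add: zext_diff)
  finally show ?thesis .
qed

lemma mem_tensor_coset:
  assumes "keys c \<subseteq> tensor_tuples Ms" "d \<in> tensor_coset E Ms c"
  shows "keys d \<subseteq> tensor_tuples Ms" "zext phi d = zext phi c"
proof -
  obtain r where r: "d = r + c" "r \<in> tensor_rel E Ms" using assms(2) by (auto simp: tensor_coset_def r_coset_def)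
  show "keys d \<subseteq> tensor_tuples Ms" "zext phi d = zext phi c"
    using r tensor_rel_props[OF r(2)] assms(1) by (simp_all add: keys_add_subset zext_add)
qed

lemma self_tensor_coset: "c \<in> tensor_coset E Ms c"
  unfolding tensor_coset_def r_coset_def using tensor_rel_0 by force

definition tensor_coords :: "('v, 'e, 'k) tens_elt \<Rightarrow> (('v, 'e) path \<times> nat list \<Rightarrow>\<^sub>0 'k)" where
  "tensor_coords X = zext phi (SOME c. keys c \<subseteq> tensor_tuples Ms \<and> X = tensor_coset E Ms c)"

lemma tensor_coords_coset:
  assumes "keys c \<subseteq> tensor_tuples Ms"
  shows "tensor_coords (tensor_coset E Ms c) = zext phi c"
proof -
  let ?P = "\<lambda>d. keys d \<subseteq> tensor_tuples Ms \<and> tensor_coset E Ms c = tensor_coset E Ms d"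
  have "?P (SOME d. ?P d)" using assms by (intro someI[of ?P c]) auto
  then show ?thesis unfolding tensor_coords_def using tensor_coset_eq_iff[OF assms] by auto
qed

lemma unit_tuple_tprod:
  assumes "k \<in> cuts (listset (map fac_len Fs))"
  shows "tprod \<Delta> (unit_tuple k c) = single k c" "adm (map fac_len Fs) (unit_tuple k c)"
proof -
  obtain w ls where k: "k = (w, ls)" by (cases k)
  have w: "w \<in> all_paths" "sum_list ls = path_len w" "ls \<in> listset (map fac_len Fs)" using assms by (auto simp: k cuts_def)
  then have ne: "ls \<noteq> []" using Fs by (auto simp: listset_iff_list_all2)
  note p = cut_path_props[OF w(1,2) ne]
  have "cut_path \<Delta> w ls \<noteq> []" using ne by (cases ls) auto
  with tprod_singles[of "c # replicate (length ls - 1) 1" "cut_path \<Delta> w ls"] p ne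
  show "tprod \<Delta> (unit_tuple k c) = single k c" unfolding unit_tuple_def k by simp
  show "adm (map fac_len Fs) (unit_tuple k c)" using adm_unit_tuple[OF assms] Fs by auto
qed

lemma zext_phi_onto:
  assumes "v \<in> cut_space (listset (map fac_len Fs))"
  shows "\<exists>c. keys c \<subseteq> tensor_tuples Ms \<and> zext phi c = v"
proof -
  have "keys v \<subseteq> cuts (listset (map fac_len Fs))" using assms by (simp add: cut_space_def)
  then show ?thesis
  proof (induction rule: linear_induct)
    case zero then show ?case by (intro exI[of _ 0]) simp
  next
    case (single k c)
    note u = unit_tuple_tprod[OF single, of c]
    show ?case using is_tuple_tup[OF Fs(1) u(2)] u(1) by (intro exI[of _ "frag_of (tup Fs (unit_tuple k c))"]) (simp add: tensor_tuples_iff)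
  next
    case (add x y)
    then obtain c d where "keys c \<subseteq> tensor_tuples Ms" "zext phi c = x" "keys d \<subseteq> tensor_tuples Ms" "zext phi d = y" by blast
    then show ?case by (intro exI[of _ "c + d"]) (simp add: keys_add_subset zext_add)
  qed
qed

lemma keys_zext_phi: "keys c \<subseteq> tensor_tuples Ms \<Longrightarrow> zext phi c \<in> cut_space (listset (map fac_len Fs))"
  unfolding cut_space_def zext_def mem_Collect_eq
  by (intro keys_sum_subset order_trans[OF keys_scale] keys_tprod is_tuple_coords(1)[OF Fs(1)]) (auto simp: tensor_tuples_iff)

text \<open>
  Once the kernel of the coordinates is known to be the group of relations, everything descends to
  the quotient; the two outer actions need to be known on tuples only.
\<close>

theorem coordinatized_tensor:
  assumes L: "\<And>a xs. keys a \<subseteq> all_paths \<Longrightarrow> is_tuple Fs xs \<Longrightarrow>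
      is_tuple Fs (L (tc a) (hd xs) # tl xs) \<and> phi (L (tc a) (hd xs) # tl xs) = lop \<Delta> (grow_first N) a (phi xs)"
    and R: "\<And>a xs. keys a \<subseteq> all_paths \<Longrightarrow> is_tuple Fs xs \<Longrightarrow>
      is_tuple Fs (butlast xs @ [R (last xs) (tc a)]) \<and> phi (butlast xs @ [R (last xs) (tc a)]) = rop \<Delta> (grow_last N) (phi xs) a"
  shows "coordinatized (tensor E Ms L R) (listset (map fac_len Fs)) tensor_coords"
    and "\<And>xs. is_tuple Fs xs \<Longrightarrow> tens E Ms xs \<in> carrier (tensor E Ms L R) \<and> tensor_coords (tens E Ms xs) = phi xs"
proof -
  let ?T = "tensor E Ms L R"
  have carr: "carrier ?T = {tensor_coset E Ms c | c. keys c \<subseteq> tensor_tuples Ms}"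
    by (auto simp: tensor_def FactGroup_def RCOSETS_def tensor_coset_def)
  have normal: "tensor_rel E Ms \<lhd> FA"
    by (rule comm_group.subgroup_imp_normal[OF abelian_free_Abelian_group subgroup_tensor_rel])
  have zero: "\<zero>\<^bsub>?T\<^esub> = tensor_coset E Ms 0"
    by (auto simp: tensor_def FactGroup_def tensor_coset_def r_coset_def)
  have add: "tensor_coset E Ms c \<oplus>\<^bsub>?T\<^esub> tensor_coset E Ms d = tensor_coset E Ms (c + d)"
    if "keys c \<subseteq> tensor_tuples Ms" "keys d \<subseteq> tensor_tuples Ms" for c d
    using normal.rcos_sum[OF normal, of c d] that by (simp add: tensor_def FactGroup_def tensor_coset_def)
  have act: "(\<Union>d\<in>tensor_coset E Ms c. tensor_coset E Ms (frag_extend (\<lambda>xs. frag_of (f xs)) d)) =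
      tensor_coset E Ms (frag_extend (\<lambda>xs. frag_of (f xs)) c) \<and> keys (frag_extend (\<lambda>xs. frag_of (f xs)) c) \<subseteq> tensor_tuples Ms \<and>
      zext phi (frag_extend (\<lambda>xs. frag_of (f xs)) c) = h (zext phi c)"
    if c: "keys c \<subseteq> tensor_tuples Ms" and f: "\<And>xs. is_tuple Fs xs \<Longrightarrow> is_tuple Fs (f xs) \<and> phi (f xs) = h (phi xs)"
      and h: "h 0 = 0" "\<And>x y. h (x - y) = h x - h y" for f h c
  proof -
    have z: "zext phi (frag_extend (\<lambda>xs. frag_of (f xs)) d) = h (zext phi d)" if "keys d \<subseteq> tensor_tuples Ms" for d
      by (rule zext_frag_extend[OF that]) (use f h in \<open>auto simp: tensor_tuples_iff\<close>)
    have k: "keys (frag_extend (\<lambda>xs. frag_of (f xs)) d) \<subseteq> tensor_tuples Ms" if "keys d \<subseteq> tensor_tuples Ms" for d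
      using that f by (intro keys_frag_extend_subset) (auto simp: tensor_tuples_iff)
    have "tensor_coset E Ms (frag_extend (\<lambda>xs. frag_of (f xs)) d) = tensor_coset E Ms (frag_extend (\<lambda>xs. frag_of (f xs)) c)"
      if "d \<in> tensor_coset E Ms c" for d
      using mem_tensor_coset[OF c that] c by (subst tensor_coset_eq_iff) (simp_all add: k z)
    then show ?thesis using self_tensor_coset[of c] k[OF c] z[OF c] by blast
  qed
  have lact: "lact ?T (tc a) (tensor_coset E Ms c) = tensor_coset E Ms (frag_extend (\<lambda>xs. frag_of (L (tc a) (hd xs) # tl xs)) c) \<and>
    keys (frag_extend (\<lambda>xs. frag_of (L (tc a) (hd xs) # tl xs)) c) \<subseteq> tensor_tuples Ms \<and>
    zext phi (frag_extend (\<lambda>xs. frag_of (L (tc a) (hd xs) # tl xs)) c) = lop \<Delta> (grow_first N) a (zext phi c)"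
    if "keys a \<subseteq> all_paths" "keys c \<subseteq> tensor_tuples Ms" for a c
    using act[OF that(2), of "\<lambda>xs. L (tc a) (hd xs) # tl xs" "lop \<Delta> (grow_first N) a"] L[OF that(1)]
    by (simp add: tensor_def ops_diff)
  have ract: "ract ?T (tensor_coset E Ms c) (tc a) = tensor_coset E Ms (frag_extend (\<lambda>xs. frag_of (butlast xs @ [R (last xs) (tc a)])) c) \<and>
    keys (frag_extend (\<lambda>xs. frag_of (butlast xs @ [R (last xs) (tc a)])) c) \<subseteq> tensor_tuples Ms \<and>
    zext phi (frag_extend (\<lambda>xs. frag_of (butlast xs @ [R (last xs) (tc a)])) c) = rop \<Delta> (grow_last N) (zext phi c) a"
    if "keys a \<subseteq> all_paths" "keys c \<subseteq> tensor_tuples Ms" for a c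
    using act[OF that(2), of "\<lambda>xs. butlast xs @ [R (last xs) (tc a)]" "\<lambda>v. rop \<Delta> (grow_last N) v a"] R[OF that(1)]
    by (simp add: tensor_def ops_diff)
  show "coordinatized ?T (listset (map fac_len Fs)) tensor_coords"
    unfolding coordinatized_def
  proof (intro conjI ballI allI impI)
    show "bij_betw tensor_coords (carrier ?T) (cut_space (listset (map fac_len Fs)))"
      unfolding bij_betw_def
    proof
      show "inj_on tensor_coords (carrier ?T)"
      proof (rule inj_onI)
        fix X Y assume "X \<in> carrier ?T" "Y \<in> carrier ?T" and eq: "tensor_coords X = tensor_coords Y"
        then obtain c d where c: "X = tensor_coset E Ms c" "Y = tensor_coset E Ms d"
          "keys c \<subseteq> tensor_tuples Ms" "keys d \<subseteq> tensor_tuples Ms" unfolding carr by blast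
        show "X = Y" using eq tensor_coset_eq_iff[OF c(3,4)] unfolding c tensor_coords_coset[OF c(3)] tensor_coords_coset[OF c(4)] by simp
      qed
      show "tensor_coords ` carrier ?T = cut_space (listset (map fac_len Fs))"
      proof
        show "tensor_coords ` carrier ?T \<subseteq> cut_space (listset (map fac_len Fs))"
          unfolding carr using keys_zext_phi by (auto simp: tensor_coords_coset)
        show "cut_space (listset (map fac_len Fs)) \<subseteq> tensor_coords ` carrier ?T"
        proof
          fix v :: "('v, 'e) path \<times> nat list \<Rightarrow>\<^sub>0 'k" assume "v \<in> cut_space (listset (map fac_len Fs))"
          from zext_phi_onto[OF this] obtain c where "keys c \<subseteq> tensor_tuples Ms" "zext phi c = v" by blast
          then show "v \<in> tensor_coords ` carrier ?T" unfolding carr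
            by (intro image_eqI[of _ _ "tensor_coset E Ms c"]) (auto simp: tensor_coords_coset)
        qed
      qed
    qed
    show "\<zero>\<^bsub>?T\<^esub> \<in> carrier ?T" unfolding carr zero by (auto intro!: exI[of _ 0])
    show "tensor_coords \<zero>\<^bsub>?T\<^esub> = 0" unfolding zero by (simp add: tensor_coords_coset)
  next
    fix x y assume "x \<in> carrier ?T" "y \<in> carrier ?T"
    then obtain c d where "x = tensor_coset E Ms c" "y = tensor_coset E Ms d" "keys c \<subseteq> tensor_tuples Ms" "keys d \<subseteq> tensor_tuples Ms"
      unfolding carr by auto
    then show "x \<oplus>\<^bsub>?T\<^esub> y \<in> carrier ?T" "tensor_coords (x \<oplus>\<^bsub>?T\<^esub> y) = tensor_coords x + tensor_coords y"
      unfolding carr by (auto simp: add tensor_coords_coset zext_add keys_add_subset intro!: exI[of _ "c + d"] dest!: subsetD[OF Poly_Mapping.keys_add])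
  next
    fix a :: "('v, 'e) path \<Rightarrow>\<^sub>0 'k" and x assume a: "keys a \<subseteq> all_paths" and "x \<in> carrier ?T"
    then obtain c where c: "x = tensor_coset E Ms c" "keys c \<subseteq> tensor_tuples Ms" unfolding carr by auto
    show "lact ?T (tc a) x \<in> carrier ?T" "tensor_coords (lact ?T (tc a) x) = lop \<Delta> (grow_first N) a (tensor_coords x)"
      using lact[OF a c(2)] c unfolding carr by (auto simp: tensor_coords_coset)
    show "ract ?T x (tc a) \<in> carrier ?T" "tensor_coords (ract ?T x (tc a)) = rop \<Delta> (grow_last N) (tensor_coords x) a"
      using ract[OF a c(2)] c unfolding carr by (auto simp: tensor_coords_coset)
  qed
  show "\<And>xs. is_tuple Fs xs \<Longrightarrow> tens E Ms xs \<in> carrier ?T \<and> tensor_coords (tens E Ms xs) = phi xs"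
    unfolding carr tens_def by (auto simp: tensor_coords_coset tensor_tuples_iff intro!: exI)
qed

end

end

lemma grow_last_add: "frag_extend (grow_last N b) (grow_last N a ls) = grow_last N (a + b) ls"
  by (auto simp: grow_last_def add.assoc)

context truncated_quiver begin

section \<open>Bimodules and their morphisms in coordinates\<close>

abbreviation "actl \<equiv> lop \<Delta> (grow_first N)"
abbreviation "actr \<equiv> rop \<Delta> (grow_last N)"

lemma act_times:
  "actl (path_mult \<Delta> x y) v = actl x (actl y v)" "actr v (path_mult \<Delta> x y) = actr (actr v x) y"
  "actr (actl x v) y = actl x (actr v y)"
proof -
  show "actl (path_mult \<Delta> x y) v = actl x (actl y v)"
    by (rule lop_lop_times[symmetric]) (rule grow_first_add)
  show "actr v (path_mult \<Delta> x y) = actr (actr v x) y"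
    by (rule rop_rop_times[symmetric]) (rule grow_last_add)
  show "actr (actl x v) y = actl x (actr v y)"
    by (rule lop_rop_commute) (rule grow_first_last_commute)
qed

text \<open>
  A vertex grows a piece by \<open>0\<close>; this keeps the list only if the outer pieces are short already.
\<close>

lemma act_scalar:
  assumes "v \<in> cut_space L" "L \<subseteq> {ls. ls \<noteq> [] \<and> hd ls < N \<and> last ls < N}"
  shows "actl (scale c unit) v = scale c v" "actr v (scale c unit) = scale c v"
proof -
  have k: "w \<in> all_paths \<and> ls \<noteq> [] \<and> hd ls < N \<and> last ls < N" if "(w, ls) \<in> keys v" for w ls
    using that assms by (auto simp: cut_space_def cuts_def)
  have "actl unit v = lin (\<lambda>k. \<Sum>u\<in>verts \<Delta>. left_op \<Delta> (grow_first N) (u, []) k) v"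
    by (simp add: lop_def lin_sum path_vec_def lin_fun_sum)
  also have "\<dots> = lin (\<lambda>k. single k 1) v"
  proof (rule lin_cong)
    fix q assume q: "q \<in> keys v"
    obtain w ls where wls: "q = (w, ls)" by (cases q)
    have "(\<Sum>u\<in>verts \<Delta>. left_op \<Delta> (grow_first N) (u, []) q) = (\<Sum>u\<in>verts \<Delta>. if u = fst w then single q 1 else 0)"
      using k[of w ls] q by (intro sum.cong) (auto simp: left_op_def wls grow_first_def)
    then show "(\<Sum>u\<in>verts \<Delta>. left_op \<Delta> (grow_first N) (u, []) q) = single q 1" using k[of w ls] q wls by simp
  qed
  finally have l: "actl unit v = v" by (simp add: lin_id)
  have "actr v unit = lin (\<lambda>k. \<Sum>u\<in>verts \<Delta>. right_op \<Delta> (grow_last N) k (u, [])) v"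
    by (simp add: rop_def lin_sum path_vec_def)
  also have "\<dots> = lin (\<lambda>k. single k 1) v"
  proof (rule lin_cong)
    fix q assume q: "q \<in> keys v"
    obtain w ls where wls: "q = (w, ls)" by (cases q)
    have "(\<Sum>u\<in>verts \<Delta>. right_op \<Delta> (grow_last N) q (u, [])) = (\<Sum>u\<in>verts \<Delta>. if u = path_end \<Delta> w then single q 1 else 0)"
      using k[of w ls] q by (intro sum.cong) (auto simp: right_op_def wls grow_last_def)
    then show "(\<Sum>u\<in>verts \<Delta>. right_op \<Delta> (grow_last N) q (u, [])) = single q 1" using k[of w ls] q wls by simp
  qed
  finally have r: "actr v unit = v" by (simp add: lin_id)
  have "actl (scale c unit) v = scale c (actl unit v)" "actr v (scale c unit) = scale c (actr v unit)"
    by (simp_all add: lop_def rop_def lin_scale lin_fun_scale)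
  then show "actl (scale c unit) v = scale c v" "actr v (scale c unit) = scale c v" unfolding l r by auto
qed

lemma act_unit:
  assumes "v \<in> cut_space L" "L \<subseteq> {ls. ls \<noteq> [] \<and> hd ls < N \<and> last ls < N}"
  shows "actl unit v = v" "actr v unit = v"
  using act_scalar[OF assms, of 1] by simp_all

lemma scalars_eq: "scalars \<Delta> N = range (\<lambda>c. tc (scale c unit))"
  by (simp add: scalars_def scale_sum path_vec_def)

lemma coordinatizedD:
  assumes "coordinatized M L \<Phi>"
  shows "\<And>x y. x \<in> carrier M \<Longrightarrow> y \<in> carrier M \<Longrightarrow> \<Phi> x = \<Phi> y \<Longrightarrow> x = y"
    "\<And>x. x \<in> carrier M \<Longrightarrow> \<Phi> x \<in> cut_space L"
    "\<And>v. v \<in> cut_space L \<Longrightarrow> inv_into (carrier M) \<Phi> v \<in> carrier M \<and> \<Phi> (inv_into (carrier M) \<Phi> v) = v"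
    "\<zero>\<^bsub>M\<^esub> \<in> carrier M" "\<Phi> \<zero>\<^bsub>M\<^esub> = 0"
    "\<And>x y. x \<in> carrier M \<Longrightarrow> y \<in> carrier M \<Longrightarrow> x \<oplus>\<^bsub>M\<^esub> y \<in> carrier M \<and> \<Phi> (x \<oplus>\<^bsub>M\<^esub> y) = \<Phi> x + \<Phi> y"
    "\<And>a x. keys a \<subseteq> all_paths \<Longrightarrow> x \<in> carrier M \<Longrightarrow> lact M (tc a) x \<in> carrier M \<and> \<Phi> (lact M (tc a) x) = actl a (\<Phi> x)"
    "\<And>a x. keys a \<subseteq> all_paths \<Longrightarrow> x \<in> carrier M \<Longrightarrow> ract M x (tc a) \<in> carrier M \<and> \<Phi> (ract M x (tc a)) = actr (\<Phi> x) a"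
proof -
  have b: "bij_betw \<Phi> (carrier M) (cut_space L)" using assms by (simp add: coordinatized_def)
  show "\<And>x y. x \<in> carrier M \<Longrightarrow> y \<in> carrier M \<Longrightarrow> \<Phi> x = \<Phi> y \<Longrightarrow> x = y" using b by (auto simp: bij_betw_def inj_on_def)
  show "\<And>x. x \<in> carrier M \<Longrightarrow> \<Phi> x \<in> cut_space L" using b by (auto simp: bij_betw_def)
  show "\<And>v. v \<in> cut_space L \<Longrightarrow> inv_into (carrier M) \<Phi> v \<in> carrier M \<and> \<Phi> (inv_into (carrier M) \<Phi> v) = v"
    using b by (metis bij_betw_def f_inv_into_f inv_into_into)
qed (use assms in \<open>simp_all add: coordinatized_def\<close>)

lemma cut_space_closed: "v \<in> cut_space L \<Longrightarrow> - v \<in> cut_space L" "0 \<in> cut_space L"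
  "v \<in> cut_space L \<Longrightarrow> w \<in> cut_space L \<Longrightarrow> v + w \<in> cut_space L"
  by (simp_all add: cut_space_def keys_add_subset)

lemma coordinatized_abelian_group:
  assumes "coordinatized M L \<Phi>" shows "abelian_group M"
proof -
  note D = coordinatizedD[OF assms]
  show ?thesis
  proof (rule abelian_groupI)
    fix x assume x: "x \<in> carrier M"
    let ?y = "inv_into (carrier M) \<Phi> (- \<Phi> x)"
    have y: "?y \<in> carrier M" "\<Phi> ?y = - \<Phi> x" using D(3)[OF cut_space_closed(1)[OF D(2)[OF x]]] by auto
    have "?y \<oplus>\<^bsub>M\<^esub> x = \<zero>\<^bsub>M\<^esub>" by (rule D(1)) (use x y D(4,5,6) in auto)
    then show "\<exists>y\<in>carrier M. y \<oplus>\<^bsub>M\<^esub> x = \<zero>\<^bsub>M\<^esub>" using y by blast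
    show "\<zero>\<^bsub>M\<^esub> \<oplus>\<^bsub>M\<^esub> x = x" by (rule D(1)) (use x D(4,5,6) in auto)
  next
    fix x y z assume "x \<in> carrier M" "y \<in> carrier M" "z \<in> carrier M"
    then show "x \<oplus>\<^bsub>M\<^esub> y \<oplus>\<^bsub>M\<^esub> z = x \<oplus>\<^bsub>M\<^esub> (y \<oplus>\<^bsub>M\<^esub> z)" by (intro D(1)) (use D(6) in \<open>auto simp: add.assoc\<close>)
  next
    fix x y assume "x \<in> carrier M" "y \<in> carrier M"
    then show "x \<oplus>\<^bsub>M\<^esub> y = y \<oplus>\<^bsub>M\<^esub> x" by (intro D(1)) (use D(6) in \<open>auto simp: add.commute\<close>)
  qed (use D(4,6) in auto)
qed

lemma carrier_AE:
  assumes "a \<in> carrier A" obtains x where "a = tc x" "keys x \<subseteq> all_paths"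
  using assms by (auto simp: carrier_A carrier_PA)

text \<open>
  Each axiom is an equation in \<open>M\<close>; by injectivity of the coordinates it can be checked on cut paths,
  where it is one of the identities for the outer actions.
\<close>

lemma coordinatized_bimodule:
  fixes M :: "(('v, 'e, 'k::field) trunc, 'm) bimod"
  assumes M: "coordinatized M L \<Phi>" and L: "L \<subseteq> {ls. ls \<noteq> [] \<and> hd ls < N \<and> last ls < N}"
  shows "bimodule A (scalars \<Delta> N) M"
proof -
  note D = coordinatizedD[OF M]
  have u: "keys (scale c unit) \<subseteq> all_paths" for c :: 'k
    by (rule order_trans[OF keys_scale keys_unit])
  show ?thesis unfolding bimodule_def
  proof (intro conjI ballI)
    show "abelian_group M" by (rule coordinatized_abelian_group[OF M])
  next
    fix a :: "('v, 'e, 'k) trunc" and x assume "a \<in> carrier A" and x: "x \<in> carrier M"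
    then obtain p where a: "a = tc p" "keys p \<subseteq> all_paths" by (auto elim: carrier_AE)
    show "lact M a x \<in> carrier M" "ract M x a \<in> carrier M" using D(7,8)[OF a(2) x] a by auto
  next
    fix a :: "('v, 'e, 'k) trunc" and x y assume "a \<in> carrier A" and x: "x \<in> carrier M" "y \<in> carrier M"
    then obtain p where a: "a = tc p" "keys p \<subseteq> all_paths" by (auto elim: carrier_AE)
    show "lact M a (x \<oplus>\<^bsub>M\<^esub> y) = lact M a x \<oplus>\<^bsub>M\<^esub> lact M a y"
      unfolding a by (rule D(1)) (use a x D(6,7) in \<open>auto simp: lop_add\<close>)
    show "ract M (x \<oplus>\<^bsub>M\<^esub> y) a = ract M x a \<oplus>\<^bsub>M\<^esub> ract M y a"
      unfolding a by (rule D(1)) (use a x D(6,8) in \<open>auto simp: rop_add\<close>)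
  next
    fix a b :: "('v, 'e, 'k) trunc" and x assume "a \<in> carrier A" "b \<in> carrier A" and x: "x \<in> carrier M"
    obtain p where a: "a = tc p" "keys p \<subseteq> all_paths" using \<open>a \<in> carrier A\<close> by (rule carrier_AE)
    obtain q where b: "b = tc q" "keys q \<subseteq> all_paths" using \<open>b \<in> carrier A\<close> by (rule carrier_AE)
    have s: "a \<oplus>\<^bsub>A\<^esub> b = tc (p + q)" "keys (p + q) \<subseteq> all_paths" using a b by (simp_all add: tc_add keys_add_subset)
    have m: "a \<otimes>\<^bsub>A\<^esub> b = tc (path_mult \<Delta> p q)" "keys (path_mult \<Delta> p q) \<subseteq> all_paths" using a b by (simp_all add: tc_mult keys_times_all)
    show "lact M (a \<oplus>\<^bsub>A\<^esub> b) x = lact M a x \<oplus>\<^bsub>M\<^esub> lact M b x" unfolding s(1) unfolding a(1) b(1)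
      by (rule D(1)) (use a(2) b(2) s(2) x D(6,7) in \<open>auto simp: lop_add\<close>)
    show "ract M x (a \<oplus>\<^bsub>A\<^esub> b) = ract M x a \<oplus>\<^bsub>M\<^esub> ract M x b" unfolding s(1) unfolding a(1) b(1)
      by (rule D(1)) (use a(2) b(2) s(2) x D(6,8) in \<open>auto simp: rop_add\<close>)
    show "lact M (a \<otimes>\<^bsub>A\<^esub> b) x = lact M a (lact M b x)" unfolding m(1) unfolding a(1) b(1)
      by (rule D(1)) (use a(2) b(2) m(2) x D(7) in \<open>auto simp: act_times\<close>)
    show "ract M x (a \<otimes>\<^bsub>A\<^esub> b) = ract M (ract M x a) b" unfolding m(1) unfolding a(1) b(1)
      by (rule D(1)) (use a(2) b(2) m(2) x D(8) in \<open>auto simp: act_times\<close>)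
    show "ract M (lact M a x) b = lact M a (ract M x b)" unfolding a(1) b(1)
      by (rule D(1)) (use a(2) b(2) x D(7,8) in \<open>auto simp: act_times\<close>)
  next
    fix x assume x: "x \<in> carrier M"
    show "lact M \<one>\<^bsub>A\<^esub> x = x" unfolding tc_one
      by (rule D(1)) (use x D(7)[OF keys_unit x] act_unit[OF D(2)[OF x] L] in auto)
    show "ract M x \<one>\<^bsub>A\<^esub> = x" unfolding tc_one
      by (rule D(1)) (use x D(8)[OF keys_unit x] act_unit[OF D(2)[OF x] L] in auto)
  next
    fix z :: "('v, 'e, 'k) trunc" and x assume "z \<in> scalars \<Delta> N" and x: "x \<in> carrier M"
    then obtain c where z: "z = tc (scale c unit)" by (auto simp: scalars_eq)
    show "lact M z x = ract M x z" unfolding z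
      by (rule D(1)) (use D(7)[OF u x] D(8)[OF u x] act_scalar[OF D(2)[OF x] L, of c] in auto)
  qed
qed

lemma ext_cut_space: "length_preserving L L' m \<Longrightarrow> v \<in> cut_space L \<Longrightarrow> ext m v \<in> cut_space L'"
  unfolding cut_space_def mem_Collect_eq ext_def
  by (rule keys_lin_subset) (fastforce simp: length_preserving_def cuts_def dest!: subsetD[OF keys_emb])

definition realizes where
  "realizes M \<Phi> M' \<Phi>' m f \<longleftrightarrow> (\<forall>x\<in>carrier M. f x \<in> carrier M' \<and> \<Phi>' (f x) = ext m (\<Phi> x))"

lemma ext_act:
  assumes "length_equivariant N L m" "v \<in> cut_space L"
  shows "ext m (actl a v) = actl a (ext m v)" "ext m (actr v a) = actr (ext m v) a"
  using assms by (auto intro!: ext_lop ext_rop simp: length_equivariant_def cut_space_def cuts_def)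

lemma realizes_bimod_hom:
  fixes M :: "(('v, 'e, 'k::field) trunc, 'm) bimod" and M' :: "(('v, 'e, 'k::field) trunc, 'n) bimod"
  assumes M: "coordinatized M L \<Phi>" and M': "coordinatized M' L' \<Phi>'" and e: "length_equivariant N L m" and f: "realizes M \<Phi> M' \<Phi>' m f"
  shows "f \<in> bimod_hom A M M'"
proof -
  note D = coordinatizedD[OF M] and D' = coordinatizedD[OF M']
  have fc: "f x \<in> carrier M'" "\<Phi>' (f x) = ext m (\<Phi> x)" if "x \<in> carrier M" for x using f that by (auto simp: realizes_def)
  show ?thesis unfolding bimod_hom_def mem_Collect_eq
  proof (intro conjI ballI funcsetI)
    fix x y assume xy: "x \<in> carrier M" "y \<in> carrier M"
    show "f (x \<oplus>\<^bsub>M\<^esub> y) = f x \<oplus>\<^bsub>M'\<^esub> f y"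
      by (rule D'(1)) (use xy D(6) D'(6) fc in \<open>auto simp: ext_add\<close>)
  next
    fix a :: "('v, 'e, 'k) trunc" and x assume "a \<in> carrier A" and x: "x \<in> carrier M"
    then obtain p where a: "a = tc p" "keys p \<subseteq> all_paths" by (auto elim: carrier_AE)
    show "f (lact M a x) = lact M' a (f x)" unfolding a
      by (rule D'(1)) (use a x D(7) D'(7) fc in \<open>auto simp: ext_act[OF e D(2)[OF x]]\<close>)
    show "f (ract M x a) = ract M' (f x) a" unfolding a
      by (rule D'(1)) (use a x D(8) D'(8) fc in \<open>auto simp: ext_act[OF e D(2)[OF x]]\<close>)
  qed (use fc in auto)
qed

text \<open>
  A cut path arises from its inner part, with outer pieces of length \<open>0\<close>, by the actions of the
  outer pieces. So the elements with outer pieces of length \<open>0\<close> generate the bimodule.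
\<close>

lemma cut_decompose:
  fixes c :: "'k::field"
  assumes "(w, ls) \<in> cuts L" "length ls \<ge> 2" "hd ls < N" "last ls < N"
  obtains p w' q where "p \<in> all_paths" "q \<in> all_paths" "w' \<in> all_paths"
    "sum_list (0 # butlast (tl ls) @ [0]) = path_len w'"
    "single (w, ls) c =
       actl (single p c) (actr (single (w', 0 # butlast (tl ls) @ [0]) (1::'k)) (single q 1))"
proof -
  let ?i = "hd ls" and ?mid = "butlast (tl ls)" and ?j = "last ls"
  have ls: "ls = ?i # ?mid @ [?j]" using assms(2) by (cases ls) auto
  have w: "w \<in> all_paths" "?i + sum_list ?mid + ?j = path_len w"
    using assms(1) arg_cong[OF ls, of sum_list] by (auto simp: cuts_def)
  obtain p r where p: "w = path_append p r" "p \<in> all_paths" "r \<in> all_paths" "composable \<Delta> p r" "path_len p = ?i"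
    using w by (auto elim!: path_splitE[of w ?i])
  have r: "path_len r = sum_list ?mid + ?j" using w p arg_cong[OF p(1), of path_len] by simp
  obtain w' q where q: "r = path_append w' q" "w' \<in> all_paths" "q \<in> all_paths" "composable \<Delta> w' q" "path_len w' = sum_list ?mid"
    using p r by (auto elim!: path_splitE[of r "sum_list ?mid"])
  have q': "path_len q = ?j" using r q arg_cong[OF q(1), of path_len] by simp
  have "actr (single (w', 0 # ?mid @ [0]) (1::'k)) (single q 1) = single (r, 0 # ?mid @ [?j]) (1::'k)"
    using q assms(4) by (simp add: rop_single grow_last_def q')
  moreover have "actl (single p c) (single (r, 0 # ?mid @ [?j]) (1::'k)) = single (w, ?i # ?mid @ [?j]) c"
    using p assms(3) by (simp add: lop_single grow_first_def)
  ultimately show ?thesis using ls by (intro that[of p q w'] p q) (simp_all add: q(5))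
qed

text \<open>
  The rule \<open>m\<close>, transported to \<open>M\<close> and \<open>M'\<close>, is a bimodule morphism with the prescribed values. There is
  no other one, because by \<open>cut_decompose\<close> the generators in \<open>S\<close> reach every cut path.
\<close>

lemma bimod_ext_realizes:
  fixes M :: "(('v, 'e, 'k::field) trunc, 'm) bimod" and M' :: "(('v, 'e, 'k::field) trunc, 'n) bimod"
  assumes M: "coordinatized M L \<Phi>" and M': "coordinatized M' L' \<Phi>'"
    and m: "length_preserving L L' m" "length_equivariant N L m"
    and L: "\<And>ls. ls \<in> L \<Longrightarrow> length ls \<ge> 2 \<and> hd ls < N \<and> last ls < N \<and> 0 # butlast (tl ls) @ [0] \<in> L"
    and g: "\<And>s. s \<in> S \<Longrightarrow> g s \<in> carrier M" and h: "\<And>s. s \<in> S \<Longrightarrow> h s \<in> carrier M'"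
    and gh: "\<And>s. s \<in> S \<Longrightarrow> \<Phi>' (h s) = ext m (\<Phi> (g s))"
    and gen: "\<And>w ls. (w, 0 # ls @ [0]) \<in> cuts L \<Longrightarrow> \<exists>s\<in>S. \<Phi> (g s) = single (w, 0 # ls @ [0]) 1"
  shows "realizes M \<Phi> M' \<Phi>' m (bimod_ext A M M' S g h)"
proof -
  note D = coordinatizedD[OF M] and D' = coordinatizedD[OF M']
  \<comment> \<open>The rule \<open>m\<close>, transported to the modules.\<close>
  define f0 where "f0 = (\<lambda>x\<in>carrier M. inv_into (carrier M') \<Phi>' (ext m (\<Phi> x)))"
  have f0: "realizes M \<Phi> M' \<Phi>' m f0"
    unfolding realizes_def f0_def using D'(3)[OF ext_cut_space[OF m(1) D(2)]] by simp
  have "bimod_ext A M M' S g h = f0"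
    unfolding bimod_ext_def
  proof (rule the_equality)
    show "f0 \<in> bimod_hom A M M' \<and> f0 \<in> extensional (carrier M) \<and> (\<forall>s\<in>S. f0 (g s) = h s)"
    proof (intro conjI ballI)
      show "f0 \<in> bimod_hom A M M'" by (rule realizes_bimod_hom[OF M M' m(2) f0])
      show "f0 \<in> extensional (carrier M)" by (simp add: f0_def)
      fix s assume s: "s \<in> S"
      show "f0 (g s) = h s" by (rule D'(1)) (use f0 s g h gh in \<open>auto simp: realizes_def\<close>)
    qed
  next
    fix f assume f: "f \<in> bimod_hom A M M' \<and> f \<in> extensional (carrier M) \<and> (\<forall>s\<in>S. f (g s) = h s)"
    have fc: "f x \<in> carrier M'" if "x \<in> carrier M" for x using f that by (auto simp: bimod_hom_def)
    have fadd: "f (x \<oplus>\<^bsub>M\<^esub> y) = f x \<oplus>\<^bsub>M'\<^esub> f y" if "x \<in> carrier M" "y \<in> carrier M" for x y using f that by (auto simp: bimod_hom_def)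
    have fact: "f (lact M a x) = lact M' a (f x)" "f (ract M x a) = ract M' (f x) a" if "x \<in> carrier M" "a \<in> carrier A" for a x
      using f that by (auto simp: bimod_hom_def)
    \<comment> \<open>A competitor \<open>f\<close> agrees with the rule \<open>m\<close>, by induction on the coordinates of its argument.\<close>
    have key: "\<forall>x\<in>carrier M. \<Phi> x = v \<longrightarrow> \<Phi>' (f x) = ext m v" if "keys v \<subseteq> cuts L" for v
      using that
    proof (induction rule: linear_induct)
      case zero
      show ?case
      proof (intro ballI impI)
        fix x assume x: "x \<in> carrier M" "\<Phi> x = 0"
        then have "x \<oplus>\<^bsub>M\<^esub> x = x" using D(6)[of x x] by (intro D(1)) auto
        then have "\<Phi>' (f x) + \<Phi>' (f x) = \<Phi>' (f x)" using fadd[OF x(1) x(1)] D'(6)[OF fc fc, OF x(1) x(1)] by simp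
        then show "\<Phi>' (f x) = ext m 0" by simp
      qed
    next
      case (single k c)
      obtain w ls where wls: "k = (w, ls)" by (cases k)
      then have c: "(w, ls) \<in> cuts L" using single by simp
      then have l: "length ls \<ge> 2" "hd ls < N" "last ls < N" "0 # butlast (tl ls) @ [0] \<in> L" using L by (auto simp: cuts_def)
      obtain p w' q where p: "p \<in> all_paths" "q \<in> all_paths" "w' \<in> all_paths"
        "sum_list (0 # butlast (tl ls) @ [0]) = path_len w'"
        "single (w, ls) c =
           actl (single p c) (actr (single (w', 0 # butlast (tl ls) @ [0]) 1) (single q 1))"
        using cut_decompose[OF c l(1-3)] by metis
      have "(w', 0 # butlast (tl ls) @ [0]) \<in> cuts L" using p l(4) by (simp add: cuts_def)
      from gen[OF this] obtain s where s: "s \<in> S" "\<Phi> (g s) = single (w', 0 # butlast (tl ls) @ [0]) 1" by blast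
      let ?p = "single p c" and ?q = "single q (1::'k)"
      have kp: "keys ?p \<subseteq> all_paths" "keys ?q \<subseteq> all_paths" using p by auto
      have carr: "tc ?p \<in> carrier A" "tc ?q \<in> carrier A" using kp by (auto simp: carrier_A carrier_PA simp del: keys_single)
      let ?y = "ract M (g s) (tc ?q)"
      have y: "?y \<in> carrier M" "\<Phi> ?y = actr (\<Phi> (g s)) ?q" using D(8)[OF kp(2) g[OF s(1)]] by auto
      have z: "lact M (tc ?p) ?y \<in> carrier M" "\<Phi> (lact M (tc ?p) ?y) = actl ?p (actr (\<Phi> (g s)) ?q)" using D(7)[OF kp(1) y(1)] y(2) by auto
      show ?case
      proof (intro ballI impI)
        fix x assume x: "x \<in> carrier M" "\<Phi> x = single k c"
        have xe: "x = lact M (tc ?p) ?y" by (rule D(1)) (use x z p(5) wls s(2) in auto)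
        have fx: "f x = lact M' (tc ?p) (ract M' (h s) (tc ?q))"
          unfolding xe using fact y(1) carr g[OF s(1)] f s(1) by simp
        have r: "ract M' (h s) (tc ?q) \<in> carrier M'" "\<Phi>' (ract M' (h s) (tc ?q)) = actr (\<Phi>' (h s)) ?q"
          using D'(8)[OF kp(2) h[OF s(1)]] by auto
        have "\<Phi>' (f x) = actl ?p (actr (\<Phi>' (h s)) ?q)" unfolding fx using D'(7)[OF kp(1) r(1)] r(2) by simp
        also have "\<dots> = ext m (actl ?p (actr (\<Phi> (g s)) ?q))"
          using D(2)[OF y(1)] D(2)[OF g[OF s(1)]] unfolding y(2) gh[OF s(1)] by (simp add: ext_act[OF m(2)])
        also have "\<dots> = ext m (single k c)" using z(2) xe x(2) by simp
        finally show "\<Phi>' (f x) = ext m (single k c)" .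
      qed
    next
      case (add v v')
      show ?case
      proof (intro ballI impI)
        fix x assume x: "x \<in> carrier M" "\<Phi> x = v + v'"
        obtain y y' where y: "y \<in> carrier M" "\<Phi> y = v" "y' \<in> carrier M" "\<Phi> y' = v'"
          using D(3)[of v] D(3)[of v'] add.hyps by (auto simp: cut_space_def)
        have "x = y \<oplus>\<^bsub>M\<^esub> y'" by (rule D(1)) (use x y D(6) in auto)
        then show "\<Phi>' (f x) = ext m (v + v')" using y add.IH D'(6)[OF fc fc, OF y(1) y(3)] by (simp add: fadd ext_add)
      qed
    qed
    show "f = f0"
    proof (rule extensionalityI[of _ "carrier M"])
      show "f \<in> extensional (carrier M)" "f0 \<in> extensional (carrier M)" using f by (simp_all add: f0_def)
      fix x assume x: "x \<in> carrier M"
      have "\<Phi>' (f x) = ext m (\<Phi> x)" using key[of "\<Phi> x"] D(2)[OF x] x by (simp add: cut_space_def)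
      then show "f x = f0 x" by (intro D'(1)) (use x fc f0 in \<open>auto simp: realizes_def\<close>)
    qed
  qed
  then show ?thesis using f0 by simp
qed

lemma finsum_coords:
  assumes M: "coordinatized M L \<Phi>" and I: "finite I" "\<And>i. i \<in> I \<Longrightarrow> f i \<in> carrier M"
  shows "finsum M f I \<in> carrier M \<and> \<Phi> (finsum M f I) = (\<Sum>i\<in>I. \<Phi> (f i))"
  using I
proof (induction I rule: finite_induct)
  interpret abelian_group M by (rule coordinatized_abelian_group[OF M])
  note D = coordinatizedD[OF M]
  {
    case empty show ?case using D(4,5) by simp
  next
    case (insert i I)
    then have "finsum M f (insert i I) = f i \<oplus>\<^bsub>M\<^esub> finsum M f I" by (intro finsum_insert) auto
    then show ?case using insert D(6) by simp
  }
qed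

lemma a_inv_coords:
  assumes M: "coordinatized M L \<Phi>" and x: "x \<in> carrier M"
  shows "\<ominus>\<^bsub>M\<^esub> x \<in> carrier M \<and> \<Phi> (\<ominus>\<^bsub>M\<^esub> x) = - \<Phi> x"
proof -
  interpret abelian_group M by (rule coordinatized_abelian_group[OF M])
  note D = coordinatizedD[OF M]
  have "\<Phi> (\<ominus>\<^bsub>M\<^esub> x) + \<Phi> x = 0" using D(6)[of "\<ominus>\<^bsub>M\<^esub> x" x] x D(5) by (simp add: l_neg)
  then show ?thesis using x by (simp add: eq_neg_iff_add_eq_0)
qed

lemma add_pow_coords:
  assumes M: "coordinatized M L \<Phi>" and x: "x \<in> carrier M"
  shows "add_pow M ((-1::int) ^ i) x \<in> carrier M \<and> \<Phi> (add_pow M ((-1::int) ^ i) x) = (if even i then \<Phi> x else - \<Phi> x)"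
proof -
  interpret abelian_group M by (rule coordinatized_abelian_group[OF M])
  have "add_pow M (1::int) x = x" "add_pow M (-1::int) x = \<ominus>\<^bsub>M\<^esub> x"
    using x add.int_pow_1[of x] add.int_pow_neg[of x 1] by (simp_all add: add_pow_def a_inv_def)
  then show ?thesis using x a_inv_coords[OF M x] by (cases "even i") (auto)
qed

lemma minus_coords:
  assumes M: "coordinatized M L \<Phi>" and x: "x \<in> carrier M" "y \<in> carrier M"
  shows "x \<ominus>\<^bsub>M\<^esub> y \<in> carrier M \<and> \<Phi> (x \<ominus>\<^bsub>M\<^esub> y) = \<Phi> x - \<Phi> y"
  using a_inv_coords[OF M x(2)] coordinatizedD(6)[OF M x(1)] by (simp add: a_minus_def)

end

section \<open>Coordinates on Q and P\<close>

definition trunc_cons :: "nat \<Rightarrow> nat \<Rightarrow> nat list \<Rightarrow> (nat list \<Rightarrow>\<^sub>0 int)" where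
  "trunc_cons N a ls = (if a < N then frag_of (a # ls) else 0)"

context truncated_quiver begin

lemma lop_cons_truncate: "lop \<Delta> cons_op (truncate x) v = lop \<Delta> (trunc_cons N) x v"
proof -
  have "lin (left_op \<Delta> (trunc_cons N) p) v = (if path_len p < N then lin (left_op \<Delta> cons_op p) v else 0)" for p
  proof (cases "path_len p < N")
    case True
    then have "left_op \<Delta> (trunc_cons N) p = (left_op \<Delta> cons_op p :: _ \<Rightarrow> (('v, 'e) path \<times> nat list \<Rightarrow>\<^sub>0 'a))"
      by (auto simp: left_op_def trunc_cons_def)
    then show ?thesis using True by simp
  next
    case False
    then have "left_op \<Delta> (trunc_cons N) p = (\<lambda>k. 0 :: ('v, 'e) path \<times> nat list \<Rightarrow>\<^sub>0 'a)" by (auto simp: left_op_def trunc_cons_def)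
    then show ?thesis using False by simp
  qed
  then show ?thesis by (simp add: lop_def truncate_def lin_lin) (intro lin_cong, simp)
qed

text \<open>
  Truncating the product in the first slot amounts to dropping the lists whose first piece has
  become too long, which is what the left action on cut paths does.
\<close>

lemma tprod_grow_first: "tprod \<Delta> (truncate (path_mult \<Delta> a z) # zs) = actl a (tprod \<Delta> (z # zs))"
  unfolding tprod.simps lop_cons_truncate
  by (rule lop_lop_times[symmetric]) (auto simp: grow_first_def trunc_cons_def)

lemma tprod_single: "keys x \<subseteq> all_paths \<Longrightarrow> tprod \<Delta> [x] = lin (\<lambda>p. single (p, [path_len p]) 1) x"
proof (induction rule: linear_induct)
  case (single p c)
  then show ?case using lop_cons_Nil[of p c] by simp
qed (simp_all add: lop_add lin_add)

text \<open>
  For a single slot this is the same reason as on the left; the entries before it commute with the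
  right action.
\<close>

lemma tprod_grow_last:
  assumes "adm \<Lambda>s (zs @ [z])" "keys b \<subseteq> all_paths"
  shows "tprod \<Delta> (zs @ [truncate (path_mult \<Delta> z b)]) = actr (tprod \<Delta> (zs @ [z])) b"
  using assms
proof (induction zs arbitrary: \<Lambda>s)
  case Nil
  then have z: "keys z \<subseteq> all_paths" by (auto simp: list_all2_Cons2 dest: len_span_keys)
  have t: "keys (truncate (path_mult \<Delta> z b)) \<subseteq> all_paths"
    using keys_truncate[OF keys_times_all[OF z Nil(2)]] short_all by blast
  show ?case unfolding append_Nil tprod_single[OF z] tprod_single[OF t]
    by (simp add: truncate_def path_mult_def rop_def lin_lin, intro lin_cong)
      (auto simp: path_times_def right_op_def grow_last_def)
next
  case (Cons y zs)
  then obtain \<Lambda> \<Lambda>s' where L: "\<Lambda>s = \<Lambda> # \<Lambda>s'" "adm \<Lambda>s' (zs @ [z])" by (auto simp: list_all2_Cons2)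
  have ne: "ls \<noteq> []" if "(w, ls) \<in> keys (tprod \<Delta> (zs @ [z]))" for w ls
    using subsetD[OF keys_tprod[OF L(2)] that] L(2) by (auto simp: cuts_def listset_iff_list_all2)
  have "actr (lop \<Delta> cons_op y (tprod \<Delta> (zs @ [z]))) b = lop \<Delta> cons_op y (actr (tprod \<Delta> (zs @ [z])) b)"
    by (rule lop_rop_commute) (auto dest!: ne simp: grow_last_Cons)
  then show ?case using Cons.IH[OF L(2) Cons.prems(2)] by simp
qed

lemma short_paths_eq: "short_paths = {p \<in> all_paths. path_len p \<in> {..<N}}" by (auto simp: short_paths_def)

lemma len_span_short: "len_span {..<N} = {x. keys x \<subseteq> short_paths}"
  by (simp add: len_span_def short_paths_eq)

lemma len_span_truncate: "x \<in> len_span \<Lambda> \<Longrightarrow> \<Lambda> \<subseteq> {..<N} \<Longrightarrow> truncate x = x"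
  by (rule truncate_short) (auto simp: len_span_def short_paths_def)

lemma coords_in: "a \<in> carrier A \<Longrightarrow> coords a \<in> len_span {..<N} \<and> tc (coords a) = a"
  by (erule carrier_AE) (simp add: coords_tc len_span_short keys_truncate tc_truncate)

lemma coords_mult:
  assumes "x \<in> carrier A" "keys a \<subseteq> all_paths"
  shows "coords (tc a \<otimes>\<^bsub>A\<^esub> x) = truncate (path_mult \<Delta> a (coords x))" "coords (x \<otimes>\<^bsub>A\<^esub> tc a) = truncate (path_mult \<Delta> (coords x) a)"
proof -
  have x: "keys (coords x) \<subseteq> all_paths" "x = tc (coords x)"
    using coords_in[OF assms(1)] len_span_keys by auto
  have "tc a \<otimes>\<^bsub>A\<^esub> x = tc (path_mult \<Delta> a (coords x))" "x \<otimes>\<^bsub>A\<^esub> tc a = tc (path_mult \<Delta> (coords x) a)"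
    using tc_mult[OF assms(2) x(1)] tc_mult[OF x(1) assms(2)] x(2) by simp_all
  then show "coords (tc a \<otimes>\<^bsub>A\<^esub> x) = truncate (path_mult \<Delta> a (coords x))" "coords (x \<otimes>\<^bsub>A\<^esub> tc a) = truncate (path_mult \<Delta> (coords x) a)"
    using x(1) assms(2) by (simp_all add: coords_tc keys_times_all)
qed

definition factor_A :: "('v, 'e, 'k::field) factor" where "factor_A = (A_bimod \<Delta> N, {..<N}, tc, coords)"
definition factor_Aplus :: "('v, 'e, 'k::field) factor" where "factor_Aplus = (Aplus_bimod \<Delta> N, {1..<N}, tc, coords)"
definition factor_path :: "nat \<Rightarrow> ('v, 'e, 'k::field) factor" where "factor_path m = (path_bimod \<Delta> m, {m}, \<lambda>x. {x}, the_elem)"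

lemma carrier_A_bimod: "carrier (A_bimod \<Delta> N) = carrier A"
  by (simp add: A_bimod_def Let_def)

lemma carrier_A_span: "carrier A = tc ` len_span {..<N}"
proof
  show "carrier A \<subseteq> tc ` len_span {..<N}" using coords_in by (metis image_eqI subsetI)
  show "tc ` len_span {..<N} \<subseteq> carrier A" by (auto simp: carrier_A carrier_PA dest!: len_span_keys)
qed

lemma paths_interval: "(\<Union>i\<in>\<Lambda>. paths \<Delta> i) = {p \<in> all_paths. path_len p \<in> \<Lambda>}"
  by (auto simp: paths_iff)

lemma vertex_keys: "keys e \<subseteq> paths \<Delta> 0 \<Longrightarrow> keys e \<subseteq> all_paths"
  by (auto simp: paths_iff)

lemma graded_factor_A: "graded_factor factor_A"
  unfolding graded_factor_def factor_A_def
  by (auto simp: A_bimod_def Let_def carrier_A_span coords_tc len_span_keys len_span_truncate tc_add tc_mult vertex_keys)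

lemma carrier_Aplus: "carrier (Aplus_bimod \<Delta> N) = tc ` len_span {1..<N}"
  by (simp add: Aplus_bimod_def path_span_def paths_interval len_span_def)

lemma graded_factor_Aplus: "graded_factor (factor_Aplus :: ('v, 'e, 'k::field) factor)"
proof -
  have "len_span {1..<N} \<subseteq> (len_span {..<N} :: (('v, 'e) path \<Rightarrow>\<^sub>0 'k) set)" by (auto simp: len_span_def)
  moreover have "truncate x = x" if "x \<in> len_span {Suc 0..<N}" for x :: "('v, 'e) path \<Rightarrow>\<^sub>0 'k"
    using that by (rule len_span_truncate) auto
  ultimately show ?thesis
    unfolding graded_factor_def factor_Aplus_def using carrier_Aplus
    by (auto simp: Aplus_bimod_def A_bimod_def Let_def coords_tc len_span_keys tc_add tc_mult vertex_keys)
qed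

lemma graded_factor_path: "graded_factor (factor_path m)"
  unfolding graded_factor_def factor_path_def
  by (auto simp: path_bimod_def path_span_def len_span_def paths_iff image_def subset_iff)

lemma fac_simps [simp]:
  "fac_mod factor_A = A_bimod \<Delta> N" "fac_len factor_A = {..<N}" "fac_co factor_A = coords"
  "fac_mod factor_Aplus = Aplus_bimod \<Delta> N" "fac_len factor_Aplus = {1..<N}" "fac_co factor_Aplus = coords"
  "fac_mod (factor_path m) = path_bimod \<Delta> m" "fac_len (factor_path m) = {m}" "fac_co (factor_path m) = the_elem"
  by (simp_all add: factor_A_def factor_Aplus_def factor_path_def)

text \<open>
  Both \<open>Q\<^sub>n\<close> and \<open>P\<^sub>n\<close> have \<open>A\<close> as first and last factor, which are the only ones that the outer actions
  affect.
\<close>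

lemma coordinatized_outer:
  fixes Fs :: "('v, 'e, 'k::field) factor list"
  assumes mid: "\<forall>F\<in>set mid. graded_factor F" and Fs: "Fs = factor_A # mid @ [factor_A]"
  shows "coordinatized (tensor (vertex_algebra \<Delta>) (map fac_mod Fs) (monoid.mult A) (monoid.mult A)) (listset (map fac_len Fs)) (tensor_coords Fs)"
    and "\<And>xs. is_tuple Fs xs \<Longrightarrow> tens (vertex_algebra \<Delta>) (map fac_mod Fs) xs \<in> carrier (tensor (vertex_algebra \<Delta>) (map fac_mod Fs) (monoid.mult A) (monoid.mult A)) \<and>
      tensor_coords Fs (tens (vertex_algebra \<Delta>) (map fac_mod Fs) xs) = tprod \<Delta> (coord_list Fs xs)"
proof -
  have g: "\<forall>F\<in>set Fs. graded_factor F" "Fs \<noteq> []" using mid graded_factor_A by (auto simp: Fs)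
  have carr: "tc a \<in> carrier A" if "keys a \<subseteq> all_paths" for a :: "('v, 'e) path \<Rightarrow>\<^sub>0 'k"
    using that by (auto simp: carrier_A carrier_PA)
  interpret ring "A :: ('v, 'e, 'k) trunc ring" by (rule ring_A)
  have L: "is_tuple Fs ((tc a \<otimes>\<^bsub>A\<^esub> hd xs) # tl xs) \<and>
      tprod \<Delta> (coord_list Fs ((tc a \<otimes>\<^bsub>A\<^esub> hd xs) # tl xs)) = actl a (tprod \<Delta> (coord_list Fs xs))"
    if a: "keys a \<subseteq> all_paths" and xs: "is_tuple Fs xs" for a xs
  proof -
    obtain x ys where x: "xs = x # ys" "x \<in> carrier A" "is_tuple (mid @ [factor_A]) ys"
      using xs by (auto simp: Fs list_all2_Cons1 carrier_A_bimod)
    show ?thesis unfolding Fs coord_list_Cons using x carr[OF a]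
      by (simp add: carrier_A_bimod coords_mult(1)[OF x(2) a] tprod_grow_first del: tprod.simps)
  qed
  have R: "is_tuple Fs (butlast xs @ [last xs \<otimes>\<^bsub>A\<^esub> tc a]) \<and>
      tprod \<Delta> (coord_list Fs (butlast xs @ [last xs \<otimes>\<^bsub>A\<^esub> tc a])) = actr (tprod \<Delta> (coord_list Fs xs)) a"
    if a: "keys a \<subseteq> all_paths" and xs: "is_tuple Fs xs" for a xs
  proof -
    have "is_tuple ((factor_A # mid) @ [factor_A]) xs" using xs by (simp add: Fs)
    then obtain ys x where x: "xs = ys @ [x]" "x \<in> carrier A" "is_tuple (factor_A # mid) ys" "length ys = length (factor_A # mid)"
      by (auto simp: list_all2_append1 list_all2_Cons1 carrier_A_bimod dest: list_all2_lengthD)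
    have c: "coord_list Fs (ys @ [z]) = coord_list (factor_A # mid) ys @ [coords z]" for z
      using coord_list_append[OF x(4), of "[factor_A]" "[z]"] by (simp add: Fs)
    have "is_tuple ((factor_A # mid) @ [factor_A]) (ys @ [x \<otimes>\<^bsub>A\<^esub> tc a])"
      using x carr[OF a] by (intro list_all2_appendI) (auto simp: carrier_A_bimod)
    moreover have "adm (map fac_len Fs) (coord_list (factor_A # mid) ys @ [coords x])"
      using is_tuple_coords(1)[OF g(1) xs] unfolding x(1) c .
    from tprod_grow_last[OF this a]
    have "tprod \<Delta> (coord_list Fs (ys @ [x \<otimes>\<^bsub>A\<^esub> tc a])) = actr (tprod \<Delta> (coord_list Fs (ys @ [x]))) a"
      unfolding c coords_mult(2)[OF x(2) a] .
    ultimately show ?thesis by (simp add: x(1) Fs)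
  qed
  show "coordinatized (tensor (vertex_algebra \<Delta>) (map fac_mod Fs) (monoid.mult A) (monoid.mult A)) (listset (map fac_len Fs)) (tensor_coords Fs)"
    by (rule coordinatized_tensor(1)[OF g L R])
  show "\<And>xs. is_tuple Fs xs \<Longrightarrow> tens (vertex_algebra \<Delta>) (map fac_mod Fs) xs \<in> carrier (tensor (vertex_algebra \<Delta>) (map fac_mod Fs) (monoid.mult A) (monoid.mult A)) \<and>
      tensor_coords Fs (tens (vertex_algebra \<Delta>) (map fac_mod Fs) xs) = tprod \<Delta> (coord_list Fs xs)"
    by (rule coordinatized_tensor(2)[OF g L R])
qed

definition Q_fac :: "nat \<Rightarrow> ('v, 'e, 'k::field) factor list" where
  "Q_fac n = factor_A # replicate n factor_Aplus @ [factor_A]"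

definition P_fac :: "nat \<Rightarrow> ('v, 'e, 'k::field) factor list" where
  "P_fac n = factor_A # (if n = 0 then [] else [factor_path (P_deg N n)]) @ [factor_A]"

abbreviation "Q_coords n \<equiv> tensor_coords (Q_fac n)"
abbreviation "P_coords n \<equiv> tensor_coords (P_fac n)"

lemma Q_fac_mod: "map fac_mod (Q_fac n) = Q_factors \<Delta> N n"
  by (simp add: Q_fac_def Q_factors_def)

lemma P_fac_mod: "map fac_mod (P_fac n) = P_factors \<Delta> N n"
  by (simp add: P_fac_def P_factors_def)

lemma Q_fac_len: "listset (map fac_len (Q_fac n)) = bar_lists N n"
  by (simp add: Q_fac_def bar_lists_def)

lemma P_fac_len: "listset (map fac_len (P_fac n)) = P_lists N n"
  by (auto simp: P_fac_def P_lists_def P_list_def set_Cons_def)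

lemma coordinatized_Q: "coordinatized (Q_mod \<Delta> N n) (bar_lists N n) (Q_coords n)"
  using coordinatized_outer(1)[OF _ Q_fac_def, of n] by (simp add: Q_mod_def Q_fac_mod Q_fac_len graded_factor_Aplus)

lemma P_mid_graded: "\<forall>F\<in>set (if n = 0 then [] else [factor_path (P_deg N n)]). graded_factor F"
  by (simp add: graded_factor_path)

lemma coordinatized_P: "coordinatized (P_mod \<Delta> N n) (P_lists N n) (P_coords n)"
  using coordinatized_outer(1)[OF P_mid_graded P_fac_def, of n] by (simp add: P_mod_def P_fac_mod P_fac_len)

lemma Q_elt_coords:
  fixes xs :: "('v, 'e, 'k::field) trunc list"
  assumes "is_tuple (Q_fac n) xs"
  shows "Q_elt \<Delta> N n xs \<in> carrier (Q_mod \<Delta> N n) \<and> Q_coords n (Q_elt \<Delta> N n xs) = tprod \<Delta> (map coords xs)"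
proof -
  let ?Fs = "Q_fac n :: ('v, 'e, 'k) factor list"
  have "coord_list ?Fs xs = map coords xs"
  proof (rule nth_equalityI)
    show "length (coord_list ?Fs xs) = length (map coords xs)"
      using list_all2_lengthD[OF assms] by (simp add: coord_list_def)
    fix i assume "i < length (coord_list ?Fs xs)"
    then have i: "i < length xs" "i < length ?Fs" by (auto simp: coord_list_def)
    then have "?Fs ! i \<in> set ?Fs" by (intro nth_mem)
    then have "fac_co (?Fs ! i) = coords" by (auto simp: Q_fac_def split: if_splits)
    then show "coord_list ?Fs xs ! i = map coords xs ! i" using i by (simp add: coord_list_def)
  qed
  then show ?thesis using coordinatized_outer(2)[OF _ Q_fac_def assms]
    by (simp add: Q_elt_def Q_mod_def Q_fac_mod graded_factor_Aplus)
qed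

lemma P_tens_coords:
  assumes "is_tuple (P_fac n) xs"
  shows "tens (vertex_algebra \<Delta>) (P_factors \<Delta> N n) xs \<in> carrier (P_mod \<Delta> N n) \<and> P_coords n (tens (vertex_algebra \<Delta>) (P_factors \<Delta> N n) xs) = tprod \<Delta> (coord_list (P_fac n) xs)"
  using coordinatized_outer(2)[OF P_mid_graded P_fac_def assms] by (simp add: P_mod_def P_fac_mod)

definition A_coords :: "('v, 'e, 'k::field) trunc \<Rightarrow> (('v, 'e) path \<times> nat list \<Rightarrow>\<^sub>0 'k)" where
  "A_coords a = tprod \<Delta> [coords a]"

lemma tc_carrier: "keys x \<subseteq> all_paths \<Longrightarrow> tc x \<in> carrier A"
  by (simp add: carrier_A carrier_PA)

text \<open>
  \<open>A\<close> itself, as the target of the augmentations, is described by paths cut into one piece.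
\<close>

lemma coordinatized_A: "coordinatized (regular_bimod (A :: ('v, 'e, 'k::field) trunc ring)) (listset [{..<N}]) A_coords"
proof -
  interpret ring "A :: ('v, 'e, 'k) trunc ring" by (rule ring_A)
  have co: "keys (coords a) \<subseteq> all_paths" if "a \<in> carrier A" for a :: "('v, 'e, 'k) trunc"
    using coords_in[OF that] len_span_keys by blast
  have adm: "adm [{..<N}] [coords a]" if "a \<in> carrier A" for a :: "('v, 'e, 'k) trunc"
    using coords_in[OF that] by simp
  have inj: "x = lin (\<lambda>k. single (fst k) 1) (tprod \<Delta> [x])" if "keys x \<subseteq> all_paths" for x :: "('v, 'e) path \<Rightarrow>\<^sub>0 'k"
    unfolding tprod_single[OF that] lin_lin by (simp add: lin_id)
  have add: "coords (a \<oplus>\<^bsub>A\<^esub> b) = coords a + coords b" if "a \<in> carrier A" "b \<in> carrier A" for a b :: "('v, 'e, 'k) trunc"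
  proof -
    have e: "tc (coords a) = a" "tc (coords b) = b" using coords_in[OF that(1)] coords_in[OF that(2)] by simp_all
    have "a \<oplus>\<^bsub>A\<^esub> b = tc (coords a + coords b)" using tc_add[OF co[OF that(1)] co[OF that(2)]] unfolding e .
    moreover have "coords a + coords b \<in> len_span {..<N}" using coords_in[OF that(1)] coords_in[OF that(2)] by simp
    ultimately show ?thesis by (simp add: coords_tc len_span_keys len_span_truncate)
  qed
  show ?thesis unfolding coordinatized_def
  proof (intro conjI ballI allI impI)
    show "bij_betw A_coords (carrier (regular_bimod (A :: ('v, 'e, 'k) trunc ring))) (cut_space (listset [{..<N}]))"
      unfolding bij_betw_def
    proof
      show "inj_on A_coords (carrier (regular_bimod (A :: ('v, 'e, 'k) trunc ring)))"
      proof (rule inj_onI)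
        fix a b :: "('v, 'e, 'k) trunc" assume "a \<in> carrier (regular_bimod A)" "b \<in> carrier (regular_bimod A)" and e: "A_coords a = A_coords b"
        then have ab: "a \<in> carrier A" "b \<in> carrier A" by (auto simp: regular_bimod_def)
        then have "coords a = coords b" using inj[OF co[OF ab(1)]] inj[OF co[OF ab(2)]] e by (simp add: A_coords_def)
        then show "a = b" using coords_in[OF ab(1)] coords_in[OF ab(2)] by metis
      qed
      show "A_coords ` carrier (regular_bimod (A :: ('v, 'e, 'k) trunc ring)) = cut_space (listset [{..<N}])"
      proof
        show "A_coords ` carrier (regular_bimod (A :: ('v, 'e, 'k) trunc ring)) \<subseteq> cut_space (listset [{..<N}])"
          using keys_tprod[OF adm] unfolding regular_bimod_def A_coords_def cut_space_def by auto
        show "cut_space (listset [{..<N}]) \<subseteq> A_coords ` carrier (regular_bimod (A :: ('v, 'e, 'k) trunc ring))"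
        proof
          fix v :: "('v, 'e) path \<times> nat list \<Rightarrow>\<^sub>0 'k" assume v: "v \<in> cut_space (listset [{..<N}])"
          let ?x = "lin (\<lambda>k. single (fst k) 1) v"
          have k: "fst k \<in> short_paths \<and> k = (fst k, [path_len (fst k)])" if "k \<in> keys v" for k
            using that v by (auto simp: cut_space_def cuts_def set_Cons_def short_paths_def)
          have x: "keys ?x \<subseteq> short_paths" by (rule keys_lin_subset) (use k in auto)
          have xa: "keys ?x \<subseteq> all_paths" using x short_all by blast
          have "tprod \<Delta> [?x] = lin (\<lambda>k. single k 1) v"
            unfolding tprod_single[OF xa] lin_lin by (rule lin_cong) (use k in auto)
          then have "tprod \<Delta> [?x] = v" by (simp add: lin_id)
          then have "A_coords (tc ?x) = v" unfolding A_coords_def coords_tc[OF xa] truncate_short[OF x] .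
          then show "v \<in> A_coords ` carrier (regular_bimod A)" using tc_carrier[OF xa]
            by (intro image_eqI[of _ _ "tc ?x"]) (simp_all add: regular_bimod_def)
        qed
      qed
    qed
    have t0: "truncate (0 :: ('v, 'e) path \<Rightarrow>\<^sub>0 'k) = 0" by (rule truncate_short) simp
    show "\<zero>\<^bsub>regular_bimod (A :: ('v, 'e, 'k) trunc ring)\<^esub> \<in> carrier (regular_bimod A)" by (simp add: regular_bimod_def)
    show "A_coords \<zero>\<^bsub>regular_bimod (A :: ('v, 'e, 'k) trunc ring)\<^esub> = 0" by (simp add: regular_bimod_def A_coords_def tc_zero coords_tc t0)
  next
    fix x y assume "x \<in> carrier (regular_bimod (A :: ('v, 'e, 'k) trunc ring))" "y \<in> carrier (regular_bimod (A :: ('v, 'e, 'k) trunc ring))"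
    then show "x \<oplus>\<^bsub>regular_bimod A\<^esub> y \<in> carrier (regular_bimod A)" "A_coords (x \<oplus>\<^bsub>regular_bimod A\<^esub> y) = A_coords x + A_coords y"
      by (auto simp: regular_bimod_def A_coords_def add lop_add)
  next
    fix a :: "('v, 'e) path \<Rightarrow>\<^sub>0 'k" and x assume a: "keys a \<subseteq> all_paths" and "x \<in> carrier (regular_bimod (A :: ('v, 'e, 'k) trunc ring))"
    then have x: "x \<in> carrier A" by (simp add: regular_bimod_def)
    show "lact (regular_bimod A) (tc a) x \<in> carrier (regular_bimod A)" "ract (regular_bimod A) x (tc a) \<in> carrier (regular_bimod A)"
      using x tc_carrier[OF a] by (simp_all add: regular_bimod_def)
    have "A_coords (tc a \<otimes>\<^bsub>A\<^esub> x) = actl a (A_coords x)"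
      unfolding A_coords_def coords_mult(1)[OF x a] by (rule tprod_grow_first)
    then show "A_coords (lact (regular_bimod A) (tc a) x) = actl a (A_coords x)" by (simp add: regular_bimod_def)
    have "A_coords (x \<otimes>\<^bsub>A\<^esub> tc a) = actr (A_coords x) a"
      unfolding A_coords_def coords_mult(2)[OF x a]
      using tprod_grow_last[of "[{..<N}]" "[]" "coords x", OF _ a] adm[OF x] unfolding append_Nil by blast
    then show "A_coords (ract (regular_bimod A) x (tc a)) = actr (A_coords x) a" by (simp add: regular_bimod_def)
  qed
qed

lemma tprod_unit: "tprod \<Delta> [unit] = (\<Sum>u\<in>verts \<Delta>. single ((u, []), [0]) 1)"
  unfolding tprod_single[OF keys_unit] by (simp add: lin_sum path_vec_def)

lemma lop_cons_unit: "fst w \<in> verts \<Delta> \<Longrightarrow> lop \<Delta> cons_op unit (single (w, ls) c) = single (w, 0 # ls) c"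
proof -
  assume w: "fst w \<in> verts \<Delta>"
  have "lop \<Delta> cons_op unit (single (w, ls) c) = (\<Sum>u\<in>verts \<Delta>. lop \<Delta> cons_op (single (u, []) 1) (single (w, ls) c))"
    by (simp add: lop_def lin_sum path_vec_def)
  also have "\<dots> = (\<Sum>u\<in>verts \<Delta>. if u = fst w then single (w, 0 # ls) c else 0)"
    by (intro sum.cong) (auto simp: lop_single)
  finally show ?thesis using w by simp
qed

lemma lop_cons_tprod_unit: "p \<in> all_paths \<Longrightarrow> lop \<Delta> cons_op (single p c) (tprod \<Delta> [unit]) = single (p, [path_len p, 0]) c"
proof -
  assume p: "p \<in> all_paths"
  have "lop \<Delta> cons_op (single p c) (tprod \<Delta> [unit]) =
     (\<Sum>v\<in>verts \<Delta>. lop \<Delta> cons_op (single p c) (single ((v, []), [0]) 1))"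
    unfolding tprod_unit by (simp add: lop_def lin_sum scale_sum)
  also have "\<dots> = (\<Sum>v\<in>verts \<Delta>. if v = path_end \<Delta> p then single (p, [path_len p, 0]) c else 0)"
    by (intro sum.cong) (auto simp: lop_single)
  finally show ?thesis using p by simp
qed

lemma tprod_singles_unit:
  assumes "set ps \<subseteq> all_paths" "ps \<noteq> []" "successively (composable \<Delta>) ps"
  shows "tprod \<Delta> (map (\<lambda>p. single p (1::'k::field)) ps @ [unit]) = single (path_concat ps, map path_len ps @ [0]) 1"
  using assms
proof (induction ps)
  case (Cons p ps)
  show ?case
  proof (cases "ps = []")
    case True
    then show ?thesis using Cons.prems lop_cons_tprod_unit[of p 1] by simp
  next
    case False
    then show ?thesis using Cons by (simp add: lop_single successively_Cons path_concat_Cons)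
  qed
qed simp

lemma path_class_tc: "path_class \<Delta> N p = tc (single p 1)"
  by (simp add: path_class_def path_vec_def)

text \<open>
  The element is obtained from \<open>1 \<otimes> v \<otimes> 1\<close> by the outer actions. In degree \<open>0\<close>, where \<open>v\<close> is a vertex
  absorbed into the first factor, this comes from \<open>\<alpha> v \<otimes> \<beta>\<close> instead.
\<close>

lemma P_elt_coords:
  fixes x y :: "('v, 'e) path \<Rightarrow>\<^sub>0 'k::field"
  assumes x: "keys x \<subseteq> all_paths" and y: "keys y \<subseteq> all_paths" and v: "v \<in> paths \<Delta> (P_deg N n)"
  shows "P_elt \<Delta> N n (tc x) v (tc y) \<in> carrier (P_mod \<Delta> N n) \<and>
    P_coords n (P_elt \<Delta> N n (tc x) v (tc y)) = actl x (actr (single (v, P_list N n 0 0) 1) y)"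
proof -
  have v': "v \<in> all_paths" "path_len v = P_deg N n" using v by (auto simp: paths_iff)
  have kv: "keys (single v (1::'k)) \<subseteq> all_paths" using v' by auto
  have unit_adm: "(unit :: ('v, 'e) path \<Rightarrow>\<^sub>0 'k) \<in> len_span {..<N}"
    using N_pos unfolding len_span_def mem_Collect_eq by (intro keys_sum_subset) (auto simp: path_vec_def)
  have tx: "truncate x = truncate (path_mult \<Delta> x unit)" and ty: "truncate y = truncate (path_mult \<Delta> unit y)"
    using x y by (simp_all only: times_unit_left times_unit_right)
  show ?thesis
  proof (cases "n = 0")
    case True
    have m: "tc x \<otimes>\<^bsub>A\<^esub> path_class \<Delta> N v = tc (path_mult \<Delta> x (single v 1))" unfolding path_class_tc by (rule tc_mult[OF x kv])
    have kx: "keys (path_mult \<Delta> x (single v 1)) \<subseteq> all_paths" by (rule keys_times_all[OF x kv])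
    have t: "is_tuple (P_fac n) [tc x \<otimes>\<^bsub>A\<^esub> path_class \<Delta> N v, tc y]"
      using True tc_carrier[OF kx] tc_carrier[OF y] unfolding m by (simp add: P_fac_def carrier_A_bimod)
    have c: "coord_list (P_fac n) [tc x \<otimes>\<^bsub>A\<^esub> path_class \<Delta> N v, tc y] = [truncate (path_mult \<Delta> x (single v 1)), truncate y]"
      unfolding m using True kx y by (simp add: P_fac_def coords_tc)
    have a: "adm [{0}, {..<N}] ([single v (1::'k)] @ [unit])"
      using unit_adm v' True by (auto simp: len_span_def)
    have "tprod \<Delta> [truncate (path_mult \<Delta> x (single v 1)), truncate y] = actl x (tprod \<Delta> ([single v 1] @ [truncate (path_mult \<Delta> unit y)]))"
      unfolding ty using tprod_grow_first[of x "single v 1" "[truncate (path_mult \<Delta> unit y)]"] by (simp del: tprod.simps)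
    also have "\<dots> = actl x (actr (tprod \<Delta> ([single v 1] @ [unit])) y)" unfolding tprod_grow_last[OF a y] ..
    also have "tprod \<Delta> ([single v (1::'k)] @ [unit]) = single (v, P_list N n 0 0) 1"
      using tprod_singles_unit[of "[v]"] v' True by (simp add: P_list_def del: tprod.simps)
    finally show ?thesis using P_tens_coords[OF t] True unfolding c by (simp add: P_elt_def del: tprod.simps)
  next
    case False
    have t: "is_tuple (P_fac n) [tc x, {path_vec v}, tc y]"
      using False tc_carrier[OF x] tc_carrier[OF y] v by (simp add: P_fac_def carrier_A_bimod path_bimod_def path_span_def path_vec_def)
    have c: "coord_list (P_fac n) [tc x, {path_vec v}, tc y] = [truncate x, single v 1, truncate y]"
      using False x y by (simp add: P_fac_def coords_tc path_vec_def)
    have a: "adm [{..<N}, {P_deg N n}, {..<N}] ([unit, single v (1::'k)] @ [unit])"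
      using unit_adm v' by (auto simp: len_span_def)
    have "tprod \<Delta> [truncate x, single v 1, truncate y] = actl x (tprod \<Delta> ([unit, single v 1] @ [truncate (path_mult \<Delta> unit y)]))"
      unfolding tx ty using tprod_grow_first[of x unit "[single v 1, truncate (path_mult \<Delta> unit y)]"] by (simp del: tprod.simps)
    also have "\<dots> = actl x (actr (tprod \<Delta> ([unit, single v 1] @ [unit])) y)" unfolding tprod_grow_last[OF a y] ..
    also have "tprod \<Delta> ([unit, single v (1::'k)] @ [unit]) = lop \<Delta> cons_op unit (tprod \<Delta> ([single v 1] @ [unit]))" by simp
    also have "tprod \<Delta> ([single v (1::'k)] @ [unit]) = single (v, [P_deg N n, 0]) 1"
      using tprod_singles_unit[of "[v]"] v' by (simp del: tprod.simps)
    also have "lop \<Delta> cons_op unit (single (v, [P_deg N n, 0]) (1::'k)) = single (v, P_list N n 0 0) 1"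
      using v' False by (simp add: lop_cons_unit P_list_def)
    finally show ?thesis using P_tens_coords[OF t] False unfolding c by (simp add: P_elt_def del: tprod.simps)
  qed
qed

end

lemma left_op_apply: "left_op G m p (w, ls) = (if composable G p w then emb (path_append p w) (m (path_len p) ls) else 0)"
  by (simp add: left_op_def)

context truncated_quiver begin

section \<open>The differential of Q in coordinates\<close>

lemma bar_lists_normal:
  assumes "ls \<in> bar_lists N n"
  shows "length ls \<ge> 2 \<and> hd ls < N \<and> last ls < N \<and> 0 # butlast (tl ls) @ [0] \<in> bar_lists N n"
  using assms N_pos by (auto simp: bar_lists_iff)

lemma P_lists_normal:
  assumes "ls \<in> P_lists N n"
  shows "length ls \<ge> 2 \<and> hd ls < N \<and> last ls < N \<and> 0 # butlast (tl ls) @ [0] \<in> P_lists N n"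
proof -
  obtain i j where "ls = P_list N n i j" "i < N" "j < N" using assms by (auto simp: P_lists_def)
  then have "length ls \<ge> 2 \<and> hd ls < N \<and> last ls < N \<and> 0 # butlast (tl ls) @ [0] = P_list N n 0 0" by (auto simp: P_list_def)
  moreover have "P_list N n 0 0 \<in> P_lists N n" using N_pos by (auto simp: P_lists_def intro!: exI[of _ 0])
  ultimately show ?thesis by simp
qed

lemma P_lists_normal_eq: "0 # ls @ [0] \<in> P_lists N n \<Longrightarrow> 0 # ls @ [0] = P_list N n 0 0"
proof -
  assume "0 # ls @ [0] \<in> P_lists N n"
  then obtain i j where e: "0 # ls @ [0] = P_list N n i j" unfolding P_lists_def by blast
  have "i = 0" "j = 0" using arg_cong[OF e, of hd] arg_cong[OF e, of last] by simp_all
  then show ?thesis using e by simp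
qed

text \<open>
  The recursion of \<open>bar_lengths\<close>, with entries of a tensor in place of lengths: the first entry is either
  multiplied into the second or left alone.
\<close>

lemma bar_lop_cons:
  fixes v :: "('v, 'e) path \<times> nat list \<Rightarrow>\<^sub>0 'k::field"
  assumes "\<And>w ls. (w, ls) \<in> keys v \<Longrightarrow> ls \<noteq> []"
  shows "ext (bar_lengths N) (lop \<Delta> cons_op x v) = actl x v - lop \<Delta> cons_op x (ext (bar_lengths N) v)"
proof -
  have e: "bar_lengths N (a # ls) = grow_first N a ls - cons_chain a (bar_lengths N ls)" if "ls \<noteq> []" for a ls
    using that by (cases ls) auto
  have "ext (bar_lengths N) (left_op \<Delta> cons_op p k) =
     left_op \<Delta> (grow_first N) p k - lin (left_op \<Delta> cons_op p) (ext (bar_lengths N) (single k (1::'k)))"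
    if k: "k \<in> keys v" for p k
    using k assms[of "fst k" "snd k"] e[of "snd k"]
    by (cases k) (auto simp: left_op_apply ext_emb left_op_emb emb_diff)
  then have "ext (bar_lengths N) (lin (left_op \<Delta> cons_op p) v) = lin (left_op \<Delta> (grow_first N) p) v - lin (left_op \<Delta> cons_op p) (ext (bar_lengths N) v)" for p
    unfolding ext_lin by (subst ext_expand[of _ v]) (simp add: lin_lin lin_fun_diff[symmetric] cong: lin_cong)
  then show ?thesis unfolding lop_def by (simp add: ext_lin lin_fun_diff)
qed

lemma bar_tprod:
  assumes "zs \<noteq> []" "\<forall>z\<in>set zs. keys z \<subseteq> all_paths"
  shows "ext (bar_lengths N) (tprod \<Delta> zs) =
    (\<Sum>i<length zs - 1. scale ((- 1) ^ i) (tprod \<Delta> (take i zs @ [truncate (path_mult \<Delta> (zs ! i) (zs ! (i + 1)))] @ drop (i + 2) zs)))"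
  using assms
proof (induction zs rule: induct_list012)
  case (2 z)
  have "ext (bar_lengths N) (tprod \<Delta> [z]) = ext (\<lambda>ls. 0) (tprod \<Delta> [z])"
  proof (rule ext_cong)
    fix w ls assume "(w, ls) \<in> keys (tprod \<Delta> [z])"
    also have "keys (tprod \<Delta> [z]) \<subseteq> {(w, ls). length ls = 1}"
      unfolding tprod_single[OF 2(2)[rule_format, of z, simplified]] by (rule keys_lin_subset) auto
    finally show "bar_lengths N ls = 0" by (auto simp: length_Suc_conv)
  qed
  then show ?case by (simp add: ext_const_0)
next
  case (3 x y zs)
  let ?T = "\<lambda>zs i. tprod \<Delta> (take i zs @ [truncate (path_mult \<Delta> (zs ! i) (zs ! (i + 1)))] @ drop (i + 2) zs)"
  have adm: "adm (map (\<lambda>_. UNIV) (y # zs)) (y # zs)"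
    using 3(4) unfolding list_all2_map1 list_all2_same by (simp add: len_span_def)
  have ne: "ls \<noteq> []" if "(w, ls) \<in> keys (tprod \<Delta> (y # zs))" for w ls
    using subsetD[OF keys_tprod[OF adm] that] by (auto simp: cuts_def set_Cons_def)
  have "ext (bar_lengths N) (tprod \<Delta> (x # y # zs)) = actl x (tprod \<Delta> (y # zs)) - lop \<Delta> cons_op x (ext (bar_lengths N) (tprod \<Delta> (y # zs)))"
    unfolding tprod.simps(2)[of _ x] by (rule bar_lop_cons) (rule ne)
  also have "actl x (tprod \<Delta> (y # zs)) = ?T (x # y # zs) 0" using tprod_grow_first[of x y zs] by (simp del: tprod.simps)
  also have "ext (bar_lengths N) (tprod \<Delta> (y # zs)) = (\<Sum>i<length zs. scale ((- 1) ^ i) (?T (y # zs) i))"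
    using 3(2) 3(4) by (simp del: tprod.simps)
  also have "lop \<Delta> cons_op x \<dots> = (\<Sum>i<length zs. scale ((- 1) ^ i) (?T (x # y # zs) (Suc i)))"
    unfolding lop_def[of _ _ x] by (simp add: lin_sum lin_fun_sum lin_scale lin_fun_scale flip: lop_def)
  finally show ?case by (simp add: sum.lessThan_Suc_shift scale_minus sum_negf del: sum.lessThan_Suc)
qed auto

lemma is_tuple_Q_iff:
  fixes xs :: "('v, 'e, 'k::field) trunc list"
  shows "is_tuple (Q_fac n) xs \<longleftrightarrow> length xs = n + 2 \<and> xs ! 0 \<in> carrier A \<and> xs ! (n + 1) \<in> carrier A \<and>
     (\<forall>j. 0 < j \<and> j \<le> n \<longrightarrow> xs ! j \<in> carrier (Aplus_bimod \<Delta> N))"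
proof -
  let ?Fs = "Q_fac n :: ('v, 'e, 'k) factor list"
  have l: "length ?Fs = n + 2" by (simp add: Q_fac_def)
  have q: "?Fs ! 0 = factor_A" "?Fs ! (n + 1) = factor_A" "\<And>j. 0 < j \<Longrightarrow> j \<le> n \<Longrightarrow> ?Fs ! j = factor_Aplus"
    by (auto simp: Q_fac_def nth_append nth_Cons')
  have "(\<forall>j<n + 2. xs ! j \<in> carrier (fac_mod (?Fs ! j))) \<longleftrightarrow> xs ! 0 \<in> carrier A \<and> xs ! (n + 1) \<in> carrier A \<and>
     (\<forall>j. 0 < j \<and> j \<le> n \<longrightarrow> xs ! j \<in> carrier (Aplus_bimod \<Delta> N))" (is "?L \<longleftrightarrow> ?R")
  proof
    assume L: ?L
    have "xs ! j \<in> carrier (Aplus_bimod \<Delta> N)" if "0 < j" "j \<le> n" for j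
      using L[rule_format, of j] that by (simp add: q(3))
    then show ?R using L[rule_format, of 0] L[rule_format, of "n + 1"] unfolding q(1,2) by (simp add: carrier_A_bimod)
  next
    assume R: ?R
    show ?L
    proof (intro allI impI)
      fix j assume "j < n + 2"
      then consider "j = 0" | "j = n + 1" | "0 < j \<and> j \<le> n" by linarith
      then show "xs ! j \<in> carrier (fac_mod (?Fs ! j))"
        using R q by cases (simp_all add: carrier_A_bimod)
    qed
  qed
  then show ?thesis unfolding list_all2_conv_all_nth l by auto
qed

lemma Aplus_sub: "carrier (Aplus_bimod \<Delta> N) \<subseteq> carrier A"
  unfolding carrier_Aplus carrier_A_span by (rule image_mono) (auto simp: len_span_def)

lemma Aplus_mult:
  fixes x y :: "('v, 'e, 'k::field) trunc"
  assumes "x \<in> carrier (Aplus_bimod \<Delta> N)" "y \<in> carrier (Aplus_bimod \<Delta> N)"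
  shows "x \<otimes>\<^bsub>A\<^esub> y \<in> carrier (Aplus_bimod \<Delta> N)"
proof -
  obtain p q where p: "x = tc p" "p \<in> len_span {1..<N}" "y = tc q" "q \<in> len_span {1..<N}" using assms by (auto simp: carrier_Aplus)
  have k: "keys p \<subseteq> all_paths" "keys q \<subseteq> all_paths" using p len_span_keys by blast+
  have "keys (path_mult \<Delta> p q) \<subseteq> long_paths (1 + 1)"
    by (rule keys_times) (use p in \<open>auto simp: len_span_def long_paths_def\<close>)
  then have t: "keys (path_mult \<Delta> p q) \<subseteq> {r \<in> all_paths. 1 \<le> path_len r}" by (auto simp: long_paths_def)
  have "truncate (path_mult \<Delta> p q) \<in> len_span {1..<N}"
    unfolding len_span_def truncate_def mem_Collect_eq by (rule keys_lin_subset) (use t in auto)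
  moreover have "x \<otimes>\<^bsub>A\<^esub> y = tc (truncate (path_mult \<Delta> p q))"
    using k by (simp add: p tc_mult tc_truncate keys_times_all)
  ultimately show ?thesis by (auto simp: carrier_Aplus)
qed

lemma coords_mult': "x \<in> carrier A \<Longrightarrow> y \<in> carrier A \<Longrightarrow> coords (x \<otimes>\<^bsub>A\<^esub> y) = truncate (path_mult \<Delta> (coords x) (coords y))"
  using coords_mult(2)[of x "coords y"] coords_in[of y] len_span_keys[OF conjunct1[OF coords_in[of y]]] by simp

lemma coords_keys: "x \<in> carrier A \<Longrightarrow> keys (coords x) \<subseteq> all_paths"
  by (rule len_span_keys[OF conjunct1[OF coords_in]])

lemma coords_one: "coords \<one>\<^bsub>A\<^esub> = (unit :: ('v, 'e) path \<Rightarrow>\<^sub>0 'k::field)"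
proof -
  have "keys (unit :: ('v, 'e) path \<Rightarrow>\<^sub>0 'k) \<subseteq> short_paths"
    using N_pos by (intro keys_sum_subset) (auto simp: path_vec_def short_paths_def)
  then show ?thesis unfolding tc_one coords_tc[OF keys_unit] by (rule truncate_short)
qed

lemma one_in_A: "\<one>\<^bsub>A\<^esub> \<in> carrier A" unfolding tc_one by (rule tc_carrier[OF keys_unit])

lemma coords_path_class: "p \<in> all_paths \<Longrightarrow> coords (path_class \<Delta> N p) = (if path_len p < N then single p 1 else 0)"
  unfolding path_class_tc by (subst coords_tc) (auto simp: truncate_single)

lemma path_class_Aplus:
  fixes p :: "('v, 'e) path"
  assumes "p \<in> all_paths" "1 \<le> path_len p"
  shows "(path_class \<Delta> N p :: ('v, 'e, 'k::field) trunc) \<in> carrier (Aplus_bimod \<Delta> N)"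
proof -
  have k: "keys (single p (1::'k)) \<subseteq> all_paths" using assms by auto
  have "path_class \<Delta> N p = tc (truncate (single p (1::'k)))" unfolding path_class_tc tc_truncate[OF k] ..
  moreover have "truncate (single p (1::'k)) \<in> len_span {1..<N}" using assms by (auto simp: truncate_single len_span_def)
  ultimately show ?thesis by (auto simp: carrier_Aplus)
qed

lemma path_class_A: "p \<in> all_paths \<Longrightarrow> path_class \<Delta> N p \<in> carrier A"
  unfolding path_class_tc by (rule tc_carrier) auto

lemma is_tuple_Q_classes:
  assumes "length ps = n" "\<forall>p\<in>set ps. p \<in> all_paths \<and> 1 \<le> path_len p" "a \<in> carrier A" "b \<in> carrier A"
  shows "is_tuple (Q_fac n) ([a] @ map (path_class \<Delta> N) ps @ [b])"
proof -
  have "is_tuple (replicate n factor_Aplus) (map (path_class \<Delta> N) ps)"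
    using assms(1,2) by (auto simp: list_all2_conv_all_nth intro!: path_class_Aplus)
  then have "is_tuple (replicate n factor_Aplus @ [factor_A]) (map (path_class \<Delta> N) ps @ [b])"
    by (rule list_all2_appendI) (simp add: carrier_A_bimod assms)
  then show ?thesis by (simp add: Q_fac_def carrier_A_bimod assms)
qed

lemma Q_path_elt:
  fixes ps :: "('v, 'e) path list"
  assumes "length ps = n" "n \<ge> 1" "\<forall>p\<in>set ps. p \<in> all_paths \<and> 1 \<le> path_len p \<and> path_len p < N" "successively (composable \<Delta>) ps"
  defines "xs \<equiv> [\<one>\<^bsub>A\<^esub>] @ map (path_class \<Delta> N) ps @ [\<one>\<^bsub>A\<^esub>] :: ('v, 'e, 'k::field) trunc list"
  shows "is_tuple (Q_fac n) xs" "Q_elt \<Delta> N n xs \<in> carrier (Q_mod \<Delta> N n)"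
    "Q_coords n (Q_elt \<Delta> N n xs) = single (path_concat ps, 0 # map path_len ps @ [0]) 1"
proof -
  show t: "is_tuple (Q_fac n) xs" unfolding xs_def using assms by (intro is_tuple_Q_classes one_in_A) auto
  have m: "map coords xs = unit # map (\<lambda>p. single p 1) ps @ [unit]"
    using assms(3) by (auto simp: xs_def coords_one coords_path_class)
  have ne: "ps \<noteq> []" using assms by auto
  have "fst (path_concat ps) \<in> verts \<Delta>" using ne assms(3) by (cases ps) (auto simp: path_concat_def)
  then have "tprod \<Delta> (map coords xs) = single (path_concat ps, 0 # map path_len ps @ [0]) 1"
    unfolding m tprod.simps using assms(3,4) ne by (subst tprod_singles_unit) (auto simp: lop_cons_unit simp del: fst_path_concat)
  then show "Q_elt \<Delta> N n xs \<in> carrier (Q_mod \<Delta> N n)"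
    "Q_coords n (Q_elt \<Delta> N n xs) = single (path_concat ps, 0 # map path_len ps @ [0]) 1"
    using Q_elt_coords[OF t] by simp_all
qed

lemma bar_cut_paths:
  assumes "(w, 0 # ls @ [0]) \<in> cuts (bar_lists N n)" "n \<ge> 1"
  obtains ps where "length ps = n" "\<forall>p\<in>set ps. p \<in> all_paths \<and> 1 \<le> path_len p \<and> path_len p < N"
    "successively (composable \<Delta>) ps" "path_concat ps = w" "map path_len ps = ls"
proof -
  have c: "w \<in> all_paths" "sum_list ls = path_len w" "length ls = n" "set ls \<subseteq> {1..<N}"
    using assms by (auto simp: cuts_def bar_lists_iff)
  have ne: "ls \<noteq> []" using c assms by auto
  note p = cut_path_props[OF c(1,2) ne]
  have "path_len q \<in> set ls" if "q \<in> set (cut_path \<Delta> w ls)" for q using p that by (metis image_eqI set_map)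
  then show ?thesis using p c by (intro that[of "cut_path \<Delta> w ls"]) fastforce+
qed

lemma Q_generators:
  assumes "(w, 0 # ls @ [0]) \<in> cuts (bar_lists N n)" "n \<ge> 1"
  shows "\<exists>xs. is_tuple (Q_fac n) xs \<and> Q_coords n (Q_elt \<Delta> N n xs) = single (w, 0 # ls @ [0]) (1::'k::field)"
proof -
  obtain ps where ps: "length ps = n" "\<forall>p\<in>set ps. p \<in> all_paths \<and> 1 \<le> path_len p \<and> path_len p < N"
    "successively (composable \<Delta>) ps" and w: "path_concat ps = w" "map path_len ps = ls"
    by (rule bar_cut_paths[OF assms])
  show ?thesis using Q_path_elt(1,3)[OF ps(1) assms(2) ps(2,3)] unfolding w by blast
qed

text \<open>
  Unrolling the recursion of \<open>bar_lengths\<close> (\<open>bar_tprod\<close>) gives the alternating sum over the products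
  of neighbouring entries, and \<open>coords\<close> sends products in \<open>A\<close> to truncated products of paths.
\<close>

lemma Q_diff_realizes:
  assumes n: "n \<ge> 1"
  shows "realizes (Q_mod \<Delta> N n :: ('v, 'e, 'k::field) A_bimodule) (Q_coords n) (Q_mod \<Delta> N (n - 1)) (Q_coords (n - 1)) (bar_lengths N) (Q_diff \<Delta> N n)"
  unfolding Q_diff_def Let_def
proof (rule bimod_ext_realizes[OF coordinatized_Q coordinatized_Q length_preserving_bar'[OF n] length_equivariant_bar bar_lists_normal])
  fix as :: "('v, 'e, 'k) trunc list" assume "as \<in> tensor_tuples (Q_factors \<Delta> N n)"
  then have t: "is_tuple (Q_fac n) as" using tensor_tuples_iff[of as "Q_fac n"] by (simp add: Q_fac_mod)
  show "Q_elt \<Delta> N n as \<in> carrier (Q_mod \<Delta> N n)" using Q_elt_coords[OF t] by simp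
  let ?merge = "\<lambda>i. take i as @ [as ! i \<otimes>\<^bsub>A\<^esub> as ! (i + 1)] @ drop (i + 2) as"
  let ?term = "\<lambda>i. add_pow (Q_mod \<Delta> N (n - 1)) ((-1::int) ^ i) (Q_elt \<Delta> N (n - 1) (?merge i))"
  have as: "length as = n + 2" "as ! 0 \<in> carrier A" "as ! (n + 1) \<in> carrier A" "\<And>j. 0 < j \<Longrightarrow> j \<le> n \<Longrightarrow> as ! j \<in> carrier (Aplus_bimod \<Delta> N)"
    using t unfolding is_tuple_Q_iff by auto
  have asA: "as ! j \<in> carrier A" if j: "j < n + 2" for j
  proof -
    consider "j = 0" | "j = n + 1" | "0 < j \<and> j \<le> n" using j by linarith
    then show ?thesis using as Aplus_sub by cases auto
  qed
  interpret ring "A :: ('v, 'e, 'k) trunc ring" by (rule ring_A)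
  have tm: "is_tuple (Q_fac (n - 1)) (?merge i)" if i: "i \<le> n" for i
    unfolding is_tuple_Q_iff
  proof (intro conjI allI impI)
    have nth: "?merge i ! j = (if j < i then as ! j else if j = i then as ! i \<otimes>\<^bsub>A\<^esub> as ! (i + 1) else as ! (j + 1))" if "j \<le> n" for j
      using that i as(1) by (auto simp: nth_append nth_Cons' add.commute)
    show "length (?merge i) = n - 1 + 2" using i n as(1) by simp
    have p: "as ! i \<otimes>\<^bsub>A\<^esub> as ! (i + 1) \<in> carrier A" using asA[of i] asA[of "i + 1"] i by simp
    show "?merge i ! 0 \<in> carrier A" unfolding nth[OF le0] using p asA[of 1] asA[of 0] by auto
    show "?merge i ! (n - 1 + 1) \<in> carrier A" using nth[of n] p asA[of n] asA[of "n + 1"] n by auto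
    fix j assume j: "0 < j \<and> j \<le> n - 1"
    show "?merge i ! j \<in> carrier (Aplus_bimod \<Delta> N)"
      using nth[of j] j as(4)[of j] as(4)[of "j + 1"] Aplus_mult[OF as(4)[of j] as(4)[of "j + 1"]] n by auto
  qed
  have co: "Q_coords (n - 1) (Q_elt \<Delta> N (n - 1) (?merge i)) = tprod \<Delta> (take i (map coords as) @ [truncate (path_mult \<Delta> (map coords as ! i) (map coords as ! (i + 1)))] @ drop (i + 2) (map coords as))"
    "Q_elt \<Delta> N (n - 1) (?merge i) \<in> carrier (Q_mod \<Delta> N (n - 1))" if i: "i \<le> n" for i
    using Q_elt_coords[OF tm[OF i]] asA[of i] asA[of "i + 1"] i as(1)
    by (simp_all add: coords_mult' take_map drop_map del: tprod.simps)
  have c: "?term i \<in> carrier (Q_mod \<Delta> N (n - 1))"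
    "Q_coords (n - 1) (?term i) = scale ((- 1) ^ i) (Q_coords (n - 1) (Q_elt \<Delta> N (n - 1) (?merge i)))" if i: "i \<in> {0..n}" for i
    using add_pow_coords[OF coordinatized_Q co(2), of i i] i by (auto simp: scale_minus)
  have fs: "finsum (Q_mod \<Delta> N (n - 1)) ?term {0..n} \<in> carrier (Q_mod \<Delta> N (n - 1)) \<and>
     Q_coords (n - 1) (finsum (Q_mod \<Delta> N (n - 1)) ?term {0..n}) = (\<Sum>i\<in>{0..n}. Q_coords (n - 1) (?term i))"
    by (rule finsum_coords[OF coordinatized_Q]) (use c in auto)
  show "finsum (Q_mod \<Delta> N (n - 1)) ?term {0..n} \<in> carrier (Q_mod \<Delta> N (n - 1))" using fs by simp
  have "map coords as \<noteq> []" using as(1) by auto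
  moreover have "\<forall>z\<in>set (map coords as). keys z \<subseteq> all_paths"
    using asA as(1) coords_keys by (fastforce simp: in_set_conv_nth)
  ultimately have "ext (bar_lengths N) (tprod \<Delta> (map coords as)) = (\<Sum>i<n + 1. scale ((- 1) ^ i)
     (tprod \<Delta> (take i (map coords as) @ [truncate (path_mult \<Delta> (map coords as ! i) (map coords as ! (i + 1)))] @ drop (i + 2) (map coords as))))"
    using bar_tprod[of "map coords as"] as(1) by (simp del: tprod.simps sum.lessThan_Suc)
  also have "\<dots> = (\<Sum>i\<in>{0..n}. Q_coords (n - 1) (?term i))"
    using c(2) co(1) by (intro sum.cong) auto
  finally show "Q_coords (n - 1) (finsum (Q_mod \<Delta> N (n - 1)) ?term {0..n}) = ext (bar_lengths N) (Q_coords n (Q_elt \<Delta> N n as))"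
    using fs Q_elt_coords[OF t] by simp
next
  fix w ls assume "(w, 0 # ls @ [0]) \<in> cuts (bar_lists N n)"
  from Q_generators[OF this n] tensor_tuples_iff[of _ "Q_fac n"]
  show "\<exists>s\<in>tensor_tuples (Q_factors \<Delta> N n). Q_coords n (Q_elt \<Delta> N n s) = single (w, 0 # ls @ [0]) (1::'k)"
    by (auto simp: Q_fac_mod)
qed

lemma length_preserving_bar_0: "length_preserving (bar_lists N 0) (listset [{..<N}]) (bar_lengths N)"
  unfolding length_preserving_def
proof
  fix ls assume "ls \<in> bar_lists N 0"
  then obtain x y where ls: "ls = [x, y]" by (auto simp: bar_lists_iff length_Suc_conv numeral_2_eq_2)
  have "bar_lengths N ls = (if x + y < N then frag_of [x + y] else 0)" by (simp add: ls grow_first_def)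
  then show "keys (bar_lengths N ls) \<subseteq> {ls' \<in> listset [{..<N}]. sum_list ls' = sum_list ls}"
    by (simp add: ls set_Cons_def)
qed

lemma Q_aug_realizes:
  "realizes (Q_mod \<Delta> N 0 :: ('v, 'e, 'k::field) A_bimodule) (Q_coords 0) (regular_bimod A) A_coords (bar_lengths N) (Q_aug \<Delta> N)"
  unfolding Q_aug_def Let_def
proof (rule bimod_ext_realizes[OF coordinatized_Q coordinatized_A _ length_equivariant_bar bar_lists_normal])
  show "length_preserving (bar_lists N 0) (listset [{..<N}]) (bar_lengths N)"
    by (rule length_preserving_bar_0)
  interpret ring "A :: ('v, 'e, 'k) trunc ring" by (rule ring_A)
  fix s :: "('v, 'e, 'k) trunc \<times> ('v, 'e, 'k) trunc" assume "s \<in> carrier A \<times> carrier A"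
  then obtain a b where s: "s = (a, b)" "a \<in> carrier A" "b \<in> carrier A" by auto
  have t: "is_tuple (Q_fac 0) [a, b]" using s by (simp add: is_tuple_Q_iff)
  show "(case s of (\<alpha>, \<beta>) \<Rightarrow> Q_elt \<Delta> N 0 [\<alpha>, \<beta>]) \<in> carrier (Q_mod \<Delta> N 0)" using Q_elt_coords[OF t] s by simp
  show "(case s of (\<alpha>, \<beta>) \<Rightarrow> \<alpha> \<otimes>\<^bsub>A\<^esub> \<beta>) \<in> carrier (regular_bimod A)" using s by (simp add: regular_bimod_def)
  have "ext (bar_lengths N) (tprod \<Delta> [coords a, coords b]) = tprod \<Delta> [truncate (path_mult \<Delta> (coords a) (coords b))]"
    using bar_tprod[of "[coords a, coords b]"] coords_keys[OF s(2)] coords_keys[OF s(3)] by (simp del: tprod.simps)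
  then show "A_coords (case s of (\<alpha>, \<beta>) \<Rightarrow> \<alpha> \<otimes>\<^bsub>A\<^esub> \<beta>) = ext (bar_lengths N) (Q_coords 0 (case s of (\<alpha>, \<beta>) \<Rightarrow> Q_elt \<Delta> N 0 [\<alpha>, \<beta>]))"
    using Q_elt_coords[OF t] s by (simp add: A_coords_def coords_mult' del: tprod.simps)
next
  fix w ls assume c: "(w, 0 # ls @ [0]) \<in> cuts (bar_lists N 0)"
  then have w: "w \<in> all_paths" "ls = []" "path_len w = 0" by (auto simp: cuts_def bar_lists_iff)
  have t: "is_tuple (Q_fac 0) [path_class \<Delta> N w, \<one>\<^bsub>A\<^esub> :: ('v, 'e, 'k) trunc]" using path_class_A[OF w(1)] one_in_A by (simp add: is_tuple_Q_iff)
  have "Q_coords 0 (Q_elt \<Delta> N 0 [path_class \<Delta> N w, \<one>\<^bsub>A\<^esub>]) = tprod \<Delta> (map (\<lambda>p. single p (1::'k)) [w] @ [unit])"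
    using Q_elt_coords[OF t] N_pos w by (simp add: coords_one coords_path_class del: tprod.simps)
  also have "\<dots> = single (w, 0 # ls @ [0]) 1" using tprod_singles_unit[of "[w]"] w by (simp del: tprod.simps)
  finally show "\<exists>s\<in>carrier A \<times> carrier A. Q_coords 0 (case s of (\<alpha>, \<beta>) \<Rightarrow> Q_elt \<Delta> N 0 [\<alpha>, \<beta>]) = single (w, 0 # ls @ [0]) (1::'k)"
    using path_class_A[OF w(1)] one_in_A by (intro bexI[of _ "(path_class \<Delta> N w, \<one>\<^bsub>A\<^esub>)"]) simp_all
qed

end

section \<open>Closed formulas for F and G on lengths\<close>

fun sub_pieces :: "('v, 'e) pre_digraph \<Rightarrow> ('v, 'e) path \<Rightarrow> nat \<Rightarrow> nat list \<Rightarrow> ('v, 'e) path list" where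
  "sub_pieces G v s [] = []"
| "sub_pieces G v s (l # ls) = subpath G v s (s + l) # sub_pieces G v (s + l) ls"

lemma length_sub_pieces [simp]: "length (sub_pieces G v s ls) = length ls"
  by (induction ls arbitrary: s) auto

text \<open>
  The lengths of \<open>p\<^sub>1, q\<^sub>1, \<dots>, p\<^sub>k, q\<^sub>k\<close>.
\<close>

definition alternating :: "nat list \<Rightarrow> nat list" where "alternating xs = concat (map (\<lambda>x. [x, 1]) xs)"

lemma alternating_simps [simp]: "alternating [] = []" "alternating (x # xs) = x # 1 # alternating xs"
  by (simp_all add: alternating_def)

lemma alternating_props: "sum_list (alternating xs) = sum_list xs + length xs" "length (alternating xs) = 2 * length xs"
  by (induction xs) auto

lemma F_cuts_pieces:
  "F_cuts G v s xs @ [subpath G v (s + sum_list xs + length xs) m] =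
    sub_pieces G v s (alternating xs) @ [subpath G v (s + sum_list xs + length xs) m]"
  by (induction xs arbitrary: s) (auto simp: add.assoc add.commute add.left_commute)

lemma sub_pieces_append: "sub_pieces G v s (ls @ ls') = sub_pieces G v s ls @ sub_pieces G v (s + sum_list ls) ls'"
  by (induction ls arbitrary: s) (auto simp: add.assoc)

text \<open>
  A tuple of classes of paths is zero in the tensor product if one of the paths has length at least \<open>N\<close>.
\<close>

definition short_frag :: "nat \<Rightarrow> nat list \<Rightarrow> (nat list \<Rightarrow>\<^sub>0 int)" where
  "short_frag N ls = (if \<forall>l\<in>set ls. l < N then frag_of ls else 0)"

lemma consf_short_frag: "x < N \<Longrightarrow> cons_chain x (short_frag N ls) = short_frag N (x # ls)"
  by (auto simp: short_frag_def)

abbreviation F_index :: "nat \<Rightarrow> nat \<Rightarrow> nat list set" where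
  "F_index N k \<equiv> {xs. length xs = k \<and> set xs \<subseteq> {1..<N}}"

lemma sum_F_index_Suc: "(\<Sum>xs\<in>F_index N (Suc k). f xs) = (\<Sum>x\<in>{1..<N}. \<Sum>xs\<in>F_index N k. f (x # xs))"
proof -
  have eq: "F_index N (Suc k) = (\<lambda>(x, xs). x # xs) ` ({1..<N} \<times> F_index N k)"
    by (auto simp: length_Suc_conv image_iff)
  have inj: "inj_on (\<lambda>(x, xs). x # xs) ({1..<N} \<times> F_index N k)" by (auto simp: inj_on_def)
  show ?thesis unfolding eq sum.reindex[OF inj] by (simp add: sum.cartesian_product case_prod_unfold)
qed

lemma finite_F_index: "finite (F_index N k)"
  using finite_lists_length_eq[of "{1..<N}" k] by (simp add: conj_commute)

lemma F_tail_even: "F_tail N (2 * k) W = (\<Sum>xs\<in>F_index N k. short_frag N (alternating xs @ [W - (sum_list xs + length xs)]))"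
proof (induction k arbitrary: W)
  case 0
  have "F_index N 0 = {[]}" by auto
  then show ?case unfolding F_tail.simps by (simp add: short_frag_def)
next
  case (Suc k)
  have s1: "F_step N (Suc (2 * k)) = {1..<N}" by (auto simp: F_step_def)
  have "F_tail N (2 * Suc k) W = (\<Sum>x\<in>{1..<N}. cons_chain x (\<Sum>y\<in>F_step N (2 * k). cons_chain y (F_tail N (2 * k) (W - x - y))))"
    by (simp add: s1)
  also have "\<dots> = (\<Sum>x\<in>{1..<N}. \<Sum>xs\<in>F_index N k. short_frag N (alternating (x # xs) @ [W - (sum_list (x # xs) + length (x # xs))]))"
  proof (rule sum.cong)
    fix x assume x: "x \<in> {1..<N}"
    then have s2: "F_step N (2 * k) = {1}" by (auto simp: F_step_def)
    have "1 < N" using x by auto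
    then have "cons_chain x (cons_chain 1 (short_frag N (alternating xs @ [W - x - 1 - (sum_list xs + length xs)])))
       = short_frag N (alternating (x # xs) @ [W - (sum_list (x # xs) + length (x # xs))])" for xs
      using x by (simp add: consf_short_frag add.assoc)
    moreover have "(\<Sum>y\<in>{1::nat}. cons_chain y (F_tail N (2 * k) (W - x - y))) = cons_chain 1 (F_tail N (2 * k) (W - x - 1))" by simp
    ultimately show "cons_chain x (\<Sum>y\<in>F_step N (2 * k). cons_chain y (F_tail N (2 * k) (W - x - y))) =
      (\<Sum>xs\<in>F_index N k. short_frag N (alternating (x # xs) @ [W - (sum_list (x # xs) + length (x # xs))]))"
      by (simp only: s2 Suc frag_extend_sum'[OF finite_F_index])
  qed simp
  also have "\<dots> = (\<Sum>xs\<in>F_index N (Suc k). short_frag N (alternating xs @ [W - (sum_list xs + length xs)]))"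
    by (simp only: sum_F_index_Suc)
  finally show ?case .
qed

text \<open>
  Two steps of the recursion of \<open>F_tail\<close> cut off one piece \<open>p\<^sub>i\<close> of arbitrary length and one piece \<open>q\<^sub>i\<close>
  of length \<open>1\<close>; in odd degree the first step cuts off \<open>q\<^sub>0\<close>.
\<close>

lemma F_tail_sum:
  defines "s \<equiv> \<lambda>n. if even n then 0 else 1"
  shows "F_tail N n W = (\<Sum>xs\<in>F_index N (n div 2).
     short_frag N ((if even n then [] else [1]) @ alternating xs @ [W - (s n + sum_list xs + length xs)]))"
proof (cases "even n")
  case True
  then show ?thesis using F_tail_even[of N "n div 2" W] by (simp add: s_def)
next
  case False
  then obtain k where n: "n = Suc (2 * k)" by (auto elim: oddE)
  have "F_step N (2 * k) = (if 1 < N then {1} else {})" by (auto simp: F_step_def)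
  then have "F_tail N n W = (if 1 < N then cons_chain 1 (F_tail N (2 * k) (W - 1)) else 0)" by (simp add: n)
  also have "\<dots> = (\<Sum>xs\<in>F_index N k. short_frag N ([1] @ alternating xs @ [W - (1 + sum_list xs + length xs)]))"
  proof (cases "1 < N")
    case True
    show ?thesis
      unfolding if_P[OF True] F_tail_even frag_extend_sum'[OF finite_F_index] consf_short_frag[OF True] by simp
  next
    case False
    then show ?thesis by (simp add: short_frag_def)
  qed
  finally show ?thesis by (simp add: n s_def)
qed

lemma zero_pairs_iff: "zero_pairs N xs \<longleftrightarrow> (\<forall>i. 2 * i + 1 < length xs \<longrightarrow> N \<le> xs ! (2 * i) + xs ! (2 * i + 1))"
proof (induction N xs rule: zero_pairs.induct)
  case (1 N a b ls)
  have "(\<forall>i. 2 * i + 1 < length (a # b # ls) \<longrightarrow> N \<le> (a # b # ls) ! (2 * i) + (a # b # ls) ! (2 * i + 1)) \<longleftrightarrow>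
    N \<le> a + b \<and> (\<forall>i. 2 * i + 1 < length ls \<longrightarrow> N \<le> ls ! (2 * i) + ls ! (2 * i + 1))" (is "(\<forall>i. ?P i) \<longleftrightarrow> ?Q")
  proof
    assume "\<forall>i. ?P i"
    then have "?P 0" "\<And>i. ?P (Suc i)" by blast+
    then show ?Q by simp
  next
    assume Q: ?Q
    have "?P i" for i using Q by (cases i) auto
    then show "\<forall>i. ?P i" by blast
  qed
  then show ?case using 1 by simp
qed auto

context truncated_quiver begin

section \<open>The differential of P in coordinates\<close>

abbreviation "vtx v i \<equiv> path_end \<Delta> (fst v, take i (snd v))"

lemma awalk_verts_nth: "awalk u p x \<Longrightarrow> i \<le> length p \<Longrightarrow> awalk_verts u p ! i = path_end \<Delta> (u, take i p)"
proof (induction p arbitrary: u i)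
  case (Cons e p)
  show ?case
  proof (cases i)
    case 0
    then show ?thesis using Cons.prems by (simp add: awalk_Cons_iff)
  next
    case (Suc j)
    have "awalk_verts (head \<Delta> e) p ! j = path_end \<Delta> (head \<Delta> e, take j p)" using Cons Suc by (simp add: awalk_Cons_iff)
    then show ?thesis using Suc by (simp add: path_end_def)
  qed
qed simp

lemma subpath_eq: "v \<in> all_paths \<Longrightarrow> i \<le> path_len v \<Longrightarrow> subpath \<Delta> v i j = (vtx v i, take (j - i) (drop i (snd v)))"
  using awalk_verts_nth[of "fst v" "snd v" "path_end \<Delta> v" i] by (simp add: subpath_def all_paths_iff)

lemma subpath_props:
  assumes v: "v \<in> all_paths" and ij: "i \<le> j" "j \<le> path_len v"
  shows "subpath \<Delta> v i j \<in> all_paths" "path_len (subpath \<Delta> v i j) = j - i" "fst (subpath \<Delta> v i j) = vtx v i" "path_end \<Delta> (subpath \<Delta> v i j) = vtx v j"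
proof -
  have e: "subpath \<Delta> v i j = (vtx v i, take (j - i) (drop i (snd v)))" using v ij by (simp add: subpath_eq)
  have "i \<le> path_len v" using ij by simp
  then obtain q r where q: "v = path_append q r" "q \<in> all_paths" "r \<in> all_paths" "composable \<Delta> q r" "path_len q = i" "q = (fst v, take i (snd v))" "r = (path_end \<Delta> q, drop i (snd v))"
    by (rule path_splitE[OF v])
  have "path_len r = path_len v - i" unfolding q(7) by simp
  then have "j - i \<le> path_len r" using ij by simp
  then obtain p p' where p: "r = path_append p p'" "p \<in> all_paths" "p' \<in> all_paths" "composable \<Delta> p p'" "path_len p = j - i" "p = (fst r, take (j - i) (snd r))" "p' = (path_end \<Delta> p, drop (j - i) (snd r))"
    by (rule path_splitE[OF q(3)])
  have pe: "p = subpath \<Delta> v i j" unfolding p(6) e unfolding q(7) unfolding q(6) by simp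
  show "subpath \<Delta> v i j \<in> all_paths" using p(2) pe by simp
  show "path_len (subpath \<Delta> v i j) = j - i" using ij by (simp add: e)
  show "fst (subpath \<Delta> v i j) = vtx v i" by (simp add: e)
  have c: "composable \<Delta> (fst v, take i (snd v)) (subpath \<Delta> v i j)" by (simp add: e)
  have "path_append (fst v, take i (snd v)) (subpath \<Delta> v i j) = (fst v, take j (snd v))"
    using ij by (simp add: e path_append_def take_add[symmetric])
  then show "path_end \<Delta> (subpath \<Delta> v i j) = vtx v j" using path_end_append[OF c] by simp
qed

lemma subpath_append:
  assumes v: "v \<in> all_paths" and "i \<le> j" "j \<le> k" "k \<le> path_len v"
  shows "path_append (subpath \<Delta> v i j) (subpath \<Delta> v j k) = subpath \<Delta> v i k"
proof -
  have "take (j - i) (drop i (snd v)) @ take (k - j) (drop j (snd v)) = take (k - i) (drop i (snd v))"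
    using assms take_add[of "j - i" "k - j" "drop i (snd v)"] by simp
  then show ?thesis using assms by (simp add: subpath_eq path_append_def)
qed

lemma subpath_full: "v \<in> all_paths \<Longrightarrow> subpath \<Delta> v 0 (path_len v) = v"
  by (simp add: subpath_eq prod_eq_iff)

lemma sub_pieces_props:
  assumes "v \<in> all_paths" "ls \<noteq> []" "s + sum_list ls = path_len v"
  shows "path_concat (sub_pieces \<Delta> v s ls) = subpath \<Delta> v s (path_len v) \<and> successively (composable \<Delta>) (sub_pieces \<Delta> v s ls) \<and>
    set (sub_pieces \<Delta> v s ls) \<subseteq> all_paths \<and> map path_len (sub_pieces \<Delta> v s ls) = ls \<and> fst (hd (sub_pieces \<Delta> v s ls)) = vtx v s"
  using assms(2,3)
proof (induction ls arbitrary: s)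
  case (Cons l ls)
  note p = subpath_props[OF assms(1), of s "s + l"]
  show ?case
  proof (cases "ls = []")
    case True
    then show ?thesis using Cons.prems p by simp
  next
    case False
    have ne: "sub_pieces \<Delta> v (s + l) ls \<noteq> []" using False by (metis length_sub_pieces length_0_conv)
    have IH: "path_concat (sub_pieces \<Delta> v (s + l) ls) = subpath \<Delta> v (s + l) (path_len v)" "successively (composable \<Delta>) (sub_pieces \<Delta> v (s + l) ls)"
      "set (sub_pieces \<Delta> v (s + l) ls) \<subseteq> all_paths" "map path_len (sub_pieces \<Delta> v (s + l) ls) = ls" "fst (hd (sub_pieces \<Delta> v (s + l) ls)) = vtx v (s + l)"
      using Cons.IH[OF False, of "s + l"] Cons.prems by auto
    have le: "s + l \<le> path_len v" using Cons.prems by simp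
    have a: "path_append (subpath \<Delta> v s (s + l)) (subpath \<Delta> v (s + l) (path_len v)) = subpath \<Delta> v s (path_len v)"
      using subpath_append[OF assms(1), of s "s + l" "path_len v"] le by simp
    show ?thesis using ne IH le p a by (auto simp: path_concat_Cons successively_Cons)
  qed
qed simp

abbreviation "sng p \<equiv> single p 1"

lemma actl_emb: "actl (sng p) (emb w f) = (if composable \<Delta> p w then emb (path_append p w) (frag_extend (grow_first N (path_len p)) f) else 0)"
  by (simp add: lop_def left_op_emb)

lemma actr_emb: "actr (emb w f) (sng p) = (if composable \<Delta> w p then emb (path_append w p) (frag_extend (grow_last N (path_len p)) f) else 0)"
  using right_op_emb[of \<Delta> "grow_last N" p w f] by (simp add: rop_def)

lemma P_list_emb: "single (v, P_list N n 0 0) 1 = emb v (P_cut N n (P_deg N n) 0)"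
  using N_pos by (simp add: P_cut_def)

lemma P_cut_right:
  assumes "v \<in> all_paths" "j \<le> m" "m \<le> path_len v" "j - i = P_deg N n" "i \<le> j"
  shows "actr (single (subpath \<Delta> v i j, P_list N n 0 0) 1) (sng (subpath \<Delta> v j m)) = emb (subpath \<Delta> v i m) (P_cut N n (m - i) 0)"
proof -
  have "P_deg N n + (m - j) = m - i" using assms by simp
  then show ?thesis using assms unfolding P_list_emb actr_emb
    by (simp add: subpath_props subpath_append grow_last_P_cut)
qed

lemma P_cut_left:
  assumes "v \<in> all_paths" "i \<le> m" "m \<le> path_len v"
  shows "actl (sng (subpath \<Delta> v 0 i)) (emb (subpath \<Delta> v i m) (P_cut N n (m - i) 0)) = emb (subpath \<Delta> v 0 m) (P_cut N n m i)"
  using assms unfolding actl_emb by (simp add: subpath_props subpath_append grow_first_P_cut)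

lemma tc_times_path_class:
  assumes "keys x \<subseteq> all_paths" "p \<in> all_paths"
  shows "tc x \<otimes>\<^bsub>A\<^esub> path_class \<Delta> N p = tc (path_mult \<Delta> x (sng p))" "path_class \<Delta> N p \<otimes>\<^bsub>A\<^esub> tc x = tc (path_mult \<Delta> (sng p) x)"
    "keys (path_mult \<Delta> x (sng p)) \<subseteq> all_paths" "keys (path_mult \<Delta> (sng p) x) \<subseteq> all_paths"
  using assms unfolding path_class_tc by (simp_all add: tc_mult keys_times_all)

text \<open>
  The subpaths of \<open>v\<close> before \<open>i\<close> and after \<open>j\<close> act on the inner piece from outside and grow the outer pieces
  from \<open>0\<close> to their lengths; when one of these is too long, both sides vanish. The next two lemmas are
  the variants with an empty subpath on one side.
\<close>

lemma P_term:
  fixes x y :: "('v, 'e) path \<Rightarrow>\<^sub>0 'k::field"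
  assumes x: "keys x \<subseteq> all_paths" and y: "keys y \<subseteq> all_paths" and v: "v \<in> all_paths"
    and ij: "i \<le> j" "j \<le> path_len v" "j - i = P_deg N n"
  shows "P_elt \<Delta> N n (tc x \<otimes>\<^bsub>A\<^esub> path_class \<Delta> N (subpath \<Delta> v 0 i)) (subpath \<Delta> v i j) (path_class \<Delta> N (subpath \<Delta> v j (path_len v)) \<otimes>\<^bsub>A\<^esub> tc y) \<in> carrier (P_mod \<Delta> N n) \<and>
    P_coords n (P_elt \<Delta> N n (tc x \<otimes>\<^bsub>A\<^esub> path_class \<Delta> N (subpath \<Delta> v 0 i)) (subpath \<Delta> v i j) (path_class \<Delta> N (subpath \<Delta> v j (path_len v)) \<otimes>\<^bsub>A\<^esub> tc y))
      = actl x (actr (emb v (P_cut N n (path_len v) i)) y)"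
proof -
  note s = subpath_props[OF v]
  have u: "subpath \<Delta> v i j \<in> paths \<Delta> (P_deg N n)" using s[OF ij(1,2)] ij(3) by (simp add: paths_iff)
  note l = tc_times_path_class[OF x s(1), of 0 i] and r = tc_times_path_class[OF y s(1), of j "path_len v"]
  have "actl (path_mult \<Delta> x (sng (subpath \<Delta> v 0 i))) (actr (single (subpath \<Delta> v i j, P_list N n 0 0) 1) (path_mult \<Delta> (sng (subpath \<Delta> v j (path_len v))) y))
    = actl x (actr (actl (sng (subpath \<Delta> v 0 i)) (actr (single (subpath \<Delta> v i j, P_list N n 0 0) 1) (sng (subpath \<Delta> v j (path_len v))))) y)"
    by (simp add: act_times)
  also have "\<dots> = actl x (actr (emb v (P_cut N n (path_len v) i)) y)"
    by (simp add: P_cut_right[OF v ij(2) order_refl ij(3,1)] P_cut_left[OF v le_trans[OF ij(1,2)] order_refl] subpath_full v)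
  finally show ?thesis using P_elt_coords[OF l(3) r(4) u] ij unfolding l(1)[simplified] by (simp add: l(1) r(2))
qed

lemma P_term_left:
  fixes x y :: "('v, 'e) path \<Rightarrow>\<^sub>0 'k::field"
  assumes x: "keys x \<subseteq> all_paths" and y: "keys y \<subseteq> all_paths" and v: "v \<in> all_paths"
    and j: "j \<le> path_len v" "j = P_deg N n"
  shows "P_elt \<Delta> N n (tc x) (subpath \<Delta> v 0 j) (path_class \<Delta> N (subpath \<Delta> v j (path_len v)) \<otimes>\<^bsub>A\<^esub> tc y) \<in> carrier (P_mod \<Delta> N n) \<and>
    P_coords n (P_elt \<Delta> N n (tc x) (subpath \<Delta> v 0 j) (path_class \<Delta> N (subpath \<Delta> v j (path_len v)) \<otimes>\<^bsub>A\<^esub> tc y))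
      = actl x (actr (emb v (P_cut N n (path_len v) 0)) y)"
proof -
  note s = subpath_props[OF v]
  have j0: "j - 0 = P_deg N n" using j(2) by simp
  have u: "subpath \<Delta> v 0 j \<in> paths \<Delta> (P_deg N n)" using s[of 0 j] j by (simp add: paths_iff)
  note r = tc_times_path_class[OF y s(1)[OF j(1) order_refl]]
  have "actr (single (subpath \<Delta> v 0 j, P_list N n 0 0) 1) (path_mult \<Delta> (sng (subpath \<Delta> v j (path_len v))) y)
    = actr (emb v (P_cut N n (path_len v) 0)) y"
    by (simp add: act_times P_cut_right[OF v j(1) order_refl j0 le0] subpath_full v)
  then show ?thesis using P_elt_coords[OF x r(4) u] unfolding r(2) by simp
qed

lemma P_term_right:
  fixes x y :: "('v, 'e) path \<Rightarrow>\<^sub>0 'k::field"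
  assumes x: "keys x \<subseteq> all_paths" and y: "keys y \<subseteq> all_paths" and v: "v \<in> all_paths"
    and i: "i \<le> path_len v" "path_len v - i = P_deg N n"
  shows "P_elt \<Delta> N n (tc x \<otimes>\<^bsub>A\<^esub> path_class \<Delta> N (subpath \<Delta> v 0 i)) (subpath \<Delta> v i (path_len v)) (tc y) \<in> carrier (P_mod \<Delta> N n) \<and>
    P_coords n (P_elt \<Delta> N n (tc x \<otimes>\<^bsub>A\<^esub> path_class \<Delta> N (subpath \<Delta> v 0 i)) (subpath \<Delta> v i (path_len v)) (tc y))
      = actl x (actr (emb v (P_cut N n (path_len v) i)) y)"
proof -
  note s = subpath_props[OF v]
  have u: "subpath \<Delta> v i (path_len v) \<in> paths \<Delta> (P_deg N n)" using s[OF i(1)] i(2) by (simp add: paths_iff)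
  note l = tc_times_path_class[OF x s(1), of 0 i]
  have "actl (path_mult \<Delta> x (sng (subpath \<Delta> v 0 i))) (actr (single (subpath \<Delta> v i (path_len v), P_list N n 0 0) 1) y)
    = actl x (actr (actl (sng (subpath \<Delta> v 0 i)) (single (subpath \<Delta> v i (path_len v), P_list N n 0 0) 1)) y)"
    by (simp add: act_times)
  also have "\<dots> = actl x (actr (emb v (P_cut N n (path_len v) i)) y)"
    by (simp add: P_list_emb P_cut_left[OF v i(1) order_refl, of n, unfolded i(2)] subpath_full v)
  finally show ?thesis using P_elt_coords[OF l(3) y u] i by (simp add: l(1))
qed

lemma P_generators:
  fixes v :: "('v, 'e) path"
  assumes v: "v \<in> paths \<Delta> (P_deg N n)"
  shows "P_elt \<Delta> N n \<one>\<^bsub>A\<^esub> v \<one>\<^bsub>A\<^esub> \<in> carrier (P_mod \<Delta> N n :: ('v, 'e, 'k::field) A_bimodule)"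
    "P_coords n (P_elt \<Delta> N n \<one>\<^bsub>A\<^esub> v \<one>\<^bsub>A\<^esub>) = single (v, P_list N n 0 0) (1::'k)"
proof -
  have v': "v \<in> all_paths" "path_len v = P_deg N n" using v by (auto simp: paths_iff)
  have "P_list N n 0 0 \<in> P_lists N n" using N_pos by (auto simp: P_lists_def intro!: exI[of _ 0])
  then have "single (v, P_list N n 0 0) (1::'k) \<in> cut_space (P_lists N n)" using v' by (simp add: cut_space_def cuts_def)
  moreover have "P_lists N n \<subseteq> {ls. ls \<noteq> [] \<and> hd ls < N \<and> last ls < N}" by (auto simp: P_lists_def)
  ultimately have "actr (single (v, P_list N n 0 0) (1::'k)) unit = single (v, P_list N n 0 0) (1::'k)"
    "actl unit (single (v, P_list N n 0 0) (1::'k)) = single (v, P_list N n 0 0) (1::'k)"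
    by (rule act_unit(2), rule act_unit(1))
  moreover have k: "keys (unit :: ('v, 'e) path \<Rightarrow>\<^sub>0 'k) \<subseteq> all_paths" by (rule keys_unit)
  ultimately show "P_elt \<Delta> N n \<one>\<^bsub>A\<^esub> v \<one>\<^bsub>A\<^esub> \<in> carrier (P_mod \<Delta> N n :: ('v, 'e, 'k) A_bimodule)"
    "P_coords n (P_elt \<Delta> N n \<one>\<^bsub>A\<^esub> v \<one>\<^bsub>A\<^esub>) = single (v, P_list N n 0 0) (1::'k)"
    using P_elt_coords[OF k k v] by (simp_all add: tc_one)
qed

lemma P_cuts_path:
  assumes "(w, 0 # ls @ [0]) \<in> cuts (P_lists N n)"
  shows "0 # ls @ [0] = P_list N n 0 0" "w \<in> paths \<Delta> (P_deg N n)"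
proof -
  show e: "0 # ls @ [0] = P_list N n 0 0" using assms by (intro P_lists_normal_eq) (simp add: cuts_def)
  have "w \<in> all_paths" "sum_list (0 # ls @ [0]) = path_len w" using assms by (auto simp: cuts_def)
  then show "w \<in> paths \<Delta> (P_deg N n)" unfolding e by (simp add: paths_iff)
qed

lemma emb_in_cut_space: "w \<in> all_paths \<Longrightarrow> keys f \<subseteq> {ls \<in> L. sum_list ls = path_len w} \<Longrightarrow> emb w f \<in> cut_space L"
  unfolding cut_space_def cuts_def by (auto dest!: subsetD[OF keys_emb])

text \<open>
  By \<open>P_term\<close> and its variants, the summands in the definition of \<open>d\<close> are the cuts of \<open>v\<close> that occur in \<open>P_lengths\<close>.
\<close>

lemma P_diff_realizes:
  assumes n: "n \<ge> 1"
  shows "realizes (P_mod \<Delta> N n :: ('v, 'e, 'k::field) A_bimodule) (P_coords n) (P_mod \<Delta> N (n - 1)) (P_coords (n - 1)) (P_lengths N n) (P_diff \<Delta> N n)"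
  unfolding P_diff_def Let_def
proof (rule bimod_ext_realizes[OF coordinatized_P coordinatized_P length_preserving_P_lengths length_equivariant_P_lengths[OF N_pos n] P_lists_normal])
  fix s :: "('v, 'e, 'k) trunc \<times> ('v, 'e) path \<times> ('v, 'e, 'k) trunc"
  assume "s \<in> carrier A \<times> paths \<Delta> (P_deg N n) \<times> carrier A"
  then obtain a v b where s: "s = (a, v, b)" "a \<in> carrier A" "v \<in> paths \<Delta> (P_deg N n)" "b \<in> carrier A" by auto
  obtain x where x: "a = tc x" "keys x \<subseteq> all_paths" using s(2) by (rule carrier_AE)
  obtain y where y: "b = tc y" "keys y \<subseteq> all_paths" using s(4) by (rule carrier_AE)
  have v: "v \<in> all_paths" "path_len v = P_deg N n" using s by (auto simp: paths_iff)
  note E = P_elt_coords[OF x(2) y(2) s(3)]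
  show "(case s of (\<alpha>, v, \<beta>) \<Rightarrow> P_elt \<Delta> N n \<alpha> v \<beta>) \<in> carrier (P_mod \<Delta> N n)" using E by (simp add: s(1) x(1) y(1))
  let ?P = "P_mod \<Delta> N (n - 1) :: ('v, 'e, 'k) A_bimodule"
  have mem: "P_list N n 0 0 \<in> P_lists N n" using N_pos by (auto simp: P_lists_def intro!: exI[of _ 0])
  have single: "single (v, P_list N n 0 0) (1::'k) \<in> cut_space (P_lists N n)"
    using v mem by (simp add: cut_space_def cuts_def)
  have rc: "actr (single (v, P_list N n 0 0) 1) y \<in> cut_space (P_lists N n)"
  proof -
    have "P_elt \<Delta> N n \<one>\<^bsub>A\<^esub> v \<one>\<^bsub>A\<^esub> \<in> carrier (P_mod \<Delta> N n :: ('v, 'e, 'k) A_bimodule)" by (rule P_generators(1)[OF s(3)])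
    from coordinatizedD(8)[OF coordinatized_P y(2) this] show ?thesis
      unfolding P_generators(2)[OF s(3)] using coordinatizedD(2)[OF coordinatized_P] by metis
  qed
  have ex: "ext (P_lengths N n) (actl x (actr (single (v, P_list N n 0 0) 1) y)) =
     actl x (actr (emb v (P_lengths N n (P_list N n 0 0))) y)"
    by (simp add: ext_act[OF length_equivariant_P_lengths[OF N_pos n] rc] ext_act[OF length_equivariant_P_lengths[OF N_pos n] single])
  have val: "P_diff_val \<Delta> N n a v b \<in> carrier ?P \<and> P_coords (n - 1) (P_diff_val \<Delta> N n a v b) = actl x (actr (emb v (P_lengths N n (P_list N n 0 0))) y)"
  proof (cases "even n")
    case True
    then obtain k where k: "n = 2 * k" "k \<ge> 1" using n by (auto elim!: evenE)
    have D: "P_deg N (n - 1) = (k - 1) * N + 1" "P_deg N n = k * N" using k by (auto simp: P_deg_def)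
    have kN: "k * N = (k - 1) * N + N" using k(2) by (cases k) auto
    let ?t = "\<lambda>j. P_elt \<Delta> N (n - 1) (a \<otimes>\<^bsub>A\<^esub> path_class \<Delta> N (subpath \<Delta> v 0 j)) (subpath \<Delta> v j (j + (k - 1) * N + 1))
        (path_class \<Delta> N (subpath \<Delta> v (j + (k - 1) * N + 1) (k * N)) \<otimes>\<^bsub>A\<^esub> b)"
    have t: "?t j \<in> carrier ?P \<and> P_coords (n - 1) (?t j) = actl x (actr (emb v (P_cut N (n - 1) (path_len v) j)) y)" if "j \<in> {0..N - 1}" for j
      using P_term[OF x(2) y(2) v(1), of j "j + (k - 1) * N + 1" "n - 1"] that v(2) D kN N_pos unfolding x(1) y(1) by simp
    have "P_diff_val \<Delta> N n a v b = finsum ?P ?t {0..N - 1}" using True k by (simp add: P_diff_val_def Let_def)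
    moreover have "finsum ?P ?t {0..N - 1} \<in> carrier ?P \<and> P_coords (n - 1) (finsum ?P ?t {0..N - 1}) = (\<Sum>j\<in>{0..N - 1}. P_coords (n - 1) (?t j))"
      by (rule finsum_coords[OF coordinatized_P]) (use t in auto)
    moreover have "(\<Sum>j\<in>{0..N - 1}. P_coords (n - 1) (?t j)) = actl x (actr (emb v (\<Sum>j<N. P_cut N (n - 1) (path_len v) j)) y)"
    proof -
      have "(\<Sum>j\<in>{0..N - 1}. P_coords (n - 1) (?t j)) = (\<Sum>j<N. actl x (actr (emb v (P_cut N (n - 1) (path_len v) j)) y))"
        using t N_pos by (intro sum.cong) auto
      also have "\<dots> = actl x (actr (emb v (\<Sum>j<N. P_cut N (n - 1) (path_len v) j)) y)"
        by (simp add: emb_sum lop_def rop_def lin_sum lin_fun_sum)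
      finally show ?thesis .
    qed
    moreover have "P_lengths N n (P_list N n 0 0) = (\<Sum>j<N. P_cut N (n - 1) (path_len v) j)"
      using True v(2) by (simp add: P_lengths_def Let_def)
    ultimately show ?thesis by simp
  next
    case False
    then obtain k where k: "n = Suc (2 * k)" by (auto elim: oddE)
    have D: "P_deg N (n - 1) = k * N" "P_deg N n = k * N + 1" using k by (auto simp: P_deg_def)
    let ?l = "P_elt \<Delta> N (n - 1) (a \<otimes>\<^bsub>A\<^esub> path_class \<Delta> N (subpath \<Delta> v 0 1)) (subpath \<Delta> v 1 (k * N + 1)) b"
    let ?r = "P_elt \<Delta> N (n - 1) a (subpath \<Delta> v 0 (k * N)) (path_class \<Delta> N (subpath \<Delta> v (k * N) (k * N + 1)) \<otimes>\<^bsub>A\<^esub> b)"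
    have l: "?l \<in> carrier ?P \<and> P_coords (n - 1) ?l = actl x (actr (emb v (P_cut N (n - 1) (path_len v) 1)) y)"
      using P_term_right[OF x(2) y(2) v(1), of 1 "n - 1"] v(2) D unfolding x(1) y(1) by simp
    have r: "?r \<in> carrier ?P \<and> P_coords (n - 1) ?r = actl x (actr (emb v (P_cut N (n - 1) (path_len v) 0)) y)"
      using P_term_left[OF x(2) y(2) v(1), of "k * N" "n - 1"] v(2) D unfolding x(1) y(1) by simp
    have "P_diff_val \<Delta> N n a v b = ?l \<ominus>\<^bsub>?P\<^esub> ?r" using False k by (simp add: P_diff_val_def Let_def)
    moreover have "?l \<ominus>\<^bsub>?P\<^esub> ?r \<in> carrier ?P \<and> P_coords (n - 1) (?l \<ominus>\<^bsub>?P\<^esub> ?r) = P_coords (n - 1) ?l - P_coords (n - 1) ?r"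
      by (rule minus_coords[OF coordinatized_P]) (use l r in auto)
    moreover have "P_lengths N n (P_list N n 0 0) = P_cut N (n - 1) (path_len v) 1 - P_cut N (n - 1) (path_len v) 0"
      using False v(2) by (simp add: P_lengths_def Let_def)
    ultimately show ?thesis using l r by (simp add: emb_diff ops_diff)
  qed
  then show "(case s of (\<alpha>, v, \<beta>) \<Rightarrow> P_diff_val \<Delta> N n \<alpha> v \<beta>) \<in> carrier ?P" by (simp add: s(1))
  show "P_coords (n - 1) (case s of (\<alpha>, v, \<beta>) \<Rightarrow> P_diff_val \<Delta> N n \<alpha> v \<beta>) = ext (P_lengths N n) (P_coords n (case s of (\<alpha>, v, \<beta>) \<Rightarrow> P_elt \<Delta> N n \<alpha> v \<beta>))"
    using val E ex by (simp add: s(1) x(1) y(1))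
next
  fix w ls assume "(w, 0 # ls @ [0]) \<in> cuts (P_lists N n)"
  note w = P_cuts_path[OF this]
  show "\<exists>s\<in>carrier A \<times> paths \<Delta> (P_deg N n) \<times> carrier A. P_coords n (case s of (\<alpha>, v, \<beta>) \<Rightarrow> P_elt \<Delta> N n \<alpha> v \<beta>) = single (w, 0 # ls @ [0]) (1::'k)"
    using P_generators(2)[OF w(2)] one_in_A w(2) unfolding w(1) by (intro bexI[of _ "(\<one>\<^bsub>A\<^esub>, w, \<one>\<^bsub>A\<^esub>)"]) simp_all
qed

lemma P_0_eq_Q_0: "P_mod \<Delta> N 0 = Q_mod \<Delta> N 0" "P_fac 0 = Q_fac 0" "P_aug \<Delta> N = Q_aug \<Delta> N"
  by (simp_all add: P_mod_def Q_mod_def P_factors_def Q_factors_def P_fac_def Q_fac_def P_aug_def Q_aug_def Q_elt_def Let_def)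

section \<open>F in coordinates\<close>

lemma emb_short_frag_tprod:
  assumes "set ps \<subseteq> all_paths" "ps \<noteq> []" "successively (composable \<Delta>) ps"
  shows "tprod \<Delta> (unit # map (\<lambda>p. coords (path_class \<Delta> N p)) ps) =
    (emb (path_concat ps) (short_frag N (0 # map path_len ps)) :: ('v, 'e) path \<times> nat list \<Rightarrow>\<^sub>0 'k::field)"
proof (cases "\<forall>p\<in>set ps. path_len p < N")
  case True
  have m: "map (\<lambda>p. coords (path_class \<Delta> N p)) ps = map2 single ps (replicate (length ps) (1::'k))"
  proof (rule nth_equalityI)
    fix i assume "i < length (map (\<lambda>p. coords (path_class \<Delta> N p)) ps :: (('v, 'e) path \<Rightarrow>\<^sub>0 'k) list)"
    then have i: "i < length ps" by simp
    then have "ps ! i \<in> all_paths" "path_len (ps ! i) < N" using True assms(1) nth_mem[OF i] by blast+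
    then show "map (\<lambda>p. coords (path_class \<Delta> N p)) ps ! i = map2 single ps (replicate (length ps) (1::'k)) ! i"
      using i by (simp add: coords_path_class)
  qed simp
  have "fst (path_concat ps) \<in> verts \<Delta>" using assms by (cases ps) (auto simp: path_concat_def)
  then have "tprod \<Delta> (unit # map (\<lambda>p. coords (path_class \<Delta> N p)) ps) = single (path_concat ps, 0 # map path_len ps) (1::'k)"
    unfolding tprod.simps m tprod_singles[OF length_replicate assms(1,2)] using assms(3) by (simp add: lop_cons_unit del: fst_path_concat)
  then show ?thesis using True N_pos by (simp add: short_frag_def)
next
  case False
  then obtain ps1 p ps2 where p: "ps = ps1 @ p # ps2" "\<not> path_len p < N" by (metis split_list)
  then have "coords (path_class \<Delta> N p) = (0 :: ('v, 'e) path \<Rightarrow>\<^sub>0 'k)" using assms(1) by (simp add: coords_path_class)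
  then have "tprod \<Delta> (unit # map (\<lambda>p. coords (path_class \<Delta> N p)) ps) = (0 :: ('v, 'e) path \<times> nat list \<Rightarrow>\<^sub>0 'k)"
    using tprod_zero[of \<Delta> "unit # map (\<lambda>p. coords (path_class \<Delta> N p)) ps1"] by (simp add: p(1) del: tprod.simps)
  moreover have "short_frag N (0 # map path_len ps) = 0" using False by (auto simp: short_frag_def)
  ultimately show ?thesis by simp
qed

text \<open>
  The entries of a summand of \<open>F\<close>, the piece \<open>r\<close> included, are consecutive subpaths of \<open>v\<close>, so the summand
  is a single cut of \<open>v\<close>, or zero if \<open>r\<close> is too long.
\<close>

lemma F_term_coords:
  assumes n: "n \<ge> 1" and v: "v \<in> paths \<Delta> (P_deg N n)" and xs: "xs \<in> F_index N (n div 2)"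
  shows "F_term \<Delta> N n v xs \<in> carrier (Q_mod \<Delta> N n :: ('v, 'e, 'k::field) A_bimodule) \<and>
    Q_coords n (F_term \<Delta> N n v xs :: ('v, 'e, 'k) tens_elt) = emb v (short_frag N (0 # (if even n then [] else [1]) @ alternating xs @
      [path_len v - ((if even n then 0 else 1) + sum_list xs + length xs)]))"
proof -
  define s where "s = (if even n then 0 else 1 :: nat)"
  define pre where "pre = (if even n then [] else [1 :: nat])"
  define R where "R = path_len v - (s + sum_list xs + length xs)"
  define body where "body = pre @ alternating xs"
  have v': "v \<in> all_paths" "path_len v = P_deg N n" using v by (auto simp: paths_iff)
  have len: "length xs = n div 2" and el: "\<forall>x\<in>set xs. 1 \<le> x \<and> x < N" using xs by auto
  have sum: "sum_list xs + length xs \<le> length xs * N"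
    using el by (induction xs) auto
  have sP: "s + sum_list xs + length xs \<le> path_len v"
    using sum unfolding v'(2) P_deg_def s_def len by auto
  have pre_sum: "sum_list pre = s" by (simp add: pre_def s_def)
  have tot: "0 + sum_list (body @ [R]) = path_len v" using sP by (simp add: body_def R_def pre_sum alternating_props)
  have Rsub: "subpath \<Delta> v (0 + sum_list body) (0 + sum_list body + R) = subpath \<Delta> v (s + sum_list xs + length xs) (path_len v)"
    using sP by (simp add: body_def R_def pre_sum alternating_props add.assoc)
  let ?entries = "(if even n then [] else [subpath \<Delta> v 0 1]) @ F_cuts \<Delta> v s xs"
  have pieces: "sub_pieces \<Delta> v 0 (body @ [R]) = ?entries @ [subpath \<Delta> v (s + sum_list xs + length xs) (path_len v)]"
  proof -
    have "sub_pieces \<Delta> v 0 (body @ [R]) = sub_pieces \<Delta> v 0 pre @ sub_pieces \<Delta> v s (alternating xs) @ [subpath \<Delta> v (s + sum_list xs + length xs) (path_len v)]"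
      unfolding sub_pieces_append using Rsub by (simp add: body_def sub_pieces_append pre_sum)
    also have "sub_pieces \<Delta> v 0 pre = (if even n then [] else [subpath \<Delta> v 0 1])" by (simp add: pre_def)
    also have "sub_pieces \<Delta> v s (alternating xs) @ [subpath \<Delta> v (s + sum_list xs + length xs) (path_len v)] = F_cuts \<Delta> v s xs @ [subpath \<Delta> v (s + sum_list xs + length xs) (path_len v)]"
      by (rule F_cuts_pieces[symmetric])
    finally show ?thesis by simp
  qed
  have ne: "body @ [R] \<noteq> []" by simp
  note sp = sub_pieces_props[OF v'(1) ne tot]
  define qs where "qs = sub_pieces \<Delta> v 0 body"
  have qs: "sub_pieces \<Delta> v 0 (body @ [R]) = qs @ [subpath \<Delta> v (s + sum_list xs + length xs) (path_len v)]"
    unfolding qs_def sub_pieces_append using Rsub by simp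
  have entries: "?entries = qs" using qs pieces by simp
  have bl: "\<forall>l\<in>set body. 1 \<le> l" using el unfolding body_def pre_def alternating_def by auto
  have ml: "map path_len qs = body" using sp unfolding qs by simp
  have q1: "\<forall>p\<in>set qs. p \<in> all_paths \<and> 1 \<le> path_len p"
  proof
    fix p assume p: "p \<in> set qs"
    then have "path_len p \<in> set body" unfolding ml[symmetric] by simp
    then show "p \<in> all_paths \<and> 1 \<le> path_len p" using bl sp p unfolding qs by auto
  qed
  have lqs: "length qs = n"
  proof -
    have "length qs = length body" by (simp add: qs_def)
    also have "\<dots> = n" using len by (auto simp: body_def pre_def alternating_props)
    finally show ?thesis .
  qed
  have rp: "subpath \<Delta> v (s + sum_list xs + length xs) (path_len v) \<in> all_paths" by (rule subpath_props(1)[OF v'(1) sP order_refl])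
  let ?as = "[\<one>\<^bsub>A\<^esub>] @ map (path_class \<Delta> N) qs @ [path_class \<Delta> N (subpath \<Delta> v (s + sum_list xs + length xs) (path_len v))] :: ('v, 'e, 'k) trunc list"
  have F: "F_term \<Delta> N n v xs = Q_elt \<Delta> N n ?as"
    unfolding F_term_def Let_def using entries by (simp add: s_def)
  have t: "is_tuple (Q_fac n) ?as"
    by (rule is_tuple_Q_classes[OF lqs q1 one_in_A path_class_A[OF rp]])
  have m: "map coords ?as = unit # map (\<lambda>p. coords (path_class \<Delta> N p)) (sub_pieces \<Delta> v 0 (body @ [R]))"
    unfolding qs by (simp add: coords_one)
  have full: "subpath \<Delta> v 0 (path_len v) = v" by (rule subpath_full[OF v'(1)])
  have "tprod \<Delta> (map coords ?as) = emb v (short_frag N (0 # body @ [R]))"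
    unfolding m using emb_short_frag_tprod[of "sub_pieces \<Delta> v 0 (body @ [R])", where 'k = 'k] sp qs
    by (simp add: full del: tprod.simps)
  then show ?thesis using Q_elt_coords[OF t] unfolding F by (simp add: body_def pre_def R_def s_def del: tprod.simps)
qed

lemma F_map_realizes:
  "realizes (P_mod \<Delta> N n :: ('v, 'e, 'k::field) A_bimodule) (P_coords n) (Q_mod \<Delta> N n) (Q_coords n) (F_lengths N n) (F_map \<Delta> N n)"
proof (cases "n = 0")
  case True
  show ?thesis unfolding realizes_def
  proof
    fix x assume x: "x \<in> carrier (P_mod \<Delta> N n :: ('v, 'e, 'k) A_bimodule)"
    have c: "P_coords n x \<in> cut_space (P_lists N 0)" using coordinatizedD(2)[OF coordinatized_P x] True by simp
    have "ext (F_lengths N n) (P_coords n x) = ext frag_of (P_coords n x)"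
    proof (rule ext_cong)
      fix w ls assume "(w, ls) \<in> keys (P_coords n x)"
      then obtain i j where "ls = [i, j]" "i < N" "j < N" using c by (auto simp: cut_space_def cuts_def P_lists_def P_list_def)
      then show "F_lengths N n ls = frag_of ls" by (simp add: True F_lengths_def)
    qed
    then show "F_map \<Delta> N n x \<in> carrier (Q_mod \<Delta> N n) \<and> Q_coords n (F_map \<Delta> N n x) = ext (F_lengths N n) (P_coords n x)"
      using x by (simp add: True F_map_def P_0_eq_Q_0 ext_frag_of)
  qed
next
  case False
  then have n: "n \<ge> 1" by simp
  have "realizes (P_mod \<Delta> N n :: ('v, 'e, 'k) A_bimodule) (P_coords n) (Q_mod \<Delta> N n) (Q_coords n) (F_lengths N n)
    (bimod_ext A (P_mod \<Delta> N n) (Q_mod \<Delta> N n) (paths \<Delta> (P_deg N n)) (\<lambda>v. P_elt \<Delta> N n \<one>\<^bsub>A\<^esub> v \<one>\<^bsub>A\<^esub>)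
      (\<lambda>v. finsum (Q_mod \<Delta> N n) (F_term \<Delta> N n v) (F_index N (n div 2))))"
  proof (rule bimod_ext_realizes[OF coordinatized_P coordinatized_Q length_preserving_F length_equivariant_F P_lists_normal])
    fix v assume v: "v \<in> paths \<Delta> (P_deg N n)"
    show "P_elt \<Delta> N n \<one>\<^bsub>A\<^esub> v \<one>\<^bsub>A\<^esub> \<in> carrier (P_mod \<Delta> N n :: ('v, 'e, 'k) A_bimodule)" by (rule P_generators(1)[OF v])
    have v': "path_len v = P_deg N n" using v by (auto simp: paths_iff)
    note t = F_term_coords[OF n v]
    have fs: "finsum (Q_mod \<Delta> N n :: ('v, 'e, 'k) A_bimodule) (F_term \<Delta> N n v) (F_index N (n div 2)) \<in> carrier (Q_mod \<Delta> N n) \<and>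
      Q_coords n (finsum (Q_mod \<Delta> N n :: ('v, 'e, 'k) A_bimodule) (F_term \<Delta> N n v) (F_index N (n div 2))) = (\<Sum>xs\<in>F_index N (n div 2). Q_coords n (F_term \<Delta> N n v xs))"
      by (rule finsum_coords[OF coordinatized_Q finite_F_index]) (use t in blast)
    then show "finsum (Q_mod \<Delta> N n :: ('v, 'e, 'k) A_bimodule) (F_term \<Delta> N n v) (F_index N (n div 2)) \<in> carrier (Q_mod \<Delta> N n)" by simp
    have "(\<Sum>xs\<in>F_index N (n div 2). Q_coords n (F_term \<Delta> N n v xs :: ('v, 'e, 'k) tens_elt)) =
       (\<Sum>xs\<in>F_index N (n div 2). emb v (cons_chain 0 (short_frag N ((if even n then [] else [1]) @ alternating xs @
      [path_len v - ((if even n then 0 else 1) + sum_list xs + length xs)]))))"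
      by (rule sum.cong[OF refl], subst conjunct2[OF t]) (use N_pos in \<open>simp_all add: consf_short_frag\<close>)
    also have "\<dots> = emb v (cons_chain 0 (F_tail N n (path_len v)))"
      by (subst F_tail_sum) (simp only: frag_extend_sum'[OF finite_F_index] emb_sum)
    also have "\<dots> = ext (F_lengths N n) (P_coords n (P_elt \<Delta> N n \<one>\<^bsub>A\<^esub> v \<one>\<^bsub>A\<^esub>))"
      unfolding P_generators(2)[OF v] by (simp add: F_lengths_def v')
    finally show "Q_coords n (finsum (Q_mod \<Delta> N n :: ('v, 'e, 'k) A_bimodule) (F_term \<Delta> N n v) (F_index N (n div 2))) = ext (F_lengths N n) (P_coords n (P_elt \<Delta> N n \<one>\<^bsub>A\<^esub> v \<one>\<^bsub>A\<^esub>))"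
      using fs by simp
  next
    fix w ls assume "(w, 0 # ls @ [0]) \<in> cuts (P_lists N n)"
    note w = P_cuts_path[OF this]
    show "\<exists>s\<in>paths \<Delta> (P_deg N n). P_coords n (P_elt \<Delta> N n \<one>\<^bsub>A\<^esub> s \<one>\<^bsub>A\<^esub>) = single (w, 0 # ls @ [0]) (1::'k)"
      unfolding w(1) using P_generators(2)[OF w(2)] w(2) by blast
  qed
  then show ?thesis using False by (simp add: F_map_def Let_def)
qed

section \<open>G in coordinates\<close>

lemma G_index_iff:
  "ps \<in> G_index \<Delta> N n \<longleftrightarrow> length ps = n \<and> (\<forall>p\<in>set ps. p \<in> all_paths \<and> 1 \<le> path_len p \<and> path_len p < N) \<and> successively (composable \<Delta>) ps"
  unfolding G_index_def successively_conv_nth by (auto simp: paths_iff)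

text \<open>
  The product of two composable paths is a path, and a path is zero in \<open>A\<close> only if it is long.
\<close>

lemma path_class_zero:
  assumes "p \<in> all_paths" "q \<in> all_paths" "composable \<Delta> p q"
  shows "path_class \<Delta> N p \<otimes>\<^bsub>A\<^esub> path_class \<Delta> N q = (\<zero>\<^bsub>A\<^esub> :: ('v, 'e, 'k::field) trunc) \<longleftrightarrow> N \<le> path_len p + path_len q"
proof -
  have k: "keys (single p (1::'k)) \<subseteq> all_paths" "keys (single q (1::'k)) \<subseteq> all_paths"
    "keys (single (path_append p q) (1::'k)) \<subseteq> all_paths" "keys (0 :: ('v, 'e) path \<Rightarrow>\<^sub>0 'k) \<subseteq> all_paths"
    using assms by auto
  have t0: "truncate (0 :: ('v, 'e) path \<Rightarrow>\<^sub>0 'k) = 0" by (rule truncate_short) simp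
  have e: "path_class \<Delta> N p \<otimes>\<^bsub>A\<^esub> path_class \<Delta> N q = tc (single (path_append p q) (1::'k))"
    unfolding path_class_tc tc_mult[OF k(1,2)] using assms(3) by (simp add: times_single)
  have nz: "single (path_append p q) (1::'k) \<noteq> 0"
    by (metis Poly_Mapping.lookup_single_eq lookup_zero one_neq_zero)
  show ?thesis unfolding e tc_zero truncate_eq_iff[OF k(3,4)] t0 using nz assms by (auto simp: truncate_single)
qed

lemma successively_nth: "successively P xs \<Longrightarrow> Suc i < length xs \<Longrightarrow> P (xs ! i) (xs ! Suc i)"
  by (simp add: successively_conv_nth)

text \<open>
  The vanishing of products in \<open>A\<close> translates into the condition \<open>zero_pairs\<close> on lengths, which also
  guarantees that the subpaths in the definition of \<open>G\<close> lie within the path. The position \<open>j\<close> of the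
  definition counts from \<open>1\<close>, that of \<open>P_cut\<close> from \<open>0\<close>.
\<close>

lemma G_val_coords:
  assumes n: "n \<ge> 1" and ps: "ps \<in> G_index \<Delta> N n"
  shows "G_val \<Delta> N n ps \<in> carrier (P_mod \<Delta> N n :: ('v, 'e, 'k::field) A_bimodule) \<and>
    P_coords n (G_val \<Delta> N n ps :: ('v, 'e, 'k) tens_elt) = emb (path_concat ps) (G_lengths N n (0 # map path_len ps @ [0]))"
proof -
  have len: "length ps = n" and pp: "\<And>p. p \<in> set ps \<Longrightarrow> p \<in> all_paths \<and> 1 \<le> path_len p \<and> path_len p < N" and suc: "successively (composable \<Delta>) ps"
    using ps unfolding G_index_iff by auto
  have nth: "ps ! i \<in> all_paths" if "i < n" for i using pp[of "ps ! i"] that len by auto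
  define w where "w = path_concat ps"
  define ls where "ls = map path_len ps"
  have ne: "ps \<noteq> []" using len n by auto
  have wp: "w \<in> all_paths"
    using ne suc pp unfolding w_def
  proof (induction ps)
    case (Cons p ps)
    then show ?case by (cases "ps = []") (auto simp: path_concat_Cons successively_Cons)
  qed simp
  have wl: "path_len w = sum_list ls" by (simp add: w_def ls_def)
  have k1: "keys (unit :: ('v, 'e) path \<Rightarrow>\<^sub>0 'k) \<subseteq> all_paths" by (rule keys_unit)
  have zero_iff: "path_class \<Delta> N (ps ! i) \<otimes>\<^bsub>A\<^esub> path_class \<Delta> N (ps ! Suc i) = (\<zero>\<^bsub>A\<^esub> :: ('v, 'e, 'k) trunc) \<longleftrightarrow> N \<le> ls ! i + ls ! Suc i"
    if "Suc i < n" for i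
    using path_class_zero[OF nth[of i] nth[of "Suc i"], where 'k = 'k] successively_nth[OF suc, of i] that len by (simp add: ls_def)
  have cP: "coordinatized (P_mod \<Delta> N n :: ('v, 'e, 'k) A_bimodule) (P_lists N n) (P_coords n)" by (rule coordinatized_P)
  note C = coordinatizedD[OF cP]
  have Psub: "P_lists N n \<subseteq> {ls. ls \<noteq> [] \<and> hd ls < N \<and> last ls < N}" by (auto simp: P_lists_def)
  have unit_act: "actl unit (actr (emb w (P_cut N n (path_len w) i)) unit) = (emb w (P_cut N n (path_len w) i) :: ('v, 'e) path \<times> nat list \<Rightarrow>\<^sub>0 'k)" for i
    using emb_in_cut_space[OF wp keys_P_cut] act_unit[OF _ Psub] by metis
  interpret ring "A :: ('v, 'e, 'k) trunc ring" by (rule ring_A)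
  have cl: "(path_class \<Delta> N (subpath \<Delta> w i j) :: ('v, 'e, 'k) trunc) \<in> carrier A" if "i \<le> j" "j \<le> path_len w" for i j
    by (rule path_class_A[OF subpath_props(1)[OF wp that]])
  show ?thesis
  proof (cases "even n")
    case True
    then obtain k where k: "n = 2 * k" by (auto elim: evenE)
    have D: "P_deg N n = k * N" using k by (simp add: P_deg_def)
    have cond: "(\<forall>i\<in>{1..k}. path_class \<Delta> N (ps ! (2 * i - 1 - 1)) \<otimes>\<^bsub>A\<^esub> path_class \<Delta> N (ps ! (2 * i - 1)) = (\<zero>\<^bsub>A\<^esub> :: ('v, 'e, 'k) trunc)) \<longleftrightarrow> zero_pairs N (ls @ [0])"
    proof -
      have "zero_pairs N (ls @ [0]) \<longleftrightarrow> (\<forall>i<k. N \<le> ls ! (2 * i) + ls ! (2 * i + 1))"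
        unfolding zero_pairs_iff using len k by (auto simp: ls_def nth_append)
      also have "\<dots> \<longleftrightarrow> (\<forall>i<k. path_class \<Delta> N (ps ! (2 * i)) \<otimes>\<^bsub>A\<^esub> path_class \<Delta> N (ps ! Suc (2 * i)) = (\<zero>\<^bsub>A\<^esub> :: ('v, 'e, 'k) trunc))"
        using zero_iff k by auto
      also have "\<dots> \<longleftrightarrow> (\<forall>i\<in>{1..k}. path_class \<Delta> N (ps ! (2 * i - 1 - 1)) \<otimes>\<^bsub>A\<^esub> path_class \<Delta> N (ps ! (2 * i - 1)) = (\<zero>\<^bsub>A\<^esub> :: ('v, 'e, 'k) trunc))" (is "?L \<longleftrightarrow> ?R")
      proof
        assume L: ?L
        show ?R
        proof
          fix i assume "i \<in> {1..k}"
          then obtain j where "i = Suc j" "j < k" by (cases i) auto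
          then show "path_class \<Delta> N (ps ! (2 * i - 1 - 1)) \<otimes>\<^bsub>A\<^esub> path_class \<Delta> N (ps ! (2 * i - 1)) = (\<zero>\<^bsub>A\<^esub> :: ('v, 'e, 'k) trunc)" using L by simp
        qed
      next
        assume R: ?R
        show ?L
        proof (intro allI impI)
          fix i assume "i < k"
          then show "path_class \<Delta> N (ps ! (2 * i)) \<otimes>\<^bsub>A\<^esub> path_class \<Delta> N (ps ! Suc (2 * i)) = (\<zero>\<^bsub>A\<^esub> :: ('v, 'e, 'k) trunc)" using R[rule_format, of "Suc i"] by simp
        qed
      qed
      finally show ?thesis by blast
    qed
    have Gl: "G_lengths N n (0 # ls @ [0]) = (if zero_pairs N (ls @ [0]) then P_cut N n (path_len w) 0 else 0)"
      using True by (simp add: G_lengths_def wl)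
    show ?thesis
    proof (cases "zero_pairs N (ls @ [0])")
      case zp: True
      have "length (ls @ [0]) = n + 1" using len by (simp add: ls_def)
      from zero_pairs_bounds[OF this True zp] have le: "k * N \<le> path_len w" using D wl by simp
      have G: "G_val \<Delta> N n ps = (P_elt \<Delta> N n \<one>\<^bsub>A\<^esub> (subpath \<Delta> w 0 (k * N)) (path_class \<Delta> N (subpath \<Delta> w (k * N) (path_len w))) :: ('v, 'e, 'k) tens_elt)"
        unfolding G_val_def Let_def using True cond zp k by (simp add: w_def)
      have u: "path_class \<Delta> N (subpath \<Delta> w (k * N) (path_len w)) = (path_class \<Delta> N (subpath \<Delta> w (k * N) (path_len w)) \<otimes>\<^bsub>A\<^esub> tc unit :: ('v, 'e, 'k) trunc)"
        using cl[OF le order_refl] by (simp flip: tc_one)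
      show ?thesis using P_term_left[OF k1 k1 wp le D[symmetric]] unfolding G u[symmetric] Gl tc_one unit_act
        using zp Gl by (simp add: w_def ls_def)
    next
      case False
      then have "G_val \<Delta> N n ps = (\<zero>\<^bsub>P_mod \<Delta> N n\<^esub> :: ('v, 'e, 'k) tens_elt)"
      proof -
        have nc: "\<not> (\<forall>i\<in>{1..k}. path_class \<Delta> N (ps ! (2 * i - 1 - 1)) \<otimes>\<^bsub>A\<^esub> path_class \<Delta> N (ps ! (2 * i - 1)) = (\<zero>\<^bsub>A\<^esub> :: ('v, 'e, 'k) trunc))"
          using cond False by blast
        have "n div 2 = k" using k by simp
        then show ?thesis unfolding G_val_def Let_def if_P[OF True] by (simp only: if_not_P[OF nc])
      qed
      then show ?thesis using C(4,5) Gl False by (simp add: w_def ls_def)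
    qed
  next
    case False
    then obtain k where k: "n = Suc (2 * k)" by (auto elim: oddE)
    have D: "P_deg N n = k * N + 1" "n div 2 = k" using k by (simp_all add: P_deg_def)
    obtain q qs where q: "ps = q # qs" using ne by (cases ps) auto
    have lsq: "ls = path_len q # map path_len qs" "length qs = 2 * k" using len k by (simp_all add: ls_def q)
    have cond: "(\<forall>i\<in>{1..k}. path_class \<Delta> N (ps ! (2 * i - 1)) \<otimes>\<^bsub>A\<^esub> path_class \<Delta> N (ps ! (2 * i + 1 - 1)) = (\<zero>\<^bsub>A\<^esub> :: ('v, 'e, 'k) trunc)) \<longleftrightarrow> zero_pairs N (tl ls @ [0])"
    proof -
      have "zero_pairs N (tl ls @ [0]) \<longleftrightarrow> (\<forall>i<k. N \<le> ls ! Suc (2 * i) + ls ! Suc (Suc (2 * i)))"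
        unfolding zero_pairs_iff using lsq by (auto simp: nth_append)
      also have "\<dots> \<longleftrightarrow> (\<forall>i<k. path_class \<Delta> N (ps ! Suc (2 * i)) \<otimes>\<^bsub>A\<^esub> path_class \<Delta> N (ps ! Suc (Suc (2 * i))) = (\<zero>\<^bsub>A\<^esub> :: ('v, 'e, 'k) trunc))"
        using zero_iff k by auto
      also have "\<dots> \<longleftrightarrow> (\<forall>i\<in>{1..k}. path_class \<Delta> N (ps ! (2 * i - 1)) \<otimes>\<^bsub>A\<^esub> path_class \<Delta> N (ps ! (2 * i + 1 - 1)) = (\<zero>\<^bsub>A\<^esub> :: ('v, 'e, 'k) trunc))" (is "?L \<longleftrightarrow> ?R")
      proof
        assume L: ?L
        show ?R
        proof
          fix i assume "i \<in> {1..k}"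
          then obtain j where "i = Suc j" "j < k" by (cases i) auto
          then show "path_class \<Delta> N (ps ! (2 * i - 1)) \<otimes>\<^bsub>A\<^esub> path_class \<Delta> N (ps ! (2 * i + 1 - 1)) = (\<zero>\<^bsub>A\<^esub> :: ('v, 'e, 'k) trunc)" using L by simp
        qed
      next
        assume R: ?R
        show ?L
        proof (intro allI impI)
          fix i assume "i < k"
          then show "path_class \<Delta> N (ps ! Suc (2 * i)) \<otimes>\<^bsub>A\<^esub> path_class \<Delta> N (ps ! Suc (Suc (2 * i))) = (\<zero>\<^bsub>A\<^esub> :: ('v, 'e, 'k) trunc)" using R[rule_format, of "Suc i"] by simp
        qed
      qed
      finally show ?thesis by blast
    qed
    have Gl: "G_lengths N n (0 # ls @ [0]) = (if zero_pairs N (tl ls @ [0]) then \<Sum>r<path_len q. P_cut N n (path_len w) r else 0)"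
      using False by (simp add: G_lengths_def wl lsq)
    show ?thesis
    proof (cases "zero_pairs N (tl ls @ [0])")
      case zp: True
      have "length (tl ls @ [0]) = 2 * k + 1" using lsq by simp
      from zero_pairs_bounds[OF this _ zp] have "k * N \<le> sum_list (tl ls)" by (simp add: P_deg_def)
      then have le: "k * N + path_len q \<le> path_len w" using wl lsq by simp
      let ?t = "\<lambda>j. P_elt \<Delta> N n (path_class \<Delta> N (subpath \<Delta> w 0 (j - 1))) (subpath \<Delta> w (j - 1) (k * N + j)) (path_class \<Delta> N (subpath \<Delta> w (k * N + j) (path_len w))) :: ('v, 'e, 'k) tens_elt"
      have t: "?t j \<in> carrier (P_mod \<Delta> N n) \<and> P_coords n (?t j) = emb w (P_cut N n (path_len w) (j - 1))" if j: "j \<in> {1..path_len q}" for j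
      proof -
        have b: "j - 1 \<le> k * N + j" "k * N + j \<le> path_len w" "k * N + j - (j - 1) = P_deg N n" "j - 1 \<le> path_len w" using j le D by auto
        have u: "tc unit \<otimes>\<^bsub>A\<^esub> path_class \<Delta> N (subpath \<Delta> w 0 (j - 1)) = (path_class \<Delta> N (subpath \<Delta> w 0 (j - 1)) :: ('v, 'e, 'k) trunc)"
          "path_class \<Delta> N (subpath \<Delta> w (k * N + j) (path_len w)) \<otimes>\<^bsub>A\<^esub> tc unit = (path_class \<Delta> N (subpath \<Delta> w (k * N + j) (path_len w)) :: ('v, 'e, 'k) trunc)"
          using cl[OF le0 b(4)] cl[OF b(2) order_refl] by (simp_all flip: tc_one)
        show ?thesis using P_term[OF k1 k1 wp b(1-3)] unfolding u unit_act .
      qed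
      have G: "G_val \<Delta> N n ps = finsum (P_mod \<Delta> N n) ?t {1..path_len q}"
      proof -
        have c: "\<forall>i\<in>{1..k}. path_class \<Delta> N (ps ! (2 * i - 1)) \<otimes>\<^bsub>A\<^esub> path_class \<Delta> N (ps ! (2 * i + 1 - 1)) = (\<zero>\<^bsub>A\<^esub> :: ('v, 'e, 'k) trunc)"
          using cond zp by blast
        have q0: "ps ! (1 - 1) = q" by (simp add: q)
        show ?thesis unfolding G_val_def Let_def if_not_P[OF False] D(2) q0 w_def[symmetric] by (simp only: if_P[OF c])
      qed
      have fs: "finsum (P_mod \<Delta> N n) ?t {1..path_len q} \<in> carrier (P_mod \<Delta> N n) \<and> P_coords n (finsum (P_mod \<Delta> N n) ?t {1..path_len q}) = (\<Sum>j\<in>{1..path_len q}. P_coords n (?t j))"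
        by (rule finsum_coords[OF coordinatized_P]) (use t in auto)
      have "(\<Sum>j\<in>{1..path_len q}. P_coords n (?t j)) = (\<Sum>j\<in>{1..path_len q}. emb w (P_cut N n (path_len w) (j - 1)))"
        using t by (intro sum.cong) auto
      also have "\<dots> = (\<Sum>r<path_len q. emb w (P_cut N n (path_len w) r))"
        by (rule sum.reindex_bij_witness[of _ Suc "\<lambda>j. j - 1"]) auto
      also have "\<dots> = emb w (G_lengths N n (0 # ls @ [0]))" unfolding Gl using zp by (simp add: emb_sum)
      finally show ?thesis using fs unfolding G by (simp add: w_def ls_def)
    next
      case zp: False
      then have "G_val \<Delta> N n ps = (\<zero>\<^bsub>P_mod \<Delta> N n\<^esub> :: ('v, 'e, 'k) tens_elt)"
      proof -
        have nc: "\<not> (\<forall>i\<in>{1..k}. path_class \<Delta> N (ps ! (2 * i - 1)) \<otimes>\<^bsub>A\<^esub> path_class \<Delta> N (ps ! (2 * i + 1 - 1)) = (\<zero>\<^bsub>A\<^esub> :: ('v, 'e, 'k) trunc))"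
          using cond zp by blast
        show ?thesis unfolding G_val_def Let_def if_not_P[OF False] D(2) by (simp only: if_not_P[OF nc])
      qed
      then show ?thesis using C(4,5) Gl zp by (simp add: w_def ls_def)
    qed
  qed
qed

lemma G_map_realizes:
  "realizes (Q_mod \<Delta> N n :: ('v, 'e, 'k::field) A_bimodule) (Q_coords n) (P_mod \<Delta> N n) (P_coords n) (G_lengths N n) (G_map \<Delta> N n)"
proof (cases "n = 0")
  case True
  show ?thesis unfolding realizes_def
  proof
    fix x assume x: "x \<in> carrier (Q_mod \<Delta> N n :: ('v, 'e, 'k) A_bimodule)"
    have c: "Q_coords n x \<in> cut_space (P_lists N 0)" using coordinatizedD(2)[OF coordinatized_Q x] True by (simp add: P_lists_0)
    have "ext (G_lengths N n) (Q_coords n x) = ext frag_of (Q_coords n x)"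
    proof (rule ext_cong)
      fix w ls assume "(w, ls) \<in> keys (Q_coords n x)"
      then obtain i j where "ls = [i, j]" "i < N" "j < N" using c by (auto simp: cut_space_def cuts_def P_lists_def P_list_def)
      then show "G_lengths N n ls = frag_of ls" by (simp add: True G_lengths_def P_cut_def P_list_def)
    qed
    then show "G_map \<Delta> N n x \<in> carrier (P_mod \<Delta> N n) \<and> P_coords n (G_map \<Delta> N n x) = ext (G_lengths N n) (Q_coords n x)"
      using x by (simp add: True G_map_def P_0_eq_Q_0 ext_frag_of)
  qed
next
  case False
  then have n: "n \<ge> 1" by simp
  have "realizes (Q_mod \<Delta> N n :: ('v, 'e, 'k) A_bimodule) (Q_coords n) (P_mod \<Delta> N n) (P_coords n) (G_lengths N n)
    (bimod_ext A (Q_mod \<Delta> N n) (P_mod \<Delta> N n) (G_index \<Delta> N n) (\<lambda>as. Q_elt \<Delta> N n ([\<one>\<^bsub>A\<^esub>] @ map (path_class \<Delta> N) as @ [\<one>\<^bsub>A\<^esub>])) (G_val \<Delta> N n))"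
  proof (rule bimod_ext_realizes[OF coordinatized_Q coordinatized_P length_preserving_G length_equivariant_G[OF N_pos] bar_lists_normal])
    fix ps assume ps: "ps \<in> G_index \<Delta> N n"
    then have i: "length ps = n" "\<forall>p\<in>set ps. p \<in> all_paths \<and> 1 \<le> path_len p \<and> path_len p < N" "successively (composable \<Delta>) ps"
      unfolding G_index_iff by auto
    note e = Q_path_elt[OF i(1) n i(2,3), where 'k = 'k]
    show "Q_elt \<Delta> N n ([\<one>\<^bsub>A\<^esub>] @ map (path_class \<Delta> N) ps @ [\<one>\<^bsub>A\<^esub>]) \<in> carrier (Q_mod \<Delta> N n :: ('v, 'e, 'k) A_bimodule)" by (rule e(2))
    have gv: "G_val \<Delta> N n ps \<in> carrier (P_mod \<Delta> N n :: ('v, 'e, 'k) A_bimodule) \<and>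
      P_coords n (G_val \<Delta> N n ps :: ('v, 'e, 'k) tens_elt) = emb (path_concat ps) (G_lengths N n (0 # map path_len ps @ [0]))"
      by (rule G_val_coords[OF n ps])
    show "G_val \<Delta> N n ps \<in> carrier (P_mod \<Delta> N n :: ('v, 'e, 'k) A_bimodule)" using gv by simp
    show "P_coords n (G_val \<Delta> N n ps :: ('v, 'e, 'k) tens_elt) = ext (G_lengths N n) (Q_coords n (Q_elt \<Delta> N n ([\<one>\<^bsub>A\<^esub>] @ map (path_class \<Delta> N) ps @ [\<one>\<^bsub>A\<^esub>])))"
      unfolding e(3) using gv by simp
  next
    fix w ls assume c: "(w, 0 # ls @ [0]) \<in> cuts (bar_lists N n)"
    obtain ps where ps: "length ps = n" "\<forall>p\<in>set ps. p \<in> all_paths \<and> 1 \<le> path_len p \<and> path_len p < N"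
      "successively (composable \<Delta>) ps" and w: "path_concat ps = w" "map path_len ps = ls"
      by (rule bar_cut_paths[OF c n])
    have "ps \<in> G_index \<Delta> N n" unfolding G_index_iff using ps by blast
    then show "\<exists>s\<in>G_index \<Delta> N n. Q_coords n (Q_elt \<Delta> N n ([\<one>\<^bsub>A\<^esub>] @ map (path_class \<Delta> N) s @ [\<one>\<^bsub>A\<^esub>])) = single (w, 0 # ls @ [0]) (1::'k)"
      using Q_path_elt(3)[OF ps(1) n ps(2,3), where 'k = 'k] unfolding w by blast
  qed
  then show ?thesis using False by (simp add: G_map_def Let_def)
qed

section \<open>The comparison morphisms\<close>

lemma realizes_compose_eq:
  assumes f: "realizes M \<Phi> M1 \<Phi>1 m f" and g: "realizes M1 \<Phi>1 M2 \<Phi>2 m' g"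
    and f': "realizes M \<Phi> M3 \<Phi>3 k f'" and g': "realizes M3 \<Phi>3 M2 \<Phi>2 k' g'"
    and M: "coordinatized M L \<Phi>" and M2: "coordinatized M2 L2 \<Phi>2"
    and eq: "\<And>ls. ls \<in> L \<Longrightarrow> frag_extend m' (m ls) = frag_extend k' (k ls)"
    and x: "x \<in> carrier M"
  shows "g (f x) = g' (f' x)"
proof (rule coordinatizedD(1)[OF M2])
  have fx: "f x \<in> carrier M1" "\<Phi>1 (f x) = ext m (\<Phi> x)" "f' x \<in> carrier M3" "\<Phi>3 (f' x) = ext k (\<Phi> x)"
    using f f' x by (auto simp: realizes_def)
  show "g (f x) \<in> carrier M2" "g' (f' x) \<in> carrier M2" using g g' fx by (auto simp: realizes_def)
  have "ext m' (ext m (\<Phi> x)) = ext k' (ext k (\<Phi> x))"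
    unfolding ext_ext using coordinatizedD(2)[OF M x] eq by (intro ext_cong) (auto simp: cut_space_def cuts_def)
  then show "\<Phi>2 (g (f x)) = \<Phi>2 (g' (f' x))" using g g' fx by (simp add: realizes_def)
qed

lemma realizes_compose_zero:
  assumes f: "realizes M \<Phi> M1 \<Phi>1 m f" and g: "realizes M1 \<Phi>1 M2 \<Phi>2 m' g"
    and M: "coordinatized M L \<Phi>" and M2: "coordinatized M2 L2 \<Phi>2"
    and eq: "\<And>ls. ls \<in> L \<Longrightarrow> frag_extend m' (m ls) = 0"
    and x: "x \<in> carrier M"
  shows "g (f x) = \<zero>\<^bsub>M2\<^esub>"
proof (rule coordinatizedD(1)[OF M2])
  have fx: "f x \<in> carrier M1" "\<Phi>1 (f x) = ext m (\<Phi> x)" using f x by (auto simp: realizes_def)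
  show "g (f x) \<in> carrier M2" "\<zero>\<^bsub>M2\<^esub> \<in> carrier M2" using g fx coordinatizedD(4)[OF M2] by (auto simp: realizes_def)
  have "ext m' (ext m (\<Phi> x)) = ext (\<lambda>ls. 0) (\<Phi> x)"
    unfolding ext_ext using coordinatizedD(2)[OF M x] eq by (intro ext_cong) (auto simp: cut_space_def cuts_def)
  then show "\<Phi>2 (g (f x)) = \<Phi>2 \<zero>\<^bsub>M2\<^esub>" using g fx coordinatizedD(5)[OF M2] by (simp add: realizes_def ext_const_0)
qed

lemma Q_complex: "augmented_complex (A :: ('v, 'e, 'k::field) trunc ring) (scalars \<Delta> N) (Q_mod \<Delta> N) (Q_diff \<Delta> N) (Q_aug \<Delta> N)"
  unfolding augmented_complex_def
proof (intro conjI allI impI ballI)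
  fix n show "bimodule A (scalars \<Delta> N) (Q_mod \<Delta> N n :: ('v, 'e, 'k) A_bimodule)"
    by (rule coordinatized_bimodule[OF coordinatized_Q]) (use bar_lists_normal in fastforce)
next
  fix n :: nat assume n: "1 \<le> n"
  show "Q_diff \<Delta> N n \<in> bimod_hom A (Q_mod \<Delta> N n :: ('v, 'e, 'k) A_bimodule) (Q_mod \<Delta> N (n - 1))"
    by (rule realizes_bimod_hom[OF coordinatized_Q coordinatized_Q length_equivariant_bar Q_diff_realizes[OF n]])
  fix x assume x: "x \<in> carrier (Q_mod \<Delta> N (n + 1) :: ('v, 'e, 'k) A_bimodule)"
  have r: "realizes (Q_mod \<Delta> N (n + 1) :: ('v, 'e, 'k) A_bimodule) (Q_coords (n + 1)) (Q_mod \<Delta> N n) (Q_coords n) (bar_lengths N) (Q_diff \<Delta> N (n + 1))"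
    using Q_diff_realizes[of "n + 1"] by simp
  show "Q_diff \<Delta> N n (Q_diff \<Delta> N (n + 1) x) = \<zero>\<^bsub>Q_mod \<Delta> N (n - 1)\<^esub>"
    by (rule realizes_compose_zero[OF r Q_diff_realizes[OF n] coordinatized_Q coordinatized_Q bar_bar x])
next
  show "Q_aug \<Delta> N \<in> bimod_hom A (Q_mod \<Delta> N 0 :: ('v, 'e, 'k) A_bimodule) (regular_bimod A)"
    by (rule realizes_bimod_hom[OF coordinatized_Q coordinatized_A length_equivariant_bar Q_aug_realizes])
  fix x assume x: "x \<in> carrier (Q_mod \<Delta> N 1 :: ('v, 'e, 'k) A_bimodule)"
  have r: "realizes (Q_mod \<Delta> N 1 :: ('v, 'e, 'k) A_bimodule) (Q_coords 1) (Q_mod \<Delta> N 0) (Q_coords 0) (bar_lengths N) (Q_diff \<Delta> N 1)"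
    using Q_diff_realizes[of 1] by simp
  have "Q_aug \<Delta> N (Q_diff \<Delta> N 1 x) = \<zero>\<^bsub>regular_bimod (A :: ('v, 'e, 'k) trunc ring)\<^esub>"
    by (rule realizes_compose_zero[OF r Q_aug_realizes coordinatized_Q coordinatized_A bar_bar x])
  then show "Q_aug \<Delta> N (Q_diff \<Delta> N 1 x) = \<zero>\<^bsub>A\<^esub>" by (simp add: regular_bimod_def)
qed

lemma P_aug_realizes:
  "realizes (P_mod \<Delta> N 0 :: ('v, 'e, 'k::field) A_bimodule) (P_coords 0) (regular_bimod A) A_coords (bar_lengths N) (P_aug \<Delta> N)"
  using Q_aug_realizes by (simp add: P_0_eq_Q_0)

lemma P_complex: "augmented_complex (A :: ('v, 'e, 'k::field) trunc ring) (scalars \<Delta> N) (P_mod \<Delta> N) (P_diff \<Delta> N) (P_aug \<Delta> N)"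
  unfolding augmented_complex_def
proof (intro conjI allI impI ballI)
  fix n show "bimodule A (scalars \<Delta> N) (P_mod \<Delta> N n :: ('v, 'e, 'k) A_bimodule)"
    by (rule coordinatized_bimodule[OF coordinatized_P]) (use P_lists_normal in fastforce)
next
  fix n :: nat assume n: "1 \<le> n"
  show "P_diff \<Delta> N n \<in> bimod_hom A (P_mod \<Delta> N n :: ('v, 'e, 'k) A_bimodule) (P_mod \<Delta> N (n - 1))"
    by (rule realizes_bimod_hom[OF coordinatized_P coordinatized_P length_equivariant_P_lengths[OF N_pos n] P_diff_realizes[OF n]])
  fix x assume x: "x \<in> carrier (P_mod \<Delta> N (n + 1) :: ('v, 'e, 'k) A_bimodule)"
  have r: "realizes (P_mod \<Delta> N (n + 1) :: ('v, 'e, 'k) A_bimodule) (P_coords (n + 1)) (P_mod \<Delta> N n) (P_coords n) (P_lengths N (n + 1)) (P_diff \<Delta> N (n + 1))"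
    using P_diff_realizes[of "n + 1"] by simp
  show "P_diff \<Delta> N n (P_diff \<Delta> N (n + 1) x) = \<zero>\<^bsub>P_mod \<Delta> N (n - 1)\<^esub>"
    by (rule realizes_compose_zero[OF r P_diff_realizes[OF n] coordinatized_P coordinatized_P _ x])
      (use P_lengths_P_lengths[OF N_pos n] in simp)
next
  show "P_aug \<Delta> N \<in> bimod_hom A (P_mod \<Delta> N 0 :: ('v, 'e, 'k) A_bimodule) (regular_bimod A)"
    using realizes_bimod_hom[OF coordinatized_Q coordinatized_A length_equivariant_bar Q_aug_realizes] by (simp add: P_0_eq_Q_0)
  fix x assume x: "x \<in> carrier (P_mod \<Delta> N 1 :: ('v, 'e, 'k) A_bimodule)"
  have r: "realizes (P_mod \<Delta> N 1 :: ('v, 'e, 'k) A_bimodule) (P_coords 1) (P_mod \<Delta> N 0) (P_coords 0) (P_lengths N 1) (P_diff \<Delta> N 1)"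
    using P_diff_realizes[of 1] by simp
  have "P_aug \<Delta> N (P_diff \<Delta> N 1 x) = \<zero>\<^bsub>regular_bimod (A :: ('v, 'e, 'k) trunc ring)\<^esub>"
    by (rule realizes_compose_zero[OF r P_aug_realizes coordinatized_P coordinatized_A bar_P_lengths x])
  then show "P_aug \<Delta> N (P_diff \<Delta> N 1 x) = \<zero>\<^bsub>A\<^esub>" by (simp add: regular_bimod_def)
qed

theorem F_chain_map:
  assumes "n \<ge> 1" "x \<in> carrier (P_mod \<Delta> N n :: ('v, 'e, 'k::field) A_bimodule)"
  shows "Q_diff \<Delta> N n (F_map \<Delta> N n x) = F_map \<Delta> N (n - 1) (P_diff \<Delta> N n x)"
  by (rule realizes_compose_eq[OF F_map_realizes Q_diff_realizes P_diff_realizes F_map_realizes coordinatized_P coordinatized_Q _ assms(2)])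
    (use assms bar_F_lengths[OF N_pos] in auto)

theorem G_chain_map:
  assumes "n \<ge> 1" "x \<in> carrier (Q_mod \<Delta> N n :: ('v, 'e, 'k::field) A_bimodule)"
  shows "P_diff \<Delta> N n (G_map \<Delta> N n x) = G_map \<Delta> N (n - 1) (Q_diff \<Delta> N n x)"
  by (rule realizes_compose_eq[OF G_map_realizes P_diff_realizes Q_diff_realizes G_map_realizes coordinatized_Q coordinatized_P _ assms(2)])
    (use assms P_lengths_G_lengths[OF N_pos] in auto)

theorem F_comparison: "comparison_morphism (A :: ('v, 'e, 'k::field) trunc ring) (scalars \<Delta> N)
      (P_mod \<Delta> N) (P_diff \<Delta> N) (P_aug \<Delta> N) (Q_mod \<Delta> N) (Q_diff \<Delta> N) (Q_aug \<Delta> N) (F_map \<Delta> N)"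
  unfolding comparison_morphism_def
proof (intro conjI allI impI ballI)
  show "augmented_complex (A :: ('v, 'e, 'k) trunc ring) (scalars \<Delta> N) (P_mod \<Delta> N) (P_diff \<Delta> N) (P_aug \<Delta> N)" by (rule P_complex)
  show "augmented_complex (A :: ('v, 'e, 'k) trunc ring) (scalars \<Delta> N) (Q_mod \<Delta> N) (Q_diff \<Delta> N) (Q_aug \<Delta> N)" by (rule Q_complex)
  show "F_map \<Delta> N n \<in> bimod_hom A (P_mod \<Delta> N n :: ('v, 'e, 'k) A_bimodule) (Q_mod \<Delta> N n)" for n
    by (rule realizes_bimod_hom[OF coordinatized_P coordinatized_Q length_equivariant_F F_map_realizes])
  show "Q_diff \<Delta> N n (F_map \<Delta> N n x) = F_map \<Delta> N (n - 1) (P_diff \<Delta> N n x)"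
    if "1 \<le> n" "x \<in> carrier (P_mod \<Delta> N n :: ('v, 'e, 'k) A_bimodule)" for n x by (rule F_chain_map[OF that])
  show "Q_aug \<Delta> N (F_map \<Delta> N 0 x) = P_aug \<Delta> N x" for x :: "('v, 'e, 'k) tens_elt"
    by (simp add: F_map_def P_0_eq_Q_0)
qed

theorem G_comparison: "comparison_morphism (A :: ('v, 'e, 'k::field) trunc ring) (scalars \<Delta> N)
      (Q_mod \<Delta> N) (Q_diff \<Delta> N) (Q_aug \<Delta> N) (P_mod \<Delta> N) (P_diff \<Delta> N) (P_aug \<Delta> N) (G_map \<Delta> N)"
  unfolding comparison_morphism_def
proof (intro conjI allI impI ballI)
  show "augmented_complex (A :: ('v, 'e, 'k) trunc ring) (scalars \<Delta> N) (Q_mod \<Delta> N) (Q_diff \<Delta> N) (Q_aug \<Delta> N)" by (rule Q_complex)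
  show "augmented_complex (A :: ('v, 'e, 'k) trunc ring) (scalars \<Delta> N) (P_mod \<Delta> N) (P_diff \<Delta> N) (P_aug \<Delta> N)" by (rule P_complex)
  show "G_map \<Delta> N n \<in> bimod_hom A (Q_mod \<Delta> N n :: ('v, 'e, 'k) A_bimodule) (P_mod \<Delta> N n)" for n
    by (rule realizes_bimod_hom[OF coordinatized_Q coordinatized_P length_equivariant_G[OF N_pos] G_map_realizes])
  show "P_diff \<Delta> N n (G_map \<Delta> N n x) = G_map \<Delta> N (n - 1) (Q_diff \<Delta> N n x)"
    if "1 \<le> n" "x \<in> carrier (Q_mod \<Delta> N n :: ('v, 'e, 'k) A_bimodule)" for n x by (rule G_chain_map[OF that])
  show "P_aug \<Delta> N (G_map \<Delta> N 0 x) = Q_aug \<Delta> N x" for x :: "('v, 'e, 'k) tens_elt"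
    by (simp add: G_map_def P_0_eq_Q_0)
qed

end

theorem theorem4p1:
  fixes \<Delta> :: "('v, 'e) pre_digraph" and N :: nat
  assumes "fin_digraph \<Delta>" and "connected \<Delta>" and "N \<ge> 1"
  shows "(\<forall>n\<ge>1.
      (\<forall>x \<in> carrier (P_mod \<Delta> N n :: ('v, 'e, 'k::field_char_0) A_bimodule).
         Q_diff \<Delta> N n (F_map \<Delta> N n x) = F_map \<Delta> N (n - 1) (P_diff \<Delta> N n x)) \<and>
      (\<forall>x \<in> carrier (Q_mod \<Delta> N n :: ('v, 'e, 'k) A_bimodule).
         P_diff \<Delta> N n (G_map \<Delta> N n x) = G_map \<Delta> N (n - 1) (Q_diff \<Delta> N n x))) \<and>
    comparison_morphism (truncated_algebra \<Delta> N :: ('v, 'e, 'k) trunc ring) (scalars \<Delta> N)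
      (P_mod \<Delta> N) (P_diff \<Delta> N) (P_aug \<Delta> N)
      (Q_mod \<Delta> N) (Q_diff \<Delta> N) (Q_aug \<Delta> N) (F_map \<Delta> N) \<and>
    comparison_morphism (truncated_algebra \<Delta> N :: ('v, 'e, 'k) trunc ring) (scalars \<Delta> N)
      (Q_mod \<Delta> N) (Q_diff \<Delta> N) (Q_aug \<Delta> N)
      (P_mod \<Delta> N) (P_diff \<Delta> N) (P_aug \<Delta> N) (G_map \<Delta> N)"
proof -
  interpret truncated_quiver \<Delta> N
    using assms(1,3) by (simp add: truncated_quiver_def truncated_quiver_axioms_def)
  show ?thesis
    using F_chain_map G_chain_map F_comparison G_comparison by blast
qed

end
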